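(* JavaScript regex matching without lower-bounded quantifiers and without lookarounds is in OptP: the problem $\mathrm{JSREGMATCH}_{\mathcal R}$, where $\mathcal R$ is the set of all JavaScript regexes without lower-bounded quantifiers and without lookarounds, belongs to OptP.
   Context: **Regexes.** Fix a finite alphabet $\Sigma$ (of the JavaScript characters) with a designated subset of word characters. JavaScript regexes without lookarounds are generated by: empty regex $\varepsilon$; character descriptor $cd\subseteq\Sigma$ (a single character $c$ stands for $\{c\}$); disjunction $r_1|r_2$; sequence $r_1r_2$; capture group $({}_g\,r)$ with group identifier $g$ (each identifier is used by at most one capture group of a regex); backreference $\backslash g$; quantifier $r\{min,\Delta,\kappa\}$ with $min\in\mathbb N$ the minimum number of repetitions, $\Delta\in\mathbb N\cup\{\infty\}$ the difference between maximum and minimum, and $\kappa=\top$ (greedy) or $\bot$ (lazy), the star being $r*=r\{0,\infty,\top\}$; anchors ^, $\$$, $\backslash b$, $\backslash B$. A quantifier is *lower-bounded* if $min\neq0$. **Semantics (ECMAScript backtracking semantics, no flags).** Fix a string $s=s_0\cdots s_{|s|-1}$ over $\Sigma$. A group map $\gamma$ assigns to each group identifier "undefined", "opened at $a$", or a closed range $(a,b)$, $a\le b$; $\emptyset$ is everywhere undefined. An action is a regex, $\mathrm{Aclose}\,g$, or $\mathrm{Acheck}\,k$ ($k$ a position). For a list of actions $l$, position $0\le p\le|s|$ and group map $\gamma$, the ordered list of results (leaves of the backtracking tree, highest priority first) $L(l,p,\gamma)$ is given by the following rules, where $\mathbin{+\!+}$ is list concatenation and $\gamma\setminus r$ is $\gamma$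 with all groups occurring in $r$ made undefined: - $L([],p,\gamma)=[(p,\gamma)]$. - $L(\mathrm{Acheck}\,k::l,p,\gamma)=L(l,p,\gamma)$ if $p>k$, else $[]$. - $L(\mathrm{Aclose}\,g::l,p,\gamma)=L(l,p,\gamma[g\mapsto(a,p)])$, where $g$ is opened at $a$ in $\gamma$. - $L(\varepsilon::l,p,\gamma)=L(l,p,\gamma)$. - $L(cd::l,p,\gamma)=L(l,p+1,\gamma)$ if $p<|s|$ and $s_p\in cd$, else $[]$. - $L((r_1|r_2)::l,p,\gamma)=L(r_1::l,p,\gamma)\mathbin{+\!+}L(r_2::l,p,\gamma)$. - $L(r_1r_2::l,p,\gamma)=L(r_1::r_2::l,p,\gamma)$. - $L(r\{0,0,\kappa\}::l,p,\gamma)=L(l,p,\gamma)$. - For $\Delta>0$, with $I=L(r::\mathrm{Acheck}\,p::r\{0,\Delta-1,\kappa\}::l,p,\gamma\setminus r)$ (where $\infty-1=\infty$) and $S=L(l,p,\gamma)$: $L(r\{0,\Delta,\top\}::l,p,\gamma)=I\mathbin{+\!+}S$ and $L(r\{0,\Delta,\bot\}::l,p,\gamma)=S\mathbin{+\!+}I$. - $L(({}_g\,r)::l,p,\gamma)=L(r::\mathrm{Aclose}\,g::l,p,\gamma[g\mapsto\text{opened at }p])$. - Anchors: $L(l,p,\gamma)$ if the anchor is satisfied at $p$, else $[]$; ^ is satisfied iff $p=0$, $\$$ iff $p=|s|$, $\backslash b$ iff exactly one of "$p>0$ and $s_{p-1}$ is a word character", "$p<|s|$ and $s_p$ is a word character"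 holds, $\backslash B$ iff $\backslash b$ is not. - $L(\backslash g::l,p,\gamma)$: if $\gamma(g)$ is not a closed range, $L(l,p,\gamma)$; if $\gamma(g)=(a,b)$ and $w=s_a\cdots s_{b-1}$, then $L(l,p+|w|,\gamma)$ if $w$ occurs in $s$ at position $p$, else $[]$. **Problem.** $\mathrm{JSREGMATCH}_{\mathcal R}$ is: given $r\in\mathcal R$ and a string $s$, compute the highest-priority match of $r$ on $s$, if it exists: for the least starting position $0\le k\le|s|$ with $L([r],k,\emptyset)\ne[]$, the answer is $k$ together with the first element $(p,\gamma)$ of that list (end position and group map); if there is no such $k$, the answer is "no match". **Instance size.** $r$ is given by its syntax tree (numbers $\Delta$ and group identifiers in binary; regex parsing is out of scope); complexity is measured in $|s|$ and the size of $r$ (and the bit lengths of those numbers), where $|\varepsilon|=|cd|=|\text{anchor}|=|\backslash g|=1$, $|r_1|r_2|=|r_1r_2|=1+|r_1|+|r_2|$, $|r\{0,\Delta,\kappa\}|=3+|r|$, $|({}_g\,r)|=2+|r|$. **OptP.** OptP is the class of optimization problems that can be solved by taking a nondeterministic Turing machine that runs in polynomial time and outputs a binary number on each accepting branch, and returning the minimal (or maximal) number output over all accepting branches. For the matching problem, solving it this way means that the optimal output encodes (determines, by a polynomial-time decoding) the answer, namely the highest-priority match or "no match". *)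

theory Defs
  imports "HOL-Computational_Algebra.Polynomial" "HOL-Library.Extended_Nat"
begin

section \<open>Regexes\<close>

datatype anchor = Input_Start | Input_End | Word_Boundary | Non_Word_Boundary

text \<open>
  JavaScript regexes without lookarounds over the alphabet \<^typ>\<open>'c\<close>. In \<open>Quant r m d greedy\<close>, \<open>m\<close> is
  the minimum number of repetitions and \<open>d\<close> the difference between maximum and minimum.
\<close>

datatype 'c regex =
    Eps
  | Chars "'c set"
  | Alt "'c regex" "'c regex"
  | Seq "'c regex" "'c regex"
  | Group nat "'c regex"
  | Backref nat
  | Quant "'c regex" nat enat bool
  | Anchor anchor

primrec groups :: "'c regex \<Rightarrow> nat list" where
  "groups Eps = []"
| "groups (Chars cd) = []"
| "groups (Alt r1 r2) = groups r1 @ groups r2"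
| "groups (Seq r1 r2) = groups r1 @ groups r2"
| "groups (Group g r) = g # groups r"
| "groups (Backref g) = []"
| "groups (Quant r m d greedy) = groups r"
| "groups (Anchor a) = []"

definition wf_regex :: "'c regex \<Rightarrow> bool" where
  "wf_regex r \<longleftrightarrow> distinct (groups r)"

primrec no_lower_bounds :: "'c regex \<Rightarrow> bool" where
  "no_lower_bounds Eps \<longleftrightarrow> True"
| "no_lower_bounds (Chars cd) \<longleftrightarrow> True"
| "no_lower_bounds (Alt r1 r2) \<longleftrightarrow> no_lower_bounds r1 \<and> no_lower_bounds r2"
| "no_lower_bounds (Seq r1 r2) \<longleftrightarrow> no_lower_bounds r1 \<and> no_lower_bounds r2"
| "no_lower_bounds (Group g r) \<longleftrightarrow> no_lower_bounds r"
| "no_lower_bounds (Backref g) \<longleftrightarrow> True"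
| "no_lower_bounds (Quant r m d greedy) \<longleftrightarrow> m = 0 \<and> no_lower_bounds r"
| "no_lower_bounds (Anchor a) \<longleftrightarrow> True"


section \<open>Backtracking semantics\<close>

datatype group_state = Undefined | Opened nat | Closed nat nat

type_synonym group_map = "nat \<Rightarrow> group_state"

datatype 'c action = Regex "'c regex" | Aclose nat | Acheck nat

definition reset :: "'c regex \<Rightarrow> group_map \<Rightarrow> group_map" where
  "reset r \<gamma> = (\<lambda>g. if g \<in> set (groups r) then Undefined else \<gamma> g)"

text \<open>In the following, \<open>W\<close> is the set of word characters and \<open>s\<close> the input string.\<close>

definition at_boundary :: "'c set \<Rightarrow> 'c list \<Rightarrow> nat \<Rightarrow> bool" where
  "at_boundary W s p \<longleftrightarrow> (p > 0 \<and> s ! (p - 1) \<in> W) \<noteq> (p < length s \<and> s ! p \<in> W)"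

primrec anchor_holds :: "'c set \<Rightarrow> 'c list \<Rightarrow> anchor \<Rightarrow> nat \<Rightarrow> bool" where
  "anchor_holds W s Input_Start p \<longleftrightarrow> p = 0"
| "anchor_holds W s Input_End p \<longleftrightarrow> p = length s"
| "anchor_holds W s Word_Boundary p \<longleftrightarrow> at_boundary W s p"
| "anchor_holds W s Non_Word_Boundary p \<longleftrightarrow> \<not> at_boundary W s p"

text \<open>
  The case \<open>m > 0\<close> below is the ECMAScript rule for lower-bounded quantifiers; it is never reached from
  a regex satisfying \<^const>\<open>no_lower_bounds\<close>. Closing a group that is not open never
  happens for a regex satisfying \<^const>\<open>wf_regex\<close>.
\<close>

function leaves ::
  "'c set \<Rightarrow> 'c list \<Rightarrow> 'c action list \<Rightarrow> nat \<Rightarrow> group_map \<Rightarrow> (nat \<times> group_map) list"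
where
  "leaves W s [] p \<gamma> = [(p, \<gamma>)]"
| "leaves W s (Acheck k # l) p \<gamma> = (if p > k then leaves W s l p \<gamma> else [])"
| "leaves W s (Aclose g # l) p \<gamma> =
     (case \<gamma> g of Opened a \<Rightarrow> leaves W s l p (\<gamma>(g := Closed a p)) | _ \<Rightarrow> [])"
| "leaves W s (Regex Eps # l) p \<gamma> = leaves W s l p \<gamma>"
| "leaves W s (Regex (Chars cd) # l) p \<gamma> =
     (if p < length s \<and> s ! p \<in> cd then leaves W s l (p + 1) \<gamma> else [])"
| "leaves W s (Regex (Alt r1 r2) # l) p \<gamma> =
     leaves W s (Regex r1 # l) p \<gamma> @ leaves W s (Regex r2 # l) p \<gamma>"
| "leaves W s (Regex (Seq r1 r2) # l) p \<gamma> = leaves W s (Regex r1 # Regex r2 # l) p \<gamma>"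
| "leaves W s (Regex (Quant r m d greedy) # l) p \<gamma> =
     (if m > 0 then leaves W s (Regex r # Regex (Quant r (m - 1) d greedy) # l) p (reset r \<gamma>)
      else if d = 0 then leaves W s l p \<gamma>
      else
        let iter = leaves W s (Regex r # Acheck p # Regex (Quant r 0 (d - 1) greedy) # l) p (reset r \<gamma>);
            skip = leaves W s l p \<gamma>
        in if greedy then iter @ skip else skip @ iter)"
| "leaves W s (Regex (Group g r) # l) p \<gamma> =
     leaves W s (Regex r # Aclose g # l) p (\<gamma>(g := Opened p))"
| "leaves W s (Regex (Anchor a) # l) p \<gamma> =
     (if anchor_holds W s a p then leaves W s l p \<gamma> else [])"
| "leaves W s (Regex (Backref g) # l) p \<gamma> =
     (case \<gamma> g of
        Closed a b \<Rightarrow>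
          (let w = take (b - a) (drop a s)
           in if take (length w) (drop p s) = w then leaves W s l (p + length w) \<gamma> else [])
      | _ \<Rightarrow> leaves W s l p \<gamma>)"
  by pat_completeness auto

text \<open>
  Termination: actions behind a check that fails at the current position are only executed
  after further input has been consumed.
\<close>

primrec regex_weight :: "'c regex \<Rightarrow> nat" where
  "regex_weight Eps = 1"
| "regex_weight (Chars cd) = 1"
| "regex_weight (Alt r1 r2) = 1 + regex_weight r1 + regex_weight r2"
| "regex_weight (Seq r1 r2) = 1 + regex_weight r1 + regex_weight r2"
| "regex_weight (Group g r) = 2 + regex_weight r"
| "regex_weight (Backref g) = 1"
| "regex_weight (Quant r m d greedy) = 3 + (m + 1) * (regex_weight r + 3)"
| "regex_weight (Anchor a) = 1"

fun actions_weight :: "nat \<Rightarrow> 'c action list \<Rightarrow> nat" where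
  "actions_weight p [] = 0"
| "actions_weight p (Acheck k # l) = (if p > k then 1 + actions_weight p l else 1)"
| "actions_weight p (Aclose g # l) = 1 + actions_weight p l"
| "actions_weight p (Regex r # l) = regex_weight r + actions_weight p l"

termination leaves
proof -
  have nil: "min (length s - a) n = 0"
    if "take (min (length s - a) n) (drop p s) = take n (drop a s)"
      and "\<not> length s - (p + min (length s - a) n) < length s - p"
    for s :: "'c list" and a n p
    using arg_cong[OF that(1), of length] that(2) by (simp add: min_def split: if_splits)
  show ?thesis
    by (relation "measures [\<lambda>(W, s, l, p, \<gamma>). length s - p, \<lambda>(W, s, l, p, \<gamma>). actions_weight p l]")
      (auto, (drule (1) nil, simp)+)
qed

definition jsregmatch :: "'c set \<Rightarrow> 'c regex \<Rightarrow> 'c list \<Rightarrow> (nat \<times> nat \<times> group_map) option" where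
  "jsregmatch W r s =
     (let matches = (\<lambda>k. k \<le> length s \<and> leaves W s [Regex r] k (\<lambda>_. Undefined) \<noteq> [])
      in if \<exists>k. matches k
         then let k = (LEAST k. matches k) in Some (k, hd (leaves W s [Regex r] k (\<lambda>_. Undefined)))
         else None)"


section \<open>Turing machines\<close>

text \<open>
  Every machine uses only finitely many of these symbols. \<open>Sym\<close> wraps the symbols of a
  problem-specific alphabet and \<open>Aux\<close> provides additional work symbols.
\<close>

datatype 'a symbol = Blank | Bit bool | Sym 'a | Aux nat

datatype direction = Move_Left | Stay | Move_Right

text \<open>
  Multi-tape machines. A transition \<open>(q, xs, q', as)\<close> is applicable in state \<open>q\<close> if the heads read
  \<open>xs\<close>; it leads to state \<open>q'\<close>, and on each tape writes a symbol and moves the head as given by \<open>as\<close>.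
  A branch halts when no transition is applicable. Tape 0 holds the input, tape 1 the output.
\<close>

record 'a ntm =
  num_tapes :: nat
  start :: nat
  accept :: nat
  trans :: "(nat \<times> 'a symbol list \<times> nat \<times> ('a symbol \<times> direction) list) set"

definition ntm :: "'a ntm \<Rightarrow> bool" where
  "ntm M \<longleftrightarrow>
     num_tapes M \<ge> 2 \<and> finite (trans M) \<and>
     (\<forall>(q, xs, q', as) \<in> trans M.
        length xs = num_tapes M \<and> length as = num_tapes M \<and> q \<noteq> accept M)"

definition deterministic :: "'a ntm \<Rightarrow> bool" where
  "deterministic M \<longleftrightarrow>
     (\<forall>q xs q1 as1 q2 as2.
        (q, xs, q1, as1) \<in> trans M \<longrightarrow> (q, xs, q2, as2) \<in> trans M \<longrightarrow> q1 = q2 \<and> as1 = as2)"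

type_synonym 'a tape = "(int \<Rightarrow> 'a symbol) \<times> int"
type_synonym 'a config = "nat \<times> 'a tape list"

fun head_symbol :: "'a tape \<Rightarrow> 'a symbol" where
  "head_symbol (t, h) = t h"

primrec offset :: "direction \<Rightarrow> int" where
  "offset Move_Left = -1"
| "offset Stay = 0"
| "offset Move_Right = 1"

fun act :: "'a symbol \<times> direction \<Rightarrow> 'a tape \<Rightarrow> 'a tape" where
  "act (x, d) (t, h) = (t(h := x), h + offset d)"

fun step :: "'a ntm \<Rightarrow> 'a config \<Rightarrow> 'a config \<Rightarrow> bool" where
  "step M (q, ts) (q', ts') \<longleftrightarrow>
     (\<exists>as. (q, map head_symbol ts, q', as) \<in> trans M \<and> ts' = map2 act as ts)"

definition initial :: "'a ntm \<Rightarrow> 'a symbol list \<Rightarrow> 'a config" where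
  "initial M w =
     (start M,
      (\<lambda>i. if 0 \<le> i \<and> i < int (length w) then w ! nat i else Blank, 0)
        # replicate (num_tapes M - 1) (\<lambda>_. Blank, 0))"

definition halts_within :: "'a ntm \<Rightarrow> 'a symbol list \<Rightarrow> nat \<Rightarrow> bool" where
  "halts_within M w t \<longleftrightarrow> (\<forall>n c. (step M ^^ n) (initial M w) c \<longrightarrow> n \<le> t)"

definition accepting_configs :: "'a ntm \<Rightarrow> 'a symbol list \<Rightarrow> 'a config set" where
  "accepting_configs M w = {c. (step M)\<^sup>*\<^sup>* (initial M w) c \<and> fst c = accept M}"

text \<open>The output is the word on tape 1 from cell 0 up to, and excluding, the first blank.\<close>

definition has_output :: "'a config \<Rightarrow> 'a symbol list \<Rightarrow> bool" where
  "has_output c w \<longleftrightarrow>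
     (let t = fst (snd c ! 1)
      in Blank \<notin> set w \<and> (\<forall>i < length w. t (int i) = w ! i) \<and> t (int (length w)) = Blank)"


section \<open>OptP\<close>

text \<open>Binary numbers are written with the most significant bit first.\<close>

fun binary :: "nat \<Rightarrow> bool list" where
  "binary n = (if n = 0 then [] else binary (n div 2) @ [odd n])"

declare binary.simps [simp del]

definition bits_value :: "bool list \<Rightarrow> nat" where
  "bits_value bs = foldl (\<lambda>n b. 2 * n + of_bool b) 0 bs"

definition bits_of :: "nat \<Rightarrow> 'a symbol list" where
  "bits_of n = map Bit (binary n)"

text \<open>Functions on numbers in binary that are computable in deterministic polynomial time.\<close>

definition polytime_decoder :: "(nat \<Rightarrow> 'a symbol list) \<Rightarrow> bool" where
  "polytime_decoder g \<longleftrightarrow>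
     (\<exists>M (p :: nat poly). ntm M \<and> deterministic M \<and>
        (\<forall>n. halts_within M (bits_of n) (poly p (length (binary n))) \<and>
             (\<exists>c \<in> accepting_configs M (bits_of n). has_output c (g n))))"

definition outputs :: "'a ntm \<Rightarrow> 'a symbol list \<Rightarrow> nat set" where
  "outputs M w =
     {bits_value bs | bs. \<exists>c \<in> accepting_configs M w. has_output c (map Bit bs)}"

text \<open>
  \<open>F\<close> is the optimum over the accepting branches of a nondeterministic polynomial-time machine.
  Here \<open>X\<close> is the set of instances, \<open>sz\<close> their size measure and \<open>enc\<close> their encoding as words.
\<close>

definition OptP_value ::
  "'x set \<Rightarrow> ('x \<Rightarrow> nat) \<Rightarrow> ('x \<Rightarrow> 'a symbol list) \<Rightarrow> ('x \<Rightarrow> nat) \<Rightarrow> bool"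
where
  "OptP_value X sz enc F \<longleftrightarrow>
     (\<exists>M (p :: nat poly). ntm M \<and>
        (\<forall>x \<in> X. halts_within M (enc x) (poly p (sz x)) \<and>
                 (\<forall>c \<in> accepting_configs M (enc x). \<exists>bs. has_output c (map Bit bs)) \<and>
                 F x \<in> outputs M (enc x)) \<and>
        ((\<forall>x \<in> X. \<forall>v \<in> outputs M (enc x). F x \<le> v) \<or>
         (\<forall>x \<in> X. \<forall>v \<in> outputs M (enc x). v \<le> F x)))"

text \<open>
  The problem of computing \<open>f x\<close> for given \<open>x \<in> X\<close> is in OptP if a polynomial-time decoder extracts
  the answer from the optimal value. The set \<open>rep y\<close> consists of the words that represent the answer \<open>y\<close>.
\<close>

definition in_OptP ::
  "'x set \<Rightarrow> ('x \<Rightarrow> nat) \<Rightarrow> ('x \<Rightarrow> 'a symbol list) \<Rightarrow>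
   ('x \<Rightarrow> 'y) \<Rightarrow> ('y \<Rightarrow> 'b symbol list set) \<Rightarrow> bool"
where
  "in_OptP X sz enc f rep \<longleftrightarrow>
     (\<exists>F g. OptP_value X sz enc F \<and> polytime_decoder g \<and> (\<forall>x \<in> X. g (F x) \<in> rep (f x)))"


section \<open>The matching problem\<close>

definition matching_instances :: "('c regex \<times> 'c list) set" where
  "matching_instances = {(r, s). wf_regex r \<and> no_lower_bounds r}"

primrec regex_size :: "'c regex \<Rightarrow> nat" where
  "regex_size Eps = 1"
| "regex_size (Chars cd) = 1"
| "regex_size (Alt r1 r2) = 1 + regex_size r1 + regex_size r2"
| "regex_size (Seq r1 r2) = 1 + regex_size r1 + regex_size r2"
| "regex_size (Group g r) = 2 + regex_size r"
| "regex_size (Backref g) = 1"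
| "regex_size (Quant r m d greedy) = 3 + regex_size r"
| "regex_size (Anchor a) = 1"

primrec number_bits :: "'c regex \<Rightarrow> nat" where
  "number_bits Eps = 0"
| "number_bits (Chars cd) = 0"
| "number_bits (Alt r1 r2) = number_bits r1 + number_bits r2"
| "number_bits (Seq r1 r2) = number_bits r1 + number_bits r2"
| "number_bits (Group g r) = length (binary g) + number_bits r"
| "number_bits (Backref g) = length (binary g)"
| "number_bits (Quant r m d greedy) =
     length (binary m) + (case d of enat n \<Rightarrow> length (binary n) | \<infinity> \<Rightarrow> 0) + number_bits r"
| "number_bits (Anchor a) = 0"

fun instance_size :: "'c regex \<times> 'c list \<Rightarrow> nat" where
  "instance_size (r, s) = length s + regex_size r + number_bits r"

text \<open>
  The syntax tree is written in prefix notation. As the alphabet \<^typ>\<open>'c\<close> is fixed and finite, there are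
  only finitely many tokens, and a character descriptor is a single token.
\<close>

datatype 'c token =
    TEps | TChars "'c set" | TAlt | TSeq | TGroup | TBackref | TQuant bool | TFinite | TInfinite
  | TAnchor anchor | TChar 'c

primrec encode_regex :: "'c regex \<Rightarrow> 'c token symbol list" where
  "encode_regex Eps = [Sym TEps]"
| "encode_regex (Chars cd) = [Sym (TChars cd)]"
| "encode_regex (Alt r1 r2) = Sym TAlt # encode_regex r1 @ encode_regex r2"
| "encode_regex (Seq r1 r2) = Sym TSeq # encode_regex r1 @ encode_regex r2"
| "encode_regex (Group g r) = Sym TGroup # bits_of g @ encode_regex r"
| "encode_regex (Backref g) = Sym TBackref # bits_of g"
| "encode_regex (Quant r m d greedy) =
     Sym (TQuant greedy) # bits_of m @
     (case d of enat n \<Rightarrow> Sym TFinite # bits_of n | \<infinity> \<Rightarrow> [Sym TInfinite]) @ encode_regex r"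
| "encode_regex (Anchor a) = [Sym (TAnchor a)]"

fun encode_instance :: "'c regex \<times> 'c list \<Rightarrow> 'c token symbol list" where
  "encode_instance (r, s) = encode_regex r @ map (\<lambda>c. Sym (TChar c)) s"

datatype answer_token = NoMatch | Match | IsOpened | IsClosed | Num

definition encode_num :: "nat \<Rightarrow> answer_token symbol list" where
  "encode_num n = Sym Num # bits_of n"

fun encode_group :: "nat \<Rightarrow> group_state \<Rightarrow> answer_token symbol list" where
  "encode_group g Undefined = []"
| "encode_group g (Opened a) = Sym IsOpened # encode_num g @ encode_num a"
| "encode_group g (Closed a b) = Sym IsClosed # encode_num g @ encode_num a @ encode_num b"

text \<open>A group map is represented by listing its groups that are not undefined, in any order.\<close>

fun answer_words :: "(nat \<times> nat \<times> group_map) option \<Rightarrow> answer_token symbol list set" where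
  "answer_words None = {[Sym NoMatch]}"
| "answer_words (Some (k, p, \<gamma>)) =
     {Sym Match # encode_num k @ encode_num p @ concat (map (\<lambda>g. encode_group g (\<gamma> g)) gs) | gs.
        distinct gs \<and> set gs = {g. \<gamma> g \<noteq> Undefined}}"

end

theory Submission imports Defs "HOL-Library.Countable_Set" begin

text \<open>
  The nondeterministic machine guesses a word of fixed polynomial length and prints it in a code of
  fixed length. The word describes a path through the backtracking search: whether to go on to the next
  starting position, one letter per step of the matcher that selects the branch of higher or lower
  priority, and then the answer itself, followed by padding. The branch accepts if the word describes
  a successful search. All outputs have the same length, so the order of the numbers is the lexicographic
  order of the paths, and the least output belongs to the leftmost leaf. The paths have polynomial
  length because, without lower bounds, every iteration of a quantifier consumes input, and the actions
  executed between two consumptions of input are bounded by the size of the list of actions.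

  The machine is written in a register language whose only loops run through the contents of a stack.
  The running time of its compilation to a multi-tape machine is polynomial in the length of the stacks.
\<close>


section \<open>A register language and its compilation to Turing machines\<close>

text \<open>The decoder sees the optimal number but not the instance, so the whole answer, group map
  included, has to be spelled out in the guessed word. Since the answer is determined by the path
  before it, two different accepted words of the same length first differ where one has
  \<open>Lo\<close> and the other \<open>Hi\<close>; only the order of these two codes matters. The
  output is printed while guessing, before the word is checked, and starts with a one so that no
  leading zeros of the code are lost.

  The obstacle is space. One step of the matcher may copy registers, so iterating its linear growth
  bound over a run would give an exponential one. The registers between two steps are bounded
  through the actions that they represent instead: \<open>list_peak\<close> never increases along a
  run, although an iteration lengthens the list of actions, and each step adds at most one entry to
  the group map.

  The exponent 5 of the guessed length comes from the answer: with \<open>x\<close> the input length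
  plus one, peaks are quadratic in \<open>x\<close>, runs cubic, and an answer may list one entry of
  quadratic length per step.\<close>

datatype ('r, 'g) cmd =
    Skip
  | Fail
  | Push 'r 'g
  | Pop 'r
  | Emit 'g
  | Then "('r, 'g) cmd" "('r, 'g) cmd" (infixr ";;" 60)
  | Choose "('r, 'g) cmd" "('r, 'g) cmd"
  | Peek 'r "'g option \<Rightarrow> ('r, 'g) cmd"
  | Drain 'r "'g \<Rightarrow> ('r, 'g) cmd"

type_synonym ('r, 'g) store = "('r \<Rightarrow> 'g list) \<times> 'g list"

definition top_of :: "'g list \<Rightarrow> 'g option" where
  "top_of xs = (case xs of [] \<Rightarrow> None | x # _ \<Rightarrow> Some x)"

lemma top_of_simps [simp]: "top_of [] = None" "top_of (x # xs) = Some x"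
  by (simp_all add: top_of_def)

text \<open>The recursion runs over a list argument rather than over the register, so a loop ends
  whatever its body does. As on the machine, the letter is popped before the body sees the
  store.\<close>

primrec iter ::
  "('g \<Rightarrow> ('r, 'g) store \<Rightarrow> ('r, 'g) store set) \<Rightarrow> 'r \<Rightarrow> 'g list \<Rightarrow> ('r, 'g) store \<Rightarrow> ('r, 'g) store set"
where
  "iter D r [] st = {st}"
| "iter D r (x # xs) st = (\<Union>st' \<in> D x ((fst st)(r := xs), snd st). iter D r xs st')"

primrec den :: "('r, 'g) cmd \<Rightarrow> ('r, 'g) store \<Rightarrow> ('r, 'g) store set" where
  "den Skip st = {st}"
| "den Fail st = {}"
| "den (Push r x) st = {((fst st)(r := x # fst st r), snd st)}"
| "den (Pop r) st = {((fst st)(r := tl (fst st r)), snd st)}"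
| "den (Emit x) st = {(fst st, snd st @ [x])}"
| "den (Then c1 c2) st = (\<Union>st' \<in> den c1 st. den c2 st')"
| "den (Choose c1 c2) st = den c1 st \<union> den c2 st"
| "den (Peek r f) st = (\<lambda>o'. den (f o')) (top_of (fst st r)) st"
| "den (Drain r f) st = iter (\<lambda>x. den (f x)) r (fst st r) st"

primrec keeps :: "'r \<Rightarrow> ('r, 'g) cmd \<Rightarrow> bool" where
  "keeps r Skip \<longleftrightarrow> True"
| "keeps r Fail \<longleftrightarrow> True"
| "keeps r (Push r' x) \<longleftrightarrow> r' \<noteq> r"
| "keeps r (Pop r') \<longleftrightarrow> r' \<noteq> r"
| "keeps r (Emit x) \<longleftrightarrow> True"
| "keeps r (Then c1 c2) \<longleftrightarrow> keeps r c1 \<and> keeps r c2"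
| "keeps r (Choose c1 c2) \<longleftrightarrow> keeps r c1 \<and> keeps r c2"
| "keeps r (Peek r' f) \<longleftrightarrow> (\<forall>x. keeps r (f x))"
| "keeps r (Drain r' f) \<longleftrightarrow> r' \<noteq> r \<and> (\<forall>x. keeps r (f x))"

text \<open>
  On the machine, a loop \<^term>\<open>Drain r f\<close> runs until \<^term>\<open>r\<close> is empty; this agrees with the
  iteration over the initial contents of \<^term>\<open>r\<close> because the body does not change \<^term>\<open>r\<close>.
\<close>

primrec wf_cmd :: "('r, 'g) cmd \<Rightarrow> bool" where
  "wf_cmd Skip \<longleftrightarrow> True"
| "wf_cmd Fail \<longleftrightarrow> True"
| "wf_cmd (Push r' x) \<longleftrightarrow> True"
| "wf_cmd (Pop r') \<longleftrightarrow> True"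
| "wf_cmd (Emit x) \<longleftrightarrow> True"
| "wf_cmd (Then c1 c2) \<longleftrightarrow> wf_cmd c1 \<and> wf_cmd c2"
| "wf_cmd (Choose c1 c2) \<longleftrightarrow> wf_cmd c1 \<and> wf_cmd c2"
| "wf_cmd (Peek r' f) \<longleftrightarrow> (\<forall>x. wf_cmd (f x))"
| "wf_cmd (Drain r f) \<longleftrightarrow> (\<forall>x. wf_cmd (f x) \<and> keeps r (f x))"

primrec choice_free :: "('r, 'g) cmd \<Rightarrow> bool" where
  "choice_free Skip \<longleftrightarrow> True"
| "choice_free Fail \<longleftrightarrow> True"
| "choice_free (Push r' x) \<longleftrightarrow> True"
| "choice_free (Pop r') \<longleftrightarrow> True"
| "choice_free (Emit x) \<longleftrightarrow> True"
| "choice_free (Then c1 c2) \<longleftrightarrow> choice_free c1 \<and> choice_free c2"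
| "choice_free (Choose c1 c2) \<longleftrightarrow> False"
| "choice_free (Peek r' f) \<longleftrightarrow> (\<forall>x. choice_free (f x))"
| "choice_free (Drain r f) \<longleftrightarrow> (\<forall>x. choice_free (f x))"

lemma iter_keeps:
  assumes D: "\<And>x st st'. st' \<in> D x st \<Longrightarrow> fst st' r = fst st r" and r: "r' \<noteq> r"
  shows "st' \<in> iter D r' xs st \<Longrightarrow> fst st' r = fst st r"
proof (induction xs arbitrary: st)
  case (Cons x xs)
  then obtain st1 where st1: "st1 \<in> D x ((fst st)(r' := xs), snd st)" "st' \<in> iter D r' xs st1"
    by auto
  from D[OF st1(1)] Cons.IH[OF st1(2)] r show ?case by simp
qed simp

lemma den_keeps: "keeps r c \<Longrightarrow> st' \<in> den c st \<Longrightarrow> fst st' r = fst st r"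
proof (induction c arbitrary: st st')
  case (Then c1 c2)
  then obtain st1 where st1: "st1 \<in> den c1 st" "st' \<in> den c2 st1" by auto
  then have "fst st1 r = fst st r" "fst st' r = fst st1 r" using Then by simp_all
  then show ?case by simp
next
  case (Peek r' f)
  let ?c = "f (top_of (fst st r'))"
  have "keeps r ?c" "st' \<in> den ?c st" using Peek.prems by simp_all
  then show ?case using Peek.IH[OF rangeI] by blast
next
  case (Drain r' f)
  have *: "fst st' r = fst st r" if "st' \<in> den (f x) st" for x st st'
    using Drain.IH[OF rangeI _ that] Drain.prems(1) by simp
  show ?case
    by (rule iter_keeps[where D = "\<lambda>x. den (f x)" and r' = r'])
      (use * Drain.prems in auto)
qed auto

text \<open>
  \<^term>\<open>space c B st\<close> bounds the length of every register that is drained when \<^term>\<open>c\<close> runs on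
  \<^term>\<open>st\<close>; this suffices to bound the running time by \<^term>\<open>time c B\<close>.
\<close>

primrec iter_space ::
  "('g \<Rightarrow> ('r, 'g) store \<Rightarrow> bool) \<Rightarrow> ('g \<Rightarrow> ('r, 'g) store \<Rightarrow> ('r, 'g) store set) \<Rightarrow>
   'r \<Rightarrow> 'g list \<Rightarrow> ('r, 'g) store \<Rightarrow> bool"
where
  "iter_space S D r [] st \<longleftrightarrow> True"
| "iter_space S D r (x # xs) st \<longleftrightarrow>
     S x ((fst st)(r := xs), snd st) \<and>
     (\<forall>st' \<in> D x ((fst st)(r := xs), snd st). iter_space S D r xs st')"

primrec space :: "('r, 'g) cmd \<Rightarrow> nat \<Rightarrow> ('r, 'g) store \<Rightarrow> bool" where
  "space Skip B st \<longleftrightarrow> True"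
| "space Fail B st \<longleftrightarrow> True"
| "space (Push r x) B st \<longleftrightarrow> True"
| "space (Pop r) B st \<longleftrightarrow> True"
| "space (Emit x) B st \<longleftrightarrow> True"
| "space (Then c1 c2) B st \<longleftrightarrow> space c1 B st \<and> (\<forall>st' \<in> den c1 st. space c2 B st')"
| "space (Choose c1 c2) B st \<longleftrightarrow> space c1 B st \<and> space c2 B st"
| "space (Peek r f) B st \<longleftrightarrow> (\<lambda>o'. space (f o') B st) (top_of (fst st r))"
| "space (Drain r f) B st \<longleftrightarrow>
     length (fst st r) \<le> B \<and> iter_space (\<lambda>x. space (f x) B) (\<lambda>x. den (f x)) r (fst st r) st"

text \<open>Counts steps of the compiled machine, where a push takes two. Branching constructs pay
  for all their branches at once, so that the bound depends on the command and on \<open>B\<close>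
  but not on the store.\<close>

primrec time :: "('r, 'g :: finite) cmd \<Rightarrow> nat \<Rightarrow> nat" where
  "time Skip B = 1"
| "time Fail B = 1"
| "time (Push r x) B = 2"
| "time (Pop r) B = 1"
| "time (Emit x) B = 1"
| "time (Then c1 c2) B = 1 + (time c1 B + time c2 B)"
| "time (Choose c1 c2) B = 1 + (time c1 B + time c2 B)"
| "time (Peek r f) B = 1 + (\<Sum>x\<in>UNIV. time (f x) B)"
| "time (Drain r f) B = 1 + B * (1 + (\<Sum>x\<in>UNIV. time (f x) B))"

lemma time_poly: "\<exists>p :: nat poly. \<forall>B. time c B = poly p B"
proof (induction c)
  case (Then c1 c2)
  then obtain p q where "\<forall>B. time c1 B = poly p B" "\<forall>B. time c2 B = poly q B" by blast
  then have "\<forall>B. time (c1 ;; c2) B = poly (1 + (p + q)) B" by simp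
  then show ?case by blast
next
  case (Choose c1 c2)
  then obtain p q where "\<forall>B. time c1 B = poly p B" "\<forall>B. time c2 B = poly q B" by blast
  then have "\<forall>B. time (Choose c1 c2) B = poly (1 + (p + q)) B" by simp
  then show ?case by blast
next
  case (Peek r f)
  then have "\<forall>x. \<exists>p. \<forall>B. time (f x) B = poly p B" by auto
  then obtain p where "\<forall>x B. time (f x) B = poly (p x) B" by metis
  then have "\<forall>B. time (Peek r f) B = poly (1 + (\<Sum>x\<in>UNIV. p x)) B" by (simp add: poly_sum)
  then show ?case by blast
next
  case (Drain r f)
  then have "\<forall>x. \<exists>p. \<forall>B. time (f x) B = poly p B" by auto
  then obtain p where "\<forall>x B. time (f x) B = poly (p x) B" by metis
  then have "\<forall>B. time (Drain r f) B = poly (1 + [:0, 1:] * (1 + (\<Sum>x\<in>UNIV. p x))) B"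
    by (simp add: poly_sum)
  then show ?case by blast
qed (auto intro: exI[of _ "[:1:]"] exI[of _ "[:2:]"])


subsection \<open>The machine\<close>

text \<open>A transition writes before it moves the head, but a push has to move left before it
  writes. \<open>Write\<close> is the state between the two.\<close>

datatype ('r, 'g) control = Run "('r, 'g) cmd list" | Write 'r 'g "('r, 'g) cmd list"

text \<open>The stacks of pending commands that can occur while \<open>c\<close> runs; they become
  the states of the machine. There are finitely many, although loops iterate, because every round of
  a loop body runs on top of the same pending \<open>Drain r f\<close>.\<close>

primrec conts :: "('r, 'g) cmd \<Rightarrow> ('r, 'g) cmd list set" where
  "conts Skip = {[Skip], []}"
| "conts Fail = {[Fail], []}"
| "conts (Push r x) = {[Push r x], []}"
| "conts (Pop r) = {[Pop r], []}"
| "conts (Emit x) = {[Emit x], []}"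
| "conts (Then c1 c2) = {[Then c1 c2]} \<union> (\<lambda>k. k @ [c2]) ` conts c1 \<union> conts c2"
| "conts (Choose c1 c2) = {[Choose c1 c2]} \<union> conts c1 \<union> conts c2"
| "conts (Peek r f) = {[Peek r f]} \<union> (\<Union>x. conts (f x))"
| "conts (Drain r f) = {[Drain r f], []} \<union> (\<Union>x. (\<lambda>k. k @ [Drain r f]) ` conts (f x))"

lemma conts_self: "[c] \<in> conts c"
  by (cases c) auto

lemma conts_Nil: "[] \<in> conts c"
  by (induction c) auto

lemma finite_conts: "finite (conts (c :: ('r, 'g :: finite) cmd))"
  by (induction c) auto

lemma conts_tl: "k \<in> conts c \<Longrightarrow> tl k \<in> conts c"
proof (induction c arbitrary: k)
  case (Then c1 c2)
  have tl: "tl (k1 @ [c2]) \<in> (\<lambda>k. k @ [c2]) ` conts c1 \<union> conts c2" if "k1 \<in> conts c1" for k1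
    using Then.IH(1)[OF that] conts_Nil[of c2] by (cases k1) auto
  show ?case using Then.prems Then.IH(2)[of k] tl by (auto simp: conts_Nil simp del: tl_append)
next
  case (Drain r f)
  have tl: "tl (k1 @ [Drain r f]) \<in> insert [] ((\<lambda>k. k @ [Drain r f]) ` conts (f x))"
    if "k1 \<in> conts (f x)" for k1 x
    using Drain.IH[OF rangeI that] by (cases k1) auto
  show ?case using Drain tl by fastforce
qed (auto simp: conts_Nil)

text \<open>Tapes are indexed by \<open>'r option\<close>: \<open>Some r\<close> is the tape of the
  register \<open>r\<close>, and \<open>None\<close> is the output tape.\<close>

type_synonym ('r, 'a) reading = "'r option \<Rightarrow> 'a symbol"
type_synonym ('r, 'a) acting = "'r option \<Rightarrow> 'a symbol \<times> direction"

definition idle :: "('r, 'a) reading \<Rightarrow> ('r, 'a) acting" where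
  "idle rd = (\<lambda>i. (rd i, Stay))"

definition read_letter :: "('g \<Rightarrow> 'a symbol) \<Rightarrow> 'a symbol \<Rightarrow> 'g option" where
  "read_letter emb y = (if y \<in> range emb then Some (inv emb y) else None)"

fun delta :: "('g \<Rightarrow> 'a symbol) \<Rightarrow> ('r, 'g) control \<Rightarrow> ('r, 'a) reading \<Rightarrow>
  (('r, 'g) control \<times> ('r, 'a) acting) set" where
  "delta emb (Run []) rd = {}"
| "delta emb (Run (Skip # k)) rd = {(Run k, idle rd)}"
| "delta emb (Run (Fail # k)) rd = {}"
| "delta emb (Run (Push r x # k)) rd =
     {(Write r x k, (idle rd)(Some r := (rd (Some r), Move_Left)))}"
| "delta emb (Write r x k) rd = {(Run k, (idle rd)(Some r := (emb x, Stay)))}"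
| "delta emb (Run (Pop r # k)) rd =
     {(Run k, (idle rd)(Some r := (rd (Some r), Move_Right)))}"
| "delta emb (Run (Emit x # k)) rd = {(Run k, (idle rd)(None := (emb x, Move_Right)))}"
| "delta emb (Run (Then c1 c2 # k)) rd = {(Run (c1 # c2 # k), idle rd)}"
| "delta emb (Run (Choose c1 c2 # k)) rd = {(Run (c1 # k), idle rd), (Run (c2 # k), idle rd)}"
| "delta emb (Run (Peek r f # k)) rd =
     {(Run (f (read_letter emb (rd (Some r))) # k), idle rd)}"
| "delta emb (Run (Drain r f # k)) rd =
     (case read_letter emb (rd (Some r)) of
        None \<Rightarrow> {(Run k, idle rd)}
      | Some x \<Rightarrow> {(Run (f x # Drain r f # k), (idle rd)(Some r := (rd (Some r), Move_Right)))})"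

text \<open>The head of a register tape is on the top of the stack; cells to its left are garbage.\<close>

definition stack_tape :: "('g \<Rightarrow> 'a symbol) \<Rightarrow> 'g list \<Rightarrow> 'a tape \<Rightarrow> bool" where
  "stack_tape emb xs T \<longleftrightarrow>
     (\<forall>i. fst T (snd T + int i) = (if i < length xs then emb (xs ! i) else Blank))"

text \<open>In contrast to a stack, whose place on the tape may drift, the output is bound to start
  at cell 0.\<close>

definition out_tape :: "('g \<Rightarrow> 'a symbol) \<Rightarrow> 'g list \<Rightarrow> 'a tape \<Rightarrow> bool" where
  "out_tape emb xs T \<longleftrightarrow>
     snd T = int (length xs) \<and>
     (\<forall>i. fst T (int i) = (if i < length xs then emb (xs ! i) else Blank))"

lemma stack_tape_head:
  "stack_tape emb xs T \<Longrightarrow> head_symbol T = (case xs of [] \<Rightarrow> Blank | x # _ \<Rightarrow> emb x)"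
  by (cases T) (auto simp: stack_tape_def dest: spec[of _ 0] split: list.splits)

text \<open>Nothing is erased: the popped letter merely ends up to the left of the head. On an empty
  register the head moves on over blanks, which agrees with \<open>tl [] = []\<close>.\<close>

lemma stack_tape_pop:
  assumes "stack_tape emb xs T"
  shows "stack_tape emb (tl xs) (act (head_symbol T, Move_Right) T)"
proof -
  obtain t h where T: "T = (t, h)" by fastforce
  have "t (h + 1 + int i) = (if i < length (tl xs) then emb (tl xs ! i) else Blank)" for i
    using assms[unfolded stack_tape_def T, rule_format, of "Suc i"]
    by (cases xs) (auto simp: algebra_simps)
  then show ?thesis by (simp add: T stack_tape_def)
qed

lemma stack_tape_push:
  assumes "stack_tape emb xs T"
  shows "stack_tape emb (x # xs) (act (emb x, Stay) (act (head_symbol T, Move_Left) T))"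
proof -
  obtain t h where T: "T = (t, h)" by fastforce
  have "(t(h - 1 := emb x)) (h - 1 + int i) =
      (if i < length (x # xs) then emb ((x # xs) ! i) else Blank)" for i
  proof (cases i)
    case (Suc j)
    then show ?thesis
      using assms[unfolded stack_tape_def T, rule_format, of j] by (auto simp: algebra_simps)
  qed simp
  then show ?thesis by (simp add: T stack_tape_def)
qed

lemma out_tape_emit:
  assumes "out_tape emb xs T"
  shows "out_tape emb (xs @ [x]) (act (emb x, Move_Right) T)"
  using assms by (cases T) (auto simp: out_tape_def nth_append)

section \<open>The transition relation of the compiled machine\<close>

locale compilation =
  fixes emb :: "'g :: finite \<Rightarrow> 'a symbol" and ids :: "'r :: finite option list"
    and prog :: "('r, 'g) cmd"
  assumes inj_emb: "inj emb" and emb_not_Blank: "emb x \<noteq> Blank"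
    and distinct_ids: "distinct ids" and set_ids: "set ids = UNIV"
    and two_ids: "length ids \<ge> 2"
    and wf_prog: "wf_cmd prog"
begin

definition letters :: "'a symbol set" where
  "letters = insert Blank (range emb)"

definition controls :: "('r, 'g) control set" where
  "controls = Run ` conts prog \<union> (\<lambda>(r, x, k). Write r x k) ` (UNIV \<times> UNIV \<times> conts prog)"

definition code :: "('r, 'g) control \<Rightarrow> nat" where
  "code = to_nat_on controls"

definition machine :: "'a ntm" where
  "machine = \<lparr>num_tapes = length ids, start = code (Run [prog]), accept = code (Run []),
     trans = (\<lambda>((q, rd), (q', ac)). (code q, map rd ids, code q', map ac ids)) `
       (SIGMA (q, rd) : controls \<times> {rd. \<forall>i. rd i \<in> letters}. delta emb q rd)\<rparr>"

lemma finite_controls: "finite controls"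
  by (auto simp: controls_def finite_conts)

lemma inj_code: "inj_on code controls"
  unfolding code_def by (simp add: finite_controls countable_finite inj_on_to_nat_on)

lemma read_letter_emb [simp]: "read_letter emb (emb x) = Some x"
  using inj_emb by (simp add: read_letter_def inv_f_f)

lemma read_letter_Blank [simp]: "read_letter emb Blank = None"
  using emb_not_Blank by (metis imageE read_letter_def)

lemma read_letter_head: "stack_tape emb xs T \<Longrightarrow> read_letter emb (head_symbol T) = top_of xs"
  by (auto simp: stack_tape_head split: list.splits)

lemma finite_delta: "finite (delta emb q rd)"
  by (cases "(emb, q, rd)" rule: delta.cases) (auto split: option.splits)

lemma ids_fun_eq: "map f ids = map g ids \<longleftrightarrow> f = g"
  using set_ids by (auto simp: fun_eq_iff)

lemma delta_conts:
  fixes c :: "('r, 'g) cmd"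
  assumes "k \<in> conts c" "(q', ac) \<in> delta emb (Run k) rd"
  shows "(\<exists>k' \<in> conts c. q' = Run k') \<or> (\<exists>k' \<in> conts c. \<exists>r x. q' = Write r x k')"
proof -
  \<comment> \<open>\<open>tgt\<close> forgets whether a push is half done, which turns the two
    alternatives of the conclusion into one statement about stacks.\<close>
  define tgt :: "('r, 'g) control \<Rightarrow> ('r, 'g) cmd list" where
    "tgt = (\<lambda>q. case q of Run k \<Rightarrow> k | Write _ _ k \<Rightarrow> k)"
  \<comment> \<open>A transition inspects only the top command and carries the commands below along.
    This lets the induction hypothesis for a subcommand apply beneath a pending
    continuation.\<close>
  have suffix: "\<exists>q1. (q1, ac) \<in> delta emb (Run k) rd \<and> tgt q' = tgt q1 @ m"
    if "k \<noteq> []" "(q', ac) \<in> delta emb (Run (k @ m)) rd" for k m q' and ac :: "('r, 'a) acting" 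
    using that by (cases "(emb, Run k, rd)" rule: delta.cases)
      (auto simp: tgt_def split: option.splits)
  have "tgt q' \<in> conts c" using assms
  proof (induction c arbitrary: k q' ac)
    case (Then c1 c2)
    consider "k = [c1 ;; c2]" | k1 where "k1 \<in> conts c1" "k = k1 @ [c2]" | "k \<in> conts c2"
      using Then.prems(1) by auto
    then show ?case
    proof cases
      case 1
      then show ?thesis using Then.prems conts_self by (force simp: tgt_def)
    next
      case 2
      show ?thesis
      proof (cases "k1 = []")
        case True
        then show ?thesis using 2 Then.IH(2)[OF conts_self] Then.prems by simp
      next
        case False
        then obtain q1 where q1: "(q1, ac) \<in> delta emb (Run k1) rd" "tgt q' = tgt q1 @ [c2]"
          using suffix Then.prems(2) 2 by blast
        then show ?thesis using Then.IH(1)[OF 2(1) q1(1)] by auto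
      qed
    next
      case 3
      then show ?thesis using Then by simp
    qed
  next
    case (Choose c1 c2)
    then show ?case using conts_self by (fastforce simp: tgt_def)
  next
    case (Peek r f)
    then show ?case using conts_self by (fastforce simp: tgt_def)
  next
    case (Drain r f)
    consider "k = [Drain r f]" | "k = []" | k1 x where "k1 \<in> conts (f x)" "k = k1 @ [Drain r f]"
      using Drain.prems(1) by auto
    then show ?case
    proof cases
      case 1
      then show ?thesis using Drain.prems conts_self[of "f _"]
        by (auto simp: tgt_def image_iff split: option.splits intro!: bexI[of _ "[f _]"])
    next
      case 3
      show ?thesis
      proof (cases "k1 = []")
        case True
        then show ?thesis using 3 Drain.prems conts_self[of "f _"]
          by (auto simp: tgt_def image_iff split: option.splits intro!: bexI[of _ "[f _]"])
      next
        case False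
        then obtain q1 where q1: "(q1, ac) \<in> delta emb (Run k1) rd" "tgt q' = tgt q1 @ [Drain r f]"
          using suffix Drain.prems(2) 3 by blast
        then show ?thesis using Drain.IH[OF _ 3(1) q1(1)] by auto
      qed
    qed (use Drain.prems in simp)
  qed (auto simp: tgt_def)
  then show ?thesis by (cases q') (auto simp: tgt_def)
qed

lemma delta_closed:
  assumes "q \<in> controls" "(q', ac) \<in> delta emb q rd"
  shows "q' \<in> controls"
proof (cases q)
  case (Run k)
  then have "k \<in> conts prog" using assms(1) by (auto simp: controls_def)
  from delta_conts[OF this assms(2)[unfolded Run]] show ?thesis
    by (auto simp: controls_def image_iff)
next
  case (Write r x k)
  then show ?thesis using assms by (auto simp: controls_def image_iff)
qed

lemma controls_tl: "Run k \<in> controls \<Longrightarrow> Run (tl k) \<in> controls"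
  using conts_tl by (auto simp: controls_def)

lemma Run_prog: "Run [prog] \<in> controls" and Run_Nil: "Run [] \<in> controls"
  using conts_self conts_Nil by (auto simp: controls_def)

definition conf :: "('r, 'g) control \<Rightarrow> ('r option \<Rightarrow> 'a tape) \<Rightarrow> 'a config" where
  "conf q tp = (code q, map tp ids)"

text \<open>The transition table is kept finite by listing only readings with symbols in
  \<open>letters\<close>; this invariant guarantees that every reading that occurs is
  listed.\<close>

definition proper :: "('r option \<Rightarrow> 'a tape) \<Rightarrow> bool" where
  "proper tp \<longleftrightarrow> (\<forall>i j. fst (tp i) j \<in> letters)"

abbreviation heads :: "('r option \<Rightarrow> 'a tape) \<Rightarrow> ('r, 'a) reading" where
  "heads tp \<equiv> (\<lambda>i. head_symbol (tp i))"

lemma heads_letters: "proper tp \<Longrightarrow> heads tp i \<in> letters"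
  by (cases "tp i") (auto simp: proper_def dest: spec[of _ i])

lemma step_conf:
  assumes "q \<in> controls" "proper tp"
  shows "step machine (conf q tp) cf \<longleftrightarrow>
    (\<exists>q' ac. (q', ac) \<in> delta emb q (heads tp) \<and> cf = conf q' (\<lambda>i. act (ac i) (tp i)))"
proof -
  obtain n ts where cf: "cf = (n, ts)" by fastforce
  have acts: "map2 act (map ac ids) (map tp ids) = map (\<lambda>i. act (ac i) (tp i)) ids" for ac
    by (simp add: zip_map_map zip_same_conv_map comp_def)
  have heads: "map head_symbol (map tp ids) = map (heads tp) ids" by simp
  have trans: "(code q, map (heads tp) ids, n, as) \<in> trans machine \<longleftrightarrow>
      (\<exists>q' ac. (q', ac) \<in> delta emb q (heads tp) \<and> n = code q' \<and> as = map ac ids)" for as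
  proof
    assume "(code q, map (heads tp) ids, n, as) \<in> trans machine"
    then obtain q0 rd q' ac where *: "q0 \<in> controls" "(q', ac) \<in> delta emb q0 rd"
      "code q = code q0" "map (heads tp) ids = map rd ids" "n = code q'" "as = map ac ids"
      by (auto simp: machine_def)
    then have "q0 = q" "rd = heads tp"
      using inj_code assms(1) ids_fun_eq[of "heads tp" rd] by (auto simp: inj_on_def)
    then show "\<exists>q' ac. (q', ac) \<in> delta emb q (heads tp) \<and> n = code q' \<and> as = map ac ids"
      using * by auto
  next
    assume "\<exists>q' ac. (q', ac) \<in> delta emb q (heads tp) \<and> n = code q' \<and> as = map ac ids"
    then obtain q' ac where *: "(q', ac) \<in> delta emb q (heads tp)" "n = code q'" "as = map ac ids"
      by blast
    have "((q, heads tp), (q', ac)) \<in>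
        (SIGMA (q, rd) : controls \<times> {rd. \<forall>i. rd i \<in> letters}. delta emb q rd)"
      using assms heads_letters * by simp
    from imageI[OF this, of "\<lambda>((q, rd), (q', ac)). (code q, map rd ids, code q', map ac ids)"]
    show "(code q, map (heads tp) ids, n, as) \<in> trans machine"
      unfolding machine_def * by simp
  qed
  have "step machine (conf q tp) cf \<longleftrightarrow>
      (\<exists>as. (\<exists>q' ac. (q', ac) \<in> delta emb q (heads tp) \<and> n = code q' \<and> as = map ac ids) \<and>
        ts = map2 act as (map tp ids))"
    by (simp only: cf conf_def step.simps heads trans)
  also have "\<dots> \<longleftrightarrow>
      (\<exists>q' ac. (q', ac) \<in> delta emb q (heads tp) \<and> cf = conf q' (\<lambda>i. act (ac i) (tp i)))"
    unfolding cf conf_def prod.inject acts[symmetric] by blast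
  finally show ?thesis .
qed

end

inductive reaches :: "'a ntm \<Rightarrow> ('a config \<Rightarrow> bool) \<Rightarrow> nat \<Rightarrow> 'a config \<Rightarrow> bool" for M P where
  stop: "P c \<Longrightarrow> reaches M P t c"
| more: "fst c \<noteq> accept M \<Longrightarrow> (\<forall>c'. step M c c' \<longrightarrow> reaches M P t c') \<Longrightarrow> reaches M P (Suc t) c"

lemma reaches_mono: "reaches M P t c \<Longrightarrow> t \<le> u \<Longrightarrow> reaches M P u c"
proof (induction arbitrary: u rule: reaches.induct)
  case (more c t)
  then obtain v where "u = Suc v" "t \<le> v" by (metis Suc_le_D Suc_le_mono)
  then show ?case using more by (auto intro: reaches.more)
qed (rule reaches.stop)

lemma reaches_trans:
  "reaches M P t c \<Longrightarrow> (\<And>c. P c \<Longrightarrow> reaches M Q u c) \<Longrightarrow> reaches M Q (t + u) c"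
proof (induction rule: reaches.induct)
  case (stop c t)
  then show ?case using reaches_mono[of M Q u c "t + u"] by simp
next
  case (more c t)
  then show ?case by (auto intro: reaches.more)
qed

lemma reaches_bound:
  assumes "reaches M P t c" and stuck: "\<And>c c'. P c \<Longrightarrow> \<not> step M c c'"
  shows "(step M ^^ n) c c' \<Longrightarrow> n \<le> t"
  using assms(1)
proof (induction arbitrary: n rule: reaches.induct)
  case (stop c t)
  then show ?case using stuck by (metis relpowp_E2 zero_le)
next
  case (more c t)
  show ?case
  proof (cases n)
    case (Suc m)
    then obtain d where "step M c d" "(step M ^^ m) d c'" using more.prems relpowp_Suc_D2 by metis
    then show ?thesis using more.IH Suc by blast
  qed simp
qed

lemma reaches_accept:
  assumes "reaches M P t c" and stuck: "\<And>c c'. P c \<Longrightarrow> \<not> step M c c'"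
  shows "(step M)\<^sup>*\<^sup>* c c' \<Longrightarrow> fst c' = accept M \<Longrightarrow> P c'"
  using assms(1)
proof (induction rule: reaches.induct)
  case (stop c t)
  then show ?case using stuck by (metis converse_rtranclpE)
next
  case (more c t)
  then show ?case by (metis converse_rtranclpE)
qed

section \<open>Tapes that hold a store\<close>

context compilation
begin

definition holds :: "('r, 'g) store \<Rightarrow> ('r option \<Rightarrow> 'a tape) \<Rightarrow> bool" where
  "holds st tp \<longleftrightarrow> (\<forall>r. stack_tape emb (fst st r) (tp (Some r))) \<and>
     out_tape emb (snd st) (tp None) \<and> proper tp"

lemma act_stay [simp]: "act (head_symbol T, Stay) T = T"
  by (cases T) simp

lemma proper_act:
  assumes "proper tp" "\<And>i. fst (ac i) \<in> letters"
  shows "proper (\<lambda>i. act (ac i) (tp i))"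
  unfolding proper_def
proof (intro allI)
  fix i j
  obtain t h x d where "tp i = (t, h)" "ac i = (x, d)" by fastforce
  then show "fst (act (ac i) (tp i)) j \<in> letters"
    using assms(1)[unfolded proper_def, rule_format, of i j] assms(2)[of i] by simp
qed

lemma reaches_conf:
  assumes "q \<in> controls" "q \<noteq> Run []" "proper tp"
    and "\<And>q' ac. (q', ac) \<in> delta emb q (heads tp) \<Longrightarrow> q' \<in> controls \<Longrightarrow>
      reaches machine P t (conf q' (\<lambda>i. act (ac i) (tp i)))"
  shows "reaches machine P (Suc t) (conf q tp)"
proof (rule reaches.more)
  show "fst (conf q tp) \<noteq> accept machine"
    using assms(1,2) inj_code Run_Nil by (auto simp: conf_def machine_def inj_on_def)
  show "\<forall>c'. step machine (conf q tp) c' \<longrightarrow> reaches machine P t c'"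
  proof (intro allI impI)
    fix c' assume "step machine (conf q tp) c'"
    then obtain q' ac where d: "(q', ac) \<in> delta emb q (heads tp)"
      and c': "c' = conf q' (\<lambda>i. act (ac i) (tp i))"
      using step_conf[OF assms(1,3)] by blast
    show "reaches machine P t c'"
      unfolding c' by (rule assms(4)[OF d delta_closed[OF assms(1) d]])
  qed
qed

lemma letters_emb: "emb x \<in> letters"
  by (simp add: letters_def)

lemma idle_same: "(\<lambda>i. act (idle (heads tp) i) (tp i)) = tp"
  by (simp add: idle_def)

lemma holds_pop:
  assumes "holds (\<sigma>, w) tp"
  shows "holds (\<sigma>(r := tl (\<sigma> r)), w)
    (\<lambda>i. act (((idle (heads tp))(Some r := (heads tp (Some r), Move_Right))) i) (tp i))"
  using assms stack_tape_pop[of emb "\<sigma> r" "tp (Some r)"]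
  by (auto simp: holds_def idle_def intro!: proper_act heads_letters)

lemma holds_emit:
  assumes "holds (\<sigma>, w) tp"
  shows "holds (\<sigma>, w @ [x]) (\<lambda>i. act (((idle (heads tp))(None := (emb x, Move_Right))) i) (tp i))"
  using assms out_tape_emit[of emb w "tp None"]
  by (auto simp: holds_def idle_def letters_emb intro!: proper_act heads_letters)

text \<open>The tapes after the first of the two steps of a push, when the head of \<open>r\<close>
  stands on a cell that may still hold garbage.\<close>

definition lifted :: "('r option \<Rightarrow> 'a tape) \<Rightarrow> 'r \<Rightarrow> 'r option \<Rightarrow> 'a tape" where
  "lifted tp r = (\<lambda>i. act (((idle (heads tp))(Some r := (heads tp (Some r), Move_Left))) i) (tp i))"

lemma proper_lifted: "proper tp \<Longrightarrow> proper (lifted tp r)"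
  by (auto simp: lifted_def idle_def intro!: proper_act heads_letters)

lemma holds_push:
  assumes "holds (\<sigma>, w) tp"
  shows "holds (\<sigma>(r := x # \<sigma> r), w)
    (\<lambda>i. act (((idle (heads (lifted tp r)))(Some r := (emb x, Stay))) i) (lifted tp r i))"
proof -
  have "proper (\<lambda>i. act (((idle (heads (lifted tp r)))(Some r := (emb x, Stay))) i) (lifted tp r i))"
    using assms proper_lifted[of tp r]
    by (intro proper_act) (auto simp: holds_def idle_def letters_emb intro!: heads_letters)
  then show ?thesis
    using assms stack_tape_push[of emb "\<sigma> r" "tp (Some r)" x]
    by (auto simp: holds_def idle_def lifted_def)
qed

lemma holds_top: "holds (\<sigma>, w) tp \<Longrightarrow> read_letter emb (heads tp (Some r)) = top_of (\<sigma> r)"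
  by (simp add: holds_def read_letter_head)

definition result :: "('r, 'g) cmd list \<Rightarrow> ('r, 'g) store set \<Rightarrow> 'a config \<Rightarrow> bool" where
  "result k S cf \<longleftrightarrow> (\<exists>st' \<in> S. \<exists>tp'. holds st' tp' \<and> cf = conf (Run k) tp')"

lemma resultI: "st' \<in> S \<Longrightarrow> holds st' tp' \<Longrightarrow> result k S (conf (Run k) tp')"
  by (auto simp: result_def)

lemma result_mono: "result k S cf \<Longrightarrow> S \<subseteq> S' \<Longrightarrow> result k S' cf"
  by (auto simp: result_def)

end

lemma reaches_weaken: "reaches M P t c \<Longrightarrow> (\<And>c. P c \<Longrightarrow> Q c) \<Longrightarrow> reaches M Q t c"
  using reaches_trans[of M P t c Q 0] by (auto intro: reaches.stop)

context compilation
begin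

text \<open>Soundness of the compilation together with its running time, by induction on
  \<open>c\<close>. The continuation \<open>k\<close> is arbitrary, since the body of a loop and the
  first half of a sequence run on top of other commands.\<close>

lemma reaches_run:
  assumes "Run (c # k) \<in> controls" "holds st tp" "space c B st" "wf_cmd c"
  shows "reaches machine (result k (den c st)) (time c B) (conf (Run (c # k)) tp)"
  using assms
proof (induction c arbitrary: st tp k)
  case Skip
  have "reaches machine (result k (den Skip st)) (Suc 0) (conf (Run (Skip # k)) tp)"
    using Skip by (intro reaches_conf) (auto simp: idle_same holds_def intro!: reaches.stop resultI)
  then show ?case by simp
next
  case Fail
  then show ?case
    by (auto simp: holds_def intro!: reaches_conf)
next
  case (Push r x)
  obtain \<sigma> w where st: "st = (\<sigma>, w)" by fastforce
  have p: "proper tp" using Push by (simp add: holds_def)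
  have "reaches machine (result k (den (Push r x) st)) (Suc (Suc 0)) (conf (Run (Push r x # k)) tp)"
  proof (rule reaches_conf)
    fix q' ac assume "(q', ac) \<in> delta emb (Run (Push r x # k)) (heads tp)" and q': "q' \<in> controls"
    then have *: "q' = Write r x k" "(\<lambda>i. act (ac i) (tp i)) = lifted tp r"
      by (auto simp: lifted_def)
    show "reaches machine (result k (den (Push r x) st)) (Suc 0) (conf q' (\<lambda>i. act (ac i) (tp i)))"
      unfolding *
    proof (rule reaches_conf)
      fix q'' ac' assume "(q'', ac') \<in> delta emb (Write r x k) (heads (lifted tp r))"
      then show "reaches machine (result k (den (Push r x) st)) 0
          (conf q'' (\<lambda>i. act (ac' i) (lifted tp r i)))"
        using holds_push[of \<sigma> w tp r x] Push.prems st
        by (auto intro!: reaches.stop resultI)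
    qed (use q' * p proper_lifted in auto)
  qed (use Push p in auto)
  then show ?case by (simp add: numeral_2_eq_2)
next
  case (Pop r)
  have "reaches machine (result k (den (Pop r) st)) (Suc 0) (conf (Run (Pop r # k)) tp)"
    using Pop holds_pop[of "fst st" "snd st" tp r]
    by (intro reaches_conf) (auto simp: holds_def simp del: fun_upd_apply intro!: reaches.stop resultI)
  then show ?case by simp
next
  case (Emit x)
  have "reaches machine (result k (den (Emit x) st)) (Suc 0) (conf (Run (Emit x # k)) tp)"
    using Emit holds_emit[of "fst st" "snd st" tp x]
    by (intro reaches_conf) (auto simp: holds_def simp del: fun_upd_apply intro!: reaches.stop resultI)
  then show ?case by simp
next
  case (Then c1 c2)
  have "reaches machine (result k (den (c1 ;; c2) st)) (Suc (time c1 B + time c2 B))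
      (conf (Run ((c1 ;; c2) # k)) tp)"
  proof (rule reaches_conf)
    fix q' ac assume "(q', ac) \<in> delta emb (Run ((c1 ;; c2) # k)) (heads tp)" and q': "q' \<in> controls"
    then have *: "q' = Run (c1 # c2 # k)" "(\<lambda>i. act (ac i) (tp i)) = tp"
      by (auto simp: idle_same)
    show "reaches machine (result k (den (c1 ;; c2) st)) (time c1 B + time c2 B)
        (conf q' (\<lambda>i. act (ac i) (tp i)))"
      unfolding *
    proof (rule reaches_trans)
      show "reaches machine (result (c2 # k) (den c1 st)) (time c1 B) (conf (Run (c1 # c2 # k)) tp)"
        using Then * q' by auto
      fix cf assume "result (c2 # k) (den c1 st) cf"
      then obtain st' tp' where st': "st' \<in> den c1 st" "holds st' tp'" "cf = conf (Run (c2 # k)) tp'"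
        by (auto simp: result_def)
      have "Run (c2 # k) \<in> controls"
        using controls_tl[of "c1 # c2 # k"] q' * by simp
      then have "reaches machine (result k (den c2 st')) (time c2 B) cf"
        using Then st' by auto
      then show "reaches machine (result k (den (c1 ;; c2) st)) (time c2 B) cf"
        by (rule reaches_weaken) (use st' in \<open>auto elim!: result_mono\<close>)
    qed
  qed (use Then in \<open>auto simp: holds_def\<close>)
  then show ?case by simp
next
  case (Choose c1 c2)
  have "reaches machine (result k (den (Choose c1 c2) st)) (Suc (time c1 B + time c2 B))
      (conf (Run (Choose c1 c2 # k)) tp)"
  proof (rule reaches_conf)
    fix q' ac assume "(q', ac) \<in> delta emb (Run (Choose c1 c2 # k)) (heads tp)" and q': "q' \<in> controls"
    then have *: "(\<lambda>i. act (ac i) (tp i)) = tp" "q' = Run (c1 # k) \<or> q' = Run (c2 # k)"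
      by (auto simp: idle_same)
    from *(2) obtain c where c: "c = c1 \<or> c = c2" "q' = Run (c # k)" by blast
    moreover have "space c B st" "wf_cmd c" using c Choose.prems by auto
    ultimately have "reaches machine (result k (den c st)) (time c B) (conf q' tp)"
      using Choose.IH Choose.prems(2) q' by (metis (no_types))
    then have "reaches machine (result k (den c st)) (time c1 B + time c2 B) (conf q' tp)"
      by (rule reaches_mono) (use c in auto)
    then show "reaches machine (result k (den (Choose c1 c2) st)) (time c1 B + time c2 B)
        (conf q' (\<lambda>i. act (ac i) (tp i)))"
      unfolding * by (rule reaches_weaken) (use c in \<open>auto elim!: result_mono\<close>)
  qed (use Choose in \<open>auto simp: holds_def\<close>)
  then show ?case by simp
next
  case (Peek r f)
  define c where "c = f (top_of (fst st r))"
  have time: "time c B \<le> (\<Sum>x\<in>UNIV. time (f x) B)"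
    unfolding c_def by (rule member_le_sum) auto
  have "reaches machine (result k (den c st)) (Suc (\<Sum>x\<in>UNIV. time (f x) B))
      (conf (Run (Peek r f # k)) tp)"
  proof (rule reaches_conf)
    fix q' ac assume "(q', ac) \<in> delta emb (Run (Peek r f # k)) (heads tp)" and q': "q' \<in> controls"
    then have *: "q' = Run (c # k)" "(\<lambda>i. act (ac i) (tp i)) = tp"
      using holds_top[of "fst st" "snd st" tp r] Peek.prems by (auto simp: idle_same c_def)
    have "reaches machine (result k (den c st)) (time c B) (conf (Run (c # k)) tp)"
      using Peek q' * by (auto simp: c_def)
    then show "reaches machine (result k (den c st)) (\<Sum>x\<in>UNIV. time (f x) B)
        (conf q' (\<lambda>i. act (ac i) (tp i)))"
      unfolding * by (rule reaches_mono) (rule time)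
  qed (use Peek in \<open>auto simp: holds_def\<close>)
  then show ?case by (simp add: c_def)
next
  case (Drain r f)
  have kc: "Run k \<in> controls" using controls_tl[OF Drain.prems(1)] by simp
  \<comment> \<open>The machine tests the tape for emptiness whereas \<open>iter\<close> recurses on
    \<open>xs\<close>. The equation \<open>fst st r = xs\<close> keeps the two in step; it survives
    a round because the body keeps \<open>r\<close>.\<close>
  have loop: "iter_space (\<lambda>x. space (f x) B) (\<lambda>x. den (f x)) r xs st \<Longrightarrow> holds st tp \<Longrightarrow>
      fst st r = xs \<Longrightarrow>
      reaches machine (result k (iter (\<lambda>x. den (f x)) r xs st))
        (1 + length xs * (1 + (\<Sum>x\<in>UNIV. time (f x) B))) (conf (Run (Drain r f # k)) tp)"
    for xs st tp
  proof (induction xs arbitrary: st tp)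
    case Nil
    have "reaches machine (result k (iter (\<lambda>x. den (f x)) r [] st)) (Suc 0)
        (conf (Run (Drain r f # k)) tp)"
      using holds_top[of "fst st" "snd st" tp r] Drain.prems(1) Nil
      by (intro reaches_conf) (auto simp: idle_same holds_def intro!: reaches.stop resultI)
    then show ?case by simp
  next
    case (Cons x xs)
    define st1 where "st1 = ((fst st)(r := xs), snd st)"
    let ?t = "\<Sum>x\<in>UNIV. time (f x) B"
    let ?P = "result k (iter (\<lambda>x. den (f x)) r (x # xs) st)"
    have time: "time (f x) B \<le> ?t" by (rule member_le_sum) auto
    have "reaches machine ?P (Suc (?t + (1 + length xs * (1 + ?t)))) (conf (Run (Drain r f # k)) tp)"
    proof (rule reaches_conf)
      fix q' ac assume "(q', ac) \<in> delta emb (Run (Drain r f # k)) (heads tp)"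
        and q': "q' \<in> controls"
      then have *: "q' = Run (f x # Drain r f # k)"
        "ac = (idle (heads tp))(Some r := (heads tp (Some r), Move_Right))"
        using holds_top[of "fst st" "snd st" tp r] Cons.prems by auto
      have holds1: "holds st1 (\<lambda>i. act (ac i) (tp i))"
        using holds_pop[of "fst st" "snd st" tp r] Cons.prems unfolding *(2) st1_def by simp
      show "reaches machine ?P (?t + (1 + length xs * (1 + ?t))) (conf q' (\<lambda>i. act (ac i) (tp i)))"
      proof (rule reaches_trans)
        have "reaches machine (result (Drain r f # k) (den (f x) st1)) (time (f x) B)
            (conf q' (\<lambda>i. act (ac i) (tp i)))"
          using Drain.IH Drain.prems(4) Cons.prems(1) q' holds1 unfolding * by (auto simp: st1_def)
        then show "reaches machine (result (Drain r f # k) (den (f x) st1)) ?t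
            (conf q' (\<lambda>i. act (ac i) (tp i)))"
          by (rule reaches_mono) (rule time)
        fix cf assume "result (Drain r f # k) (den (f x) st1) cf"
        then obtain st' tp' where st': "st' \<in> den (f x) st1" "holds st' tp'"
          "cf = conf (Run (Drain r f # k)) tp'"
          by (auto simp: result_def)
        have "fst st' r = xs"
          using den_keeps[of r "f x" st' st1] st'(1) Drain.prems(4) by (simp add: st1_def)
        then have "reaches machine (result k (iter (\<lambda>x. den (f x)) r xs st'))
            (1 + length xs * (1 + ?t)) cf"
          using Cons st' by (auto simp: st1_def)
        then show "reaches machine ?P (1 + length xs * (1 + ?t)) cf"
          by (rule reaches_weaken) (use st' in \<open>auto simp: st1_def elim!: result_mono\<close>)
      qed
    qed (use Drain.prems Cons.prems in \<open>auto simp: holds_def\<close>)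
    then show ?case by (simp add: algebra_simps)
  qed
  have "reaches machine (result k (den (Drain r f) st))
      (1 + length (fst st r) * (1 + (\<Sum>x\<in>UNIV. time (f x) B))) (conf (Run (Drain r f # k)) tp)"
    using loop[of "fst st r" st tp] Drain.prems by simp
  then show ?case
    by (rule reaches_mono) (use Drain.prems(3) in \<open>simp del: mult_Suc_right\<close>)
qed

lemma step_conf_proper:
  assumes "q \<in> controls" "proper tp" "(q', ac) \<in> delta emb q (heads tp)"
  shows "step machine (conf q tp) (conf q' (\<lambda>i. act (ac i) (tp i)))"
  using assms step_conf by blast

lemma step_confI:
  assumes "q \<in> controls" "holds st tp" "(q', ac) \<in> delta emb q (heads tp)"
    "tp' = (\<lambda>i. act (ac i) (tp i))" "(step machine)\<^sup>*\<^sup>* (conf q' tp') cf"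
  shows "(step machine)\<^sup>*\<^sup>* (conf q tp) cf"
  using assms step_conf_proper[of q tp q' ac]
  by (auto simp: holds_def intro: converse_rtranclp_into_rtranclp)

lemma step_idleI:
  assumes "q \<in> controls" "holds st tp" "(q', idle (heads tp)) \<in> delta emb q (heads tp)"
    "(step machine)\<^sup>*\<^sup>* (conf q' tp) cf"
  shows "(step machine)\<^sup>*\<^sup>* (conf q tp) cf"
  by (rule step_confI[OF assms(1-3) _ assms(4)]) (simp add: idle_same)

text \<open>Completeness of the compilation. It has to be proved separately because
  \<open>reaches\<close> also holds if all branches of the machine get stuck.\<close>

lemma run_exists:
  assumes "Run (c # k) \<in> controls" "holds st tp" "wf_cmd c" "st' \<in> den c st"
  shows "\<exists>tp'. holds st' tp' \<and> (step machine)\<^sup>*\<^sup>* (conf (Run (c # k)) tp) (conf (Run k) tp')"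
  using assms
proof (induction c arbitrary: st tp k st')
  case Skip
  have "(step machine)\<^sup>*\<^sup>* (conf (Run (Skip # k)) tp) (conf (Run k) tp)"
    by (rule step_idleI[OF Skip.prems(1,2)]) auto
  then show ?case using Skip.prems by auto
next
  case (Push r x)
  obtain \<sigma> w where st: "st = (\<sigma>, w)" by fastforce
  define tp' where "tp' = (\<lambda>i. act (((idle (heads (lifted tp r)))(Some r := (emb x, Stay))) i) (lifted tp r i))"
  have p: "proper tp" using Push.prems by (simp add: holds_def)
  have w: "Write r x k \<in> controls"
    using delta_closed[OF Push.prems(1), of _ _ "heads tp"] by auto
  have "step machine (conf (Write r x k) (lifted tp r)) (conf (Run k) tp')"
    unfolding tp'_def by (rule step_conf_proper[OF w proper_lifted[OF p]]) (simp del: fun_upd_apply)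
  moreover have "step machine (conf (Run (Push r x # k)) tp) (conf (Write r x k) (lifted tp r))"
    unfolding lifted_def by (rule step_conf_proper[OF Push.prems(1) p]) (simp del: fun_upd_apply)
  moreover have "holds st' tp'"
    using holds_push[of \<sigma> w tp r x] Push.prems st by (simp add: tp'_def)
  ultimately show ?case by (meson converse_rtranclp_into_rtranclp r_into_rtranclp)
next
  case (Pop r)
  have "(Run k, (idle (heads tp))(Some r := (heads tp (Some r), Move_Right)))
      \<in> delta emb (Run (Pop r # k)) (heads tp)" by simp
  from step_confI[OF Pop.prems(1,2) this refl rtranclp.rtrancl_refl] show ?case
    using holds_pop[of "fst st" "snd st" tp r] Pop.prems by auto
next
  case (Emit x)
  have "(Run k, (idle (heads tp))(None := (emb x, Move_Right)))
      \<in> delta emb (Run (Emit x # k)) (heads tp)" by simp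
  from step_confI[OF Emit.prems(1,2) this refl rtranclp.rtrancl_refl] show ?case
    using holds_emit[of "fst st" "snd st" tp x] Emit.prems by auto
next
  case (Then c1 c2)
  then obtain st1 where st1: "st1 \<in> den c1 st" "st' \<in> den c2 st1" by auto
  have c: "Run (c1 # c2 # k) \<in> controls"
    using delta_closed[OF Then.prems(1), of _ _ "heads tp"] by auto
  then have c2: "Run (c2 # k) \<in> controls" using controls_tl by fastforce
  obtain tp1 where tp1: "holds st1 tp1"
    "(step machine)\<^sup>*\<^sup>* (conf (Run (c1 # c2 # k)) tp) (conf (Run (c2 # k)) tp1)"
    using Then.IH(1)[OF c Then.prems(2) _ st1(1)] Then.prems(3) by auto
  obtain tp2 where tp2: "holds st' tp2"
    "(step machine)\<^sup>*\<^sup>* (conf (Run (c2 # k)) tp1) (conf (Run k) tp2)"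
    using Then.IH(2)[OF c2 tp1(1) _ st1(2)] Then.prems(3) by auto
  have "(step machine)\<^sup>*\<^sup>* (conf (Run ((c1 ;; c2) # k)) tp) (conf (Run k) tp2)"
    using tp1(2) tp2(2) by (intro step_idleI[OF Then.prems(1,2)]) auto
  then show ?case using tp2 by blast
next
  case (Choose c1 c2)
  obtain c where c: "c = c1 \<or> c = c2" "st' \<in> den c st" using Choose.prems by auto
  have "Run (c # k) \<in> controls"
    using delta_closed[OF Choose.prems(1), of _ _ "heads tp"] c(1) by auto
  then obtain tp1 where tp1: "holds st' tp1"
    "(step machine)\<^sup>*\<^sup>* (conf (Run (c # k)) tp) (conf (Run k) tp1)"
    using Choose c by (metis wf_cmd.simps(7))
  have "(Run (c # k), idle (heads tp)) \<in> delta emb (Run (Choose c1 c2 # k)) (heads tp)"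
    using c(1) by auto
  then have "(step machine)\<^sup>*\<^sup>* (conf (Run (Choose c1 c2 # k)) tp) (conf (Run k) tp1)"
    using tp1(2) by (intro step_idleI[OF Choose.prems(1,2)])
  then show ?case using tp1 by blast
next
  case (Peek r f)
  define c where "c = f (top_of (fst st r))"
  have top: "read_letter emb (heads tp (Some r)) = top_of (fst st r)"
    using holds_top[of "fst st" "snd st" tp r] Peek.prems by simp
  have d: "(Run (c # k), idle (heads tp)) \<in> delta emb (Run (Peek r f # k)) (heads tp)"
    by (simp add: c_def top)
  obtain tp1 where tp1: "holds st' tp1"
    "(step machine)\<^sup>*\<^sup>* (conf (Run (c # k)) tp) (conf (Run k) tp1)"
    using Peek.IH[of c k st tp st'] delta_closed[OF Peek.prems(1) d] Peek.prems
    by (auto simp: c_def)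
  then have "(step machine)\<^sup>*\<^sup>* (conf (Run (Peek r f # k)) tp) (conf (Run k) tp1)"
    using d by (intro step_idleI[OF Peek.prems(1,2)])
  then show ?case using tp1 by blast
next
  case (Drain r f)
  have loop: "holds st tp \<Longrightarrow> fst st r = xs \<Longrightarrow> st' \<in> iter (\<lambda>x. den (f x)) r xs st \<Longrightarrow>
      \<exists>tp'. holds st' tp' \<and> (step machine)\<^sup>*\<^sup>* (conf (Run (Drain r f # k)) tp) (conf (Run k) tp')"
    for xs st tp
  proof (induction xs arbitrary: st tp)
    case Nil
    have "(step machine)\<^sup>*\<^sup>* (conf (Run (Drain r f # k)) tp) (conf (Run k) tp)"
      using holds_top[of "fst st" "snd st" tp r] Nil
      by (intro step_idleI[OF Drain.prems(1) Nil.prems(1)]) auto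
    then show ?case using Nil by auto
  next
    case (Cons x xs)
    define st1 where "st1 = ((fst st)(r := xs), snd st)"
    define ac where "ac = (idle (heads tp))(Some r := (heads tp (Some r), Move_Right))"
    define tp1 where "tp1 = (\<lambda>i. act (ac i) (tp i))"
    have d: "(Run (f x # Drain r f # k), ac) \<in> delta emb (Run (Drain r f # k)) (heads tp)"
      using holds_top[of "fst st" "snd st" tp r] Cons.prems by (simp add: ac_def)
    have tp1: "holds st1 tp1"
      using holds_pop[of "fst st" "snd st" tp r] Cons.prems unfolding st1_def ac_def tp1_def by simp
    obtain st2 where st2: "st2 \<in> den (f x) st1" "st' \<in> iter (\<lambda>x. den (f x)) r xs st2"
      using Cons.prems(3) by (auto simp: st1_def)
    have "fst st2 r = xs"
      using den_keeps[of r "f x" st2 st1] st2(1) Drain.prems(3) by (simp add: st1_def)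
    moreover obtain tp2 where tp2: "holds st2 tp2"
      "(step machine)\<^sup>*\<^sup>* (conf (Run (f x # Drain r f # k)) tp1) (conf (Run (Drain r f # k)) tp2)"
      using Drain.IH[OF _ delta_closed[OF Drain.prems(1) d] tp1 _ st2(1)] Drain.prems(3) by auto
    ultimately obtain tp3 where tp3: "holds st' tp3"
      "(step machine)\<^sup>*\<^sup>* (conf (Run (Drain r f # k)) tp2) (conf (Run k) tp3)"
      using Cons.IH[OF tp2(1) _ st2(2)] by blast
    have "(step machine)\<^sup>*\<^sup>* (conf (Run (Drain r f # k)) tp) (conf (Run k) tp3)"
      using tp2(2) tp3(2) by (intro step_confI[OF Drain.prems(1) Cons.prems(1) d tp1_def]) auto
    then show ?case using tp3 by blast
  qed
  show ?case using loop[OF Drain.prems(2) refl] Drain.prems(4) by simp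
qed simp

lemma ntm_machine: "ntm machine"
proof -
  have "Run [] \<noteq> q" if "(q', ac) \<in> delta emb q rd" for q q' ac rd
    using that by auto
  then have "code q \<noteq> code (Run [])" if "q \<in> controls" "(q', ac) \<in> delta emb q rd" for q q' ac rd
    using that inj_code Run_Nil by (metis inj_onD)
  moreover have "finite {rd :: 'r option \<Rightarrow> 'a symbol. \<forall>i. rd i \<in> letters}"
    using finite_set_of_finite_funs[of "UNIV :: 'r option set" letters] by (simp add: letters_def)
  ultimately show ?thesis
    using two_ids
    by (auto simp: ntm_def machine_def intro!: finite_imageI finite_SigmaI finite_controls finite_delta)
qed

lemma deterministic_machine:
  assumes "choice_free prog"
  shows "deterministic machine"
proof -
  have free: "\<forall>c \<in> set k. choice_free c" if "k \<in> conts c" "choice_free c" for k and c :: "('r, 'g) cmd"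
    using that
  proof (induction c arbitrary: k)
    case (Peek r f)
    then show ?case by (auto dest: Peek.IH[OF rangeI])
  next
    case (Drain r f)
    have "\<forall>c \<in> set k. choice_free c" if "k \<in> conts (f x)" for k x
      using Drain.IH[OF rangeI that] Drain.prems(2) by simp
    then show ?case using Drain.prems by auto
  qed auto
  have "q1 = q2 \<and> ac1 = ac2"
    if "q \<in> controls" "(q1, ac1) \<in> delta emb q rd" "(q2, ac2) \<in> delta emb q rd" for q q1 q2 ac1 ac2 rd
  proof (cases q)
    case (Run k)
    then have "\<forall>c \<in> set k. choice_free c" using that(1) free assms by (auto simp: controls_def)
    then show ?thesis
      using that(2,3) unfolding Run
      by (cases "(emb, Run k, rd)" rule: delta.cases) (auto split: option.splits)
  qed (use that in auto)
  note det = this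
  show ?thesis
    unfolding deterministic_def
  proof (intro allI impI)
    fix p xs p1 as1 p2 as2
    assume t: "(p, xs, p1, as1) \<in> trans machine" "(p, xs, p2, as2) \<in> trans machine"
    obtain q1 rd1 q1' ac1 where 1: "q1 \<in> controls" "(q1', ac1) \<in> delta emb q1 rd1"
      "p = code q1" "xs = map rd1 ids" "p1 = code q1'" "as1 = map ac1 ids"
      using t(1) by (auto simp: machine_def)
    obtain q2 rd2 q2' ac2 where 2: "q2 \<in> controls" "(q2', ac2) \<in> delta emb q2 rd2"
      "p = code q2" "xs = map rd2 ids" "p2 = code q2'" "as2 = map ac2 ids"
      using t(2) by (auto simp: machine_def)
    have "q1 = q2" using 1 2 inj_code by (metis inj_onD)
    moreover have "rd1 = rd2" using 1(4) 2(4) ids_fun_eq by metis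
    ultimately have "q1' = q2' \<and> ac1 = ac2" using det 1(1,2) 2(2) by blast
    then show "p1 = p2 \<and> as1 = as2" using 1 2 by simp
  qed
qed

end

section \<open>Input and output of the compiled machine\<close>

lemma has_output_unique:
  assumes "has_output c w" "has_output c w'"
  shows "w = w'"
proof -
  have "\<not> length w < length w'" if "has_output c w" "has_output c w'" for w w'
  proof
    assume "length w < length w'"
    moreover from this have "w' ! length w = Blank"
      using that unfolding has_output_def Let_def by metis
    ultimately have "Blank \<in> set w'" by (metis nth_mem)
    then show False using that(2) by (simp add: has_output_def Let_def)
  qed
  with assms have "length w = length w'" by (meson linorder_neqE_nat)
  then show ?thesis using assms by (auto simp: has_output_def Let_def intro!: nth_equalityI)
qed

text \<open>Tape 0 holds the input and tape 1 the output, hence the prescribed beginning of the list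
  of tape indices.\<close>

locale compilation_io = compilation emb ids prog
  for emb :: "'g :: finite \<Rightarrow> 'a symbol" and ids :: "'r :: finite option list" and prog +
  fixes inp :: 'r and rest :: "'r option list"
  assumes ids: "ids = Some inp # None # rest"
begin

definition input_store :: "'g list \<Rightarrow> ('r, 'g) store" where
  "input_store xs = ((\<lambda>_. [])(inp := xs), [])"

lemma initial_conf:
  obtains tp where "initial machine (map emb xs) = conf (Run [prog]) tp" "holds (input_store xs) tp"
proof
  define tp :: "'r option \<Rightarrow> 'a tape" where
    "tp = (\<lambda>_. (\<lambda>_. Blank, 0))(Some inp :=
      (\<lambda>i. if 0 \<le> i \<and> i < int (length (map emb xs)) then map emb xs ! nat i else Blank, 0))"
  have rest: "Some inp \<notin> set rest" "inp \<noteq> r \<Longrightarrow> Some r \<noteq> Some inp" for r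
    using distinct_ids ids by auto
  have "map tp rest = replicate (length rest) (\<lambda>_. Blank, 0)"
    using rest by (intro map_replicate_const[THEN trans[rotated]] map_cong) (auto simp: tp_def)
  moreover have "num_tapes machine - 1 = Suc (length rest)" "start machine = code (Run [prog])"
    by (simp_all add: machine_def) (simp add: ids)
  moreover have "map tp ids = tp (Some inp) # tp None # map tp rest" by (simp add: ids)
  ultimately show "initial machine (map emb xs) = conf (Run [prog]) tp"
    unfolding initial_def conf_def by (simp add: tp_def)
  have "proper tp" by (auto simp: proper_def tp_def letters_def)
  then show "holds (input_store xs) tp"
    by (auto simp: holds_def input_store_def stack_tape_def out_tape_def tp_def)
qed

theorem machine_correct:
  assumes "space prog B (input_store xs)"
  shows "halts_within machine (map emb xs) (time prog B)"
    and "c \<in> accepting_configs machine (map emb xs) \<Longrightarrow>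
      \<exists>st \<in> den prog (input_store xs). has_output c (map emb (snd st))"
    and "st \<in> den prog (input_store xs) \<Longrightarrow>
      \<exists>c \<in> accepting_configs machine (map emb xs). has_output c (map emb (snd st))"
proof -
  obtain tp where tp: "initial machine (map emb xs) = conf (Run [prog]) tp"
    "holds (input_store xs) tp"
    by (rule initial_conf)
  let ?P = "result [] (den prog (input_store xs))"
  have r: "reaches machine ?P (time prog B) (initial machine (map emb xs))"
    unfolding tp(1) by (rule reaches_run[OF Run_prog tp(2) assms wf_prog])
  have stuck: "\<not> step machine c c'" if "?P c" for c c'
  proof -
    obtain tp' where "proper tp'" "c = conf (Run []) tp'"
      using \<open>?P c\<close> by (auto simp: result_def holds_def)
    then show ?thesis using step_conf[OF Run_Nil] by simp
  qed
  have out: "has_output (conf q tp) (map emb (snd st))" if "holds st tp" for q st tp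
  proof -
    have "map tp ids ! 1 = tp None" by (simp add: ids)
    then have "fst (snd (conf q tp) ! 1) = fst (tp None)" by (simp add: conf_def)
    moreover have "Blank \<notin> set (map emb (snd st))" using emb_not_Blank by (metis ex_map_conv)
    ultimately show ?thesis
      using that by (simp add: has_output_def holds_def out_tape_def Let_def)
  qed
  show "halts_within machine (map emb xs) (time prog B)"
    unfolding halts_within_def using reaches_bound[OF r stuck] by blast
  show "\<exists>st \<in> den prog (input_store xs). has_output c (map emb (snd st))"
    if "c \<in> accepting_configs machine (map emb xs)"
  proof -
    have "?P c" using that reaches_accept[OF r stuck, of c] by (simp add: accepting_configs_def)
    then obtain st tp' where "st \<in> den prog (input_store xs)" "holds st tp'" "c = conf (Run []) tp'"
      unfolding result_def by blast
    then show ?thesis using out by blast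
  qed
  show "\<exists>c \<in> accepting_configs machine (map emb xs). has_output c (map emb (snd st))"
    if "st \<in> den prog (input_store xs)"
  proof -
    obtain tp' where "holds st tp'"
      "(step machine)\<^sup>*\<^sup>* (conf (Run [prog]) tp) (conf (Run []) tp')"
      using run_exists[OF Run_prog tp(2) wf_prog \<open>st \<in> den prog (input_store xs)\<close>] by blast
    then show ?thesis
      using out[of st tp' "Run []"] unfolding accepting_configs_def tp(1)
      by (auto simp: conf_def machine_def)
  qed
qed

end


section \<open>Growth of registers\<close>

definition tot :: "('r :: finite, 'g) store \<Rightarrow> nat" where
  "tot st = (\<Sum>r\<in>UNIV. length (fst st r))"

lemma length_le_tot: "length (fst st r) \<le> tot st"
  unfolding tot_def by (rule member_le_sum) auto

lemma tot_upd: "tot (\<sigma>(r := xs), w) + length (\<sigma> r) = tot (\<sigma>, w') + length xs"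
proof -
  have "(\<Sum>i\<in>UNIV. length ((\<sigma>(r := xs)) i)) = length xs + (\<Sum>i\<in>UNIV - {r}. length (\<sigma> i))"
    by (subst sum.remove[of _ r]) auto
  moreover have "(\<Sum>i\<in>UNIV. length (\<sigma> i)) = length (\<sigma> r) + (\<Sum>i\<in>UNIV - {r}. length (\<sigma> i))"
    by (subst sum.remove[of _ r]) auto
  ultimately show ?thesis by (simp add: tot_def)
qed

lemma iter_space_mono:
  "iter_space S D r xs st \<Longrightarrow> (\<And>x st. S x st \<Longrightarrow> S' x st) \<Longrightarrow> iter_space S' D r xs st"
  by (induction xs arbitrary: st) auto

lemma space_mono: "space c B st \<Longrightarrow> B \<le> B' \<Longrightarrow> space c B' st"
proof (induction c arbitrary: st)
  case (Peek r f)
  then show ?case using Peek.IH[OF rangeI] by simp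
next
  case (Drain r f)
  show ?case
    using Drain.prems
    by (auto elim!: iter_space_mono intro: Drain.IH[OF rangeI] order_trans)
qed auto

text \<open>Two kinds of growth bounds are combined. The additive one is suited to loop bodies, as
  it adds up over the rounds; but copying a register exceeds every additive bound. The
  multiplicative \<open>grows_linearly\<close> admits copies and is closed under sequencing and case
  distinction, and it is never iterated.\<close>

definition grows_by :: "('r :: finite, 'g) cmd \<Rightarrow> nat \<Rightarrow> bool" where
  "grows_by c b \<longleftrightarrow> (\<forall>st. space c (tot st + b) st \<and> (\<forall>st' \<in> den c st. tot st' \<le> tot st + b))"

definition grows_linearly :: "('r :: finite, 'g) cmd \<Rightarrow> bool" where
  "grows_linearly c \<longleftrightarrow>
     (\<exists>a. \<forall>st. space c (a * (tot st + 1)) st \<and> (\<forall>st' \<in> den c st. tot st' \<le> a * (tot st + 1)))"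

lemma grows_by_space: "grows_by c b \<Longrightarrow> tot st + b \<le> B \<Longrightarrow> space c B st"
  unfolding grows_by_def using space_mono by blast

lemma grows_by_tot: "grows_by c b \<Longrightarrow> st' \<in> den c st \<Longrightarrow> tot st' \<le> tot st + b"
  unfolding grows_by_def by blast

lemma grows_byI:
  "(\<And>st. space c (tot st + b) st) \<Longrightarrow> (\<And>st st'. st' \<in> den c st \<Longrightarrow> tot st' \<le> tot st + b) \<Longrightarrow> grows_by c b"
  unfolding grows_by_def by blast

lemma grows_by_mono: "grows_by c b \<Longrightarrow> b \<le> b' \<Longrightarrow> grows_by c b'"
  unfolding grows_by_def by (meson add_left_mono order_trans space_mono)

lemma grows_by_Skip: "grows_by Skip b" and grows_by_Fail: "grows_by Fail b"
  and grows_by_Emit: "grows_by (Emit x) b"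
  by (auto simp: grows_by_def tot_def)

lemma tot_Push: "tot ((fst st)(r := x # fst st r), snd st) = Suc (tot st)"
  using tot_upd[of "fst st" r "x # fst st r" "snd st" "snd st"] by simp

lemma tot_Pop: "tot ((fst st)(r := tl (fst st r)), snd st) = tot st - length (fst st r) + (length (fst st r) - 1)"
  using tot_upd[of "fst st" r "tl (fst st r)" "snd st" "snd st"] length_le_tot[of st r] by simp

lemma grows_by_Push: "0 < b \<Longrightarrow> grows_by (Push r x) b"
  by (intro grows_byI) (auto simp: tot_Push)

lemma grows_by_Pop: "grows_by (Pop r) b"
proof (intro grows_byI)
  show "tot st' \<le> tot st + b" if "st' \<in> den (Pop r) st" for st st'
    using that length_le_tot[of st r] by (auto simp: tot_Pop)
qed simp

lemma grows_by_Then: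
  assumes "grows_by c1 b1" "grows_by c2 b2" "b1 + b2 \<le> b"
  shows "grows_by (c1 ;; c2) b"
proof (intro grows_byI)
  fix st
  have "space c1 (tot st + b) st" using grows_by_space[OF assms(1)] assms(3) by simp
  moreover have "space c2 (tot st + b) st'" if "st' \<in> den c1 st" for st'
    using assms grows_by_tot[OF assms(1) that] by (intro grows_by_space[OF assms(2)]) simp
  ultimately show "space (c1 ;; c2) (tot st + b) st" by simp
  fix st'' assume "st'' \<in> den (c1 ;; c2) st"
  then obtain st' where st': "st' \<in> den c1 st" "st'' \<in> den c2 st'" by auto
  show "tot st'' \<le> tot st + b"
    using grows_by_tot[OF assms(1) st'(1)] grows_by_tot[OF assms(2) st'(2)] assms(3) by simp
qed

lemma grows_by_Peek: "(\<And>x. grows_by (f x) b) \<Longrightarrow> grows_by (Peek r f) b"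
  by (simp add: grows_by_def)

text \<open>Every round pops a letter before the body adds at most \<open>b\<close>, so its net
  growth is \<open>b - 1\<close>. A body with bound 1 yields a loop that does not grow the store, so
  such loops can be nested freely.\<close>

lemma grows_iter:
  assumes f: "\<And>x. grows_by (f x) b" and keeps: "\<And>x. keeps r (f x)"
  shows "fst st r = xs \<Longrightarrow> tot st + length xs * (b - 1) + (b - 1) \<le> B \<Longrightarrow>
    iter_space (\<lambda>x. space (f x) B) (\<lambda>x. den (f x)) r xs st \<and>
    (\<forall>st' \<in> iter (\<lambda>x. den (f x)) r xs st. tot st' \<le> tot st + length xs * (b - 1))"
proof (induction xs arbitrary: st)
  case (Cons x xs)
  define st1 where "st1 = ((fst st)(r := xs), snd st)"
  have t1: "Suc (tot st1) = tot st"
    using tot_upd[of "fst st" r xs "snd st" "snd st"] Cons.prems by (simp add: st1_def)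
  have s: "space (f x) B st1"
    by (rule grows_by_space[OF f]) (use Cons.prems(2) t1 in simp)
  have step: "iter_space (\<lambda>x. space (f x) B) (\<lambda>x. den (f x)) r xs st2 \<and>
    (\<forall>st' \<in> iter (\<lambda>x. den (f x)) r xs st2. tot st' \<le> tot st + length (x # xs) * (b - 1))"
    if "st2 \<in> den (f x) st1" for st2
  proof -
    have t2: "tot st2 \<le> tot st + (b - 1)" using grows_by_tot[OF f that] t1 by linarith
    have "fst st2 r = xs" using den_keeps[OF keeps that] by (simp add: st1_def)
    from Cons.IH[OF this] t2 Cons.prems(2) show ?thesis by fastforce
  qed
  show ?case
    using s step by (simp flip: st1_def)
qed simp

lemma grows_by_Drain:
  fixes f :: "'g \<Rightarrow> ('r :: finite, 'g) cmd"
  assumes "\<And>x. grows_by (f x) 1" "\<And>x. keeps r (f x)"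
  shows "grows_by (Drain r f) b"
proof (intro grows_byI)
  fix st :: "('r, 'g) store"
  note iter = grows_iter[of f 1, OF assms refl]
  show "space (Drain r f) (tot st + b) st"
    using iter[of st "tot st + b"] length_le_tot[of st r] by simp
  show "tot st' \<le> tot st + b" if "st' \<in> den (Drain r f) st" for st'
    using that iter[of st "tot st"] by fastforce
qed

lemma grows_linearlyI:
  "(\<And>st. space c (a * (tot st + 1)) st) \<Longrightarrow> (\<And>st st'. st' \<in> den c st \<Longrightarrow> tot st' \<le> a * (tot st + 1)) \<Longrightarrow>
   grows_linearly c"
  unfolding grows_linearly_def by blast

lemma grows_linearly_by:
  assumes "grows_by c b"
  shows "grows_linearly c"
proof (rule grows_linearlyI)
  show "space c (Suc b * (tot st + 1)) st" for st
    by (rule grows_by_space[OF assms]) (simp add: algebra_simps)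
  show "tot st' \<le> Suc b * (tot st + 1)" if "st' \<in> den c st" for st st'
    using grows_by_tot[OF assms that] by (simp add: algebra_simps)
qed

lemma grows_linearly_Then:
  assumes "grows_linearly c1" "grows_linearly c2"
  shows "grows_linearly (c1 ;; c2)"
proof -
  obtain a1 where "\<forall>st. space c1 (a1 * (tot st + 1)) st \<and> (\<forall>st' \<in> den c1 st. tot st' \<le> a1 * (tot st + 1))"
    using assms(1) unfolding grows_linearly_def by (elim exE)
  then have 1: "space c1 (a1 * (tot st + 1)) st"
    "st' \<in> den c1 st \<Longrightarrow> tot st' \<le> a1 * (tot st + 1)" for st st'
    by blast+
  obtain a2 where "\<forall>st. space c2 (a2 * (tot st + 1)) st \<and> (\<forall>st' \<in> den c2 st. tot st' \<le> a2 * (tot st + 1))"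
    using assms(2) unfolding grows_linearly_def by (elim exE)
  then have 2: "space c2 (a2 * (tot st + 1)) st"
    "st' \<in> den c2 st \<Longrightarrow> tot st' \<le> a2 * (tot st + 1)" for st st'
    by blast+
  \<comment> \<open>After \<open>c1\<close>, the size plus one is at most
    \<open>(a1 + 1) * (tot st + 1)\<close>, which \<open>c2\<close> multiplies by \<open>a2\<close>;
    the summand \<open>a1\<close> covers \<open>c1\<close> itself.\<close>
  let ?a = "a1 + a2 * (a1 + 1)"
  have le: "a2 * (tot st' + 1) \<le> ?a * (tot st + 1)" if "st' \<in> den c1 st" for st st'
  proof -
    have "tot st' + 1 \<le> (a1 + 1) * (tot st + 1)" using 1(2)[OF that] by (simp add: algebra_simps)
    then have "a2 * (tot st' + 1) \<le> a2 * ((a1 + 1) * (tot st + 1))" by (rule mult_le_mono2)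
    then show ?thesis by (simp add: algebra_simps)
  qed
  show ?thesis
  proof (rule grows_linearlyI)
    show "space (c1 ;; c2) (?a * (tot st + 1)) st" for st
      using space_mono[OF 1(1)] space_mono[OF 2(1) le] by (simp add: algebra_simps)
    show "tot st' \<le> ?a * (tot st + 1)" if "st' \<in> den (c1 ;; c2) st" for st st'
      using that 2(2) le by (simp only: den.simps UN_iff) (meson order_trans)
  qed
qed

lemma grows_linearly_Peek:
  fixes f :: "'g :: finite option \<Rightarrow> ('r :: finite, 'g) cmd"
  assumes "\<And>x. grows_linearly (f x)"
  shows "grows_linearly (Peek r f)"
proof -
  have "\<forall>x. \<exists>a. \<forall>st. space (f x) (a * (tot st + 1)) st \<and> (\<forall>st' \<in> den (f x) st. tot st' \<le> a * (tot st + 1))"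
    using assms unfolding grows_linearly_def by blast
  then obtain a where a: "\<And>x st. space (f x) (a x * (tot st + 1)) st"
    "\<And>x st st'. st' \<in> den (f x) st \<Longrightarrow> tot st' \<le> a x * (tot st + 1)"
    by metis
  have le: "a x * n \<le> (\<Sum>x\<in>UNIV. a x) * n" for x n
    by (intro mult_le_mono1 member_le_sum) auto
  show ?thesis
  proof (rule grows_linearlyI)
    show "space (Peek r f) ((\<Sum>x\<in>UNIV. a x) * (tot st + 1)) st" for st
      using space_mono[OF a(1) le] by simp
    show "tot st' \<le> (\<Sum>x\<in>UNIV. a x) * (tot st + 1)" if "st' \<in> den (Peek r f) st" for st st'
      using that a(2) le by (simp only: den.simps) (meson order_trans)
  qed
qed

lemma grows_linearly_Drain:
  fixes f :: "'g \<Rightarrow> ('r :: finite, 'g) cmd"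
  assumes "\<And>x. grows_by (f x) b" "\<And>x. keeps r (f x)"
  shows "grows_linearly (Drain r f)"
proof (rule grows_linearlyI)
  fix st :: "('r, 'g) store"
  note iter = grows_iter[of f b, OF assms refl]
  have le: "tot st + length (fst st r) * (b - 1) + (b - 1) \<le> Suc b * (tot st + 1)"
    using mult_le_mono[OF length_le_tot[of st r], of "b - 1" b] by (simp add: algebra_simps)
  show "space (Drain r f) (Suc b * (tot st + 1)) st"
    using iter[OF le] length_le_tot[of st r] by simp
  show "tot st' \<le> Suc b * (tot st + 1)" if "st' \<in> den (Drain r f) st" for st'
    using that iter[OF le] le by fastforce
qed

definition take_top :: "'r \<Rightarrow> ('g option \<Rightarrow> ('r, 'g) cmd) \<Rightarrow> ('r, 'g) cmd" where
  "take_top r f = Peek r (\<lambda>x. case x of None \<Rightarrow> f None | Some _ \<Rightarrow> Pop r ;; f x)"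

lemma den_take_top [simp]:
  "den (take_top r f) st = den (f (top_of (fst st r))) ((fst st)(r := tl (fst st r)), snd st)"
  by (cases st; cases "fst st r") (auto simp: take_top_def fun_upd_idem)

lemma keeps_take_top [simp]: "keeps r (take_top r' f) \<longleftrightarrow> keeps r (f None) \<and> (\<forall>x. r' \<noteq> r \<and> keeps r (f (Some x)))"
  by (auto simp: take_top_def split: option.splits)

lemma wf_take_top [simp]: "wf_cmd (take_top r f) \<longleftrightarrow> (\<forall>x. wf_cmd (f x))"
  by (auto simp: take_top_def split: option.splits) (metis option.exhaust)

text \<open>The popped letter pays for one push in the branch \<open>Some x\<close>, hence the bound
  \<open>Suc b\<close> there.\<close>

lemma grows_by_take_top:
  fixes f :: "'g option \<Rightarrow> ('r :: finite, 'g) cmd"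
  assumes none: "grows_by (f None) b" and some: "\<And>x. grows_by (f (Some x)) (Suc b)"
  shows "grows_by (take_top r f) b"
proof (rule grows_byI)
  fix st :: "('r, 'g) store"
  define st1 where "st1 = ((fst st)(r := tl (fst st r)), snd st)"
  have t1: "Suc (tot st1) = tot st" if "fst st r = x # xs" for x xs
    using tot_upd[of "fst st" r xs "snd st" "snd st"] that by (simp add: st1_def)
  show "space (take_top r f) (tot st + b) st"
  proof (cases "fst st r")
    case Nil
    then show ?thesis using grows_by_space[OF none] by (simp add: take_top_def)
  next
    case (Cons x xs)
    then show ?thesis
      using grows_by_space[OF some, of st1 "tot st + b"] t1[OF Cons]
      by (simp add: take_top_def st1_def)
  qed
  show "tot st' \<le> tot st + b" if "st' \<in> den (take_top r f) st" for st'
  proof (cases "fst st r")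
    case Nil
    then show ?thesis using grows_by_tot[OF none, of st' st] that by (simp add: fun_upd_idem)
  next
    case (Cons x xs)
    then show ?thesis
      using grows_by_tot[OF some, of st' x st1] t1[OF Cons] that by (simp add: st1_def)
  qed
qed

lemma grows_linearly_take_top:
  fixes f :: "'g :: finite option \<Rightarrow> ('r :: finite, 'g) cmd"
  assumes "\<And>x. grows_linearly (f x)"
  shows "grows_linearly (take_top r f)"
  unfolding take_top_def
  by (rule grows_linearly_Peek)
    (auto split: option.splits intro: assms grows_linearly_Then grows_linearly_by grows_by_Pop)

lemma grows_by_if: "grows_by c b \<Longrightarrow> grows_by d b \<Longrightarrow> grows_by (if P then c else d) b"
  by simp

lemma grows_linearly_if: "grows_linearly c \<Longrightarrow> grows_linearly d \<Longrightarrow> grows_linearly (if P then c else d)"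
  by simp


subsection \<open>Moving and copying registers\<close>

definition move :: "'r \<Rightarrow> 'r \<Rightarrow> ('r, 'g) cmd" where
  "move i j = Drain i (\<lambda>x. Push j x)"

definition clear :: "'r \<Rightarrow> ('r, 'g) cmd" where
  "clear i = Drain i (\<lambda>_. Skip)"

text \<open>The register \<^term>\<open>t\<close> is scratch.\<close>

definition copy :: "'r \<Rightarrow> 'r \<Rightarrow> 'r \<Rightarrow> ('r, 'g) cmd" where
  "copy i j t = move i t ;; Drain t (\<lambda>x. Push i x ;; Push j x)"

definition dup :: "'r \<Rightarrow> 'r \<Rightarrow> 'r \<Rightarrow> ('r, 'g) cmd" where
  "dup i j t = Drain i (\<lambda>x. Push j x ;; Push t x) ;; move t i"

text \<open>A loop cannot be left early, so it has to remember whether the prefix has ended. The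
  register \<open>t\<close> serves as the flag: the first letter that violates \<open>P\<close>
  makes it non-empty, and all later letters follow.\<close>

definition split_off :: "('g \<Rightarrow> bool) \<Rightarrow> 'r \<Rightarrow> 'r \<Rightarrow> 'r \<Rightarrow> ('r, 'g) cmd" where
  "split_off P i j t =
     Drain i (\<lambda>x. Peek t (\<lambda>y. if y = None \<and> P x then Push j x else Push t x)) ;; move t i"

lemma iter_move:
  "i \<noteq> j \<Longrightarrow> \<sigma> i = xs \<Longrightarrow>
   iter (\<lambda>x. den (Push j x)) i xs (\<sigma>, w) = {(\<sigma>(i := [], j := rev xs @ \<sigma> j), w)}"
proof (induction xs arbitrary: \<sigma>)
  case (Cons x xs)
  have "iter (\<lambda>x. den (Push j x)) i (x # xs) (\<sigma>, w) =
      iter (\<lambda>x. den (Push j x)) i xs (\<sigma>(i := xs, j := x # \<sigma> j), w)"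
    using Cons.prems by simp
  also have "\<dots> = {((\<sigma>(i := xs, j := x # \<sigma> j))(i := [], j := rev xs @ x # \<sigma> j), w)}"
    using Cons.prems by (subst Cons.IH) auto
  also have "(\<sigma>(i := xs, j := x # \<sigma> j))(i := [], j := rev xs @ x # \<sigma> j) =
      \<sigma>(i := [], j := rev (x # xs) @ \<sigma> j)"
    by (rule ext) simp
  finally show ?case .
qed (simp add: fun_upd_idem)

lemma den_move [simp]:
  "i \<noteq> j \<Longrightarrow> den (move i j) (\<sigma>, w) = {(\<sigma>(i := [], j := rev (\<sigma> i) @ \<sigma> j), w)}"
  using iter_move[of i j \<sigma> "\<sigma> i" w] by (simp add: move_def)

lemma iter_clear: "\<sigma> i = xs \<Longrightarrow> iter (\<lambda>x. den Skip) i xs (\<sigma>, w) = {(\<sigma>(i := []), w)}"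
  by (induction xs arbitrary: \<sigma>) (simp_all add: fun_upd_idem)

lemma den_clear [simp]: "den (clear i) (\<sigma>, w) = {(\<sigma>(i := []), w)}"
  using iter_clear[of \<sigma> i "\<sigma> i" w] by (simp add: clear_def)

lemma iter_dup:
  "i \<noteq> j \<Longrightarrow> i \<noteq> t \<Longrightarrow> j \<noteq> t \<Longrightarrow> \<sigma> i = xs \<Longrightarrow>
   iter (\<lambda>x. den (Push j x ;; Push t x)) i xs (\<sigma>, w) =
     {(\<sigma>(i := [], j := rev xs @ \<sigma> j, t := rev xs @ \<sigma> t), w)}"
proof (induction xs arbitrary: \<sigma>)
  case Nil
  then show ?case by (simp add: fun_upd_idem)
next
  case (Cons x xs)
  let ?\<sigma> = "\<sigma>(i := xs, j := x # \<sigma> j, t := x # \<sigma> t)"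
  have "iter (\<lambda>x. den (Push j x ;; Push t x)) i (x # xs) (\<sigma>, w) =
      iter (\<lambda>x. den (Push j x ;; Push t x)) i xs (?\<sigma>, w)"
    using Cons.prems by simp
  also have "\<dots> = {(?\<sigma>(i := [], j := rev xs @ ?\<sigma> j, t := rev xs @ ?\<sigma> t), w)}"
    using Cons.prems by (subst Cons.IH) simp_all
  also have "?\<sigma>(i := [], j := rev xs @ ?\<sigma> j, t := rev xs @ ?\<sigma> t) =
      \<sigma>(i := [], j := rev (x # xs) @ \<sigma> j, t := rev (x # xs) @ \<sigma> t)"
    using Cons.prems by (intro ext) simp
  finally show ?case .
qed

lemma den_copy [simp]:
  assumes "i \<noteq> j" "i \<noteq> t" "j \<noteq> t" "\<sigma> t = []"
  shows "den (copy i j t) (\<sigma>, w) = {(\<sigma>(j := \<sigma> i @ \<sigma> j), w)}"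
proof -
  let ?\<sigma> = "\<sigma>(i := [], t := rev (\<sigma> i))"
  have "den (copy i j t) (\<sigma>, w) =
      iter (\<lambda>x. den (Push i x ;; Push j x)) t (rev (\<sigma> i)) (?\<sigma>, w)"
    using assms by (simp add: copy_def)
  also have "\<dots> = {(?\<sigma>(t := [], i := \<sigma> i, j := \<sigma> i @ \<sigma> j), w)}"
    using assms by (subst iter_dup) auto
  also have "?\<sigma>(t := [], i := \<sigma> i, j := \<sigma> i @ \<sigma> j) = \<sigma>(j := \<sigma> i @ \<sigma> j)"
    using assms by (intro ext) auto
  finally show ?thesis .
qed

lemma den_dup [simp]:
  assumes "i \<noteq> j" "i \<noteq> t" "j \<noteq> t" "\<sigma> t = []"
  shows "den (dup i j t) (\<sigma>, w) = {(\<sigma>(j := rev (\<sigma> i) @ \<sigma> j), w)}"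
proof -
  let ?\<sigma> = "\<sigma>(i := [], j := rev (\<sigma> i) @ \<sigma> j, t := rev (\<sigma> i))"
  have "den (dup i j t) (\<sigma>, w) = den (move t i) (?\<sigma>, w)"
    using assms iter_dup[of i j t \<sigma> "\<sigma> i" w] by (simp add: dup_def del: den_move den.simps(3))
  also have "\<dots> = {(?\<sigma>(t := [], i := \<sigma> i), w)}"
    using assms by simp
  also have "?\<sigma>(t := [], i := \<sigma> i) = \<sigma>(j := rev (\<sigma> i) @ \<sigma> j)"
    using assms by (intro ext) auto
  finally show ?thesis .
qed

lemma iter_split_off_rest:
  fixes P :: "'g \<Rightarrow> bool" and i j t :: 'r
  assumes "i \<noteq> j" "i \<noteq> t" "j \<noteq> t"
  defines "D \<equiv> \<lambda>x. den (Peek t (\<lambda>y. if y = None \<and> P x then Push j x else Push t x))"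
  shows "\<sigma> i = xs \<Longrightarrow> \<sigma> t \<noteq> [] \<Longrightarrow> iter D i xs (\<sigma>, w) = {(\<sigma>(i := [], t := rev xs @ \<sigma> t), w)}"
proof (induction xs arbitrary: \<sigma>)
  case Nil
  then show ?case by (simp add: fun_upd_idem)
next
  case (Cons x xs)
  let ?\<sigma> = "\<sigma>(i := xs, t := x # \<sigma> t)"
  obtain y where "top_of (\<sigma> t) = Some y" using Cons.prems by (cases "\<sigma> t") auto
  then have "iter D i (x # xs) (\<sigma>, w) = iter D i xs (?\<sigma>, w)"
    using assms by simp
  also have "\<dots> = {(?\<sigma>(i := [], t := rev xs @ ?\<sigma> t), w)}"
    using assms by (subst Cons.IH) simp_all
  also have "?\<sigma>(i := [], t := rev xs @ ?\<sigma> t) = \<sigma>(i := [], t := rev (x # xs) @ \<sigma> t)"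
    by (intro ext) simp
  finally show ?case .
qed

lemma iter_split_off:
  fixes P :: "'g \<Rightarrow> bool" and i j t :: 'r
  assumes "i \<noteq> j" "i \<noteq> t" "j \<noteq> t"
  defines "D \<equiv> \<lambda>x. den (Peek t (\<lambda>y. if y = None \<and> P x then Push j x else Push t x))"
  shows "\<sigma> i = xs \<Longrightarrow> \<sigma> t = [] \<Longrightarrow> iter D i xs (\<sigma>, w) =
     {(\<sigma>(i := [], j := rev (takeWhile P xs) @ \<sigma> j, t := rev (dropWhile P xs)), w)}"
proof (induction xs arbitrary: \<sigma>)
  case Nil
  then show ?case by (simp add: fun_upd_idem)
next
  case (Cons x xs)
  show ?case
  proof (cases "P x")
    case True
    let ?\<sigma> = "\<sigma>(i := xs, j := x # \<sigma> j)"
    have "iter D i (x # xs) (\<sigma>, w) = iter D i xs (?\<sigma>, w)"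
      using assms Cons.prems True by simp
    also have "\<dots> = {(?\<sigma>(i := [], j := rev (takeWhile P xs) @ ?\<sigma> j, t := rev (dropWhile P xs)), w)}"
      using assms Cons.prems by (subst Cons.IH) simp_all
    also have "?\<sigma>(i := [], j := rev (takeWhile P xs) @ ?\<sigma> j, t := rev (dropWhile P xs)) =
        \<sigma>(i := [], j := rev (takeWhile P (x # xs)) @ \<sigma> j, t := rev (dropWhile P (x # xs)))"
      using assms True by (intro ext) simp
    finally show ?thesis .
  next
    case False
    let ?\<sigma> = "\<sigma>(i := xs, t := [x])"
    have "iter D i (x # xs) (\<sigma>, w) = iter D i xs (?\<sigma>, w)"
      using assms Cons.prems False by simp
    also have "\<dots> = {(?\<sigma>(i := [], t := rev xs @ ?\<sigma> t), w)}"
      unfolding D_def using assms by (subst iter_split_off_rest) simp_all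
    also have "?\<sigma>(i := [], t := rev xs @ ?\<sigma> t) =
        \<sigma>(i := [], j := rev (takeWhile P (x # xs)) @ \<sigma> j, t := rev (dropWhile P (x # xs)))"
      using assms False by (intro ext) simp
    finally show ?thesis .
  qed
qed

lemma den_split_off [simp]:
  assumes "i \<noteq> j" "i \<noteq> t" "j \<noteq> t" "\<sigma> t = []"
  shows "den (split_off P i j t) (\<sigma>, w) =
    {(\<sigma>(i := dropWhile P (\<sigma> i), j := rev (takeWhile P (\<sigma> i)) @ \<sigma> j), w)}"
proof -
  let ?\<sigma> = "\<sigma>(i := [], j := rev (takeWhile P (\<sigma> i)) @ \<sigma> j, t := rev (dropWhile P (\<sigma> i)))"
  have "den (split_off P i j t) (\<sigma>, w) = den (move t i) (?\<sigma>, w)"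
    using assms iter_split_off[of i j t \<sigma> "\<sigma> i" P w] by (simp add: split_off_def del: den_move)
  also have "\<dots> = {(?\<sigma>(t := [], i := dropWhile P (\<sigma> i)), w)}"
    using assms by simp
  also have "?\<sigma>(t := [], i := dropWhile P (\<sigma> i)) =
      \<sigma>(i := dropWhile P (\<sigma> i), j := rev (takeWhile P (\<sigma> i)) @ \<sigma> j)"
    using assms by (intro ext) auto
  finally show ?thesis .
qed

lemma keeps_macros [simp]:
  "keeps r (move i j) \<longleftrightarrow> i \<noteq> r \<and> j \<noteq> r"
  "keeps r (clear i) \<longleftrightarrow> i \<noteq> r"
  "keeps r (copy i j t) \<longleftrightarrow> i \<noteq> r \<and> j \<noteq> r \<and> t \<noteq> r"
  "keeps r (dup i j t) \<longleftrightarrow> i \<noteq> r \<and> j \<noteq> r \<and> t \<noteq> r"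
  "i \<noteq> r \<and> j \<noteq> r \<and> t \<noteq> r \<Longrightarrow> keeps r (split_off P i j t)"
  by (auto simp: move_def clear_def copy_def dup_def split_off_def)

lemma wf_macros [simp]:
  "wf_cmd (move i j) \<longleftrightarrow> i \<noteq> j"
  "wf_cmd (clear i)"
  "i \<noteq> t \<Longrightarrow> j \<noteq> t \<Longrightarrow> wf_cmd (copy i j t)"
  "i \<noteq> t \<Longrightarrow> i \<noteq> j \<Longrightarrow> wf_cmd (dup i j t)"
  "i \<noteq> t \<Longrightarrow> i \<noteq> j \<Longrightarrow> wf_cmd (split_off P i j t)"
  by (auto simp: move_def clear_def copy_def dup_def split_off_def)

lemma grows_by_move: "i \<noteq> j \<Longrightarrow> grows_by (move i j) b"
  unfolding move_def by (intro grows_by_Drain grows_by_Push) auto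

lemma grows_by_clear: "grows_by (clear i) b"
  unfolding clear_def by (intro grows_by_Drain grows_by_Skip) auto

lemma grows_by_split_off: "i \<noteq> j \<Longrightarrow> i \<noteq> t \<Longrightarrow> j \<noteq> t \<Longrightarrow> grows_by (split_off P i j t) b"
  unfolding split_off_def
  by (intro grows_by_Then[of _ 0 _ 0] grows_by_Drain grows_by_Peek grows_by_if grows_by_Push grows_by_move) auto

lemma grows_linearly_copy: "i \<noteq> j \<Longrightarrow> i \<noteq> t \<Longrightarrow> j \<noteq> t \<Longrightarrow> grows_linearly (copy i j t)"
  unfolding copy_def
  by (intro grows_linearly_Then grows_linearly_by[OF grows_by_move] grows_linearly_Drain[where b = 2]
      grows_by_Then[of _ 1 _ 1] grows_by_Push) auto

lemma grows_linearly_dup: "i \<noteq> j \<Longrightarrow> i \<noteq> t \<Longrightarrow> j \<noteq> t \<Longrightarrow> grows_linearly (dup i j t)"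
  unfolding dup_def
  by (intro grows_linearly_Then grows_linearly_by[OF grows_by_move] grows_linearly_Drain[where b = 2]
      grows_by_Then[of _ 1 _ 1] grows_by_Push) auto


section \<open>The matching program\<close>

datatype out = Lo | Hi | OTok answer_token | OBit bool

datatype mark =
    Tick | Close_Mark | Check_Mark | Open_Entry | Closed_Entry | Sep_Mark
  | Starting | Running | Finishing | Yes | No

datatype 'c letter = LTok "'c token" | LBit bool | LOut out | LMark mark

text \<open>Between two steps of the matcher, \<open>rA\<close> holds the actions, \<open>rL\<close>
  and \<open>rR\<close> the input before and after the current position, \<open>rK\<close> the
  starting position, \<open>rG\<close> the group map, \<open>rE\<close> the part of the answer still
  expected, \<open>rY\<close> the part of the guessed word still to be read, and \<open>rPh\<close>
  the phase. The other registers are empty then: \<open>rInp\<close> receives the input, the rest is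
  scratch.\<close>

datatype reg =
    rInp | rA | rL | rR | rK | rG | rE | rY | rPh | rT | rU | rX | rN | rQ | rV | rW | rD | rS | rS2
  | rQ2 | rF | rH | rB | rB2 | rP | rC | rFl

instance anchor :: finite
proof
  have *: "(UNIV :: anchor set) = {Input_Start, Input_End, Word_Boundary, Non_Word_Boundary}"
    by (intro UNIV_eq_I) (rename_tac x, case_tac x, auto)
  show "finite (UNIV :: anchor set)" by (subst *) simp
qed

instance token :: (finite) finite
proof
  have *: "(UNIV :: 'a token set) = {TEps, TAlt, TSeq, TGroup, TBackref, TFinite, TInfinite}
      \<union> range TChars \<union> range TQuant \<union> range TAnchor \<union> range TChar"
    by (intro UNIV_eq_I) (rename_tac x, case_tac x, auto)
  show "finite (UNIV :: 'a token set)" by (subst *) simp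
qed

instance answer_token :: finite
proof
  have *: "(UNIV :: answer_token set) = {NoMatch, Match, IsOpened, IsClosed, Num}"
    by (intro UNIV_eq_I) (rename_tac x, case_tac x, auto)
  show "finite (UNIV :: answer_token set)" by (subst *) simp
qed

instance out :: finite
proof
  have *: "(UNIV :: out set) = {Lo, Hi} \<union> range OTok \<union> range OBit"
    by (intro UNIV_eq_I) (rename_tac x, case_tac x, auto)
  show "finite (UNIV :: out set)" by (subst *) simp
qed

instance mark :: finite
proof
  have *: "(UNIV :: mark set) = {Tick, Close_Mark, Check_Mark, Open_Entry, Closed_Entry, Sep_Mark,
      Starting, Running, Finishing, Yes, No}"
    by (intro UNIV_eq_I) (rename_tac x, case_tac x, auto)
  show "finite (UNIV :: mark set)" by (subst *) simp
qed

instance letter :: (finite) finite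
proof
  have *: "(UNIV :: 'a letter set) = range LTok \<union> range LBit \<union> range LOut \<union> range LMark"
    by (intro UNIV_eq_I) (rename_tac x, case_tac x, auto)
  show "finite (UNIV :: 'a letter set)" by (subst *) simp
qed

definition reg_list :: "reg list" where
  "reg_list = [rA, rL, rR, rK, rG, rE, rY, rPh, rT, rU, rX, rN, rQ, rV, rW, rD, rS, rS2,
     rQ2, rF, rH, rB, rB2, rP, rC, rFl]"

lemma UNIV_reg: "(UNIV :: reg set) = set (rInp # reg_list)"
  by (intro UNIV_eq_I) (rename_tac x, case_tac x, auto simp: reg_list_def)

instance reg :: finite
  by standard (simp add: UNIV_reg)

type_synonym 'c prog = "(reg, 'c letter) cmd"


subsection \<open>Representation of the matching state\<close>

definition lbits :: "nat \<Rightarrow> 'c letter list" where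
  "lbits n = map LBit (binary n)"

lemma bits_value_append: "bits_value (xs @ [b]) = 2 * bits_value xs + of_bool b"
  by (simp add: bits_value_def)

lemma bits_value_binary [simp]: "bits_value (binary n) = n"
proof (induction n rule: binary.induct)
  case (1 n)
  show ?case
  proof (cases "n = 0")
    case False
    then have "bits_value (binary n) = 2 * (n div 2) + of_bool (odd n)"
      using 1 by (subst binary.simps) (simp add: bits_value_append)
    then show ?thesis by (simp add: mod2_eq_if[symmetric])
  qed (simp add: binary.simps bits_value_def)
qed

lemma lbits_eq_iff: "lbits m = lbits n \<longleftrightarrow> m = n"
proof -
  have "inj LBit" by (auto intro: injI)
  then have "lbits m = lbits n \<longleftrightarrow> binary m = binary n" unfolding lbits_def by (rule inj_map_eq_map)
  moreover have "binary m = binary n \<Longrightarrow> m = n" by (metis bits_value_binary)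
  ultimately show ?thesis by auto
qed

definition is_bit :: "'c letter \<Rightarrow> bool" where
  "is_bit x = (case x of LBit _ \<Rightarrow> True | _ \<Rightarrow> False)"

definition is_char :: "'c letter \<Rightarrow> bool" where
  "is_char x = (case x of LTok (TChar _) \<Rightarrow> True | _ \<Rightarrow> False)"

primrec regex_letters :: "'c regex \<Rightarrow> 'c letter list" where
  "regex_letters Eps = [LTok TEps]"
| "regex_letters (Chars cd) = [LTok (TChars cd)]"
| "regex_letters (Alt r1 r2) = LTok TAlt # regex_letters r1 @ regex_letters r2"
| "regex_letters (Seq r1 r2) = LTok TSeq # regex_letters r1 @ regex_letters r2"
| "regex_letters (Group g r) = LTok TGroup # lbits g @ regex_letters r"
| "regex_letters (Backref g) = LTok TBackref # lbits g"
| "regex_letters (Quant r m d greedy) =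
     LTok (TQuant greedy) # lbits m @
     (case d of enat n \<Rightarrow> LTok TFinite # lbits n | \<infinity> \<Rightarrow> [LTok TInfinite]) @ regex_letters r"
| "regex_letters (Anchor a) = [LTok (TAnchor a)]"

text \<open>A position is represented by the reversed prefix of the input that ends there.\<close>

definition prefix :: "'c list \<Rightarrow> nat \<Rightarrow> 'c letter list" where
  "prefix s p = map (\<lambda>c. LTok (TChar c)) (rev (take p s))"

definition suffix :: "'c list \<Rightarrow> nat \<Rightarrow> 'c letter list" where
  "suffix s p = map (\<lambda>c. LTok (TChar c)) (drop p s)"

primrec action_letters :: "'c list \<Rightarrow> 'c action \<Rightarrow> 'c letter list" where
  "action_letters s (Regex r) = regex_letters r"
| "action_letters s (Aclose g) = LMark Close_Mark # lbits g"
| "action_letters s (Acheck k) = LMark Check_Mark # prefix s k"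

fun state_kind :: "group_state \<Rightarrow> 'c letter" where
  "state_kind (Closed a b) = LMark Closed_Entry"
| "state_kind _ = LMark Open_Entry"

fun state_letters :: "'c list \<Rightarrow> group_state \<Rightarrow> 'c letter list" where
  "state_letters s Undefined = []"
| "state_letters s (Opened a) = prefix s a"
| "state_letters s (Closed a b) = prefix s a @ LMark Sep_Mark # prefix s b"

text \<open>The letter for the kind occurs only at the start of an entry and therefore also
  separates the entries.\<close>

fun entry_letters :: "'c list \<Rightarrow> nat \<times> group_state \<Rightarrow> 'c letter list" where
  "entry_letters s (g, v) = state_kind v # lbits g @ state_letters s v"


subsection \<open>Group maps as association lists\<close>

definition unset_flag :: "'c prog" where
  "unset_flag = take_top rF (\<lambda>x. if x = None then Skip else Push rF (LMark No))"

definition compare_step :: "'c letter \<Rightarrow> 'c prog" where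
  "compare_step x = Push rS2 x ;; take_top rQ (\<lambda>y. case y of
       None \<Rightarrow> unset_flag
     | Some y \<Rightarrow> if y = x then Push rQ2 y else Push rQ y ;; unset_flag)"

text \<open>Both identifiers survive: the one in \<open>rS\<close> is collected in
  \<open>rS2\<close>, and matched letters of \<open>rQ\<close> are parked in \<open>rQ2\<close> and
  moved back, so that \<open>rQ\<close> can be compared with the next entry. A remainder in
  \<open>rQ\<close> after the loop means that it was the longer one.\<close>

definition compare_ids :: "'c prog" where
  "compare_ids =
     Drain rS compare_step ;;
     Peek rQ (\<lambda>x. if x = None then Skip else unset_flag) ;;
     move rQ2 rQ"

text \<open>An entry is known to be complete only at the next kind letter or at the end of
  \<open>rG\<close>. It is therefore collected in \<open>rB\<close> first and filed afterwards:
  under \<open>rW\<close> if its identifier is the one sought, under \<open>rH\<close>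
  otherwise.\<close>

definition flush_entry :: "'c prog" where
  "flush_entry = Peek rB (\<lambda>x. if x = None then Skip else
     move rB rB2 ;;
     take_top rB2 (\<lambda>k. case k of None \<Rightarrow> Skip | Some k \<Rightarrow>
       split_off is_bit rB2 rS rX ;;
       take_top rF (\<lambda>x. if x = None then Skip else Push rF (LMark Yes)) ;;
       compare_ids ;;
       Peek rF (\<lambda>f. if f = Some (LMark Yes) then clear rS2 ;; Push rW k ;; move rB2 rW
         else Push rH k ;; move rS2 rH ;; move rB2 rH)))"

definition is_kind :: "'c letter \<Rightarrow> bool" where
  "is_kind x \<longleftrightarrow> x = LMark Open_Entry \<or> x = LMark Closed_Entry"

definition take_step :: "'c letter \<Rightarrow> 'c prog" where
  "take_step x = (if is_kind x then flush_entry else Skip) ;; Push rB x"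

text \<open>
  Removes from \<^term>\<open>rG\<close> the entry of the group whose identifier is in \<^term>\<open>rQ\<close> (least significant
  bit on top) and puts its state into \<^term>\<open>rV\<close>.
\<close>

definition take_out :: "'c prog" where
  "take_out =
     Push rF (LMark Yes) ;;
     Drain rG take_step ;;
     flush_entry ;; clear rF ;; move rH rG ;; move rW rV"

text \<open>Functional model of the loop over \<open>compare_step\<close>: the matched letters of
  \<open>ys\<close>, the remainder of \<open>ys\<close>, and whether no mismatch occurred. It goes
  on after a mismatch because the loop does.\<close>

fun cmp :: "'g list \<Rightarrow> 'g list \<Rightarrow> 'g list \<times> 'g list \<times> bool" where
  "cmp [] ys = ([], ys, True)"
| "cmp (x # xs) [] = (case cmp xs [] of (m, r, b) \<Rightarrow> (m, r, False))"
| "cmp (x # xs) (y # ys) =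
     (if y = x then case cmp xs ys of (m, r, b) \<Rightarrow> (y # m, r, b)
      else case cmp xs (y # ys) of (m, r, b) \<Rightarrow> (m, r, False))"

lemma cmp_append: "cmp xs ys = (m, r, b) \<Longrightarrow> m @ r = ys"
  by (induction xs ys arbitrary: m r b rule: cmp.induct) (auto split: if_splits prod.splits)

lemma cmp_equal: "cmp xs ys = (m, r, b) \<Longrightarrow> b \<and> r = [] \<longleftrightarrow> xs = ys"
  by (induction xs ys arbitrary: m r b rule: cmp.induct) (auto split: if_splits prod.splits)

lemma den_unset_flag: "den unset_flag (\<sigma>, w) = {(\<sigma>(rF := if \<sigma> rF = [] then [] else LMark No # tl (\<sigma> rF)), w)}"
  by (cases "\<sigma> rF") (auto simp: unset_flag_def fun_upd_idem)

lemma iter_compare_step: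
  "cmp xs ys = (m, r, b) \<Longrightarrow> \<sigma> rS = xs \<Longrightarrow> \<sigma> rQ = ys \<Longrightarrow> \<sigma> rF = [f] \<Longrightarrow>
    iter (\<lambda>x. den (compare_step x)) rS xs (\<sigma>, w) =
      {(\<sigma>(rS := [], rS2 := rev xs @ \<sigma> rS2, rQ := r, rQ2 := rev m @ \<sigma> rQ2,
        rF := [if b then f else LMark No]), w)}"
proof (induction xs ys arbitrary: \<sigma> m r b f rule: cmp.induct)
  case (1 ys)
  then show ?case by (auto intro!: ext)
next
  case (2 x xs)
  obtain m' r' b' where c: "cmp xs [] = (m', r', b')" by (metis prod_cases3)
  then have e: "m = m'" "r = r'" "b = False" using 2 by auto
  let ?\<sigma> = "\<sigma>(rS := xs, rS2 := x # \<sigma> rS2, rF := [LMark No])"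
  have "den (compare_step x) (\<sigma>(rS := xs), w) = {(?\<sigma>, w)}"
    using 2 by (simp add: compare_step_def den_unset_flag fun_upd_idem)
  then have "iter (\<lambda>x. den (compare_step x)) rS (x # xs) (\<sigma>, w) = iter (\<lambda>x. den (compare_step x)) rS xs (?\<sigma>, w)"
    by simp
  also have "\<dots> = {(?\<sigma>(rS := [], rS2 := rev xs @ ?\<sigma> rS2, rQ := r, rQ2 := rev m @ ?\<sigma> rQ2,
      rF := [LMark No]), w)}"
    using 2 e c by (subst 2(1)[OF c]) auto
  also have "?\<sigma>(rS := [], rS2 := rev xs @ ?\<sigma> rS2, rQ := r, rQ2 := rev m @ ?\<sigma> rQ2, rF := [LMark No])
      = \<sigma>(rS := [], rS2 := rev (x # xs) @ \<sigma> rS2, rQ := r, rQ2 := rev m @ \<sigma> rQ2,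
        rF := [if b then f else LMark No])"
    by (intro ext) (simp add: e)
  finally show ?case .
next
  case (3 x xs y ys)
  show ?case
  proof (cases "y = x")
    case True
    obtain m' r' b' where c: "cmp xs ys = (m', r', b')" by (metis prod_cases3)
    then have e: "m = x # m'" "r = r'" "b = b'" using 3 True by auto
    let ?\<sigma> = "\<sigma>(rS := xs, rS2 := x # \<sigma> rS2, rQ := ys, rQ2 := x # \<sigma> rQ2)"
    have "den (compare_step x) (\<sigma>(rS := xs), w) = {(?\<sigma>, w)}"
      using 3 True by (simp add: compare_step_def)
    then have "iter (\<lambda>x. den (compare_step x)) rS (x # xs) (\<sigma>, w) = iter (\<lambda>x. den (compare_step x)) rS xs (?\<sigma>, w)"
      by simp
    also have "\<dots> = {(?\<sigma>(rS := [], rS2 := rev xs @ ?\<sigma> rS2, rQ := r, rQ2 := rev m' @ ?\<sigma> rQ2,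
        rF := [if b then f else LMark No]), w)}"
      using 3 e c True by (subst 3(1)[OF True c]) auto
    also have "?\<sigma>(rS := [], rS2 := rev xs @ ?\<sigma> rS2, rQ := r, rQ2 := rev m' @ ?\<sigma> rQ2,
        rF := [if b then f else LMark No])
      = \<sigma>(rS := [], rS2 := rev (x # xs) @ \<sigma> rS2, rQ := r, rQ2 := rev m @ \<sigma> rQ2,
        rF := [if b then f else LMark No])"
      by (intro ext) (simp add: e)
    finally show ?thesis .
  next
    case False
    obtain m' r' b' where c: "cmp xs (y # ys) = (m', r', b')" by (metis prod_cases3)
    then have e: "m = m'" "r = r'" "b = False" using 3 False by auto
    let ?\<sigma> = "\<sigma>(rS := xs, rS2 := x # \<sigma> rS2, rF := [LMark No])"
    have "den (compare_step x) (\<sigma>(rS := xs), w) = {(?\<sigma>, w)}"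
      using 3 False by (auto simp: compare_step_def den_unset_flag intro!: ext)
    then have "iter (\<lambda>x. den (compare_step x)) rS (x # xs) (\<sigma>, w) = iter (\<lambda>x. den (compare_step x)) rS xs (?\<sigma>, w)"
      by simp
    also have "\<dots> = {(?\<sigma>(rS := [], rS2 := rev xs @ ?\<sigma> rS2, rQ := r, rQ2 := rev m @ ?\<sigma> rQ2,
        rF := [LMark No]), w)}"
      using 3 e c False by (subst 3(2)[OF False c]) auto
    also have "?\<sigma>(rS := [], rS2 := rev xs @ ?\<sigma> rS2, rQ := r, rQ2 := rev m @ ?\<sigma> rQ2, rF := [LMark No])
      = \<sigma>(rS := [], rS2 := rev (x # xs) @ \<sigma> rS2, rQ := r, rQ2 := rev m @ \<sigma> rQ2,
        rF := [if b then f else LMark No])"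
      by (intro ext) (simp add: e)
    finally show ?thesis .
  qed
qed

lemma den_compare_ids:
  assumes "\<sigma> rS2 = []" "\<sigma> rQ2 = []" "\<sigma> rF = [LMark Yes]"
  shows "den compare_ids (\<sigma>, w) = {(\<sigma>(rS := [], rS2 := rev (\<sigma> rS),
    rF := [LMark (if \<sigma> rS = \<sigma> rQ then Yes else No)]), w)}"
proof -
  obtain m r b where c: "cmp (\<sigma> rS) (\<sigma> rQ) = (m, r, b)" by (metis prod_cases3)
  note facts = cmp_append[OF c] cmp_equal[OF c]
  show ?thesis
    using iter_compare_step[OF c refl refl assms(3), of w] assms facts
    by (cases r) (auto simp: compare_ids_def den_unset_flag intro!: ext)
qed

lemma den_flush_entry:
  assumes "\<sigma> rB = rev (k # map LBit bs @ p)" "\<sigma> rB2 = []" "\<sigma> rS = []" "\<sigma> rX = []" "\<sigma> rS2 = []"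
    "\<sigma> rQ2 = []" "\<sigma> rF = [f]" "p = [] \<or> \<not> is_bit (hd p)"
  shows "den flush_entry (\<sigma>, w) =
    (if rev (map LBit bs) = \<sigma> rQ
     then {(\<sigma>(rB := [], rF := [LMark Yes], rW := rev (k # p) @ \<sigma> rW), w)}
     else {(\<sigma>(rB := [], rF := [LMark No], rH := \<sigma> rB @ \<sigma> rH), w)})"
proof -
  have t: "takeWhile is_bit (map LBit bs @ p) = map LBit bs" "dropWhile is_bit (map LBit bs @ p) = p"
    using assms(8) by (cases p; induction bs; auto simp: is_bit_def)+
  have "\<sigma> rB \<noteq> []" using assms(1) by simp
  then obtain x where top: "top_of (\<sigma> rB) = Some x" by (cases "\<sigma> rB") simp_all
  have rB: "rev (\<sigma> rB) = k # map LBit bs @ p" using assms(1) by simp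
  have H: "rev p @ rev (map LBit bs) @ k # \<sigma> rH = \<sigma> rB @ \<sigma> rH" using assms(1) by simp
  show ?thesis
  proof (cases "rev (map LBit bs) = \<sigma> rQ")
    case True
    then show ?thesis
      using assms(2-7) by (simp add: flush_entry_def top rB t den_compare_ids, intro ext) simp
  next
    case False
    then show ?thesis
      using assms(2-7) by (simp add: flush_entry_def top rB t den_compare_ids, intro ext) (simp add: H)
  qed
qed

lemma is_kind_state_kind [simp]: "is_kind (state_kind v)"
  by (cases v) (auto simp: is_kind_def)

lemma prefix_not_kind: "x \<in> set (prefix s p) \<Longrightarrow> \<not> is_kind x"
  by (auto simp: prefix_def is_kind_def)

lemma state_letters_not_kind: "x \<in> set (state_letters s v) \<Longrightarrow> \<not> is_kind x"
  by (cases v) (auto dest: prefix_not_kind simp: is_kind_def)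

lemma prefix_not_bit: "prefix s p = [] \<or> \<not> is_bit (hd (prefix s p))"
  by (cases "rev (take p s)") (auto simp: prefix_def is_bit_def)

lemma state_letters_not_bit: "state_letters s v = [] \<or> \<not> is_bit (hd (state_letters s v))"
  using prefix_not_bit[of s] by (cases v) (auto simp: is_bit_def hd_append)

lemma iter_take_step_tail:
  "\<forall>y \<in> set ys. \<not> is_kind y \<Longrightarrow> \<sigma> rG = ys @ xs \<Longrightarrow>
   iter (\<lambda>x. den (take_step x)) rG (ys @ xs) (\<sigma>, w) =
     iter (\<lambda>x. den (take_step x)) rG xs (\<sigma>(rG := xs, rB := rev ys @ \<sigma> rB), w)"
proof (induction ys arbitrary: \<sigma>)
  case Nil
  then show ?case by (simp add: fun_upd_idem)
next
  case (Cons y ys)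
  let ?\<sigma> = "\<sigma>(rG := ys @ xs, rB := y # \<sigma> rB)"
  have "iter (\<lambda>x. den (take_step x)) rG ((y # ys) @ xs) (\<sigma>, w) =
      iter (\<lambda>x. den (take_step x)) rG (ys @ xs) (?\<sigma>, w)"
    using Cons.prems by (simp add: take_step_def)
  also have "\<dots> = iter (\<lambda>x. den (take_step x)) rG xs (?\<sigma>(rG := xs, rB := rev ys @ ?\<sigma> rB), w)"
    using Cons.prems by (subst Cons.IH) auto
  also have "?\<sigma>(rG := xs, rB := rev ys @ ?\<sigma> rB) = \<sigma>(rG := xs, rB := rev (y # ys) @ \<sigma> rB)"
    by (intro ext) simp
  finally show ?case .
qed

lemma den_flush_entry_letters:
  assumes "\<sigma> rB = rev (entry_letters s (g', v))" "\<sigma> rB2 = []" "\<sigma> rS = []" "\<sigma> rX = []" "\<sigma> rS2 = []"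
    "\<sigma> rQ2 = []" "\<sigma> rF = [f]" "\<sigma> rQ = rev (lbits g)"
  shows "den flush_entry (\<sigma>, w) =
    (if g' = g
     then {(\<sigma>(rB := [], rF := [LMark Yes], rW := rev (state_kind v # state_letters s v) @ \<sigma> rW), w)}
     else {(\<sigma>(rB := [], rF := [LMark No], rH := rev (entry_letters s (g', v)) @ \<sigma> rH), w)})"
proof -
  show ?thesis
    using den_flush_entry[of \<sigma> "state_kind v" "binary g'" "state_letters s v" f w]
      assms state_letters_not_bit[of s v] lbits_eq_iff[of g' g, where ?'a = 'a]
    by (cases "g' = g") (simp_all add: lbits_def)
qed

text \<open>The entry \<open>e\<close> is pending in \<open>rB\<close> while the letters of
  \<open>G\<close> are still to be read. The final \<open>flush_entry\<close> belongs to the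
  statement because only then have all entries of \<open>e # G\<close> been filed.\<close>

lemma iter_take_step:
  assumes "\<sigma> rB2 = []" "\<sigma> rS = []" "\<sigma> rX = []" "\<sigma> rS2 = []" "\<sigma> rQ2 = []"
    "\<sigma> rQ = rev (lbits g)"
  shows "\<sigma> rB = rev (entry_letters s e) \<Longrightarrow> \<sigma> rF = [f] \<Longrightarrow> \<sigma> rG = concat (map (entry_letters s) G) \<Longrightarrow>
    (\<Union>st \<in> iter (\<lambda>x. den (take_step x)) rG (concat (map (entry_letters s) G)) (\<sigma>, w).
      den (flush_entry ;; clear rF) st) =
    {(\<sigma>(rG := [], rB := [], rF := [],
        rH := rev (concat (map (entry_letters s) (filter (\<lambda>e. fst e \<noteq> g) (e # G)))) @ \<sigma> rH,
        rW := rev (concat (map (\<lambda>e. state_kind (snd e) # state_letters s (snd e))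
          (filter (\<lambda>e. fst e = g) (e # G)))) @ \<sigma> rW), w)}"
  using assms
proof (induction G arbitrary: \<sigma> e f)
  case Nil
  obtain g' v where e: "e = (g', v)" by fastforce
  show ?case
    using Nil unfolding e
    by (simp add: den_flush_entry_letters del: entry_letters.simps) (auto intro!: ext)
next
  case (Cons e' G)
  obtain g' v where e: "e = (g', v)" by fastforce
  obtain g1 v1 where e': "e' = (g1, v1)" by fastforce
  let ?tl = "lbits g1 @ state_letters s v1"
  let ?xs = "concat (map (entry_letters s) G)"
  define H where "H = (if g' = g then \<sigma> rH else rev (entry_letters s e) @ \<sigma> rH)"
  define W where "W = (if g' = g then rev (state_kind v # state_letters s v) @ \<sigma> rW else \<sigma> rW)"
  define F where "F = (if g' = g then LMark Yes else LMark No :: 'a letter)"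
  let ?\<sigma>1 = "\<sigma>(rG := ?tl @ ?xs, rB := [state_kind v1], rF := [F], rH := H, rW := W)"
  let ?\<sigma>2 = "\<sigma>(rG := ?xs, rB := rev (entry_letters s e'), rF := [F], rH := H, rW := W)"
  have tl: "\<forall>y \<in> set ?tl. \<not> is_kind y"
    by (auto simp: lbits_def is_kind_def dest: state_letters_not_kind[unfolded is_kind_def])
  have "den (take_step (state_kind v1)) (\<sigma>(rG := ?tl @ ?xs), w) = {(?\<sigma>1, w)}"
    using Cons.prems unfolding e
    by (auto simp: take_step_def den_flush_entry_letters F_def H_def W_def e
      simp del: entry_letters.simps intro!: ext)
  then have "iter (\<lambda>x. den (take_step x)) rG (concat (map (entry_letters s) (e' # G))) (\<sigma>, w) =
      iter (\<lambda>x. den (take_step x)) rG (?tl @ ?xs) (?\<sigma>1, w)"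
    by (simp add: e')
  also have "\<dots> = iter (\<lambda>x. den (take_step x)) rG ?xs (?\<sigma>1(rG := ?xs, rB := rev ?tl @ ?\<sigma>1 rB), w)"
    by (rule iter_take_step_tail[OF tl]) simp
  also have "?\<sigma>1(rG := ?xs, rB := rev ?tl @ ?\<sigma>1 rB) = ?\<sigma>2"
    by (intro ext) (simp add: e')
  finally have "(\<Union>st \<in> iter (\<lambda>x. den (take_step x)) rG (concat (map (entry_letters s) (e' # G))) (\<sigma>, w).
      den (flush_entry ;; clear rF) st) =
    (\<Union>st \<in> iter (\<lambda>x. den (take_step x)) rG ?xs (?\<sigma>2, w). den (flush_entry ;; clear rF) st)"
    by (rule arg_cong)
  also have "\<dots> = {(?\<sigma>2(rG := [], rB := [], rF := [],
        rH := rev (concat (map (entry_letters s) (filter (\<lambda>e. fst e \<noteq> g) (e' # G)))) @ ?\<sigma>2 rH,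
        rW := rev (concat (map (\<lambda>e. state_kind (snd e) # state_letters s (snd e))
          (filter (\<lambda>e. fst e = g) (e' # G)))) @ ?\<sigma>2 rW), w)}"
    by (rule Cons.IH) (use Cons.prems in simp_all)
  also have "?\<sigma>2(rG := [], rB := [], rF := [],
        rH := rev (concat (map (entry_letters s) (filter (\<lambda>e. fst e \<noteq> g) (e' # G)))) @ ?\<sigma>2 rH,
        rW := rev (concat (map (\<lambda>e. state_kind (snd e) # state_letters s (snd e))
          (filter (\<lambda>e. fst e = g) (e' # G)))) @ ?\<sigma>2 rW) =
      \<sigma>(rG := [], rB := [], rF := [],
        rH := rev (concat (map (entry_letters s) (filter (\<lambda>e. fst e \<noteq> g) (e # e' # G)))) @ \<sigma> rH,
        rW := rev (concat (map (\<lambda>e. state_kind (snd e) # state_letters s (snd e))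
          (filter (\<lambda>e. fst e = g) (e # e' # G)))) @ \<sigma> rW)"
    by (intro ext) (simp add: H_def W_def e)
  finally show ?case .
qed

lemma den_take_out:
  assumes "\<sigma> rB = []" "\<sigma> rB2 = []" "\<sigma> rS = []" "\<sigma> rX = []" "\<sigma> rS2 = []" "\<sigma> rQ2 = []" "\<sigma> rF = []"
    "\<sigma> rH = []" "\<sigma> rW = []" "\<sigma> rV = []" "\<sigma> rQ = rev (lbits g)"
    "\<sigma> rG = concat (map (entry_letters s) G)"
  shows "den take_out (\<sigma>, w) =
    {(\<sigma>(rG := concat (map (entry_letters s) (filter (\<lambda>e. fst e \<noteq> g) G)),
        rV := concat (map (\<lambda>e. state_kind (snd e) # state_letters s (snd e))
          (filter (\<lambda>e. fst e = g) G))), w)}"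
proof (cases G)
  case Nil
  then show ?thesis
    using assms by (auto simp: take_out_def flush_entry_def intro!: ext)
next
  case (Cons e G')
  obtain g1 v1 where e: "e = (g1, v1)" by fastforce
  let ?tl = "lbits g1 @ state_letters s v1"
  let ?xs = "concat (map (entry_letters s) G')"
  let ?\<sigma>1 = "\<sigma>(rG := ?tl @ ?xs, rB := [state_kind v1], rF := [LMark Yes])"
  let ?\<sigma>2 = "\<sigma>(rG := ?xs, rB := rev (entry_letters s e), rF := [LMark Yes])"
  have tl: "\<forall>y \<in> set ?tl. \<not> is_kind y"
    by (auto simp: lbits_def is_kind_def dest: state_letters_not_kind[unfolded is_kind_def])
  \<comment> \<open>The first kind letter finds \<open>rB\<close> empty, so nothing is flushed. From
    here on an entry is pending, as \<open>iter_take_step\<close> requires.\<close>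
  have "den (take_step (state_kind v1)) ((\<sigma>(rF := [LMark Yes]))(rG := ?tl @ ?xs), w) = {(?\<sigma>1, w)}"
    using assms by (auto simp: take_step_def flush_entry_def intro!: ext)
  then have "den (Drain rG take_step) (\<sigma>(rF := [LMark Yes]), w) =
      iter (\<lambda>x. den (take_step x)) rG (?tl @ ?xs) (?\<sigma>1, w)"
    using assms(12) by (simp add: e Cons)
  also have "\<dots> = iter (\<lambda>x. den (take_step x)) rG ?xs (?\<sigma>1(rG := ?xs, rB := rev ?tl @ ?\<sigma>1 rB), w)"
    by (rule iter_take_step_tail[OF tl]) simp
  also have "?\<sigma>1(rG := ?xs, rB := rev ?tl @ ?\<sigma>1 rB) = ?\<sigma>2"
    by (intro ext) (simp add: e)
  finally have 1: "den (Drain rG take_step) (\<sigma>(rF := [LMark Yes]), w) =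
      iter (\<lambda>x. den (take_step x)) rG ?xs (?\<sigma>2, w)" .
  have "den take_out (\<sigma>, w) = (\<Union>st \<in> (\<Union>st \<in> den (Drain rG take_step) (\<sigma>(rF := [LMark Yes]), w).
      den (flush_entry ;; clear rF) st). den (move rH rG ;; move rW rV) st)"
    using assms by (simp add: take_out_def del: den.simps(9) den_move)
  also have "(\<Union>st \<in> den (Drain rG take_step) (\<sigma>(rF := [LMark Yes]), w). den (flush_entry ;; clear rF) st) =
    {(?\<sigma>2(rG := [], rB := [], rF := [],
        rH := rev (concat (map (entry_letters s) (filter (\<lambda>e. fst e \<noteq> g) (e # G')))) @ ?\<sigma>2 rH,
        rW := rev (concat (map (\<lambda>e. state_kind (snd e) # state_letters s (snd e))
          (filter (\<lambda>e. fst e = g) (e # G')))) @ ?\<sigma>2 rW), w)}"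
    unfolding 1 by (rule iter_take_step) (use assms in simp_all)
  finally show ?thesis
    using assms Cons by (auto intro!: ext)
qed


lemma iter_step:
  "D x (\<sigma>(r := xs), w) = {st} \<Longrightarrow> iter D r (x # xs) (\<sigma>, w) = iter D r xs st"
  by simp

subsection \<open>Parsing a regex\<close>

text \<open>In prefix notation a leaf completes one missing subexpression, a unary operator replaces
  one by one, and a binary operator replaces one by two.\<close>

definition adjust :: "'c letter \<Rightarrow> 'c prog" where
  "adjust x = (case x of
     LTok t \<Rightarrow> (case t of
         TEps \<Rightarrow> Pop rN | TChars _ \<Rightarrow> Pop rN | TBackref \<Rightarrow> Pop rN | TAnchor _ \<Rightarrow> Pop rN
       | TAlt \<Rightarrow> Push rN (LMark Tick) | TSeq \<Rightarrow> Push rN (LMark Tick)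
       | _ \<Rightarrow> Skip)
   | _ \<Rightarrow> Skip)"

text \<open>When the counter has run out, bits may still follow, namely the identifier of a
  backreference that ends the regex. They are accepted as long as \<open>rX\<close> is empty, that
  is, until another letter has been set aside.\<close>

definition parse_step :: "'c letter \<Rightarrow> 'c prog" where
  "parse_step x = Peek rN (\<lambda>n. Peek rX (\<lambda>y.
     if n \<noteq> None \<or> is_bit x \<and> y = None then Push rT x ;; adjust x else Push rX x))"

text \<open>
  Moves the regex at the top of \<^term>\<open>rA\<close>, reversed, to \<^term>\<open>rT\<close>; \<^term>\<open>rN\<close> counts the
  subexpressions in prefix notation that are still missing.
\<close>

definition take_regex :: "'c prog" where
  "take_regex = Push rN (LMark Tick) ;; Drain rA parse_step ;; move rX rA"

lemma iter_parse_bits: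
  "\<sigma> rA = map LBit bs @ xs \<Longrightarrow> \<sigma> rX = [] \<Longrightarrow>
   iter (\<lambda>x. den (parse_step x)) rA (map LBit bs @ xs) (\<sigma>, w) =
     iter (\<lambda>x. den (parse_step x)) rA xs (\<sigma>(rA := xs, rT := rev (map LBit bs) @ \<sigma> rT), w)"
proof (induction bs arbitrary: \<sigma>)
  case Nil
  then show ?case by (simp add: fun_upd_idem)
next
  case (Cons b bs)
  let ?\<sigma> = "\<sigma>(rA := map LBit bs @ xs, rT := LBit b # \<sigma> rT)"
  have "den (parse_step (LBit b)) (\<sigma>(rA := map LBit bs @ xs), w) = {(?\<sigma>, w)}"
    using Cons.prems by (simp add: parse_step_def adjust_def is_bit_def)
  then have "iter (\<lambda>x. den (parse_step x)) rA (map LBit (b # bs) @ xs) (\<sigma>, w) =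
      iter (\<lambda>x. den (parse_step x)) rA (map LBit bs @ xs) (?\<sigma>, w)"
    by simp
  also have "\<dots> = iter (\<lambda>x. den (parse_step x)) rA xs
      (?\<sigma>(rA := xs, rT := rev (map LBit bs) @ ?\<sigma> rT), w)"
    using Cons.prems by (subst Cons.IH) auto
  also have "?\<sigma>(rA := xs, rT := rev (map LBit bs) @ ?\<sigma> rT) =
      \<sigma>(rA := xs, rT := rev (map LBit (b # bs)) @ \<sigma> rT)"
    by (intro ext) simp
  finally show ?case .
qed

lemma iter_parse_letter:
  assumes "\<sigma> rA = x # xs" "\<sigma> rN = n # ns"
    and "den (adjust x) (\<sigma>(rA := xs, rT := x # \<sigma> rT), w) = {(\<sigma>(rA := xs, rT := x # \<sigma> rT, rN := m), w)}"
  shows "iter (\<lambda>x. den (parse_step x)) rA (x # xs) (\<sigma>, w) =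
     iter (\<lambda>x. den (parse_step x)) rA xs (\<sigma>(rA := xs, rT := x # \<sigma> rT, rN := m), w)"
  using assms by (simp add: parse_step_def)

lemma den_adjust_leaf:
  "t = TEps \<or> (\<exists>cd. t = TChars cd) \<or> t = TBackref \<or> (\<exists>a. t = TAnchor a) \<Longrightarrow>
   den (adjust (LTok t)) (\<sigma>, w) = {(\<sigma>(rN := tl (\<sigma> rN)), w)}"
  by (auto simp: adjust_def)

lemma den_adjust_binary:
  "t = TAlt \<or> t = TSeq \<Longrightarrow>
   den (adjust (LTok t)) (\<sigma>, w) = {(\<sigma>(rN := LMark Tick # \<sigma> rN), w)}"
  by (auto simp: adjust_def)

lemma den_adjust_other:
  "t = TGroup \<or> (\<exists>b. t = TQuant b) \<or> t = TFinite \<or> t = TInfinite \<Longrightarrow>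
   den (adjust (LTok t)) (\<sigma>, w) = {(\<sigma>(rN := \<sigma> rN), w)}"
  by (auto simp: adjust_def)

lemma iter_parse_leaf:
  assumes "\<sigma> rA = LTok t # xs" "\<sigma> rN = n # ns"
    "t = TEps \<or> (\<exists>cd. t = TChars cd) \<or> t = TBackref \<or> (\<exists>a. t = TAnchor a)"
  shows "iter (\<lambda>x. den (parse_step x)) rA (LTok t # xs) (\<sigma>, w) =
     iter (\<lambda>x. den (parse_step x)) rA xs (\<sigma>(rA := xs, rN := ns, rT := LTok t # \<sigma> rT), w)"
proof -
  have "iter (\<lambda>x. den (parse_step x)) rA (LTok t # xs) (\<sigma>, w) =
     iter (\<lambda>x. den (parse_step x)) rA xs (\<sigma>(rA := xs, rT := LTok t # \<sigma> rT, rN := ns), w)"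
    using assms by (intro iter_parse_letter) (simp_all add: den_adjust_leaf)
  also have "\<sigma>(rA := xs, rT := LTok t # \<sigma> rT, rN := ns) = \<sigma>(rA := xs, rN := ns, rT := LTok t # \<sigma> rT)"
    by (intro ext) simp
  finally show ?thesis .
qed

text \<open>Reading one regex takes exactly one tick off the counter. The counter is an arbitrary
  non-empty list because inside an operator further subexpressions are missing.\<close>

lemma iter_parse_regex:
  "\<sigma> rA = regex_letters r @ xs \<Longrightarrow> \<sigma> rN = n # ns \<Longrightarrow> \<sigma> rX = [] \<Longrightarrow>
   iter (\<lambda>x. den (parse_step x)) rA (regex_letters r @ xs) (\<sigma>, w) =
     iter (\<lambda>x. den (parse_step x)) rA xs
       (\<sigma>(rA := xs, rN := ns, rT := rev (regex_letters r) @ \<sigma> rT), w)"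
proof (induction r arbitrary: \<sigma> n ns xs)
  case Eps
  show ?case
    unfolding regex_letters.simps append.simps rev.simps
    by (rule iter_parse_leaf) (use Eps in auto)
next
  case (Chars cd)
  show ?case
    unfolding regex_letters.simps append.simps rev.simps
    by (rule iter_parse_leaf) (use Chars in auto)
next
  case (Anchor a)
  show ?case
    unfolding regex_letters.simps append.simps rev.simps
    by (rule iter_parse_leaf) (use Anchor in auto)
next
  case (Alt r1 r2)
  let ?\<sigma> = "\<sigma>(rA := regex_letters r1 @ regex_letters r2 @ xs, rT := LTok TAlt # \<sigma> rT,
    rN := LMark Tick # n # ns)"
  let ?\<sigma>1 = "?\<sigma>(rA := regex_letters r2 @ xs, rN := n # ns, rT := rev (regex_letters r1) @ ?\<sigma> rT)"
  have "iter (\<lambda>x. den (parse_step x)) rA (regex_letters (Alt r1 r2) @ xs) (\<sigma>, w) =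
      iter (\<lambda>x. den (parse_step x)) rA (regex_letters r1 @ regex_letters r2 @ xs) (?\<sigma>, w)"
    using Alt.prems
    by (simp add: iter_parse_letter[where m = "LMark Tick # n # ns"] den_adjust_binary del: iter.simps)
  also have "\<dots> = iter (\<lambda>x. den (parse_step x)) rA (regex_letters r2 @ xs) (?\<sigma>1, w)"
    using Alt.prems by (intro Alt.IH(1)) auto
  also have "\<dots> = iter (\<lambda>x. den (parse_step x)) rA xs
      (?\<sigma>1(rA := xs, rN := ns, rT := rev (regex_letters r2) @ ?\<sigma>1 rT), w)"
    using Alt.prems by (intro Alt.IH(2)) auto
  also have "?\<sigma>1(rA := xs, rN := ns, rT := rev (regex_letters r2) @ ?\<sigma>1 rT) =
      \<sigma>(rA := xs, rN := ns, rT := rev (regex_letters (Alt r1 r2)) @ \<sigma> rT)"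
    by (intro ext) simp
  finally show ?case .
next
  case (Seq r1 r2)
  let ?\<sigma> = "\<sigma>(rA := regex_letters r1 @ regex_letters r2 @ xs, rT := LTok TSeq # \<sigma> rT,
    rN := LMark Tick # n # ns)"
  let ?\<sigma>1 = "?\<sigma>(rA := regex_letters r2 @ xs, rN := n # ns, rT := rev (regex_letters r1) @ ?\<sigma> rT)"
  have "iter (\<lambda>x. den (parse_step x)) rA (regex_letters (Seq r1 r2) @ xs) (\<sigma>, w) =
      iter (\<lambda>x. den (parse_step x)) rA (regex_letters r1 @ regex_letters r2 @ xs) (?\<sigma>, w)"
    using Seq.prems
    by (simp add: iter_parse_letter[where m = "LMark Tick # n # ns"] den_adjust_binary del: iter.simps)
  also have "\<dots> = iter (\<lambda>x. den (parse_step x)) rA (regex_letters r2 @ xs) (?\<sigma>1, w)"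
    using Seq.prems by (intro Seq.IH(1)) auto
  also have "\<dots> = iter (\<lambda>x. den (parse_step x)) rA xs
      (?\<sigma>1(rA := xs, rN := ns, rT := rev (regex_letters r2) @ ?\<sigma>1 rT), w)"
    using Seq.prems by (intro Seq.IH(2)) auto
  also have "?\<sigma>1(rA := xs, rN := ns, rT := rev (regex_letters r2) @ ?\<sigma>1 rT) =
      \<sigma>(rA := xs, rN := ns, rT := rev (regex_letters (Seq r1 r2)) @ \<sigma> rT)"
    by (intro ext) simp
  finally show ?case .
next
  case (Group g r)
  let ?\<sigma> = "\<sigma>(rA := lbits g @ regex_letters r @ xs, rT := LTok TGroup # \<sigma> rT, rN := n # ns)"
  let ?\<sigma>1 = "?\<sigma>(rA := regex_letters r @ xs, rT := rev (lbits g) @ ?\<sigma> rT)"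
  have "iter (\<lambda>x. den (parse_step x)) rA (regex_letters (Group g r) @ xs) (\<sigma>, w) =
      iter (\<lambda>x. den (parse_step x)) rA (lbits g @ regex_letters r @ xs) (?\<sigma>, w)"
    using Group.prems
    by (simp add: iter_parse_letter[where m = "n # ns"] den_adjust_other del: iter.simps)
  also have "\<dots> = iter (\<lambda>x. den (parse_step x)) rA (regex_letters r @ xs) (?\<sigma>1, w)"
    using Group.prems unfolding lbits_def by (intro iter_parse_bits) auto
  also have "\<dots> = iter (\<lambda>x. den (parse_step x)) rA xs
      (?\<sigma>1(rA := xs, rN := ns, rT := rev (regex_letters r) @ ?\<sigma>1 rT), w)"
    using Group.prems by (intro Group.IH) auto
  also have "?\<sigma>1(rA := xs, rN := ns, rT := rev (regex_letters r) @ ?\<sigma>1 rT) =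
      \<sigma>(rA := xs, rN := ns, rT := rev (regex_letters (Group g r)) @ \<sigma> rT)"
    by (intro ext) simp
  finally show ?case .
next
  case (Backref g)
  let ?\<sigma> = "\<sigma>(rA := lbits g @ xs, rT := LTok TBackref # \<sigma> rT, rN := ns)"
  have "iter (\<lambda>x. den (parse_step x)) rA (regex_letters (Backref g) @ xs) (\<sigma>, w) =
      iter (\<lambda>x. den (parse_step x)) rA (lbits g @ xs) (?\<sigma>, w)"
    using Backref.prems
    by (simp add: iter_parse_letter[where m = ns] den_adjust_leaf del: iter.simps)
  also have "\<dots> = iter (\<lambda>x. den (parse_step x)) rA xs (?\<sigma>(rA := xs, rT := rev (lbits g) @ ?\<sigma> rT), w)"
    using Backref.prems unfolding lbits_def by (intro iter_parse_bits) auto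
  also have "?\<sigma>(rA := xs, rT := rev (lbits g) @ ?\<sigma> rT) =
      \<sigma>(rA := xs, rN := ns, rT := rev (regex_letters (Backref g)) @ \<sigma> rT)"
    by (intro ext) simp
  finally show ?case .
next
  case (Quant r m d greedy)
  define ds where "ds = (case d of enat n \<Rightarrow> binary n | \<infinity> \<Rightarrow> [])"
  define dt :: "'a token" where "dt = (case d of enat n \<Rightarrow> TFinite | \<infinity> \<Rightarrow> TInfinite)"
  have d: "(case d of enat n \<Rightarrow> LTok TFinite # lbits n | \<infinity> \<Rightarrow> [LTok TInfinite]) = LTok dt # map LBit ds"
    by (simp add: ds_def dt_def lbits_def split: enat.split)
  have dt: "dt = TGroup \<or> (\<exists>b. dt = TQuant b) \<or> dt = TFinite \<or> dt = TInfinite"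
    by (simp add: dt_def split: enat.split)
  let ?y1 = "LTok dt # map LBit ds @ regex_letters r @ xs"
  let ?\<sigma> = "\<sigma>(rA := lbits m @ ?y1, rT := LTok (TQuant greedy) # \<sigma> rT, rN := n # ns)"
  let ?\<sigma>1 = "?\<sigma>(rA := ?y1, rT := rev (lbits m) @ ?\<sigma> rT)"
  let ?\<sigma>2 = "?\<sigma>1(rA := map LBit ds @ regex_letters r @ xs, rT := LTok dt # ?\<sigma>1 rT, rN := n # ns)"
  let ?\<sigma>3 = "?\<sigma>2(rA := regex_letters r @ xs, rT := rev (map LBit ds) @ ?\<sigma>2 rT)"
  have "iter (\<lambda>x. den (parse_step x)) rA (regex_letters (Quant r m d greedy) @ xs) (\<sigma>, w) =
      iter (\<lambda>x. den (parse_step x)) rA (lbits m @ ?y1) (?\<sigma>, w)"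
    using Quant.prems
    by (simp add: iter_parse_letter[where m = "n # ns"] den_adjust_other d del: iter.simps)
  also have "\<dots> = iter (\<lambda>x. den (parse_step x)) rA ?y1 (?\<sigma>1, w)"
    using Quant.prems unfolding lbits_def by (intro iter_parse_bits) auto
  also have "\<dots> = iter (\<lambda>x. den (parse_step x)) rA (map LBit ds @ regex_letters r @ xs) (?\<sigma>2, w)"
    using Quant.prems
    by (intro iter_parse_letter[where m = "n # ns" and n = n and ns = ns])
      (simp_all add: den_adjust_other[OF dt])
  also have "\<dots> = iter (\<lambda>x. den (parse_step x)) rA (regex_letters r @ xs) (?\<sigma>3, w)"
    using Quant.prems by (intro iter_parse_bits) auto
  also have "\<dots> = iter (\<lambda>x. den (parse_step x)) rA xs
      (?\<sigma>3(rA := xs, rN := ns, rT := rev (regex_letters r) @ ?\<sigma>3 rT), w)"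
    using Quant.prems by (intro Quant.IH) auto
  also have "?\<sigma>3(rA := xs, rN := ns, rT := rev (regex_letters r) @ ?\<sigma>3 rT) =
      \<sigma>(rA := xs, rN := ns, rT := rev (regex_letters (Quant r m d greedy)) @ \<sigma> rT)"
    by (intro ext) (simp add: d)
  finally show ?case .
qed

lemma iter_parse_rest:
  "\<sigma> rA = xs \<Longrightarrow> \<sigma> rN = [] \<Longrightarrow> \<sigma> rX \<noteq> [] \<or> xs = [] \<or> \<not> is_bit (hd xs) \<Longrightarrow>
   iter (\<lambda>x. den (parse_step x)) rA xs (\<sigma>, w) = {(\<sigma>(rA := [], rX := rev xs @ \<sigma> rX), w)}"
proof (induction xs arbitrary: \<sigma>)
  case Nil
  then show ?case by (simp add: fun_upd_idem)
next
  case (Cons x xs)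
  let ?\<sigma> = "\<sigma>(rA := xs, rX := x # \<sigma> rX)"
  have "den (parse_step x) (\<sigma>(rA := xs), w) = {(?\<sigma>, w)}"
    using Cons.prems by (cases "\<sigma> rX") (auto simp: parse_step_def)
  then have "iter (\<lambda>x. den (parse_step x)) rA (x # xs) (\<sigma>, w) = iter (\<lambda>x. den (parse_step x)) rA xs (?\<sigma>, w)"
    by simp
  also have "\<dots> = {(?\<sigma>(rA := [], rX := rev xs @ ?\<sigma> rX), w)}"
    using Cons.prems by (intro Cons.IH) auto
  also have "?\<sigma>(rA := [], rX := rev xs @ ?\<sigma> rX) = \<sigma>(rA := [], rX := rev (x # xs) @ \<sigma> rX)"
    by (intro ext) simp
  finally show ?case .
qed

lemma den_take_regex:
  assumes "\<sigma> rA = regex_letters r @ xs" "xs = [] \<or> \<not> is_bit (hd xs)" "\<sigma> rN = []" "\<sigma> rX = []"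
  shows "den take_regex (\<sigma>, w) = {(\<sigma>(rA := xs, rT := rev (regex_letters r) @ \<sigma> rT), w)}"
proof -
  let ?\<sigma> = "\<sigma>(rN := [LMark Tick])"
  let ?\<sigma>1 = "?\<sigma>(rA := xs, rN := [], rT := rev (regex_letters r) @ ?\<sigma> rT)"
  let ?\<sigma>2 = "?\<sigma>1(rA := [], rX := rev xs @ ?\<sigma>1 rX)"
  have "den (Drain rA parse_step) (?\<sigma>, w) =
      iter (\<lambda>x. den (parse_step x)) rA (regex_letters r @ xs) (?\<sigma>, w)"
    using assms by simp
  also have "\<dots> = iter (\<lambda>x. den (parse_step x)) rA xs (?\<sigma>1, w)"
    using assms by (intro iter_parse_regex[where n = "LMark Tick" and ns = "[]"]) auto
  also have "\<dots> = {(?\<sigma>2, w)}"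
    using assms by (intro iter_parse_rest) auto
  finally have 1: "den (Drain rA parse_step) (?\<sigma>, w) = {(?\<sigma>2, w)}" .
  have "den take_regex (\<sigma>, w) = (\<Union>st \<in> den (Drain rA parse_step) (?\<sigma>, w). den (move rX rA) st)"
    using assms by (simp add: take_regex_def del: den.simps(9))
  also have "\<dots> = {(?\<sigma>2(rX := [], rA := xs), w)}"
    unfolding 1 using assms by simp
  also have "?\<sigma>2(rX := [], rA := xs) = \<sigma>(rA := xs, rT := rev (regex_letters r) @ \<sigma> rT)"
    using assms by (intro ext) auto
  finally show ?thesis .
qed


subsection \<open>Binary counters\<close>

text \<open>The least significant bit comes first. Subtracting one preserves the number of bits and
  can thus leave a leading zero, which \<open>binary\<close> never writes; \<open>drop_zero\<close>
  restores the normal form.\<close>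

fun pred_bits :: "bool list \<Rightarrow> bool list" where
  "pred_bits [] = []"
| "pred_bits (True # bs) = False # bs"
| "pred_bits (False # bs) = True # pred_bits bs"

fun succ_bits :: "bool list \<Rightarrow> bool list" where
  "succ_bits [] = [True]"
| "succ_bits (True # bs) = False # succ_bits bs"
| "succ_bits (False # bs) = True # bs"

definition drop_zero :: "bool list \<Rightarrow> bool list" where
  "drop_zero bs = (if bs \<noteq> [] \<and> \<not> last bs then butlast bs else bs)"

lemma rev_binary: "n > 0 \<Longrightarrow> rev (binary n) = odd n # rev (binary (n div 2))"
  by (subst binary.simps) simp

lemma binary_0 [simp]: "binary 0 = []"
  by (simp add: binary.simps)

lemma lbits_0 [simp]: "lbits 0 = []"
  by (simp add: lbits_def)

lemma binary_eq_Nil [simp]: "binary n = [] \<longleftrightarrow> n = 0"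
  by (subst binary.simps) simp

lemma hd_binary: "n > 0 \<Longrightarrow> hd (binary n)"
proof (induction n rule: less_induct)
  case (less n)
  have b: "binary n = binary (n div 2) @ [odd n]" using less.prems by (subst binary.simps) simp
  show ?case
  proof (cases "n div 2 = 0")
    case True
    then have "n = 1" using less.prems by simp
    then show ?thesis unfolding b by simp
  next
    case False
    then show ?thesis using less.IH[of "n div 2"] less.prems unfolding b by (simp add: hd_append)
  qed
qed

lemma rev_binary_odd: "rev (binary (Suc (2 * m))) = True # rev (binary m)"
  by (subst rev_binary) auto

lemma rev_binary_even: "m > 0 \<Longrightarrow> rev (binary (2 * m)) = False # rev (binary m)"
  by (subst rev_binary) auto

lemma succ_bits_binary: "succ_bits (rev (binary n)) = rev (binary (Suc n))"
proof (induction n rule: less_induct)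
  case (less n)
  consider "n = 0" | m where "n = Suc (2 * m)" | m where "n = 2 * m" "m > 0"
    by (metis bot_nat_0.not_eq_extremum mult_0_right oddE evenE Suc_eq_plus1)
  then show ?case
  proof cases
    case 1
    then show ?thesis using rev_binary_odd[of 0] by simp
  next
    case (2 m)
    then have "succ_bits (rev (binary m)) = rev (binary (Suc m))" using less.IH by simp
    moreover have "Suc n = 2 * Suc m" using 2 by simp
    ultimately show ?thesis
      using rev_binary_even[of "Suc m"] unfolding 2 rev_binary_odd by simp
  next
    case (3 m)
    then show ?thesis by (simp add: rev_binary_even rev_binary_odd)
  qed
qed

lemma pred_bits_eq_Nil [simp]: "pred_bits bs = [] \<longleftrightarrow> bs = []"
  by (cases bs rule: pred_bits.cases) auto

lemma drop_zero_True: "drop_zero (True # bs) = True # drop_zero bs"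
  by (simp add: drop_zero_def)

lemma drop_zero_False_Cons: "bs \<noteq> [] \<Longrightarrow> last bs \<Longrightarrow> drop_zero (False # bs) = False # bs"
  by (simp add: drop_zero_def)

text \<open>A borrow turns the low bit into \<open>True\<close>, and prepending \<open>True\<close>
  commutes with \<open>drop_zero\<close>. Without a borrow the leading bit changes only for
  \<open>n = 1\<close>.\<close>

lemma pred_bits_binary: "n > 0 \<Longrightarrow> drop_zero (pred_bits (rev (binary n))) = rev (binary (n - 1))"
proof (induction n rule: less_induct)
  case (less n)
  consider "n = 1" | m where "n = Suc (2 * m)" "m > 0" | m where "n = 2 * m" "m > 0"
    using less.prems by (metis One_nat_def bot_nat_0.not_eq_extremum mult_0_right oddE evenE Suc_eq_plus1)
  then show ?case
  proof cases
    case 1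
    then show ?thesis using rev_binary_odd[of 0] by (simp add: drop_zero_def)
  next
    case (2 m)
    have "last (rev (binary m))" using hd_binary[of m] 2 by (simp add: last_rev)
    then have "drop_zero (False # rev (binary m)) = False # rev (binary m)"
      using 2 by (intro drop_zero_False_Cons) auto
    then show ?thesis using 2 by (simp add: rev_binary_odd rev_binary_even)
  next
    case (3 m)
    then have "drop_zero (pred_bits (rev (binary m))) = rev (binary (m - 1))" using less.IH by simp
    moreover have "n - 1 = Suc (2 * (m - 1))" using 3 by simp
    ultimately show ?thesis using 3(2) by (simp only: 3(1) rev_binary_even rev_binary_odd)
        (simp add: drop_zero_True)
  qed
qed

text \<open>A non-empty \<open>rF\<close> signals a pending borrow; \<open>carry_step\<close> below
  uses it for the carry in the same way.\<close>

definition borrow_step :: "'c letter \<Rightarrow> 'c prog" where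
  "borrow_step x = Peek rF (\<lambda>f. if f = None then Push rS x
     else if x = LBit False then Push rS (LBit True)
     else Pop rF ;; Push rS (LBit False))"

text \<open>The loop reverses the bits, so afterwards the most significant one is on top of
  \<open>rS\<close>, where a leading zero can be removed.\<close>

definition decrement :: "'c prog" where
  "decrement = Push rF (LMark Tick) ;; Drain rD borrow_step ;;
     Peek rS (\<lambda>x. if x = Some (LBit False) then Pop rS else Skip) ;;
     move rS rD ;; clear rF"

definition carry_step :: "'c letter \<Rightarrow> 'c prog" where
  "carry_step x = Peek rF (\<lambda>f. if f = None then Push rS x
     else if x = LBit True then Push rS (LBit False)
     else Pop rF ;; Push rS (LBit True))"

definition increment :: "'c prog" where
  "increment = Push rF (LMark Tick) ;; Drain rC carry_step ;;
     take_top rF (\<lambda>f. if f = None then Skip else Push rS (LBit True)) ;;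
     move rS rC"

lemma iter_borrow_done:
  "\<sigma> rD = xs \<Longrightarrow> \<sigma> rF = [] \<Longrightarrow>
   iter (\<lambda>x. den (borrow_step x)) rD xs (\<sigma>, w) = {(\<sigma>(rD := [], rS := rev xs @ \<sigma> rS), w)}"
proof (induction xs arbitrary: \<sigma>)
  case Nil
  then show ?case by (simp add: fun_upd_idem)
next
  case (Cons x xs)
  let ?\<sigma> = "\<sigma>(rD := xs, rS := x # \<sigma> rS)"
  have "iter (\<lambda>x. den (borrow_step x)) rD (x # xs) (\<sigma>, w) = iter (\<lambda>x. den (borrow_step x)) rD xs (?\<sigma>, w)"
    using Cons.prems by (intro iter_step) (simp add: borrow_step_def)
  also have "\<dots> = {(?\<sigma>(rD := [], rS := rev xs @ ?\<sigma> rS), w)}"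
    using Cons.prems by (intro Cons.IH) auto
  also have "?\<sigma>(rD := [], rS := rev xs @ ?\<sigma> rS) = \<sigma>(rD := [], rS := rev (x # xs) @ \<sigma> rS)"
    by (intro ext) simp
  finally show ?case .
qed

lemma iter_borrow:
  "\<sigma> rD = map LBit bs \<Longrightarrow> \<sigma> rF = [f] \<Longrightarrow>
   iter (\<lambda>x. den (borrow_step x)) rD (map LBit bs) (\<sigma>, w) =
     {(\<sigma>(rD := [], rS := rev (map LBit (pred_bits bs)) @ \<sigma> rS, rF := if True \<in> set bs then [] else [f]), w)}"
proof (induction bs arbitrary: \<sigma>)
  case Nil
  then show ?case by (simp add: fun_upd_idem)
next
  case (Cons b bs)
  show ?case
  proof (cases b)
    case True
    let ?\<sigma> = "\<sigma>(rD := map LBit bs, rS := LBit False # \<sigma> rS, rF := [])"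
    have "iter (\<lambda>x. den (borrow_step x)) rD (map LBit (b # bs)) (\<sigma>, w) =
        iter (\<lambda>x. den (borrow_step x)) rD (map LBit bs) (?\<sigma>, w)"
      using Cons.prems True
      by (simp del: iter.simps, intro iter_step) (simp add: borrow_step_def fun_upd_twist)
    also have "\<dots> = {(?\<sigma>(rD := [], rS := rev (map LBit bs) @ ?\<sigma> rS), w)}"
      by (intro iter_borrow_done) auto
    also have "?\<sigma>(rD := [], rS := rev (map LBit bs) @ ?\<sigma> rS) =
        \<sigma>(rD := [], rS := rev (map LBit (pred_bits (b # bs))) @ \<sigma> rS,
          rF := if True \<in> set (b # bs) then [] else [f])"
      by (intro ext) (simp add: True)
    finally show ?thesis .
  next
    case False
    let ?\<sigma> = "\<sigma>(rD := map LBit bs, rS := LBit True # \<sigma> rS)"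
    have "iter (\<lambda>x. den (borrow_step x)) rD (map LBit (b # bs)) (\<sigma>, w) =
        iter (\<lambda>x. den (borrow_step x)) rD (map LBit bs) (?\<sigma>, w)"
      using Cons.prems False
      by (simp del: iter.simps, intro iter_step) (simp add: borrow_step_def)
    also have "\<dots> = {(?\<sigma>(rD := [], rS := rev (map LBit (pred_bits bs)) @ ?\<sigma> rS,
        rF := if True \<in> set bs then [] else [f]), w)}"
      using Cons.prems by (intro Cons.IH) auto
    also have "?\<sigma>(rD := [], rS := rev (map LBit (pred_bits bs)) @ ?\<sigma> rS,
        rF := if True \<in> set bs then [] else [f]) =
        \<sigma>(rD := [], rS := rev (map LBit (pred_bits (b # bs))) @ \<sigma> rS,
          rF := if True \<in> set (b # bs) then [] else [f])"
      by (intro ext) (simp add: False)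
    finally show ?thesis .
  qed
qed

lemma den_decrement:
  assumes "\<sigma> rD = rev (lbits n)" "n > 0" "\<sigma> rS = []" "\<sigma> rF = []"
  shows "den decrement (\<sigma>, w) = {(\<sigma>(rD := rev (lbits (n - 1))), w)}"
proof -
  let ?bs = "rev (binary n)"
  let ?\<sigma> = "\<sigma>(rF := [LMark Tick])"
  let ?f = "if True \<in> set ?bs then [] else [LMark Tick]"
  let ?\<sigma>1 = "?\<sigma>(rD := [], rS := rev (map LBit (pred_bits ?bs)) @ ?\<sigma> rS, rF := ?f)"
  let ?\<sigma>2 = "?\<sigma>1(rS := rev (map LBit (drop_zero (pred_bits ?bs))))"
  have D: "\<sigma> rD = map LBit ?bs" using assms(1) by (simp add: lbits_def rev_map)
  have 1: "den (Drain rD borrow_step) (?\<sigma>, w) = {(?\<sigma>1, w)}"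
    using D iter_borrow[of ?\<sigma> ?bs] by simp
  have 2: "den (Peek rS (\<lambda>x. if x = Some (LBit False) then Pop rS else Skip)) (?\<sigma>1, w) = {(?\<sigma>2, w)}"
  proof (cases "pred_bits ?bs" rule: rev_cases)
    case (snoc ys y)
    then show ?thesis using assms(3) by (auto simp: drop_zero_def intro!: ext)
  qed (use assms(2) in simp)
  have "den decrement (\<sigma>, w) =
      (\<Union>st \<in> den (Drain rD borrow_step) (?\<sigma>, w).
        den (Peek rS (\<lambda>x. if x = Some (LBit False) then Pop rS else Skip) ;; move rS rD ;; clear rF) st)"
    by (simp add: decrement_def assms(4) del: den.simps(9))
  also have "\<dots> = (\<Union>st \<in> {(?\<sigma>2, w)}. den (move rS rD ;; clear rF) st)"
    unfolding 1 using 2 by (simp del: den.simps(8))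
  also have "\<dots> = {(\<sigma>(rD := rev (lbits (n - 1))), w)}"
    using assms pred_bits_binary[of n] by (auto simp: lbits_def rev_map intro!: ext)
  finally show ?thesis .
qed

lemma iter_carry_done:
  "\<sigma> rC = xs \<Longrightarrow> \<sigma> rF = [] \<Longrightarrow>
   iter (\<lambda>x. den (carry_step x)) rC xs (\<sigma>, w) = {(\<sigma>(rC := [], rS := rev xs @ \<sigma> rS), w)}"
proof (induction xs arbitrary: \<sigma>)
  case Nil
  then show ?case by (simp add: fun_upd_idem)
next
  case (Cons x xs)
  let ?\<sigma> = "\<sigma>(rC := xs, rS := x # \<sigma> rS)"
  have "iter (\<lambda>x. den (carry_step x)) rC (x # xs) (\<sigma>, w) = iter (\<lambda>x. den (carry_step x)) rC xs (?\<sigma>, w)"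
    using Cons.prems by (intro iter_step) (simp add: carry_step_def)
  also have "\<dots> = {(?\<sigma>(rC := [], rS := rev xs @ ?\<sigma> rS), w)}"
    using Cons.prems by (intro Cons.IH) auto
  also have "?\<sigma>(rC := [], rS := rev xs @ ?\<sigma> rS) = \<sigma>(rC := [], rS := rev (x # xs) @ \<sigma> rS)"
    by (intro ext) simp
  finally show ?case .
qed

lemma iter_carry:
  "\<sigma> rC = map LBit bs \<Longrightarrow> \<sigma> rF = [f] \<Longrightarrow>
   (\<Union>st \<in> iter (\<lambda>x. den (carry_step x)) rC (map LBit bs) (\<sigma>, w).
      den (take_top rF (\<lambda>f. if f = None then Skip else Push rS (LBit True))) st) =
     {(\<sigma>(rC := [], rS := rev (map LBit (succ_bits bs)) @ \<sigma> rS, rF := []), w)}"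
proof (induction bs arbitrary: \<sigma>)
  case Nil
  then show ?case by (auto intro!: ext)
next
  case (Cons b bs)
  show ?case
  proof (cases b)
    case True
    let ?\<sigma> = "\<sigma>(rC := map LBit bs, rS := LBit False # \<sigma> rS)"
    have "iter (\<lambda>x. den (carry_step x)) rC (map LBit (b # bs)) (\<sigma>, w) =
        iter (\<lambda>x. den (carry_step x)) rC (map LBit bs) (?\<sigma>, w)"
      using Cons.prems True
      by (simp del: iter.simps, intro iter_step) (simp add: carry_step_def)
    then have "(\<Union>st \<in> iter (\<lambda>x. den (carry_step x)) rC (map LBit (b # bs)) (\<sigma>, w).
      den (take_top rF (\<lambda>f. if f = None then Skip else Push rS (LBit True))) st) =
      (\<Union>st \<in> iter (\<lambda>x. den (carry_step x)) rC (map LBit bs) (?\<sigma>, w).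
      den (take_top rF (\<lambda>f. if f = None then Skip else Push rS (LBit True))) st)"
      by (rule arg_cong)
    also have "\<dots> = {(?\<sigma>(rC := [], rS := rev (map LBit (succ_bits bs)) @ ?\<sigma> rS, rF := []), w)}"
      using Cons.prems by (intro Cons.IH) auto
    also have "?\<sigma>(rC := [], rS := rev (map LBit (succ_bits bs)) @ ?\<sigma> rS, rF := []) =
        \<sigma>(rC := [], rS := rev (map LBit (succ_bits (b # bs))) @ \<sigma> rS, rF := [])"
      by (intro ext) (simp add: True)
    finally show ?thesis .
  next
    case False
    let ?\<sigma> = "\<sigma>(rC := map LBit bs, rS := LBit True # \<sigma> rS, rF := [])"
    have "iter (\<lambda>x. den (carry_step x)) rC (map LBit (b # bs)) (\<sigma>, w) =
        iter (\<lambda>x. den (carry_step x)) rC (map LBit bs) (?\<sigma>, w)"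
      using Cons.prems False
      by (simp del: iter.simps, intro iter_step) (simp add: carry_step_def fun_upd_twist)
    also have "\<dots> = {(?\<sigma>(rC := [], rS := rev (map LBit bs) @ ?\<sigma> rS), w)}"
      by (intro iter_carry_done) auto
    finally show ?thesis
      by (simp only:) (auto simp: False intro!: ext)
  qed
qed

lemma den_increment:
  assumes "\<sigma> rC = rev (lbits n)" "\<sigma> rS = []" "\<sigma> rF = []"
  shows "den increment (\<sigma>, w) = {(\<sigma>(rC := rev (lbits (Suc n))), w)}"
proof -
  let ?bs = "rev (binary n)"
  let ?\<sigma> = "\<sigma>(rF := [LMark Tick])"
  let ?\<sigma>1 = "?\<sigma>(rC := [], rS := rev (map LBit (succ_bits ?bs)) @ ?\<sigma> rS, rF := [])"
  have C: "\<sigma> rC = map LBit ?bs" using assms(1) by (simp add: lbits_def rev_map)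
  have "den increment (\<sigma>, w) =
      (\<Union>st \<in> (\<Union>st \<in> iter (\<lambda>x. den (carry_step x)) rC (map LBit ?bs) (?\<sigma>, w).
        den (take_top rF (\<lambda>f. if f = None then Skip else Push rS (LBit True))) st). den (move rS rC) st)"
    using C by (simp add: increment_def assms(3) del: den_take_top den_move)
  also have "(\<Union>st \<in> iter (\<lambda>x. den (carry_step x)) rC (map LBit ?bs) (?\<sigma>, w).
        den (take_top rF (\<lambda>f. if f = None then Skip else Push rS (LBit True))) st) = {(?\<sigma>1, w)}"
    using C by (intro iter_carry) auto
  finally show ?thesis
    using assms succ_bits_binary[of n] by (auto simp: lbits_def rev_map intro!: ext)
qed

lemma iter_increment:
  "\<sigma> r = xs \<Longrightarrow> \<sigma> rC = rev (lbits n) \<Longrightarrow> \<sigma> rS = [] \<Longrightarrow> \<sigma> rF = [] \<Longrightarrow> r \<notin> {rC, rS, rF} \<Longrightarrow>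
   iter (\<lambda>x. den increment) r xs (\<sigma>, w) = {(\<sigma>(r := [], rC := rev (lbits (n + length xs))), w)}"
proof (induction xs arbitrary: \<sigma> n)
  case Nil
  then show ?case by (auto intro!: ext)
next
  case (Cons x xs)
  let ?\<sigma> = "\<sigma>(r := xs, rC := rev (lbits (Suc n)))"
  have "iter (\<lambda>x. den increment) r (x # xs) (\<sigma>, w) = iter (\<lambda>x. den increment) r xs (?\<sigma>, w)"
    using Cons.prems by (intro iter_step) (subst den_increment, auto)
  also have "\<dots> = {(?\<sigma>(r := [], rC := rev (lbits (Suc n + length xs))), w)}"
    using Cons.prems by (intro Cons.IH) auto
  also have "?\<sigma>(r := [], rC := rev (lbits (Suc n + length xs))) =
      \<sigma>(r := [], rC := rev (lbits (n + length (x # xs))))"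
    by (intro ext) simp
  finally show ?case .
qed


section \<open>One step of the matching program\<close>

subsection \<open>The abstract machine\<close>

text \<open>
  The abstract machine reads one letter per step: \<^const>\<open>Lo\<close> and \<^const>\<open>Hi\<close> select the branch
  with higher and lower priority at a choice, and the letters of the answer must be read in the end.
  A step without choice reads \<^const>\<open>Lo\<close>, and so does every step after the answer.
\<close>

type_synonym groups = "(nat \<times> group_state) list"

definition lookup :: "groups \<Rightarrow> nat \<Rightarrow> group_state" where
  "lookup G g = (case map_of G g of None \<Rightarrow> Undefined | Some v \<Rightarrow> v)"

definition without :: "nat \<Rightarrow> groups \<Rightarrow> groups" where
  "without g G = filter (\<lambda>e. fst e \<noteq> g) G"

text \<open>The test \<open>b = greedy\<close> selects skipping, which is the branch of lower
  priority precisely for greedy quantifiers. A backreference moves the entry of its group to the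
  front, as the program does by taking the entry out and putting it back; this does not change
  \<open>lookup\<close>.\<close>

fun lstep :: "'c set \<Rightarrow> 'c list \<Rightarrow> 'c action list \<times> nat \<times> groups \<Rightarrow> bool \<Rightarrow>
  ('c action list \<times> nat \<times> groups) option" where
  "lstep W s ([], p, G) b = None"
| "lstep W s (Acheck k # l, p, G) b = (if b \<or> p \<le> k then None else Some (l, p, G))"
| "lstep W s (Aclose g # l, p, G) b =
     (if b then None else case lookup G g of
        Opened a \<Rightarrow> Some (l, p, (g, Closed a p) # without g G)
      | _ \<Rightarrow> None)"
| "lstep W s (Regex Eps # l, p, G) b = (if b then None else Some (l, p, G))"
| "lstep W s (Regex (Chars cd) # l, p, G) b =
     (if \<not> b \<and> p < length s \<and> s ! p \<in> cd then Some (l, p + 1, G) else None)"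
| "lstep W s (Regex (Alt r1 r2) # l, p, G) b = Some (Regex (if b then r2 else r1) # l, p, G)"
| "lstep W s (Regex (Seq r1 r2) # l, p, G) b =
     (if b then None else Some (Regex r1 # Regex r2 # l, p, G))"
| "lstep W s (Regex (Quant r m d greedy) # l, p, G) b =
     (if d = 0 then if b then None else Some (l, p, G)
      else if b = greedy then Some (l, p, G)
      else Some (Regex r # Acheck p # Regex (Quant r 0 (d - 1) greedy) # l, p,
        filter (\<lambda>e. fst e \<notin> set (groups r)) G))"
| "lstep W s (Regex (Group g r) # l, p, G) b =
     (if b then None else Some (Regex r # Aclose g # l, p, (g, Opened p) # without g G))"
| "lstep W s (Regex (Anchor a) # l, p, G) b =
     (if \<not> b \<and> anchor_holds W s a p then Some (l, p, G) else None)"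
| "lstep W s (Regex (Backref g) # l, p, G) b =
     (if b then None else case lookup G g of
        Closed i j \<Rightarrow>
          (let w = take (j - i) (drop i s)
           in if take (length w) (drop p s) = w
              then Some (l, p + length w, (g, Closed i j) # without g G) else None)
      | Opened i \<Rightarrow> Some (l, p, (g, Opened i) # without g G)
      | Undefined \<Rightarrow> Some (l, p, G))"

datatype 'c phase = Start nat | Matching nat "'c action list" nat groups | Finish "out list"

definition num_out :: "nat \<Rightarrow> out list" where
  "num_out n = OTok Num # map OBit (binary n)"

fun entry_out :: "nat \<times> group_state \<Rightarrow> out list" where
  "entry_out (g, Undefined) = []"
| "entry_out (g, Opened a) = OTok IsOpened # num_out g @ num_out a"
| "entry_out (g, Closed a b) = OTok IsClosed # num_out g @ num_out a @ num_out b"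

definition answer_out :: "nat \<Rightarrow> nat \<Rightarrow> groups \<Rightarrow> out list" where
  "answer_out k p G = OTok Match # num_out k @ num_out p @ concat (map entry_out G)"

text \<open>Matching at the current start has priority over moving on, so the least path uses the
  first start that has a match, and \<open>Hi\<close> at the end of the input, which claims that
  there is none, comes last. The answer is not produced but demanded letter by letter, since it is
  part of the guessed word.\<close>

fun astep :: "'c set \<Rightarrow> 'c list \<Rightarrow> 'c regex \<Rightarrow> 'c phase \<Rightarrow> out \<Rightarrow> 'c phase option" where
  "astep W s r (Start k) y =
     (if y = Lo then Some (Matching k [Regex r] k [])
      else if y = Hi then Some (if k < length s then Start (k + 1) else Finish [OTok NoMatch])
      else None)"
| "astep W s r (Matching k l p G) y =
     (if l = [] then if y = Lo then Some (Finish (answer_out k p G)) else None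
      else if y = Lo \<or> y = Hi then
        map_option (\<lambda>(l, p, G). Matching k l p G) (lstep W s (l, p, G) (y = Hi))
      else None)"
| "astep W s r (Finish []) y = (if y = Lo then Some (Finish []) else None)"
| "astep W s r (Finish (e # es)) y = (if y = e then Some (Finish es) else None)"

text \<open>Entries for undefined groups are ruled out, so that the keys of the list are exactly the
  groups that an answer has to mention.\<close>

fun positions_le :: "nat \<Rightarrow> group_state \<Rightarrow> bool" where
  "positions_le n Undefined \<longleftrightarrow> False"
| "positions_le n (Opened a) \<longleftrightarrow> a \<le> n"
| "positions_le n (Closed a b) \<longleftrightarrow> a \<le> n \<and> b \<le> n"

definition groups_ok :: "nat \<Rightarrow> groups \<Rightarrow> bool" where
  "groups_ok n G \<longleftrightarrow> distinct (map fst G) \<and> (\<forall>e \<in> set G. positions_le n (snd e))"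

fun bound_free :: "'c action \<Rightarrow> bool" where
  "bound_free (Regex r) \<longleftrightarrow> no_lower_bounds r"
| "bound_free _ \<longleftrightarrow> True"

fun phase_ok :: "nat \<Rightarrow> 'c phase \<Rightarrow> bool" where
  "phase_ok n (Start k) \<longleftrightarrow> k \<le> n"
| "phase_ok n (Matching k l p G) \<longleftrightarrow>
     k \<le> n \<and> p \<le> n \<and> groups_ok n G \<and> (\<forall>a \<in> set l. bound_free a)"
| "phase_ok n (Finish es) \<longleftrightarrow> True"

lemma filter_groups:
  "distinct (map fst G) \<Longrightarrow> filter (\<lambda>e. fst e = g) G = (case map_of G g of None \<Rightarrow> [] | Some v \<Rightarrow> [(g, v)])"
proof (induction G)
  case (Cons e G)
  then show ?case
    by (cases e) (force simp: filter_empty_conv split: option.splits dest: map_of_SomeD)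
qed simp

lemma groups_ok_filter: "groups_ok n G \<Longrightarrow> groups_ok n (filter P G)"
  by (auto simp: groups_ok_def intro: distinct_map_filter)

lemma groups_ok_Cons:
  "groups_ok n G \<Longrightarrow> positions_le n v \<Longrightarrow> groups_ok n ((g, v) # without g G)"
  using groups_ok_filter[of n G "\<lambda>e. fst e \<noteq> g"]
  by (auto simp: groups_ok_def without_def)

lemma groups_ok_lookup: "groups_ok n G \<Longrightarrow> lookup G g = Undefined \<or> positions_le n (lookup G g)"
  by (auto simp: lookup_def groups_ok_def split: option.splits dest: map_of_SomeD)

lemma groups_ok_without: "groups_ok n G \<Longrightarrow> lookup G g = Undefined \<Longrightarrow> without g G = G"
  by (auto simp: lookup_def groups_ok_def without_def filter_id_conv split: option.splits
      dest: map_of_SomeD simp: map_of_eq_None_iff)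

lemma lstep_ok:
  assumes "lstep W s (l, p, G) b = Some (l', p', G')" "p \<le> length s" "groups_ok (length s) G"
    "\<forall>a \<in> set l. bound_free a"
  shows "p' \<le> length s \<and> groups_ok (length s) G' \<and> (\<forall>a \<in> set l'. bound_free a)"
proof -
  \<comment> \<open>The captured word has \<open>j - i\<close> letters, so agreeing with it forces
    the input to have as many letters after \<open>p\<close>.\<close>
  have w: "p + (j - i) \<le> length s"
    if "take (j - i) (drop p s) = take (j - i) (drop i s)" "i \<le> length s" "j \<le> length s" for i j
  proof -
    have "length (take (j - i) (drop p s)) = length (take (j - i) (drop i s))"
      using that(1) by (rule arg_cong)
    then show ?thesis using that(2,3) assms(2) by (simp only: length_take length_drop)
  qed
  show ?thesis
  proof (cases "(W, s, (l, p, G), b)" rule: lstep.cases)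
    case (3 W' s' g l1 p' G' b')
    then show ?thesis
      using assms groups_ok_lookup[OF assms(3), of g]
      by (auto intro!: groups_ok_Cons split: if_splits group_state.splits)
  next
    case (8 W' s' r m d greedy l1 p' G' b')
    then show ?thesis
      using assms by (auto simp: groups_ok_filter split: if_splits)
  next
    case (11 W' s' g l1 p' G' b')
    then show ?thesis
      using assms groups_ok_lookup[OF assms(3), of g] w
      by (auto simp: Let_def intro!: groups_ok_Cons split: if_splits group_state.splits)
  qed (use assms in \<open>auto intro!: groups_ok_Cons split: if_splits\<close>)
qed

lemma astep_ok: "astep W s r ph y = Some ph' \<Longrightarrow> phase_ok (length s) ph \<Longrightarrow> no_lower_bounds r \<Longrightarrow>
  phase_ok (length s) ph'"
proof (cases ph)
  case (Matching k l p G)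
  assume "astep W s r ph y = Some ph'" "phase_ok (length s) ph" "no_lower_bounds r"
  then show ?thesis
    using lstep_ok[of W s l p G "y = Hi"] Matching
    by (fastforce split: if_splits)
next
  case (Finish es)
  assume "astep W s r ph y = Some ph'" "phase_ok (length s) ph"
  then show ?thesis using Finish by (cases es) (auto split: if_splits)
qed (auto split: if_splits simp: groups_ok_def)


subsection \<open>The programs\<close>

definition anchor_test :: "'c set \<Rightarrow> anchor \<Rightarrow> 'c letter option \<Rightarrow> 'c letter option \<Rightarrow> bool" where
  "anchor_test W a l r =
     (let word = (\<lambda>x. \<exists>c \<in> W. x = Some (LTok (TChar c)))
      in case a of
        Input_Start \<Rightarrow> l = None
      | Input_End \<Rightarrow> r = None
      | Word_Boundary \<Rightarrow> word l \<noteq> word r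
      | Non_Word_Boundary \<Rightarrow> word l = word r)"

text \<open>Positions are unary: \<open>p > k\<close> holds if something is left of the prefix of
  length \<open>p\<close> after \<open>k\<close> letters have been removed from a copy of
  it.\<close>

definition do_check :: "'c prog" where
  "do_check =
     split_off is_char rA rT rX ;; copy rL rU rX ;; Drain rT (\<lambda>_. Pop rU) ;;
     Peek rU (\<lambda>x. if x = None then Fail else Skip) ;; clear rU"

definition do_close :: "'c prog" where
  "do_close =
     split_off is_bit rA rQ rX ;; take_out ;;
     take_top rV (\<lambda>x. if x = Some (LMark Open_Entry)
       then copy rL rG rX ;; Push rG (LMark Sep_Mark) ;; move rV rU ;; move rU rG ;; move rQ rG ;;
         Push rG (LMark Closed_Entry)
       else Fail)"

definition do_chars :: "'c set \<Rightarrow> 'c prog" where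
  "do_chars cd = take_top rR (\<lambda>x. case x of
     Some (LTok (TChar c)) \<Rightarrow> if c \<in> cd then Push rL (LTok (TChar c)) else Fail
   | _ \<Rightarrow> Fail)"

definition do_alt :: "bool \<Rightarrow> 'c prog" where
  "do_alt b =
     (if b then take_regex ;; clear rT
      else take_regex ;; move rT rU ;; take_regex ;; clear rT ;; move rU rT ;; move rT rA)"

text \<open>The identifier is needed twice, for the new entry and for the action that closes the
  group behind the body. It is reversed in \<open>rQ\<close>, and \<open>dup\<close> reverses it
  back.\<close>

definition do_group :: "'c prog" where
  "do_group =
     split_off is_bit rA rQ rX ;; take_regex ;; dup rQ rA rX ;; Push rA (LMark Close_Mark) ;;
     move rT rA ;; take_out ;; clear rV ;; copy rL rG rX ;; move rQ rG ;;
     Push rG (LMark Open_Entry)"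

definition match_char :: "'c letter \<Rightarrow> 'c prog" where
  "match_char c = take_top rR (\<lambda>x. if x = Some c then Push rL c else Fail)"

text \<open>For a closed group \<open>rV\<close> holds the prefix up to the start of the range, a
  separator, and the prefix up to its end. Moving the second prefix to \<open>rU\<close> puts it
  into reading order; dropping as many letters as the first prefix has leaves the captured
  word.\<close>

definition do_backref :: "'c prog" where
  "do_backref =
     split_off is_bit rA rQ rX ;; take_out ;;
     take_top rV (\<lambda>x. case x of
       None \<Rightarrow> clear rQ
     | Some k \<Rightarrow> copy rV rG rX ;; move rQ rG ;; Push rG k ;;
         (if k = LMark Closed_Entry
          then split_off is_char rV rT rX ;; Pop rV ;; move rV rU ;; Drain rT (\<lambda>_. Pop rU) ;;
            Drain rU match_char
          else clear rV))"

text \<open>The regex is read backwards, so its bits arrive before the token that they belong to.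
  They wait in \<open>rP\<close> until that token shows whether they identify a group.\<close>

definition reset_step :: "'c letter \<Rightarrow> 'c prog" where
  "reset_step x = Push rA x ;; Push rU x ;;
     (if is_bit x then Push rP x
      else if x = LTok TGroup then move rP rQ ;; take_out ;; clear rV ;; clear rQ
      else clear rP)"

text \<open>The pass over \<open>rT\<close> resets the groups and makes two copies of the body: the
  one in \<open>rA\<close> stays below as the body of the remaining quantifier, the one in
  \<open>rU\<close> goes on top to be executed.\<close>

definition do_iterate :: "bool \<Rightarrow> 'c token \<Rightarrow> 'c prog" where
  "do_iterate greedy t =
     take_regex ;; Drain rT reset_step ;; move rD rA ;; Push rA (LTok t) ;;
     Push rA (LTok (TQuant greedy)) ;; copy rL rA rX ;; Push rA (LMark Check_Mark) ;;
     move rU rT ;; move rT rA"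

text \<open>The lower bound 0 is written with no bits at all, so the token for the upper bound comes
  first.\<close>

definition do_quant :: "bool \<Rightarrow> bool \<Rightarrow> 'c prog" where
  "do_quant greedy b = take_top rA (\<lambda>x.
     if x = Some (LTok TFinite) then
       split_off is_bit rA rD rX ;;
       Peek rD (\<lambda>d. if d = None then if b then Fail else take_regex ;; clear rT
         else if b = greedy then take_regex ;; clear rT ;; clear rD
         else decrement ;; do_iterate greedy TFinite)
     else if x = Some (LTok TInfinite) then
       if b = greedy then take_regex ;; clear rT else do_iterate greedy TInfinite
     else Fail)"

definition do_anchor :: "'c set \<Rightarrow> anchor \<Rightarrow> 'c prog" where
  "do_anchor W a = Peek rL (\<lambda>l. Peek rR (\<lambda>r. if anchor_test W a l r then Skip else Fail))"

definition put_bit :: "'c letter \<Rightarrow> 'c prog" where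
  "put_bit x = (case x of LBit b \<Rightarrow> Push rT (LOut (OBit b)) | _ \<Rightarrow> Skip)"

definition put_counter :: "'c prog" where
  "put_counter = Push rT (LOut (OTok Num)) ;; move rC rS ;; Drain rS put_bit"

text \<open>The last position of an entry has been counted completely only when the next entry
  begins. \<open>rFl\<close> tells whether there is such a position to print.\<close>

definition start_entry :: "answer_token \<Rightarrow> 'c prog" where
  "start_entry t =
     Peek rFl (\<lambda>x. if x = None then Push rFl (LMark Tick) else put_counter) ;;
     Push rT (LOut (OTok t)) ;; Push rT (LOut (OTok Num))"

definition put_entry :: "'c letter \<Rightarrow> 'c prog" where
  "put_entry x = (case x of
     LMark Open_Entry \<Rightarrow> start_entry IsOpened
   | LMark Closed_Entry \<Rightarrow> start_entry IsClosed
   | LMark Sep_Mark \<Rightarrow> put_counter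
   | LBit b \<Rightarrow> put_bit x
   | _ \<Rightarrow> increment)"

text \<open>Positions are stored in unary but belong into the answer in binary, hence the counting.
  The result goes to \<open>rE\<close>, and the guessed letters are compared with it in the steps
  that follow.\<close>

definition do_answer :: "'c prog" where
  "do_answer =
     Push rT (LOut (OTok Match)) ;;
     Drain rK (\<lambda>_. increment) ;; put_counter ;;
     Drain rL (\<lambda>_. increment) ;; put_counter ;;
     Drain rG put_entry ;; take_top rFl (\<lambda>x. if x = None then Skip else put_counter) ;;
     clear rR ;; move rT rE ;; Pop rPh ;; Push rPh (LMark Finishing)"

definition do_action :: "'c set \<Rightarrow> 'c letter \<Rightarrow> bool \<Rightarrow> 'c prog" where
  "do_action W x b = (case x of
     LTok t \<Rightarrow> (case t of
       TAlt \<Rightarrow> do_alt b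
     | TQuant greedy \<Rightarrow> do_quant greedy b
     | _ \<Rightarrow> if b then Fail else (case t of
         TEps \<Rightarrow> Skip
       | TChars cd \<Rightarrow> do_chars cd
       | TSeq \<Rightarrow> Skip
       | TGroup \<Rightarrow> do_group
       | TBackref \<Rightarrow> do_backref
       | TAnchor a \<Rightarrow> do_anchor W a
       | _ \<Rightarrow> Fail))
   | LMark Check_Mark \<Rightarrow> if b then Fail else do_check
   | LMark Close_Mark \<Rightarrow> if b then Fail else do_close
   | _ \<Rightarrow> Fail)"

definition do_start :: "out \<Rightarrow> 'c prog" where
  "do_start y =
     (if y = Lo then copy rL rK rX ;; Pop rPh ;; Push rPh (LMark Running)
      else if y = Hi then take_top rR (\<lambda>x. case x of
          Some c \<Rightarrow> Push rL c
        | None \<Rightarrow> clear rA ;; clear rL ;; Push rE (LOut (OTok NoMatch)) ;;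
            Pop rPh ;; Push rPh (LMark Finishing))
      else Fail)"

definition do_run :: "'c set \<Rightarrow> out \<Rightarrow> 'c prog" where
  "do_run W y = take_top rA (\<lambda>x. case x of
     None \<Rightarrow> if y = Lo then do_answer else Fail
   | Some x \<Rightarrow> if y = Lo \<or> y = Hi then do_action W x (y = Hi) else Fail)"

definition do_finish :: "out \<Rightarrow> 'c prog" where
  "do_finish y = take_top rE (\<lambda>x. case x of
     None \<Rightarrow> if y = Lo then Skip else Fail
   | Some e \<Rightarrow> if e = LOut y then Skip else Fail)"

definition body :: "'c set \<Rightarrow> 'c letter \<Rightarrow> 'c prog" where
  "body W x = (case x of
     LOut y \<Rightarrow> Peek rPh (\<lambda>ph.
       if ph = Some (LMark Starting) then do_start y
       else if ph = Some (LMark Running) then do_run W y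
       else if ph = Some (LMark Finishing) then do_finish y
       else Fail)
   | _ \<Rightarrow> Fail)"


subsection \<open>Correctness of the programs\<close>

definition regs :: "'c letter list \<Rightarrow> 'c letter list \<Rightarrow> 'c letter list \<Rightarrow> 'c letter list \<Rightarrow>
  'c letter list \<Rightarrow> 'c letter list \<Rightarrow> mark \<Rightarrow> 'c letter list \<Rightarrow> reg \<Rightarrow> 'c letter list" where
  "regs a l r k g e ph y = (\<lambda>_. [])(rA := a, rL := l, rR := r, rK := k, rG := g, rE := e,
     rPh := [LMark ph], rY := y)"

lemma regs_apply [simp]:
  "regs a l r k g e ph y rA = a" "regs a l r k g e ph y rL = l" "regs a l r k g e ph y rR = r"
  "regs a l r k g e ph y rK = k" "regs a l r k g e ph y rG = g" "regs a l r k g e ph y rE = e"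
  "regs a l r k g e ph y rPh = [LMark ph]" "regs a l r k g e ph y rY = y"
  "regs a l r k g e ph y rInp = []" "regs a l r k g e ph y rT = []" "regs a l r k g e ph y rU = []"
  "regs a l r k g e ph y rX = []" "regs a l r k g e ph y rN = []" "regs a l r k g e ph y rQ = []"
  "regs a l r k g e ph y rV = []" "regs a l r k g e ph y rW = []" "regs a l r k g e ph y rD = []"
  "regs a l r k g e ph y rS = []" "regs a l r k g e ph y rS2 = []" "regs a l r k g e ph y rQ2 = []"
  "regs a l r k g e ph y rF = []" "regs a l r k g e ph y rH = []" "regs a l r k g e ph y rB = []"
  "regs a l r k g e ph y rB2 = []" "regs a l r k g e ph y rP = []" "regs a l r k g e ph y rC = []"
  "regs a l r k g e ph y rFl = []"
  by (simp_all add: regs_def)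

lemma regs_eqI:
  assumes "\<sigma> rA = a" "\<sigma> rL = l" "\<sigma> rR = r" "\<sigma> rK = k" "\<sigma> rG = g" "\<sigma> rE = e" "\<sigma> rPh = [LMark ph]"
    "\<sigma> rY = y" "\<sigma> rInp = []" "\<sigma> rT = []" "\<sigma> rU = []" "\<sigma> rX = []" "\<sigma> rN = []" "\<sigma> rQ = []" "\<sigma> rV = []"
    "\<sigma> rW = []" "\<sigma> rD = []" "\<sigma> rS = []" "\<sigma> rS2 = []" "\<sigma> rQ2 = []" "\<sigma> rF = []" "\<sigma> rH = []" "\<sigma> rB = []"
    "\<sigma> rB2 = []" "\<sigma> rP = []" "\<sigma> rC = []" "\<sigma> rFl = []"
  shows "\<sigma> = regs a l r k g e ph y"
proof
  fix x show "\<sigma> x = regs a l r k g e ph y x"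
    by (cases x) (simp_all add: assms)
qed

section \<open>Correctness of the programs for single actions\<close>

lemma takeWhile_bits:
  assumes "a = [] \<or> \<not> is_bit (hd a)"
  shows "takeWhile is_bit (lbits g @ a) = lbits g" "dropWhile is_bit (lbits g @ a) = a"
proof -
  have b: "\<forall>x \<in> set (lbits g). is_bit x" by (auto simp: lbits_def is_bit_def)
  have "takeWhile is_bit a = []" "dropWhile is_bit a = a" using assms by (cases a; simp)+
  then show "takeWhile is_bit (lbits g @ a) = lbits g" by (simp add: b)
  show "dropWhile is_bit (lbits g @ a) = a"
    using \<open>dropWhile is_bit a = a\<close> by (simp add: b)
qed

lemma takeWhile_chars:
  assumes "a = [] \<or> \<not> is_char (hd a)"
  shows "takeWhile is_char (prefix s k @ a) = prefix s k" "dropWhile is_char (prefix s k @ a) = a"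
proof -
  have b: "\<forall>x \<in> set (prefix s k). is_char x" by (auto simp: prefix_def is_char_def)
  have "takeWhile is_char a = []" "dropWhile is_char a = a" using assms by (cases a; simp)+
  then show "takeWhile is_char (prefix s k @ a) = prefix s k" by (simp add: b)
  show "dropWhile is_char (prefix s k @ a) = a"
    using \<open>dropWhile is_char a = a\<close> by (simp add: b)
qed

lemma regex_letters_hd [simp]:
  "regex_letters r \<noteq> []" "\<not> is_bit (hd (regex_letters r))" "\<not> is_bit (hd (regex_letters r @ a))" "\<not> is_char (hd (regex_letters r @ a))"
  by (cases r; simp add: is_bit_def is_char_def)+

lemma iter_pop:
  "\<sigma> i = xs \<Longrightarrow> i \<noteq> j \<Longrightarrow> iter (\<lambda>_. den (Pop j)) i xs (\<sigma>, w) = {(\<sigma>(i := [], j := drop (length xs) (\<sigma> j)), w)}"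
proof (induction xs arbitrary: \<sigma>)
  case Nil
  then show ?case by (simp add: fun_upd_idem)
next
  case (Cons x xs)
  let ?\<sigma> = "\<sigma>(i := xs, j := tl (\<sigma> j))"
  have "iter (\<lambda>_. den (Pop j)) i (x # xs) (\<sigma>, w) = iter (\<lambda>_. den (Pop j)) i xs (?\<sigma>, w)"
    using Cons.prems by (intro iter_step) simp
  also have "\<dots> = {(?\<sigma>(i := [], j := drop (length xs) (?\<sigma> j)), w)}"
    using Cons.prems by (intro Cons.IH) auto
  also have "?\<sigma>(i := [], j := drop (length xs) (?\<sigma> j)) = \<sigma>(i := [], j := drop (length (x # xs)) (\<sigma> j))"
    by (intro ext) (simp add: drop_Suc)
  finally show ?case .
qed

lemma den_drain_pop:
  "i \<noteq> j \<Longrightarrow> den (Drain i (\<lambda>_. Pop j)) (\<sigma>, w) = {(\<sigma>(i := [], j := drop (length (\<sigma> i)) (\<sigma> j)), w)}"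
  using iter_pop[of \<sigma> i "\<sigma> i" j w] by (simp del: iter.simps)

lemma length_prefix [simp]: "length (prefix s p) = min p (length s)"
  by (simp add: prefix_def min.commute)

lemma den_do_check:
  assumes "p \<le> length s" "a = [] \<or> \<not> is_char (hd a)"
  shows "den do_check (regs (prefix s k @ a) (prefix s p) r k' g e ph y, w) =
    (if p \<le> k then {} else {(regs a (prefix s p) r k' g e ph y, w)})"
proof (cases "p \<le> k")
  case True
  then show ?thesis
    using assms(1)
    by (simp add: do_check_def takeWhile_chars[OF assms(2)] den_drain_pop del: den.simps(9))
next
  case False
  then have "drop k (prefix s p) \<noteq> []" using assms(1) by simp
  then obtain x where x: "top_of (drop k (prefix s p)) = Some x"
    by (cases "drop k (prefix s p)") auto
  show ?thesis
    using False assms(1)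
    by (simp add: do_check_def takeWhile_chars[OF assms(2)] den_drain_pop x del: den.simps(9))
      (rule regs_eqI; simp)
qed

lemma den_take_out_regs:
  fixes G :: groups
  assumes "\<sigma> rB = []" "\<sigma> rB2 = []" "\<sigma> rS = []" "\<sigma> rX = []" "\<sigma> rS2 = []" "\<sigma> rQ2 = []" "\<sigma> rF = []"
    "\<sigma> rH = []" "\<sigma> rW = []" "\<sigma> rV = []" "\<sigma> rQ = rev (lbits g)"
    "\<sigma> rG = concat (map (entry_letters s) G)" "distinct (map fst G)"
  shows "den take_out (\<sigma>, w) =
    {(\<sigma>(rG := concat (map (entry_letters s) (without g G)),
        rV := (case map_of G g of None \<Rightarrow> [] | Some v \<Rightarrow> state_kind v # state_letters s v)), w)}"
  using den_take_out[OF assms(1-12)] filter_groups[OF assms(13), of g]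
  by (simp add: without_def split: option.splits)

abbreviation group_letters :: "'c list \<Rightarrow> groups \<Rightarrow> 'c letter list" where
  "group_letters s G \<equiv> concat (map (entry_letters s) G)"

lemma den_do_close:
  assumes "groups_ok (length s) G" "a = [] \<or> \<not> is_bit (hd a)"
  shows "den do_close (regs (lbits g @ a) (prefix s p) r k (group_letters s G) e ph y, w) =
    (case lookup G g of
       Opened i \<Rightarrow> {(regs a (prefix s p) r k (group_letters s ((g, Closed i p) # without g G)) e ph y, w)}
     | _ \<Rightarrow> {})"
proof -
  have d: "distinct (map fst G)" using assms(1) by (simp add: groups_ok_def)
  note simps = do_close_def takeWhile_bits[OF assms(2)]
    den_take_out_regs[where g = g and G = G and s = s, OF _ _ _ _ _ _ _ _ _ _ _ _ d]
  show ?thesis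
  proof (cases "lookup G g")
    case Undefined
    then have "map_of G g = None"
      using groups_ok_lookup[OF assms(1), of g] assms(1)
      by (auto simp: lookup_def groups_ok_def split: option.splits dest: map_of_SomeD)
    then show ?thesis by (simp add: simps Undefined)
  next
    case (Opened i)
    then have "map_of G g = Some (Opened i)" by (simp add: lookup_def split: option.splits)
    then show ?thesis by (simp add: simps Opened) (rule regs_eqI; simp)
  next
    case (Closed i j)
    then have "map_of G g = Some (Closed i j)" by (simp add: lookup_def split: option.splits)
    then show ?thesis by (simp add: simps Closed)
  qed
qed

lemma den_do_chars:
  "den (do_chars cd) (regs a (prefix s p) (suffix s p) k g e ph y, w) =
    (if p < length s \<and> s ! p \<in> cd
     then {(regs a (prefix s (p + 1)) (suffix s (p + 1)) k g e ph y, w)} else {})"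
proof (cases "p < length s")
  case True
  then have "suffix s p = LTok (TChar (s ! p)) # suffix s (p + 1)"
    "prefix s (p + 1) = LTok (TChar (s ! p)) # prefix s p"
    by (simp_all add: suffix_def prefix_def Cons_nth_drop_Suc[symmetric] take_Suc_conv_app_nth)
  then show ?thesis using True by (simp add: do_chars_def) (intro impI regs_eqI; simp)
next
  case False
  then show ?thesis by (simp add: do_chars_def suffix_def)
qed

lemma den_do_alt:
  assumes "a = [] \<or> \<not> is_bit (hd a)"
  shows "den (do_alt b) (regs (regex_letters r1 @ regex_letters r2 @ a) l r k g e ph y, w) =
    {(regs (regex_letters (if b then r2 else r1) @ a) l r k g e ph y, w)}"
proof (cases b)
  case True
  then show ?thesis
    using assms
    by (simp add: do_alt_def den_take_regex[where r = r1 and xs = "regex_letters r2 @ a"])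
      (rule regs_eqI; simp)
next
  case False
  then show ?thesis
    using assms
    by (simp add: do_alt_def den_take_regex[where r = r1 and xs = "regex_letters r2 @ a"]
        den_take_regex[where r = r2 and xs = a])
      (rule regs_eqI; simp)
qed

lemma den_do_group:
  assumes "groups_ok (length s) G" "a = [] \<or> \<not> is_bit (hd a)"
  shows "den do_group (regs (lbits g @ regex_letters q @ a) (prefix s p) r k (group_letters s G) e ph y, w) =
    {(regs (regex_letters q @ LMark Close_Mark # lbits g @ a) (prefix s p) r k
       (group_letters s ((g, Opened p) # without g G)) e ph y, w)}"
proof -
  have d: "distinct (map fst G)" using assms(1) by (simp add: groups_ok_def)
  have b: "regex_letters q @ a = [] \<or> \<not> is_bit (hd (regex_letters q @ a))" by simp
  show ?thesis
    using assms(2)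
    by (simp add: do_group_def takeWhile_bits[OF b] den_take_regex[where r = q and xs = a]
        den_take_out_regs[where g = g and G = G and s = s, OF _ _ _ _ _ _ _ _ _ _ _ _ d])
      (rule regs_eqI; simp)
qed

lemma den_do_anchor:
  assumes "p \<le> length s"
  shows "den (do_anchor W a) (regs as (prefix s p) (suffix s p) k g e ph y, w) =
    (if anchor_holds W s a p then {(regs as (prefix s p) (suffix s p) k g e ph y, w)} else {})"
proof -
  have l: "top_of (prefix s p) = (if p = 0 then None else Some (LTok (TChar (s ! (p - 1)))))"
  proof (cases p)
    case (Suc q)
    then show ?thesis using assms by (simp add: prefix_def take_Suc_conv_app_nth)
  qed (simp add: prefix_def)
  have r: "top_of (suffix s p) = (if p < length s then Some (LTok (TChar (s ! p))) else None)"
    by (cases "p < length s") (simp_all add: suffix_def Cons_nth_drop_Suc[symmetric])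
  have "anchor_test W a (top_of (prefix s p)) (top_of (suffix s p)) \<longleftrightarrow> anchor_holds W s a p"
    using assms by (cases a) (auto simp: anchor_test_def l r at_boundary_def)
  then show ?thesis by (simp add: do_anchor_def)
qed

lemma iter_match_char:
  "\<sigma> rU = u \<Longrightarrow> iter (\<lambda>x. den (match_char x)) rU u (\<sigma>, w) =
    (if take (length u) (\<sigma> rR) = u
     then {(\<sigma>(rU := [], rR := drop (length u) (\<sigma> rR), rL := rev u @ \<sigma> rL), w)} else {})"
proof (induction u arbitrary: \<sigma>)
  case Nil
  then show ?case by (simp add: fun_upd_idem)
next
  case (Cons c u)
  show ?case
  proof (cases "top_of (\<sigma> rR) = Some c")
    case True
    then obtain r where r: "\<sigma> rR = c # r" by (cases "\<sigma> rR") auto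
    let ?\<sigma> = "\<sigma>(rU := u, rR := r, rL := c # \<sigma> rL)"
    have "iter (\<lambda>x. den (match_char x)) rU (c # u) (\<sigma>, w) = iter (\<lambda>x. den (match_char x)) rU u (?\<sigma>, w)"
      by (intro iter_step) (simp add: match_char_def r)
    also have "\<dots> = (if take (length u) (?\<sigma> rR) = u
        then {(?\<sigma>(rU := [], rR := drop (length u) (?\<sigma> rR), rL := rev u @ ?\<sigma> rL), w)} else {})"
      by (intro Cons.IH) simp
    also have "?\<sigma>(rU := [], rR := drop (length u) (?\<sigma> rR), rL := rev u @ ?\<sigma> rL) =
        \<sigma>(rU := [], rR := drop (length (c # u)) (\<sigma> rR), rL := rev (c # u) @ \<sigma> rL)"
      by (intro ext) (simp add: r)
    finally show ?thesis by (simp add: r)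
  next
    case False
    have "den (match_char c) (\<sigma>(rU := u), w) = {}"
      using False by (simp add: match_char_def)
    moreover have "take (length (c # u)) (\<sigma> rR) \<noteq> c # u" using False by (cases "\<sigma> rR") auto
    ultimately show ?thesis by simp
  qed
qed

lemma den_drain_match_char:
  "den (Drain rU match_char) (\<sigma>, w) =
    (if take (length (\<sigma> rU)) (\<sigma> rR) = \<sigma> rU
     then {(\<sigma>(rU := [], rR := drop (length (\<sigma> rU)) (\<sigma> rR), rL := rev (\<sigma> rU) @ \<sigma> rL), w)} else {})"
  using iter_match_char[of \<sigma> "\<sigma> rU" w] by (simp del: iter.simps)

lemma den_do_backref:
  assumes "groups_ok (length s) G" "a = [] \<or> \<not> is_bit (hd a)"
  shows "den do_backref (regs (lbits g @ a) (prefix s p) (suffix s p) k (group_letters s G) e ph y, w) =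
    (case lookup G g of
       Closed i j \<Rightarrow>
         (let u = take (j - i) (drop i s)
          in if take (length u) (drop p s) = u
             then {(regs a (prefix s (p + length u)) (suffix s (p + length u)) k
               (group_letters s ((g, Closed i j) # without g G)) e ph y, w)} else {})
     | Opened i \<Rightarrow>
         {(regs a (prefix s p) (suffix s p) k (group_letters s ((g, Opened i) # without g G)) e ph y, w)}
     | Undefined \<Rightarrow> {(regs a (prefix s p) (suffix s p) k (group_letters s G) e ph y, w)})"
proof -
  have d: "distinct (map fst G)" using assms(1) by (simp add: groups_ok_def)
  note simps = do_backref_def takeWhile_bits[OF assms(2)]
    den_take_out_regs[where g = g and G = G and s = s, OF _ _ _ _ _ _ _ _ _ _ _ _ d]
  show ?thesis
  proof (cases "lookup G g")
    case Undefined
    then have "map_of G g = None"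
      using groups_ok_lookup[OF assms(1), of g] assms(1)
      by (auto simp: lookup_def groups_ok_def split: option.splits dest: map_of_SomeD)
    then show ?thesis
      using groups_ok_without[OF assms(1) Undefined]
      by (simp add: simps Undefined) (rule regs_eqI; simp)
  next
    case (Opened i)
    then have "map_of G g = Some (Opened i)" by (simp add: lookup_def split: option.splits)
    then show ?thesis by (simp add: simps Opened) (rule regs_eqI; simp)
  next
    case (Closed i j)
    then have m: "map_of G g = Some (Closed i j)" by (simp add: lookup_def split: option.splits)
    have ij: "i \<le> length s" "j \<le> length s" using groups_ok_lookup[OF assms(1), of g] Closed by auto
    define ch :: "'a \<Rightarrow> 'a letter" where "ch = (\<lambda>c. LTok (TChar c))"
    define u where "u = take (j - i) (drop i s)"
    have inj: "inj ch" by (auto simp: ch_def intro: injI)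
    have u: "drop i (rev (prefix s j)) = map ch u"
      by (simp add: prefix_def ch_def u_def rev_map drop_map drop_take)
    have match: "take (length u) (suffix s p) = map ch u \<longleftrightarrow> take (length u) (drop p s) = u"
      unfolding suffix_def ch_def[symmetric] take_map by (simp add: inj_map_eq_map[OF inj])
    have pre: "rev (map ch u) @ prefix s p = prefix s (p + length u)"
      if "take (length u) (drop p s) = u"
      using that by (simp add: prefix_def take_add ch_def rev_map)
    have suf: "drop (length u) (suffix s p) = suffix s (p + length u)"
      by (simp add: suffix_def drop_map add.commute)
    have c: "LMark Sep_Mark # prefix s j = [] \<or> \<not> is_char (hd (LMark Sep_Mark # prefix s j))"
      by (simp add: is_char_def)
    show ?thesis
      unfolding Closed group_state.case u_def[symmetric] Let_def
      by (simp add: simps m takeWhile_chars[OF c] den_drain_pop den_drain_match_char u match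
          ij(1) min_absorb1 suf del: den.simps(9))
        (intro impI regs_eqI; simp add: pre)
  qed
qed


text \<open>Every round overwrites \<open>r\<close> with the rest of the list, so what it held
  before can only survive if there is no round.\<close>

lemma iter_ignores: "xs \<noteq> [] \<Longrightarrow> iter D r xs (\<sigma>(r := ys), w) = iter D r xs (\<sigma>, w)"
  by (cases xs) auto

lemma iter_reset_bits:
  "\<sigma> rT = rev (map LBit bs) @ xs \<Longrightarrow>
   iter (\<lambda>x. den (reset_step x)) rT (rev (map LBit bs) @ xs) (\<sigma>, w) =
     iter (\<lambda>x. den (reset_step x)) rT xs (\<sigma>(rT := xs, rA := map LBit bs @ \<sigma> rA,
       rU := map LBit bs @ \<sigma> rU, rP := map LBit bs @ \<sigma> rP), w)"
proof (induction bs arbitrary: \<sigma> rule: rev_induct)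
  case Nil
  then show ?case by (simp add: fun_upd_idem)
next
  case (snoc b bs)
  let ?\<sigma> = "\<sigma>(rT := rev (map LBit bs) @ xs, rA := LBit b # \<sigma> rA, rU := LBit b # \<sigma> rU,
    rP := LBit b # \<sigma> rP)"
  have e: "rev (map LBit (bs @ [b])) @ xs = LBit b # rev (map LBit bs) @ xs" by simp
  have "iter (\<lambda>x. den (reset_step x)) rT (LBit b # rev (map LBit bs) @ xs) (\<sigma>, w) =
      iter (\<lambda>x. den (reset_step x)) rT (rev (map LBit bs) @ xs) (?\<sigma>, w)"
    by (intro iter_step) (simp add: reset_step_def is_bit_def)
  also have "\<dots> = iter (\<lambda>x. den (reset_step x)) rT xs (?\<sigma>(rT := xs, rA := map LBit bs @ ?\<sigma> rA,
       rU := map LBit bs @ ?\<sigma> rU, rP := map LBit bs @ ?\<sigma> rP), w)"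
    by (intro snoc.IH) simp
  also have "?\<sigma>(rT := xs, rA := map LBit bs @ ?\<sigma> rA, rU := map LBit bs @ ?\<sigma> rU,
        rP := map LBit bs @ ?\<sigma> rP) =
      \<sigma>(rT := xs, rA := map LBit (bs @ [b]) @ \<sigma> rA, rU := map LBit (bs @ [b]) @ \<sigma> rU,
        rP := map LBit (bs @ [b]) @ \<sigma> rP)"
    by (intro ext) simp
  finally show ?case unfolding e .
qed

lemma iter_reset_token:
  assumes "t \<noteq> TGroup"
  shows "iter (\<lambda>x. den (reset_step x)) rT (LTok t # xs) (\<sigma>, w) =
     iter (\<lambda>x. den (reset_step x)) rT xs
       (\<sigma>(rT := xs, rA := LTok t # \<sigma> rA, rU := LTok t # \<sigma> rU, rP := []), w)"
  using assms by (intro iter_step) (simp add: reset_step_def is_bit_def)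

lemma iter_reset_leaf:
  assumes "t \<noteq> TGroup" "\<sigma> rP = []" "\<sigma> rG = gs"
  shows "iter (\<lambda>x. den (reset_step x)) rT (LTok t # xs) (\<sigma>, w) =
     iter (\<lambda>x. den (reset_step x)) rT xs
       (\<sigma>(rT := xs, rA := LTok t # \<sigma> rA, rU := LTok t # \<sigma> rU, rG := gs), w)"
proof -
  have "\<sigma>(rT := xs, rA := LTok t # \<sigma> rA, rU := LTok t # \<sigma> rU, rP := []) =
      \<sigma>(rT := xs, rA := LTok t # \<sigma> rA, rU := LTok t # \<sigma> rU, rG := gs)"
    using assms by (intro ext) auto
  with iter_reset_token[OF assms(1), of xs \<sigma> w] show ?thesis by (simp only:)
qed

text \<open>The identifier of a group precedes the letter \<^const>\<open>TGroup\<close> in the reversed regex.\<close>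

lemma iter_reset:
  assumes "\<sigma> rB = []" "\<sigma> rB2 = []" "\<sigma> rS = []" "\<sigma> rX = []" "\<sigma> rS2 = []" "\<sigma> rQ2 = []" "\<sigma> rF = []"
    "\<sigma> rH = []" "\<sigma> rW = []" "\<sigma> rV = []" "\<sigma> rQ = []" "\<sigma> rP = []" "distinct (map fst G)"
    "\<sigma> rG = group_letters s G"
  shows "iter (\<lambda>x. den (reset_step x)) rT (rev (regex_letters r) @ xs) (\<sigma>, w) =
     iter (\<lambda>x. den (reset_step x)) rT xs
       (\<sigma>(rT := xs, rA := regex_letters r @ \<sigma> rA, rU := regex_letters r @ \<sigma> rU,
          rG := group_letters s (filter (\<lambda>e. fst e \<notin> set (groups r)) G)), w)"
  using assms
proof (induction r arbitrary: \<sigma> xs G)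
  case Eps
  show ?case
    unfolding regex_letters.simps rev.simps append.simps
    by (rule iter_reset_leaf) (use Eps in auto)
next
  case (Chars cd)
  show ?case
    unfolding regex_letters.simps rev.simps append.simps
    by (rule iter_reset_leaf) (use Chars in auto)
next
  case (Anchor a)
  show ?case
    unfolding regex_letters.simps rev.simps append.simps
    by (rule iter_reset_leaf) (use Anchor in auto)
next
  case (Backref g)
  let ?D = "\<lambda>x. den (reset_step x)"
  let ?y = "LTok TBackref # xs"
  let ?\<sigma>0 = "\<sigma>(rT := rev (lbits g) @ ?y)"
  let ?\<sigma>1 = "?\<sigma>0(rT := ?y, rA := lbits g @ ?\<sigma>0 rA, rU := lbits g @ ?\<sigma>0 rU, rP := lbits g @ ?\<sigma>0 rP)"
  let ?\<sigma>2 = "?\<sigma>1(rT := xs, rA := LTok TBackref # ?\<sigma>1 rA, rU := LTok TBackref # ?\<sigma>1 rU, rP := [])"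
  have e: "rev (regex_letters (Backref g)) @ xs = rev (lbits g) @ ?y" by simp
  have "iter ?D rT (rev (lbits g) @ ?y) (\<sigma>, w) = iter ?D rT (rev (lbits g) @ ?y) (?\<sigma>0, w)"
    by (rule iter_ignores[symmetric]) simp
  also have "\<dots> = iter ?D rT ?y (?\<sigma>1, w)"
    unfolding lbits_def by (rule iter_reset_bits) simp
  also have "\<dots> = iter ?D rT xs (?\<sigma>2, w)"
    by (rule iter_reset_token) simp
  also have "?\<sigma>2 = \<sigma>(rT := xs, rA := regex_letters (Backref g) @ \<sigma> rA,
      rU := regex_letters (Backref g) @ \<sigma> rU,
      rG := group_letters s (filter (\<lambda>e. fst e \<notin> set (groups (Backref g))) G))"
    using Backref by (intro ext) simp
  finally show ?case unfolding e .
next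
  case (Alt r1 r2)
  let ?D = "\<lambda>x. den (reset_step x)"
  let ?y = "rev (regex_letters r1) @ LTok TAlt # xs"
  let ?G2 = "filter (\<lambda>e. fst e \<notin> set (groups r2)) G"
  let ?G1 = "filter (\<lambda>e. fst e \<notin> set (groups r1)) ?G2"
  let ?\<sigma>1 = "\<sigma>(rT := ?y, rA := regex_letters r2 @ \<sigma> rA, rU := regex_letters r2 @ \<sigma> rU,
    rG := group_letters s ?G2)"
  let ?\<sigma>2 = "?\<sigma>1(rT := LTok TAlt # xs, rA := regex_letters r1 @ ?\<sigma>1 rA, rU := regex_letters r1 @ ?\<sigma>1 rU,
    rG := group_letters s ?G1)"
  let ?\<sigma>3 = "?\<sigma>2(rT := xs, rA := LTok TAlt # ?\<sigma>2 rA, rU := LTok TAlt # ?\<sigma>2 rU,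
    rG := group_letters s (filter (\<lambda>e. fst e \<notin> set (groups (Alt r1 r2))) G))"
  have e: "rev (regex_letters (Alt r1 r2)) @ xs = rev (regex_letters r2) @ ?y" by simp
  have d: "distinct (map fst ?G2)" using Alt.prems(13) by (rule distinct_map_filter)
  have f: "?G1 = filter (\<lambda>e. fst e \<notin> set (groups (Alt r1 r2))) G"
    by (auto intro!: filter_cong)
  have "iter ?D rT (rev (regex_letters r2) @ ?y) (\<sigma>, w) = iter ?D rT ?y (?\<sigma>1, w)"
    by (rule Alt.IH(2)) (use Alt.prems in simp_all)
  also have "\<dots> = iter ?D rT (LTok TAlt # xs) (?\<sigma>2, w)"
    by (rule Alt.IH(1)) (use Alt.prems d in simp_all)
  also have "\<dots> = iter ?D rT xs (?\<sigma>3, w)"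
    by (rule iter_reset_leaf) (use Alt.prems f in simp_all)
  also have "?\<sigma>3 = \<sigma>(rT := xs, rA := regex_letters (Alt r1 r2) @ \<sigma> rA,
      rU := regex_letters (Alt r1 r2) @ \<sigma> rU,
      rG := group_letters s (filter (\<lambda>e. fst e \<notin> set (groups (Alt r1 r2))) G))"
    by (intro ext) simp
  finally show ?case unfolding e .
next
  case (Seq r1 r2)
  let ?D = "\<lambda>x. den (reset_step x)"
  let ?y = "rev (regex_letters r1) @ LTok TSeq # xs"
  let ?G2 = "filter (\<lambda>e. fst e \<notin> set (groups r2)) G"
  let ?G1 = "filter (\<lambda>e. fst e \<notin> set (groups r1)) ?G2"
  let ?\<sigma>1 = "\<sigma>(rT := ?y, rA := regex_letters r2 @ \<sigma> rA, rU := regex_letters r2 @ \<sigma> rU,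
    rG := group_letters s ?G2)"
  let ?\<sigma>2 = "?\<sigma>1(rT := LTok TSeq # xs, rA := regex_letters r1 @ ?\<sigma>1 rA, rU := regex_letters r1 @ ?\<sigma>1 rU,
    rG := group_letters s ?G1)"
  let ?\<sigma>3 = "?\<sigma>2(rT := xs, rA := LTok TSeq # ?\<sigma>2 rA, rU := LTok TSeq # ?\<sigma>2 rU,
    rG := group_letters s (filter (\<lambda>e. fst e \<notin> set (groups (Seq r1 r2))) G))"
  have e: "rev (regex_letters (Seq r1 r2)) @ xs = rev (regex_letters r2) @ ?y" by simp
  have d: "distinct (map fst ?G2)" using Seq.prems(13) by (rule distinct_map_filter)
  have f: "?G1 = filter (\<lambda>e. fst e \<notin> set (groups (Seq r1 r2))) G"
    by (auto intro!: filter_cong)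
  have "iter ?D rT (rev (regex_letters r2) @ ?y) (\<sigma>, w) = iter ?D rT ?y (?\<sigma>1, w)"
    by (rule Seq.IH(2)) (use Seq.prems in simp_all)
  also have "\<dots> = iter ?D rT (LTok TSeq # xs) (?\<sigma>2, w)"
    by (rule Seq.IH(1)) (use Seq.prems d in simp_all)
  also have "\<dots> = iter ?D rT xs (?\<sigma>3, w)"
    by (rule iter_reset_leaf) (use Seq.prems f in simp_all)
  also have "?\<sigma>3 = \<sigma>(rT := xs, rA := regex_letters (Seq r1 r2) @ \<sigma> rA,
      rU := regex_letters (Seq r1 r2) @ \<sigma> rU,
      rG := group_letters s (filter (\<lambda>e. fst e \<notin> set (groups (Seq r1 r2))) G))"
    by (intro ext) simp
  finally show ?case unfolding e .
next
  case (Group g r)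
  let ?D = "\<lambda>x. den (reset_step x)"
  let ?y = "LTok TGroup # xs"
  let ?G1 = "filter (\<lambda>e. fst e \<notin> set (groups r)) G"
  let ?\<sigma>1 = "\<sigma>(rT := rev (lbits g) @ ?y, rA := regex_letters r @ \<sigma> rA, rU := regex_letters r @ \<sigma> rU,
    rG := group_letters s ?G1)"
  let ?\<sigma>2 = "?\<sigma>1(rT := ?y, rA := lbits g @ ?\<sigma>1 rA, rU := lbits g @ ?\<sigma>1 rU, rP := lbits g @ ?\<sigma>1 rP)"
  let ?\<sigma>3 = "\<sigma>(rT := xs, rA := regex_letters (Group g r) @ \<sigma> rA,
      rU := regex_letters (Group g r) @ \<sigma> rU,
      rG := group_letters s (filter (\<lambda>e. fst e \<notin> set (groups (Group g r))) G))"
  have e: "rev (regex_letters (Group g r)) @ xs = rev (regex_letters r) @ rev (lbits g) @ ?y" by simp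
  have d: "distinct (map fst ?G1)" using Group.prems(13) by (rule distinct_map_filter)
  have f: "without g ?G1 = filter (\<lambda>e. fst e \<notin> set (groups (Group g r))) G"
    by (auto simp: without_def intro!: filter_cong)
  have "iter ?D rT (rev (regex_letters r) @ rev (lbits g) @ ?y) (\<sigma>, w) =
      iter ?D rT (rev (lbits g) @ ?y) (?\<sigma>1, w)"
    by (rule Group.IH) (use Group.prems in simp_all)
  also have "\<dots> = iter ?D rT ?y (?\<sigma>2, w)"
    unfolding lbits_def by (rule iter_reset_bits) simp
  also have "\<dots> = iter ?D rT xs (?\<sigma>3, w)"
  proof (rule iter_step)
    have "den (reset_step (LTok TGroup)) (?\<sigma>2(rT := xs), w) =
      (\<Union>st \<in> den take_out (?\<sigma>2(rT := xs, rA := LTok TGroup # ?\<sigma>2 rA, rU := LTok TGroup # ?\<sigma>2 rU,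
        rP := [], rQ := rev (lbits g)), w). den (clear rV ;; clear rQ) st)"
      using Group.prems by (simp add: reset_step_def is_bit_def)
    also have "\<dots> = {(?\<sigma>3, w)}"
      using Group.prems
      by (subst den_take_out_regs[where g = g and G = ?G1 and s = s])
        (use d in \<open>simp_all add: f, (intro ext; simp)?\<close>)
    finally show "den (reset_step (LTok TGroup)) (?\<sigma>2(rT := xs), w) = {(?\<sigma>3, w)}" .
  qed
  finally show ?case unfolding e .
next
  case (Quant r m d greedy)
  define ds where "ds = (case d of enat n \<Rightarrow> binary n | \<infinity> \<Rightarrow> [])"
  define dt :: "'a token" where "dt = (case d of enat n \<Rightarrow> TFinite | \<infinity> \<Rightarrow> TInfinite)"
  have d: "(case d of enat n \<Rightarrow> LTok TFinite # lbits n | \<infinity> \<Rightarrow> [LTok TInfinite]) = LTok dt # map LBit ds"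
    by (simp add: ds_def dt_def lbits_def split: enat.split)
  have dt: "dt \<noteq> TGroup"
    by (simp add: dt_def split: enat.split)
  let ?D = "\<lambda>x. den (reset_step x)"
  let ?y1 = "LTok (TQuant greedy) # xs"
  let ?y2 = "rev (lbits m) @ ?y1"
  let ?y3 = "rev (map LBit ds) @ LTok dt # ?y2"
  let ?\<sigma>1 = "\<sigma>(rT := ?y3, rA := regex_letters r @ \<sigma> rA, rU := regex_letters r @ \<sigma> rU,
    rG := group_letters s (filter (\<lambda>e. fst e \<notin> set (groups r)) G))"
  let ?\<sigma>2 = "?\<sigma>1(rT := LTok dt # ?y2, rA := map LBit ds @ ?\<sigma>1 rA, rU := map LBit ds @ ?\<sigma>1 rU,
    rP := map LBit ds @ ?\<sigma>1 rP)"
  let ?\<sigma>3 = "?\<sigma>2(rT := ?y2, rA := LTok dt # ?\<sigma>2 rA, rU := LTok dt # ?\<sigma>2 rU, rP := [])"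
  let ?\<sigma>4 = "?\<sigma>3(rT := ?y1, rA := lbits m @ ?\<sigma>3 rA, rU := lbits m @ ?\<sigma>3 rU, rP := lbits m @ ?\<sigma>3 rP)"
  let ?\<sigma>5 = "?\<sigma>4(rT := xs, rA := LTok (TQuant greedy) # ?\<sigma>4 rA, rU := LTok (TQuant greedy) # ?\<sigma>4 rU,
    rP := [])"
  have e: "rev (regex_letters (Quant r m d greedy)) @ xs = rev (regex_letters r) @ ?y3"
    by (simp add: d)
  have "iter ?D rT (rev (regex_letters r) @ ?y3) (\<sigma>, w) = iter ?D rT ?y3 (?\<sigma>1, w)"
    by (rule Quant.IH) (use Quant.prems in simp_all)
  also have "\<dots> = iter ?D rT (LTok dt # ?y2) (?\<sigma>2, w)"
    by (rule iter_reset_bits) simp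
  also have "\<dots> = iter ?D rT ?y2 (?\<sigma>3, w)"
    by (rule iter_reset_token[OF dt])
  also have "\<dots> = iter ?D rT ?y1 (?\<sigma>4, w)"
    unfolding lbits_def by (rule iter_reset_bits) simp
  also have "\<dots> = iter ?D rT xs (?\<sigma>5, w)"
    by (rule iter_reset_token) simp
  also have "?\<sigma>5 = \<sigma>(rT := xs, rA := regex_letters (Quant r m d greedy) @ \<sigma> rA,
      rU := regex_letters (Quant r m d greedy) @ \<sigma> rU,
      rG := group_letters s (filter (\<lambda>e. fst e \<notin> set (groups (Quant r m d greedy))) G))"
    using Quant.prems by (intro ext) (simp add: d)
  finally show ?case unfolding e .
qed

lemma den_drain_reset:
  assumes "\<sigma> rB = []" "\<sigma> rB2 = []" "\<sigma> rS = []" "\<sigma> rX = []" "\<sigma> rS2 = []" "\<sigma> rQ2 = []" "\<sigma> rF = []"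
    "\<sigma> rH = []" "\<sigma> rW = []" "\<sigma> rV = []" "\<sigma> rQ = []" "\<sigma> rP = []" "distinct (map fst G)"
    "\<sigma> rG = group_letters s G" "\<sigma> rT = rev (regex_letters r)"
  shows "den (Drain rT reset_step) (\<sigma>, w) =
       {(\<sigma>(rT := [], rA := regex_letters r @ \<sigma> rA, rU := regex_letters r @ \<sigma> rU,
          rG := group_letters s (filter (\<lambda>e. fst e \<notin> set (groups r)) G)), w)}"
  using iter_reset[OF assms(1-14), of r "[]" w] assms(15) by (simp del: iter.simps(2))

lemma den_do_iterate:
  assumes "distinct (map fst G)" "a = [] \<or> \<not> is_bit (hd a)" "\<sigma> = regs (regex_letters q @ a) (prefix s p) r k (group_letters s G) e ph y"
  shows "den (do_iterate greedy t) (\<sigma>(rD := rev (lbits n)), w) =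
    {(regs (regex_letters q @ LMark Check_Mark # prefix s p @ LTok (TQuant greedy) # LTok t # lbits n @
        regex_letters q @ a) (prefix s p) r k (group_letters s (filter (\<lambda>e. fst e \<notin> set (groups q)) G)) e ph y, w)}"
  using assms(2) unfolding assms(3)
  by (simp add: do_iterate_def den_take_regex[where r = q and xs = a]
      den_drain_reset[where r = q and G = G and s = s, OF _ _ _ _ _ _ _ _ _ _ _ _ assms(1)]
      del: den.simps(9))
    (rule regs_eqI; simp)

lemma den_do_quant:
  assumes "distinct (map fst G)" "a = [] \<or> \<not> is_bit (hd a)"
  shows "den (do_quant greedy b) (regs ((case d of enat n \<Rightarrow> LTok TFinite # lbits n | \<infinity> \<Rightarrow> [LTok TInfinite]) @
      regex_letters q @ a) (prefix s p) r k (group_letters s G) e ph y, w) =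
    (if d = 0 then if b then {} else {(regs a (prefix s p) r k (group_letters s G) e ph y, w)}
     else if b = greedy then {(regs a (prefix s p) r k (group_letters s G) e ph y, w)}
     else {(regs (regex_letters q @ LMark Check_Mark # prefix s p @ regex_letters (Quant q 0 (d - 1) greedy) @ a)
       (prefix s p) r k (group_letters s (filter (\<lambda>e. fst e \<notin> set (groups q)) G)) e ph y, w)})"
proof -
  have upd: "(regs a' l r' k' g e' ph' y')(rA := a'') = regs a'' l r' k' g e' ph' y'"
    for a' a'' l r' k' g e' y' :: "'a letter list" and ph'
    by (intro regs_eqI) simp_all
  have updD: "(regs a' l r' k' g e' ph' y')(rD := []) = regs a' l r' k' g e' ph' y'"
    for a' a'' l r' k' g e' y' :: "'a letter list" and ph'
    by (intro regs_eqI) simp_all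
  have bits: "regex_letters q @ a = [] \<or> \<not> is_bit (hd (regex_letters q @ a))" by simp
  have iterate: "den (do_iterate greedy t) ((regs (regex_letters q @ a) (prefix s p) r k (group_letters s G) e ph y)
      (rD := rev (lbits n)), w) =
    {(regs (regex_letters q @ LMark Check_Mark # prefix s p @ LTok (TQuant greedy) # LTok t # lbits n @
        regex_letters q @ a) (prefix s p) r k (group_letters s (filter (\<lambda>e. fst e \<notin> set (groups q)) G)) e ph y, w)}"
    for t n
    by (rule den_do_iterate[OF assms refl])
  have skip: "den (take_regex ;; clear rT) (regs (regex_letters q @ a) (prefix s p) r k (group_letters s G) e ph y, w) =
      {(regs a (prefix s p) r k (group_letters s G) e ph y, w)}"
    using assms(2)
    by (simp add: den_take_regex[where r = q and xs = a]) (rule regs_eqI; simp)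
  show ?thesis
  proof (cases d)
    case (enat n)
    show ?thesis
    proof (cases "n = 0")
      case True
      then show ?thesis
        using skip by (simp add: do_quant_def enat upd lbits_def updD zero_enat_def del: den.simps(6))
          (simp add: takeWhile_bits[OF bits, of 0, unfolded lbits_def, simplified] upd updD)
    next
      case False
      define f :: "'a letter option \<Rightarrow> 'a prog" where "f = (\<lambda>d. if d = None then if b then Fail else take_regex ;; clear rT
         else if b = greedy then take_regex ;; clear rT ;; clear rD
         else decrement ;; do_iterate greedy TFinite)"
      let ?\<sigma> = "(regs (regex_letters q @ a) (prefix s p) r k (group_letters s G) e ph y)"
      have "rev (lbits n :: 'a letter list) \<noteq> []" using False by (simp add: lbits_def)
      then obtain x :: "'a letter" where x: "top_of (rev (lbits n)) = Some x" by (metis neq_Nil_conv top_of_simps(2))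
      have "den (do_quant greedy b) (regs (LTok TFinite # lbits n @ regex_letters q @ a)
          (prefix s p) r k (group_letters s G) e ph y, w) = den (f (Some x)) (?\<sigma>(rD := rev (lbits n)), w)"
        by (simp add: do_quant_def upd takeWhile_bits[OF bits] x f_def)
      also have "\<dots> = (if b = greedy then {(regs a (prefix s p) r k (group_letters s G) e ph y, w)}
         else den (do_iterate greedy TFinite) (?\<sigma>(rD := rev (lbits (n - 1))), w))"
        using assms(2) False
        by (simp add: f_def den_take_regex[where r = q and xs = a] den_decrement)
          (intro impI regs_eqI; simp)
      finally show ?thesis
        using False by (simp add: enat iterate zero_enat_def one_enat_def)
    qed
  next
    case infinity
    show ?thesis
      using skip iterate[of TInfinite 0]
      by (simp add: do_quant_def infinity upd lbits_def updD del: den.simps(6))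
  qed
qed


section \<open>Computing the expected answer\<close>

lemma iter_put_bit:
  "\<sigma> rS = map LBit bs \<Longrightarrow> iter (\<lambda>x. den (put_bit x)) rS (map LBit bs) (\<sigma>, w) =
    {(\<sigma>(rS := [], rT := rev (map LOut (map OBit bs)) @ \<sigma> rT), w)}"
proof (induction bs arbitrary: \<sigma>)
  case Nil
  then show ?case by (simp add: fun_upd_idem)
next
  case (Cons b bs)
  let ?\<sigma> = "\<sigma>(rS := map LBit bs, rT := LOut (OBit b) # \<sigma> rT)"
  have "iter (\<lambda>x. den (put_bit x)) rS (LBit b # map LBit bs) (\<sigma>, w) =
      iter (\<lambda>x. den (put_bit x)) rS (map LBit bs) (?\<sigma>, w)"
    by (intro iter_step) (simp add: put_bit_def)
  also have "\<dots> = {(?\<sigma>(rS := [], rT := rev (map LOut (map OBit bs)) @ ?\<sigma> rT), w)}"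
    by (intro Cons.IH) simp
  also have "?\<sigma>(rS := [], rT := rev (map LOut (map OBit bs)) @ ?\<sigma> rT) =
      \<sigma>(rS := [], rT := rev (map LOut (map OBit (b # bs))) @ \<sigma> rT)"
    by (intro ext) simp
  finally show ?case unfolding list.map(2) .
qed

lemma den_put_counter:
  assumes "\<sigma> rC = rev (lbits n)" "\<sigma> rS = []"
  shows "den put_counter (\<sigma>, w) = {(\<sigma>(rC := [], rT := rev (map LOut (num_out n)) @ \<sigma> rT), w)}"
proof -
  let ?\<sigma> = "\<sigma>(rT := LOut (OTok Num) # \<sigma> rT, rC := [], rS := map LBit (binary n))"
  let ?\<sigma>' = "?\<sigma>(rS := [], rT := rev (map LOut (map OBit (binary n))) @ ?\<sigma> rT)"
  have "den put_counter (\<sigma>, w) = den (Drain rS put_bit) (?\<sigma>, w)"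
    using assms by (simp add: put_counter_def lbits_def del: den.simps(9))
  also have "\<dots> = {(?\<sigma>', w)}"
    using iter_put_bit[of ?\<sigma> "binary n" w] by simp
  also have "?\<sigma>' = \<sigma>(rC := [], rT := rev (map LOut (num_out n)) @ \<sigma> rT)"
    using assms by (intro ext) (simp add: num_out_def)
  finally show ?thesis .
qed

text \<open>An entry is printed in two portions: \<open>entry_init\<close> while its letters are
  read, whereas \<open>last_pos\<close> stays in the counter until the next entry or the
  end.\<close>

fun last_pos :: "group_state \<Rightarrow> nat" where
  "last_pos Undefined = 0"
| "last_pos (Opened a) = a"
| "last_pos (Closed a b) = b"

fun entry_init :: "nat \<Rightarrow> group_state \<Rightarrow> out list" where
  "entry_init g (Closed a b) = map OBit (binary g) @ num_out a"
| "entry_init g _ = map OBit (binary g)"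

fun entry_token :: "group_state \<Rightarrow> answer_token" where
  "entry_token (Closed a b) = IsClosed"
| "entry_token _ = IsOpened"

lemma entry_out_split:
  "v \<noteq> Undefined \<Longrightarrow>
   entry_out (g, v) = [OTok (entry_token v), OTok Num] @ entry_init g v @ num_out (last_pos v)"
  by (cases v) (auto simp: num_out_def)

lemma iter_put_bits:
  "\<sigma> rG = map LBit bs @ xs \<Longrightarrow> iter (\<lambda>x. den (put_entry x)) rG (map LBit bs @ xs) (\<sigma>, w) =
    iter (\<lambda>x. den (put_entry x)) rG xs (\<sigma>(rG := xs, rT := rev (map LOut (map OBit bs)) @ \<sigma> rT), w)"
proof (induction bs arbitrary: \<sigma>)
  case Nil
  then show ?case by (simp add: fun_upd_idem)
next
  case (Cons b bs)
  let ?\<sigma> = "\<sigma>(rG := map LBit bs @ xs, rT := LOut (OBit b) # \<sigma> rT)"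
  have "iter (\<lambda>x. den (put_entry x)) rG (LBit b # map LBit bs @ xs) (\<sigma>, w) =
      iter (\<lambda>x. den (put_entry x)) rG (map LBit bs @ xs) (?\<sigma>, w)"
    by (intro iter_step) (simp add: put_entry_def put_bit_def)
  also have "\<dots> = iter (\<lambda>x. den (put_entry x)) rG xs
      (?\<sigma>(rG := xs, rT := rev (map LOut (map OBit bs)) @ ?\<sigma> rT), w)"
    by (intro Cons.IH) simp
  also have "?\<sigma>(rG := xs, rT := rev (map LOut (map OBit bs)) @ ?\<sigma> rT) =
      \<sigma>(rG := xs, rT := rev (map LOut (map OBit (b # bs))) @ \<sigma> rT)"
    by (intro ext) simp
  finally show ?case unfolding list.map(2) append.simps .
qed

lemma iter_put_chars:
  "\<sigma> rG = map (\<lambda>c. LTok (TChar c)) cs @ xs \<Longrightarrow> \<sigma> rC = rev (lbits n) \<Longrightarrow> \<sigma> rS = [] \<Longrightarrow> \<sigma> rF = [] \<Longrightarrow>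
   iter (\<lambda>x. den (put_entry x)) rG (map (\<lambda>c. LTok (TChar c)) cs @ xs) (\<sigma>, w) =
    iter (\<lambda>x. den (put_entry x)) rG xs (\<sigma>(rG := xs, rC := rev (lbits (n + length cs))), w)"
proof (induction cs arbitrary: \<sigma> n)
  case Nil
  then show ?case by (simp add: fun_upd_idem)
next
  case (Cons c cs)
  let ?cs = "map (\<lambda>c. LTok (TChar c)) cs"
  let ?\<sigma> = "\<sigma>(rG := ?cs @ xs, rC := rev (lbits (Suc n)))"
  have "iter (\<lambda>x. den (put_entry x)) rG (LTok (TChar c) # ?cs @ xs) (\<sigma>, w) =
      iter (\<lambda>x. den (put_entry x)) rG (?cs @ xs) (?\<sigma>, w)"
    using Cons.prems by (intro iter_step) (simp add: put_entry_def den_increment)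
  also have "\<dots> = iter (\<lambda>x. den (put_entry x)) rG xs
      (?\<sigma>(rG := xs, rC := rev (lbits (Suc n + length cs))), w)"
    using Cons.prems by (intro Cons.IH) simp_all
  also have "?\<sigma>(rG := xs, rC := rev (lbits (Suc n + length cs))) =
      \<sigma>(rG := xs, rC := rev (lbits (n + length (c # cs))))"
    by (intro ext) simp
  finally show ?case unfolding list.map(2) append.simps .
qed

lemma iter_put_prefix:
  assumes "\<sigma> rG = prefix s p @ xs" "p \<le> length s" "\<sigma> rC = []" "\<sigma> rS = []" "\<sigma> rF = []"
  shows "iter (\<lambda>x. den (put_entry x)) rG (prefix s p @ xs) (\<sigma>, w) =
    iter (\<lambda>x. den (put_entry x)) rG xs (\<sigma>(rG := xs, rC := rev (lbits p)), w)"
  using iter_put_chars[of \<sigma> "rev (take p s)" xs 0 w] assms by (simp add: prefix_def min_absorb2)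

lemma iter_put_entry_tail:
  assumes "\<sigma> rG = lbits g @ state_letters s v @ xs" "positions_le (length s) v"
    "\<sigma> rC = []" "\<sigma> rS = []" "\<sigma> rF = []"
  shows "iter (\<lambda>x. den (put_entry x)) rG (lbits g @ state_letters s v @ xs) (\<sigma>, w) =
    iter (\<lambda>x. den (put_entry x)) rG xs (\<sigma>(rG := xs, rC := rev (lbits (last_pos v)),
      rT := rev (map LOut (entry_init g v)) @ \<sigma> rT), w)"
proof -
  let ?D = "\<lambda>x. den (put_entry x)"
  let ?\<sigma>1 = "\<sigma>(rG := state_letters s v @ xs, rT := rev (map LOut (map OBit (binary g))) @ \<sigma> rT)"
  have 1: "iter ?D rG (lbits g @ state_letters s v @ xs) (\<sigma>, w) =
      iter ?D rG (state_letters s v @ xs) (?\<sigma>1, w)"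
    unfolding lbits_def by (rule iter_put_bits) (use assms in \<open>simp add: lbits_def\<close>)
  show ?thesis
  proof (cases v)
    case (Opened a)
    have "iter ?D rG (prefix s a @ xs) (?\<sigma>1, w) = iter ?D rG xs (?\<sigma>1(rG := xs, rC := rev (lbits a)), w)"
      by (rule iter_put_prefix) (use assms Opened in simp_all)
    also have "?\<sigma>1(rG := xs, rC := rev (lbits a)) =
        \<sigma>(rG := xs, rC := rev (lbits (last_pos v)), rT := rev (map LOut (entry_init g v)) @ \<sigma> rT)"
      by (intro ext) (simp add: Opened)
    finally show ?thesis unfolding 1 by (simp only: Opened state_letters.simps)
  next
    case (Closed a b)
    let ?y = "LMark Sep_Mark # prefix s b @ xs"
    let ?\<sigma>2 = "?\<sigma>1(rG := ?y, rC := rev (lbits a))"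
    let ?\<sigma>3 = "?\<sigma>2(rG := prefix s b @ xs, rC := [], rT := rev (map LOut (num_out a)) @ ?\<sigma>2 rT)"
    have "iter ?D rG (prefix s a @ ?y) (?\<sigma>1, w) = iter ?D rG ?y (?\<sigma>2, w)"
      by (rule iter_put_prefix) (use assms Closed in simp_all)
    also have "\<dots> = iter ?D rG (prefix s b @ xs) (?\<sigma>3, w)"
      using assms by (intro iter_step) (simp add: put_entry_def den_put_counter[where n = a])
    also have "\<dots> = iter ?D rG xs (?\<sigma>3(rG := xs, rC := rev (lbits b)), w)"
      by (rule iter_put_prefix) (use assms Closed in simp_all)
    also have "?\<sigma>3(rG := xs, rC := rev (lbits b)) =
        \<sigma>(rG := xs, rC := rev (lbits (last_pos v)), rT := rev (map LOut (entry_init g v)) @ \<sigma> rT)"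
      by (intro ext) (simp add: Closed)
    finally show ?thesis unfolding 1 by (simp only: Closed state_letters.simps append_assoc append_Cons)
  qed (use assms in simp)
qed

lemma den_start_entry:
  assumes "\<sigma> rS = []" "\<sigma> rC = rev (lbits c)" "\<sigma> rFl = [] \<and> c = 0 \<or> \<sigma> rFl = [LMark Tick]"
  shows "den (start_entry t) (\<sigma>, w) =
    {(\<sigma>(rFl := [LMark Tick], rC := [],
        rT := rev (map LOut ((if \<sigma> rFl = [] then [] else num_out c) @ [OTok t, OTok Num])) @ \<sigma> rT), w)}"
  using assms by (auto simp: start_entry_def den_put_counter intro!: ext)

text \<open>The number \<open>c\<close> in the counter stems from the entry before \<open>G\<close>.
  The command after the loop is included because it prints the number of the last entry.\<close>

lemma iter_put_entry:
  "\<forall>e \<in> set G. positions_le (length s) (snd e) \<Longrightarrow> \<sigma> rG = group_letters s G \<Longrightarrow>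
   \<sigma> rC = rev (lbits c) \<Longrightarrow> \<sigma> rS = [] \<Longrightarrow> \<sigma> rF = [] \<Longrightarrow> \<sigma> rFl = [] \<and> c = 0 \<or> \<sigma> rFl = [LMark Tick] \<Longrightarrow>
   (\<Union>st \<in> iter (\<lambda>x. den (put_entry x)) rG (group_letters s G) (\<sigma>, w).
      den (take_top rFl (\<lambda>x. if x = None then Skip else put_counter)) st) =
    {(\<sigma>(rG := [], rFl := [], rC := [],
        rT := rev (map LOut ((if \<sigma> rFl = [] then [] else num_out c) @ concat (map entry_out G))) @ \<sigma> rT), w)}"
proof (induction G arbitrary: \<sigma> c)
  case Nil
  then show ?case by (auto simp: den_put_counter intro!: ext)
next
  case (Cons e G)
  obtain g v where e: "e = (g, v)" by fastforce
  have v: "positions_le (length s) v" "v \<noteq> Undefined" using Cons.prems(1) e by auto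
  let ?D = "\<lambda>x. den (put_entry x)"
  let ?F = "\<lambda>st. den (take_top rFl (\<lambda>x. if x = None then Skip else put_counter)) st"
  let ?y = "group_letters s G"
  let ?out1 = "(if \<sigma> rFl = [] then [] else num_out c) @ [OTok (entry_token v), OTok Num]"
  let ?\<sigma>1 = "\<sigma>(rG := lbits g @ state_letters s v @ ?y, rFl := [LMark Tick], rC := [],
    rT := rev (map LOut ?out1) @ \<sigma> rT)"
  let ?\<sigma>2 = "?\<sigma>1(rG := ?y, rC := rev (lbits (last_pos v)), rT := rev (map LOut (entry_init g v)) @ ?\<sigma>1 rT)"
  have k: "put_entry (state_kind v) = start_entry (entry_token v)"
    by (cases v) (simp_all add: put_entry_def)
  have "group_letters s (e # G) = state_kind v # lbits g @ state_letters s v @ ?y"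
    by (simp add: e)
  then have "iter ?D rG (group_letters s (e # G)) (\<sigma>, w) =
      iter ?D rG (state_kind v # lbits g @ state_letters s v @ ?y) (\<sigma>, w)"
    by (rule arg_cong)
  also have "\<dots> = iter ?D rG (lbits g @ state_letters s v @ ?y) (?\<sigma>1, w)"
    using Cons.prems by (intro iter_step) (simp add: k den_start_entry[where c = c])
  also have "\<dots> = iter ?D rG ?y (?\<sigma>2, w)"
    by (rule iter_put_entry_tail) (use Cons.prems v in simp_all)
  finally have "(\<Union>st \<in> iter ?D rG (group_letters s (e # G)) (\<sigma>, w). ?F st) =
      (\<Union>st \<in> iter ?D rG ?y (?\<sigma>2, w). ?F st)"
    by (rule arg_cong)
  also have "\<dots> = {(?\<sigma>2(rG := [], rFl := [], rC := [],
      rT := rev (map LOut ((if ?\<sigma>2 rFl = [] then [] else num_out (last_pos v)) @ concat (map entry_out G))) @ ?\<sigma>2 rT), w)}"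
    by (rule Cons.IH) (use Cons.prems in simp_all)
  also have "?\<sigma>2(rG := [], rFl := [], rC := [],
      rT := rev (map LOut ((if ?\<sigma>2 rFl = [] then [] else num_out (last_pos v)) @ concat (map entry_out G))) @ ?\<sigma>2 rT) =
    \<sigma>(rG := [], rFl := [], rC := [],
      rT := rev (map LOut ((if \<sigma> rFl = [] then [] else num_out c) @ concat (map entry_out (e # G)))) @ \<sigma> rT)"
    by (intro ext) (simp add: e entry_out_split[OF v(2)])
  finally show ?case .
qed

lemma den_drain_increment:
  assumes "r \<notin> {rC, rS, rF}" "\<sigma> rC = []" "\<sigma> rS = []" "\<sigma> rF = []"
  shows "den (Drain r (\<lambda>_. increment)) (\<sigma>, w) = {(\<sigma>(r := [], rC := rev (lbits (length (\<sigma> r)))), w)}"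
  using iter_increment[of \<sigma> r "\<sigma> r" 0 w] assms by simp

lemma den_do_answer:
  assumes "k \<le> length s" "p \<le> length s" "groups_ok (length s) G"
  shows "den do_answer (regs [] (prefix s p) (suffix s p) (prefix s k) (group_letters s G) [] Running y, w) =
    {(regs [] [] [] [] [] (map LOut (answer_out k p G)) Finishing y, w)}"
proof -
  let ?\<sigma> = "regs [] (prefix s p) (suffix s p) (prefix s k) (group_letters s G) [] Running y"
  let ?T1 = "rev (map LOut (OTok Match # num_out k @ num_out p))"
  let ?\<sigma>1 = "?\<sigma>(rK := [], rL := [], rT := ?T1)"
  have G: "\<forall>e \<in> set G. positions_le (length s) (snd e)" using assms(3) by (simp add: groups_ok_def)
  have 1: "den do_answer (?\<sigma>, w) =
     (\<Union>st \<in> (\<Union>st \<in> iter (\<lambda>x. den (put_entry x)) rG (group_letters s G) (?\<sigma>1, w).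
        den (take_top rFl (\<lambda>x. if x = None then Skip else put_counter)) st).
        den (clear rR ;; move rT rE ;; Pop rPh ;; Push rPh (LMark Finishing)) st)"
  proof -
    have s: "(\<Union>st \<in> S. \<Union>st' \<in> A st. B st') = (\<Union>st' \<in> (\<Union>st \<in> S. A st). B st')" for S A B by blast
    let ?\<sigma>m = "?\<sigma>(rT := [LOut (OTok Match)])"
    let ?\<sigma>a = "?\<sigma>m(rK := [], rC := rev (lbits k))"
    let ?\<sigma>b = "?\<sigma>a(rC := [], rT := rev (map LOut (num_out k)) @ ?\<sigma>a rT)"
    let ?\<sigma>c = "?\<sigma>b(rL := [], rC := rev (lbits p))"
    let ?\<sigma>d = "?\<sigma>c(rC := [], rT := rev (map LOut (num_out p)) @ ?\<sigma>c rT)"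
    have a: "den (Drain rK (\<lambda>_. increment)) (?\<sigma>m, w) = {(?\<sigma>a, w)}"
      using assms by (subst den_drain_increment) (simp_all add: min_absorb1)
    have b: "den put_counter (?\<sigma>a, w) = {(?\<sigma>b, w)}"
      by (subst den_put_counter[where n = k]) simp_all
    have c: "den (Drain rL (\<lambda>_. increment)) (?\<sigma>b, w) = {(?\<sigma>c, w)}"
      using assms by (subst den_drain_increment) (simp_all add: min_absorb1)
    have d: "den put_counter (?\<sigma>c, w) = {(?\<sigma>d, w)}"
      by (subst den_put_counter[where n = p]) simp_all
    have e: "?\<sigma>d = ?\<sigma>1"
      by (intro ext) simp
    have "den (Push rT (LOut (OTok Match))) (?\<sigma>, w) = {(?\<sigma>m, w)}"
      by (simp only: den.simps(3) fst_conv snd_conv regs_apply)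
    then have "den do_answer (?\<sigma>, w) = (\<Union>st \<in> den (Drain rG put_entry) (?\<sigma>d, w).
        den (take_top rFl (\<lambda>x. if x = None then Skip else put_counter) ;;
          clear rR ;; move rT rE ;; Pop rPh ;; Push rPh (LMark Finishing)) st)"
      unfolding do_answer_def by (simp only: den.simps(6) a b c d UN_insert UN_empty Un_empty_right)
    also have "den (Drain rG put_entry) (?\<sigma>d, w) =
        iter (\<lambda>x. den (put_entry x)) rG (group_letters s G) (?\<sigma>1, w)"
      unfolding e by simp
    finally show ?thesis unfolding den.simps(6) s .
  qed
  have 2: "(\<Union>st \<in> iter (\<lambda>x. den (put_entry x)) rG (group_letters s G) (?\<sigma>1, w).
        den (take_top rFl (\<lambda>x. if x = None then Skip else put_counter)) st) =
    {(?\<sigma>1(rG := [], rFl := [], rC := [],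
        rT := rev (map LOut ((if ?\<sigma>1 rFl = [] then [] else num_out 0) @ concat (map entry_out G))) @ ?\<sigma>1 rT), w)}"
    by (rule iter_put_entry[OF G]) simp_all
  show ?thesis
    unfolding 1 2
    by simp (rule regs_eqI; simp add: answer_out_def)
qed


section \<open>Steps of the program and steps of the abstract machine\<close>

fun phase_regs :: "'c list \<Rightarrow> 'c regex \<Rightarrow> 'c phase \<Rightarrow> 'c letter list \<Rightarrow> reg \<Rightarrow> 'c letter list" where
  "phase_regs s q (Start k) y =
     regs (regex_letters q) (prefix s k) (suffix s k) [] [] [] Starting y"
| "phase_regs s q (Matching k l p G) y =
     regs (concat (map (action_letters s) l)) (prefix s p) (suffix s p) (prefix s k)
       (group_letters s G) [] Running y"
| "phase_regs s q (Finish es) y = regs [] [] [] [] [] (map LOut es) Finishing y"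

lemma regex_letters_hd_char [simp]: "\<not> is_char (hd (regex_letters r))"
  using regex_letters_hd(4)[of r "[]"] by simp

lemma marks_not [simp]: "\<not> is_bit (LMark m)" "\<not> is_char (LMark m)"
  by (simp_all add: is_bit_def is_char_def)

lemma action_letters_hd [simp]:
  "action_letters s a \<noteq> []" "\<not> is_bit (hd (action_letters s a))"
  "\<not> is_char (hd (action_letters s a))"
  by (cases a; simp)+

lemma actions_hd:
  "concat (map (action_letters s) l) = [] \<or> \<not> is_bit (hd (concat (map (action_letters s) l)))"
  by (cases l) (simp_all del: action_letters.simps)

lemma actions_hd_char:
  "concat (map (action_letters s) l) = [] \<or> \<not> is_char (hd (concat (map (action_letters s) l)))"
  by (cases l) (simp_all del: action_letters.simps)

lemma regs_upd:
  "(regs a l r k g e ph y)(rA := a') = regs a' l r k g e ph y"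
  "(regs a l r k g e ph y)(rL := a') = regs a a' r k g e ph y"
  "(regs a l r k g e ph y)(rR := a') = regs a l a' k g e ph y"
  "(regs a l r k g e ph y)(rE := a') = regs a l r k g a' ph y"
  "(regs a l r k g e ph y)(rK := a') = regs a l r a' g e ph y"
  "(regs a l r k g e ph y)(rPh := [LMark ph']) = regs a l r k g e ph' y"
  "(regs a l r k g e ph y)(rY := a') = regs a l r k g e ph a'"
  by (intro regs_eqI; simp)+

lemma den_do_action:
  assumes "l \<noteq> []" "p \<le> length s" "groups_ok (length s) G" "\<forall>a \<in> set l. bound_free a"
  shows "den (take_top rA (\<lambda>x. case x of None \<Rightarrow> Fail | Some x \<Rightarrow> do_action W x b))
      (phase_regs s q (Matching k l p G) y, w) =
    (case lstep W s (l, p, G) b of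
       None \<Rightarrow> {}
     | Some (l', p', G') \<Rightarrow> {(phase_regs s q (Matching k l' p' G') y, w)})"
proof -
  have d: "distinct (map fst G)" using assms(3) by (simp add: groups_ok_def)
  show ?thesis
  proof (cases "(W, s, (l, p, G), b)" rule: lstep.cases)
    case (1 W' s' p' G' b')
    then show ?thesis using assms by simp
  next
    case (2 W' s' j l1 p' G' b')
    then show ?thesis
      using assms den_do_check[OF assms(2) actions_hd_char]
      by (simp add: do_action_def regs_upd)
  next
    case (3 W' s' g l1 p' G' b')
    then show ?thesis
      using den_do_close[OF assms(3) actions_hd]
      by (simp add: do_action_def regs_upd split: group_state.split)
  next
    case (4 W' s' l1 p' G' b')
    then show ?thesis by (simp add: do_action_def regs_upd)
  next
    case (5 W' s' cd l1 p' G' b')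
    then show ?thesis by (simp add: do_action_def regs_upd den_do_chars)
  next
    case (6 W' s' r1 r2 l1 p' G' b')
    then show ?thesis
      by (simp add: do_action_def regs_upd den_do_alt[OF actions_hd])
  next
    case (7 W' s' r1 r2 l1 p' G' b')
    then show ?thesis by (simp add: do_action_def regs_upd)
  next
    case (8 W' s' r m dd greedy l1 p' G' b')
    have "m = 0" "distinct (map fst G')" using assms(4) d 8 by simp_all
    then show ?thesis
      using 8 by (simp add: do_action_def regs_upd den_do_quant[OF _ actions_hd])
  next
    case (9 W' s' g r l1 p' G' b')
    then show ?thesis
      using den_do_group[OF assms(3) actions_hd]
      by (simp add: do_action_def regs_upd)
  next
    case (10 W' s' a l1 p' G' b')
    then show ?thesis
      using den_do_anchor[OF assms(2)] by (simp add: do_action_def regs_upd)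
  next
    case (11 W' s' g l1 p' G' b')
    then show ?thesis
      using den_do_backref[OF assms(3) actions_hd]
      by (simp add: do_action_def regs_upd Let_def split: group_state.split)
  qed
qed

text \<open>All choices have been made in the guess, so a step of the program either fails or has a
  single result.\<close>

theorem den_body:
  assumes "phase_ok (length s) ph"
  shows "den (body W (LOut y)) (phase_regs s q ph ys, w) =
    (case astep W s q ph y of None \<Rightarrow> {} | Some ph' \<Rightarrow> {(phase_regs s q ph' ys, w)})"
proof (cases ph)
  case (Start k)
  show ?thesis
  proof (cases "k < length s")
    case True
    then have "suffix s k = LTok (TChar (s ! k)) # suffix s (k + 1)"
      "prefix s (k + 1) = LTok (TChar (s ! k)) # prefix s k"
      by (simp_all add: suffix_def prefix_def Cons_nth_drop_Suc[symmetric] take_Suc_conv_app_nth)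
    then show ?thesis using True by (simp add: Start body_def do_start_def regs_upd)
  next
    case False
    then have "suffix s k = []" by (simp add: suffix_def)
    then show ?thesis
      using False by (simp add: Start body_def do_start_def regs_upd)
  qed
next
  case (Matching k l p G)
  then have ok: "k \<le> length s" "p \<le> length s" "groups_ok (length s) G" "\<forall>a \<in> set l. bound_free a"
    using assms by auto
  show ?thesis
  proof (cases l)
    case Nil
    then show ?thesis
      using den_do_answer[OF ok(1-3)]
      by (simp add: Matching body_def do_run_def regs_upd)
  next
    case (Cons a l')
    have "action_letters s a \<noteq> []" by (cases a) auto
    then obtain x xs where x: "concat (map (action_letters s) l) = x # xs"
      using Cons by (cases "action_letters s a") auto
    have l: "l \<noteq> []" using Cons by simp
    show ?thesis
      using den_do_action[OF l ok(2-4), of W "y = Hi" q k ys w] l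
      by (cases "lstep W s (l, p, G) (y = Hi)"; cases y)
        (simp_all add: Matching body_def do_run_def x split: prod.split)
  qed
next
  case (Finish es)
  then show ?thesis
    by (cases es) (auto simp: body_def do_finish_def regs_upd)
qed


subsection \<open>Growth of the programs\<close>

lemma grows_by_unset_flag: "grows_by unset_flag b"
  unfolding unset_flag_def by (intro grows_by_take_top) (simp_all add: grows_by_Skip grows_by_Push)

lemma grows_by_compare_step: "grows_by (compare_step x) 1"
  unfolding compare_step_def
proof (rule grows_by_Then[of _ 1 _ 0])
  show "grows_by (take_top rQ (\<lambda>y. case y of None \<Rightarrow> unset_flag
     | Some y \<Rightarrow> if y = x then Push rQ2 y else Push rQ y ;; unset_flag)) 0"
    by (intro grows_by_take_top)
      (auto simp: grows_by_unset_flag intro!: grows_by_Push grows_by_Then[of _ 1 _ 0])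
qed (auto intro: grows_by_Push)

lemma keeps_compare_step: "keeps rS (compare_step x)"
  by (auto simp: compare_step_def unset_flag_def split: option.splits)

lemma grows_by_compare_ids: "grows_by compare_ids b"
  unfolding compare_ids_def
  by (rule grows_by_mono[of _ 0])
    (auto intro!: grows_by_Then[of _ 0 _ 0] grows_by_Drain grows_by_compare_step grows_by_Peek
      grows_by_Skip grows_by_unset_flag grows_by_move keeps_compare_step)

text \<open>The kind letter popped from \<open>rB2\<close> pays for pushing it again, so nothing is
  gained. Thus \<open>take_step\<close> grows by 1 only, which is the amount at which the loop over
  \<open>rG\<close> does not grow the store.\<close>

lemma grows_by_flush_entry: "grows_by flush_entry b"
proof -
  have 1: "grows_by (clear rS2 ;; Push rW k ;; move rB2 rW) 1" for k :: "'a letter"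
    by (rule grows_by_Then[OF grows_by_clear[where b = 0] grows_by_Then[OF grows_by_Push[where b = 1]
        grows_by_move[where b = 0], where b = 1]]) simp_all
  have 2: "grows_by (Push rH k ;; move rS2 rH ;; move rB2 rH) 1" for k :: "'a letter"
    by (rule grows_by_Then[OF grows_by_Push[where b = 1] grows_by_Then[OF grows_by_move[where b = 0]
        grows_by_move[where b = 0], where b = 0]]) simp_all
  have 3: "grows_by (take_top rF (\<lambda>x. if x = None then Skip else Push rF (LMark Yes))) 0"
    by (intro grows_by_take_top) (simp_all add: grows_by_Skip grows_by_Push)
  have 4: "grows_by (Peek rF (\<lambda>f. if f = Some (LMark Yes) then clear rS2 ;; Push rW k ;; move rB2 rW
         else Push rH k ;; move rS2 rH ;; move rB2 rH)) 1" for k :: "'a letter"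
    using 1 2 by (intro grows_by_Peek grows_by_if)
  have 5: "grows_by (split_off is_bit rB2 rS rX ;;
       take_top rF (\<lambda>x. if x = None then Skip else Push rF (LMark Yes)) ;;
       compare_ids ;;
       Peek rF (\<lambda>f. if f = Some (LMark Yes) then clear rS2 ;; Push rW k ;; move rB2 rW
         else Push rH k ;; move rS2 rH ;; move rB2 rH)) (Suc 0)" for k :: "'a letter"
    by (rule grows_by_Then[OF grows_by_split_off[where b = 0] grows_by_Then[OF 3
        grows_by_Then[OF grows_by_compare_ids[where b = 0] 4, where b = 1], where b = 1]]) simp_all
  have 6: "grows_by (take_top rB2 (\<lambda>k. case k of None \<Rightarrow> Skip | Some k \<Rightarrow>
       split_off is_bit rB2 rS rX ;;
       take_top rF (\<lambda>x. if x = None then Skip else Push rF (LMark Yes)) ;;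
       compare_ids ;;
       Peek rF (\<lambda>f. if f = Some (LMark Yes) then clear rS2 ;; Push rW k ;; move rB2 rW
         else Push rH k ;; move rS2 rH ;; move rB2 rH)) :: 'a prog) 0"
    by (rule grows_by_take_top, unfold option.case, rule grows_by_Skip, rule 5)
  have 7: "grows_by (move rB rB2 ;; take_top rB2 (\<lambda>k. case k of None \<Rightarrow> Skip | Some k \<Rightarrow>
       split_off is_bit rB2 rS rX ;;
       take_top rF (\<lambda>x. if x = None then Skip else Push rF (LMark Yes)) ;;
       compare_ids ;;
       Peek rF (\<lambda>f. if f = Some (LMark Yes) then clear rS2 ;; Push rW k ;; move rB2 rW
         else Push rH k ;; move rS2 rH ;; move rB2 rH)) :: 'a prog) 0"
    by (rule grows_by_Then[OF grows_by_move[where b = 0] 6]) simp_all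
  have "grows_by (flush_entry :: 'a prog) 0"
    unfolding flush_entry_def by (intro grows_by_Peek grows_by_if grows_by_Skip 7)
  then show ?thesis by (rule grows_by_mono) simp
qed

lemma keeps_flush [simp]: "keeps rG flush_entry"
  by (auto simp: flush_entry_def compare_ids_def compare_step_def unset_flag_def split: option.splits)

lemma grows_by_take_step: "grows_by (take_step x) 1"
  unfolding take_step_def
  by (intro grows_by_Then[of _ 0 _ 1] grows_by_if grows_by_flush_entry grows_by_Skip grows_by_Push) auto

lemma keeps_take_step: "keeps rG (take_step x)"
  by (simp add: take_step_def)

lemma grows_by_take_out: "grows_by take_out 1"
  unfolding take_out_def
  by (intro grows_by_Then[of _ 1 _ 0] grows_by_Then[of _ 0 _ 0] grows_by_Push grows_by_Drain
      grows_by_take_step keeps_take_step grows_by_flush_entry grows_by_clear grows_by_move) auto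

lemma grows_by_adjust: "grows_by (adjust x) 1"
  by (auto simp: adjust_def grows_by_Pop grows_by_Push grows_by_Skip split: letter.split token.split)

lemma grows_by_parse_step: "grows_by (parse_step x) 2"
  unfolding parse_step_def
  by (intro grows_by_Peek grows_by_if grows_by_Then[of _ 1 _ 1] grows_by_Push grows_by_adjust) auto

lemma keeps_parse_step: "keeps rA (parse_step x)"
  by (auto simp: parse_step_def adjust_def split: letter.split token.split)

lemma linear_take_regex: "grows_linearly take_regex"
  unfolding take_regex_def
  by (intro grows_linearly_Then grows_linearly_by[OF grows_by_Push[where b = 1]]
      grows_linearly_Drain[where b = 2] grows_by_parse_step keeps_parse_step
      grows_linearly_by[OF grows_by_move[where b = 0]]) auto

lemma grows_by_put_counter: "grows_by put_counter 1"
proof -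
  have "grows_by (put_bit x) 1" for x :: "'a letter"
    by (auto simp: put_bit_def grows_by_Push grows_by_Skip split: letter.split)
  moreover have "keeps rS (put_bit x)" for x :: "'a letter"
    by (auto simp: put_bit_def split: letter.split)
  ultimately have "grows_by (Drain rS put_bit :: 'a prog) 0" by (rule grows_by_Drain)
  then show ?thesis
    unfolding put_counter_def
    by (intro grows_by_Then[OF grows_by_Push[where b = 1] grows_by_Then[OF grows_by_move[where b = 0]]])
      simp_all
qed

lemma keeps_carry_step: "keeps rC (carry_step x)" "keeps rD (borrow_step x)"
  by (simp_all add: carry_step_def borrow_step_def)

lemma grows_by_carry_step: "grows_by (carry_step x) 1" "grows_by (borrow_step x) 1"
  unfolding carry_step_def borrow_step_def
  by (intro grows_by_Peek grows_by_if grows_by_Then[of _ 0 _ 1] grows_by_Push grows_by_Pop; simp)+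

lemma grows_by_increment: "grows_by increment 1"
proof -
  have "grows_by (take_top rF (\<lambda>f. if f = None then Skip else Push rS (LBit True)) :: 'a prog) 0"
    by (intro grows_by_take_top) (simp_all add: grows_by_Skip grows_by_Push)
  then show ?thesis
    unfolding increment_def
    by (intro grows_by_Then[OF grows_by_Push[where b = 1] grows_by_Then[OF grows_by_Drain[where b = 0]
        grows_by_Then[OF _ grows_by_move[where b = 0]]]])
      (simp_all add: keeps_carry_step grows_by_carry_step[unfolded One_nat_def])
qed

lemma linear_decrement: "grows_linearly (decrement :: 'c :: finite prog)"
  unfolding decrement_def
  by (intro grows_linearly_Then grows_linearly_Peek grows_linearly_if
      grows_linearly_by[OF grows_by_Push[where b = 1]] grows_linearly_by[OF grows_by_Pop[where b = 0]]
      grows_linearly_by[OF grows_by_Skip[where b = 0]]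
      grows_linearly_by[OF grows_by_Drain[where b = 0]] keeps_carry_step grows_by_carry_step
      grows_linearly_by[OF grows_by_move[where b = 0]] grows_linearly_by[OF grows_by_clear[where b = 0]])
    simp_all

lemma keeps_others:
  "r \<in> {rG, rT, rY, rK, rL} \<Longrightarrow> keeps r increment"
  "keeps rG put_counter" "keeps rY put_counter" "keeps rT take_out" "keeps rY take_out"
  "keeps rY take_regex" "keeps rY decrement"
  by (auto simp: increment_def carry_step_def put_counter_def put_bit_def take_out_def take_step_def
      flush_entry_def compare_ids_def compare_step_def unset_flag_def take_regex_def parse_step_def
      adjust_def decrement_def borrow_step_def split: option.split letter.split token.split)

lemma grows_by_put_entry: "grows_by (put_entry x) 3" and keeps_put_entry: "keeps rG (put_entry x)"
  and keeps_put_entry': "keeps rY (put_entry x)"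
proof -
  have "grows_by (start_entry t :: 'a prog) 3" for t
  proof -
    have "grows_by (Peek rFl (\<lambda>x. if x = None then Push rFl (LMark Tick) else put_counter) :: 'a prog) 1"
      by (intro grows_by_Peek grows_by_if grows_by_Push grows_by_put_counter) simp
    then show ?thesis
      unfolding start_entry_def
      by (rule grows_by_Then[OF _ grows_by_Then[OF grows_by_Push[where b = 1] grows_by_Push[where b = 1],
          where b = 2]]) simp_all
  qed
  moreover have "grows_by (put_counter :: 'a prog) 3" "grows_by (increment :: 'a prog) 3"
    by (rule grows_by_mono[OF grows_by_put_counter] grows_by_mono[OF grows_by_increment]; simp)+
  ultimately show "grows_by (put_entry x) 3"
    by (auto simp: put_entry_def put_bit_def intro!: grows_by_Push split: letter.split mark.split)
  show "keeps rG (put_entry x)" "keeps rY (put_entry x)"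
    by (auto simp: put_entry_def start_entry_def put_bit_def keeps_others split: letter.split mark.split)
qed

lemma grows_by_reset_step: "grows_by (reset_step x) 3"
proof -
  have *: "grows_by (if is_bit x then Push rP x
      else if x = LTok TGroup then move rP rQ ;; take_out ;; clear rV ;; clear rQ
      else clear rP) 1"
    by (intro grows_by_if grows_by_Push grows_by_clear grows_by_Then[OF grows_by_move[where b = 0]
        grows_by_Then[OF grows_by_take_out grows_by_Then[OF grows_by_clear[where b = 0]
          grows_by_clear[where b = 0], where b = 0], where b = 1]])
      simp_all
  show ?thesis
    unfolding reset_step_def
    by (rule grows_by_Then[OF grows_by_Push[where b = 1] grows_by_Then[OF grows_by_Push[where b = 1] *,
        where b = 2]]) simp_all
qed

lemma keeps_reset_step: "keeps rT (reset_step x)" "keeps rY (reset_step x)"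
  by (simp_all add: reset_step_def keeps_others)

lemmas linear_basic =
  grows_linearly_by[OF grows_by_Skip[where b = 0]] grows_linearly_by[OF grows_by_Fail[where b = 0]]
  grows_linearly_by[OF grows_by_Push[where b = 1]] grows_linearly_by[OF grows_by_Pop[where b = 0]]
  grows_linearly_by[OF grows_by_move[where b = 0]] grows_linearly_by[OF grows_by_clear[where b = 0]]
  grows_linearly_by[OF grows_by_split_off[where b = 0]] grows_linearly_by[OF grows_by_take_out]
  grows_linearly_by[OF grows_by_put_counter] grows_linearly_copy grows_linearly_dup
  linear_take_regex linear_decrement

lemma linear_do_iterate: "grows_linearly (do_iterate greedy t)"
  unfolding do_iterate_def
  by (intro grows_linearly_Then linear_basic grows_linearly_Drain[OF grows_by_reset_step keeps_reset_step(1)]) simp_all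

text \<open>A bound for a single step is enough, because the size of the store before each step is
  controlled by \<open>tot_phase_regs\<close>.\<close>

lemma linear_body:
  fixes W :: "'a :: finite set"
  shows "grows_linearly (body W x)"
proof -
  have drain: "grows_linearly (Drain r (\<lambda>_. Pop r') :: 'a prog)" if "r \<noteq> r'" for r r'
    by (rule grows_linearly_Drain[where b = 1]) (use that in \<open>auto intro: grows_by_Pop\<close>)
  have incr: "grows_linearly (Drain r (\<lambda>_. increment) :: 'a prog)" if "r \<in> {rK, rL}" for r
    by (rule grows_linearly_Drain[OF grows_by_increment]) (use that in \<open>auto simp: keeps_others\<close>)
  have "grows_by (match_char c :: 'a prog) 0" "keeps rU (match_char c :: 'a prog)" for c
    unfolding match_char_def
    by (auto intro!: grows_by_take_top simp: grows_by_Fail grows_by_Push)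
  then have mch: "grows_linearly (Drain rU match_char :: 'a prog)" by (rule grows_linearly_Drain)
  have ent: "grows_linearly (Drain rG put_entry :: 'a prog)"
    by (rule grows_linearly_Drain[OF grows_by_put_entry keeps_put_entry])
  note intros = grows_linearly_Then grows_linearly_Peek grows_linearly_if grows_linearly_take_top
    linear_basic drain incr mch ent linear_do_iterate
  have act: "grows_linearly (do_action W x b :: 'a prog)" for x b
    unfolding do_action_def do_check_def do_close_def do_chars_def do_alt_def do_group_def
      do_backref_def do_quant_def do_anchor_def
    by (auto intro!: intros split: letter.split token.split mark.split option.split)
  have "grows_linearly (do_answer :: 'a prog)"
    unfolding do_answer_def by (intro intros) simp_all
  then show ?thesis
    unfolding body_def do_start_def do_run_def do_finish_def
    by (auto intro!: intros act split: letter.split option.split)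
qed

lemma keeps_body: "keeps rY (body W x)"
  by (auto simp: body_def do_start_def do_run_def do_finish_def do_action_def do_check_def do_close_def
      do_chars_def do_alt_def do_group_def do_backref_def do_quant_def do_anchor_def do_answer_def
      match_char_def do_iterate_def keeps_others keeps_put_entry' keeps_reset_step
      split: letter.split token.split mark.split option.split)

lemma wf_body: "wf_cmd (body W x)"
proof -
  have [simp]: "wf_cmd (take_out :: 'a prog)"
    by (auto simp: take_out_def take_step_def flush_entry_def compare_ids_def compare_step_def
        unset_flag_def split: option.split)
  have [simp]: "wf_cmd (take_regex :: 'a prog)" "wf_cmd (decrement :: 'a prog)"
    "wf_cmd (increment :: 'a prog)" "wf_cmd (put_counter :: 'a prog)"
    by (auto simp: take_regex_def parse_step_def adjust_def decrement_def borrow_step_def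
        increment_def carry_step_def put_counter_def put_bit_def split: letter.split token.split)
  have [simp]: "wf_cmd (put_entry x :: 'a prog)" "wf_cmd (reset_step x :: 'a prog)" for x
    by (auto simp: put_entry_def start_entry_def put_bit_def reset_step_def split: letter.split mark.split)
  show ?thesis
    by (auto simp: body_def do_start_def do_run_def do_finish_def do_action_def do_check_def do_close_def
      do_chars_def do_alt_def do_group_def do_backref_def do_quant_def do_anchor_def do_answer_def
      match_char_def do_iterate_def keeps_others keeps_put_entry keeps_reset_step
      split: letter.split token.split mark.split option.split)
qed


section \<open>Runs of the abstract machine\<close>

primrec lrun :: "'c set \<Rightarrow> 'c list \<Rightarrow> 'c action list \<times> nat \<times> groups \<Rightarrow> bool list \<Rightarrow>
  ('c action list \<times> nat \<times> groups) option" where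
  "lrun W s st [] = Some st"
| "lrun W s st (b # bs) = (case lstep W s st b of None \<Rightarrow> None | Some st' \<Rightarrow> lrun W s st' bs)"

text \<open>A word is not comparable with its proper extensions. This does no harm, as a complete
  run never extends another: no step leads out of the empty list of actions.\<close>

definition lex_less :: "bool list \<Rightarrow> bool list \<Rightarrow> bool" where
  "lex_less bs bs' \<longleftrightarrow> (\<exists>u v v'. bs = u @ False # v \<and> bs' = u @ True # v')"

lemma lex_less_Cons: "lex_less bs bs' \<Longrightarrow> lex_less (b # bs) (b # bs')"
  unfolding lex_less_def by (metis append_Cons)

lemma lex_less_False_True: "lex_less (False # bs) (True # bs')"
  unfolding lex_less_def by (metis append_Nil)

text \<open>
  \<^term>\<open>best_run W s st L\<close> states that the complete runs from \<^term>\<open>st\<close> are those of a backtracking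
  tree with leaves \<^term>\<open>L\<close>, as far as existence and the leaf of highest priority are concerned.
\<close>

definition best_run :: "'c set \<Rightarrow> 'c list \<Rightarrow> 'c action list \<times> nat \<times> groups \<Rightarrow> (nat \<times> group_map) list \<Rightarrow> bool" where
  "best_run W s st L \<longleftrightarrow>
     (if L = [] then \<forall>bs p G. lrun W s st bs \<noteq> Some ([], p, G)
      else \<exists>bs p G. lrun W s st bs = Some ([], p, G) \<and> hd L = (p, lookup G) \<and>
        (\<forall>bs' p' G'. lrun W s st bs' = Some ([], p', G') \<longrightarrow> bs' = bs \<or> lex_less bs bs'))"

lemma best_runI:
  assumes "L \<noteq> []" "lrun W s st bs = Some ([], p, G)" "hd L = (p, lookup G)"
    "\<And>bs' p' G'. lrun W s st bs' = Some ([], p', G') \<Longrightarrow> bs' = bs \<or> lex_less bs bs'"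
  shows "best_run W s st L"
proof -
  have "lrun W s st bs = Some ([], p, G) \<and> hd L = (p, lookup G) \<and>
      (\<forall>bs' p' G'. lrun W s st bs' = Some ([], p', G') \<longrightarrow> bs' = bs \<or> lex_less bs bs')"
    using assms(2-4) by blast
  then show ?thesis unfolding best_run_def if_not_P[OF assms(1)] by blast
qed

lemma best_run_Nil: "best_run W s ([], p, G) [(p, lookup G)]"
proof -
  have "bs = []" if "lrun W s ([], p, G) bs = Some ([], p', G')" for bs p' G'
    using that by (cases bs) auto
  moreover have "lrun W s ([], p, G) [] = Some ([], p, G)" by simp
  ultimately show ?thesis unfolding best_run_def by (simp del: lrun.simps) blast
qed

lemma lrun_nonempty: "fst st \<noteq> [] \<Longrightarrow> lrun W s st bs = Some ([], p, G) \<Longrightarrow>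
  \<exists>b bs' st'. bs = b # bs' \<and> lstep W s st b = Some st' \<and> lrun W s st' bs' = Some ([], p, G)"
  by (cases bs) (auto split: option.splits)

lemma best_run_stuck:
  assumes "fst st \<noteq> []" "\<And>b. lstep W s st b = None"
  shows "best_run W s st []"
  using assms lrun_nonempty[OF assms(1)] by (fastforce simp: best_run_def)

lemma best_run_step:
  assumes ne: "fst st \<noteq> []" and F: "lstep W s st False = Some st1" and T: "lstep W s st True = None"
    and best: "best_run W s st1 L"
  shows "best_run W s st L"
proof (cases "L = []")
  case True
  have "lrun W s st bs \<noteq> Some ([], p, G)" for bs p G
  proof
    assume "lrun W s st bs = Some ([], p, G)"
    then obtain b bs' st' where "lstep W s st b = Some st'" "lrun W s st' bs' = Some ([], p, G)"
      using lrun_nonempty[OF ne] by blast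
    then show False using best F T True by (cases b) (auto simp: best_run_def)
  qed
  then show ?thesis using True by (simp add: best_run_def)
next
  case False
  then obtain bs p G where b: "lrun W s st1 bs = Some ([], p, G)" "hd L = (p, lookup G)"
    "\<And>bs' p' G'. lrun W s st1 bs' = Some ([], p', G') \<Longrightarrow> bs' = bs \<or> lex_less bs bs'"
    using best by (auto simp: best_run_def)
  have "bs' = False # bs \<or> lex_less (False # bs) bs'" if "lrun W s st bs' = Some ([], p', G')" for bs' p' G'
  proof -
    obtain b' bs1 st' where "bs' = b' # bs1" "lstep W s st b' = Some st'" "lrun W s st' bs1 = Some ([], p', G')"
      using lrun_nonempty[OF ne \<open>lrun W s st bs' = Some ([], p', G')\<close>] by blast
    then show ?thesis using b(3) F T by (cases b') (auto intro: lex_less_Cons)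
  qed
  moreover have "lrun W s st (False # bs) = Some ([], p, G)" using b(1) F by simp
  ultimately show ?thesis using b(2) False by (intro best_runI)
qed

text \<open>Runs through the first branch precede all runs through the second, just as the head of
  \<open>L1 @ L2\<close> comes from \<open>L2\<close> only if \<open>L1\<close> is empty.\<close>

lemma best_run_choice:
  assumes ne: "fst st \<noteq> []" and F: "lstep W s st False = Some st1" and T: "lstep W s st True = Some st2"
    and best1: "best_run W s st1 L1" and best2: "best_run W s st2 L2"
  shows "best_run W s st (L1 @ L2)"
proof -
  have inv: "\<exists>b bs1. bs = b # bs1 \<and> lrun W s (if b then st2 else st1) bs1 = Some ([], p, G)"
    if "lrun W s st bs = Some ([], p, G)" for bs p G
  proof -
    obtain b bs' st' where "bs = b # bs'" "lstep W s st b = Some st'"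
      "lrun W s st' bs' = Some ([], p, G)"
      using lrun_nonempty[OF ne \<open>lrun W s st bs = Some ([], p, G)\<close>] by blast
    then show ?thesis using F T by (cases b) auto
  qed
  consider "L1 = []" "L2 = []" | "L1 \<noteq> []" | "L1 = []" "L2 \<noteq> []" by blast
  then show ?thesis
  proof cases
    case 1
    then have "lrun W s (if b then st2 else st1) bs \<noteq> Some ([], p, G)" for b bs p G
      using best1 best2 by (auto simp: best_run_def)
    then show ?thesis using 1 inv unfolding best_run_def by auto
  next
    case 2
    then obtain bs p G where b: "lrun W s st1 bs = Some ([], p, G)" "hd L1 = (p, lookup G)"
      "\<And>bs' p' G'. lrun W s st1 bs' = Some ([], p', G') \<Longrightarrow> bs' = bs \<or> lex_less bs bs'"
      using best1 by (auto simp: best_run_def)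
    have "bs' = False # bs \<or> lex_less (False # bs) bs'" if r: "lrun W s st bs' = Some ([], p', G')" for bs' p' G'
    proof -
      obtain b' bs1 where "bs' = b' # bs1" "lrun W s (if b' then st2 else st1) bs1 = Some ([], p', G')"
        using inv[OF r] by blast
      then show ?thesis
        using b(3) by (cases b') (auto intro: lex_less_Cons lex_less_False_True)
    qed
    moreover have "lrun W s st (False # bs) = Some ([], p, G)" using b(1) F by simp
    ultimately show ?thesis using b(2) 2 by (intro best_runI) auto
  next
    case 3
    then obtain bs p G where b: "lrun W s st2 bs = Some ([], p, G)" "hd L2 = (p, lookup G)"
      "\<And>bs' p' G'. lrun W s st2 bs' = Some ([], p', G') \<Longrightarrow> bs' = bs \<or> lex_less bs bs'"
      using best2 by (auto simp: best_run_def)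
    have no: "lrun W s st1 bs' \<noteq> Some ([], p', G')" for bs' p' G'
      using best1 3 by (simp add: best_run_def)
    have "bs' = True # bs \<or> lex_less (True # bs) bs'" if r: "lrun W s st bs' = Some ([], p', G')" for bs' p' G'
    proof -
      obtain b' bs1 where "bs' = b' # bs1" "lrun W s (if b' then st2 else st1) bs1 = Some ([], p', G')"
        using inv[OF r] by blast
      then show ?thesis
        using b(3)[of bs1 p' G'] no by (cases b') (auto intro: lex_less_Cons)
    qed
    moreover have "lrun W s st (True # bs) = Some ([], p, G)" using b(1) T by simp
    ultimately show ?thesis using b(2) 3 by (intro best_runI) auto
  qed
qed

lemma map_of_filter_fst: "map_of (filter (\<lambda>e. P (fst e)) G) g = (if P g then map_of G g else None)"
  by (induction G) auto

lemma lookup_update: "lookup ((g, v) # without g G) = (lookup G)(g := v)"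
  by (rule ext) (simp add: lookup_def without_def map_of_filter_fst[where P = "\<lambda>h. h \<noteq> g"])

lemma lookup_reset: "lookup (filter (\<lambda>e. fst e \<notin> set (groups r)) G) = reset r (lookup G)"
  by (rule ext) (simp add: lookup_def reset_def map_of_filter_fst[where P = "\<lambda>h. h \<notin> set (groups r)"])

text \<open>Induction along the recursion of \<open>leaves\<close>. The list \<open>G\<close> is
  generalised, since different lists represent the same group map and a step may rearrange the
  list.\<close>

lemma leaves_best_run:
  "\<gamma> = lookup G \<Longrightarrow> \<forall>a \<in> set l. bound_free a \<Longrightarrow> best_run W s (l, p, G) (leaves W s l p \<gamma>)"
proof (induction W s l p \<gamma> arbitrary: G rule: leaves.induct)
  case (1 W s p \<gamma>)
  then show ?case by (simp add: best_run_Nil)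
next
  case (2 W s k l p \<gamma>)
  then show ?case by (auto intro!: best_run_stuck intro: best_run_step)
next
  case (3 W s g l p \<gamma>)
  show ?case
  proof (cases "lookup G g")
    case (Opened a)
    have "best_run W s (l, p, (g, Closed a p) # without g G) (leaves W s l p (\<gamma>(g := Closed a p)))"
      by (rule "3.IH") (use 3 Opened in \<open>auto simp: lookup_update\<close>)
    then show ?thesis using Opened 3 by (auto intro: best_run_step)
  qed (use 3 in \<open>auto intro!: best_run_stuck\<close>)
next
  case (4 W s l p \<gamma>)
  then show ?case by (auto intro: best_run_step)
next
  case (5 W s cd l p \<gamma>)
  then show ?case by (auto intro!: best_run_stuck intro: best_run_step)
next
  case (6 W s r1 r2 l p \<gamma>)
  have "best_run W s (Regex r1 # l, p, G) (leaves W s (Regex r1 # l) p \<gamma>)"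
    "best_run W s (Regex r2 # l, p, G) (leaves W s (Regex r2 # l) p \<gamma>)"
    using 6 by auto
  then show ?case by (auto intro: best_run_choice)
next
  case (7 W s r1 r2 l p \<gamma>)
  then have "best_run W s (Regex r1 # Regex r2 # l, p, G) (leaves W s (Regex r1 # Regex r2 # l) p \<gamma>)"
    by auto
  then show ?case by (auto intro: best_run_step)
next
  case (8 W s r m d greedy l p \<gamma>)
  have m: "m = 0" using 8 by simp
  show ?case
  proof (cases "d = 0")
    case True
    then have "best_run W s (l, p, G) (leaves W s l p \<gamma>)" using 8 m by auto
    then show ?thesis using True m by (auto intro: best_run_step)
  next
    case False
    let ?l = "Regex r # Acheck p # Regex (Quant r 0 (d - 1) greedy) # l"
    let ?G = "filter (\<lambda>e. fst e \<notin> set (groups r)) G"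
    have skip: "best_run W s (l, p, G) (leaves W s l p \<gamma>)" using 8 m False by auto
    have iter: "best_run W s (?l, p, ?G) (leaves W s ?l p (reset r \<gamma>))"
      by (rule "8.IH"(3)) (use "8.prems" m False in \<open>auto simp: lookup_reset\<close>)
    show ?thesis
    proof (cases greedy)
      case True
      then show ?thesis
        using best_run_choice[OF _ _ _ iter skip, of "(Regex (Quant r m d greedy) # l, p, G)"] m False
        by (simp add: Let_def)
    next
      case greedy: False
      then show ?thesis
        using best_run_choice[OF _ _ _ skip iter, of "(Regex (Quant r m d greedy) # l, p, G)"] m False
        by (simp add: Let_def)
    qed
  qed
next
  case (9 W s g r l p \<gamma>)
  have "best_run W s (Regex r # Aclose g # l, p, (g, Opened p) # without g G)
      (leaves W s (Regex r # Aclose g # l) p (\<gamma>(g := Opened p)))"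
    by (rule "9.IH") (use 9 in \<open>auto simp: lookup_update\<close>)
  then show ?case by (auto intro: best_run_step)
next
  case (10 W s a l p \<gamma>)
  then show ?case by (auto intro!: best_run_stuck intro: best_run_step)
next
  case (11 W s g l p \<gamma>)
  show ?case
  proof (cases "lookup G g")
    case Undefined
    then have "best_run W s (l, p, G) (leaves W s l p \<gamma>)" using 11 by auto
    then show ?thesis using Undefined 11 by (auto intro: best_run_step)
  next
    case (Opened a)
    have "lookup ((g, Opened a) # without g G) = \<gamma>"
      using Opened 11 by (auto simp: lookup_update)
    then have "best_run W s (l, p, (g, Opened a) # without g G) (leaves W s l p \<gamma>)"
      by (intro "11.IH"(2)) (use 11 Opened in auto)
    then show ?thesis using Opened 11 by (auto intro: best_run_step)
  next
    case (Closed a b)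
    define w where "w = take (b - a) (drop a s)"
    show ?thesis
    proof (cases "take (length w) (drop p s) = w")
      case True
      have lk: "lookup ((g, Closed a b) # without g G) = \<gamma>"
        using Closed 11 by (auto simp: lookup_update)
      have "best_run W s (l, p + length w, (g, Closed a b) # without g G) (leaves W s l (p + length w) \<gamma>)"
        by (rule "11.IH"(3)[of a b w]) (use lk "11.prems" Closed True in \<open>simp_all add: w_def\<close>)
      moreover have "lstep W s (Regex (Backref g) # l, p, G) False =
          Some (l, p + length w, (g, Closed a b) # without g G)"
        using Closed True by (simp add: w_def Let_def)
      moreover have "leaves W s (Regex (Backref g) # l) p \<gamma> = leaves W s l (p + length w) \<gamma>"
        using Closed True "11.prems" by (simp add: w_def Let_def)
      ultimately show ?thesis by (auto intro: best_run_step)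
    next
      case False
      then have "lstep W s (Regex (Backref g) # l, p, G) b' = None" for b'
        using Closed by (simp add: w_def Let_def)
      moreover have "leaves W s (Regex (Backref g) # l) p \<gamma> = []"
        using Closed False "11.prems" by (simp add: w_def Let_def)
      ultimately show ?thesis by (auto intro: best_run_stuck)
    qed
  qed
qed


subsection \<open>Bounds\<close>

text \<open>Two quantities are bounded at once: the weight limits the number of steps without
  consumption of input, the number of letters the space.\<close>

definition regex_cost :: "'c regex \<Rightarrow> nat" where
  "regex_cost r = regex_weight r + length (regex_letters r)"

text \<open>Weight plus letters again: a close or check action has weight 1 and consists of a mark
  followed by an identifier or by at most \<open>n\<close> letters.\<close>

fun action_cost :: "nat \<Rightarrow> 'c action \<Rightarrow> nat" where
  "action_cost n (Regex r) = regex_cost r"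
| "action_cost n (Aclose g) = 2 + length (binary g)"
| "action_cost n (Acheck k) = 2 + n"

definition cost :: "nat \<Rightarrow> 'c action list \<Rightarrow> nat" where
  "cost n l = sum_list (map (action_cost n) l)"

text \<open>
  An iteration of a quantifier enlarges the list of actions. The peak of a regex bounds the size of
  its part of the list of actions until it has been matched.
\<close>

primrec peak :: "nat \<Rightarrow> 'c regex \<Rightarrow> nat" where
  "peak n Eps = 2"
| "peak n (Chars cd) = 2"
| "peak n (Alt r1 r2) = 2 + peak n r1 + peak n r2"
| "peak n (Seq r1 r2) = 2 + peak n r1 + peak n r2"
| "peak n (Group g r) = 3 + length (binary g) + peak n r"
| "peak n (Backref g) = 2 + length (binary g)"
| "peak n (Quant r m d greedy) = peak n r + 2 + n + regex_cost (Quant r m d greedy)"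
| "peak n (Anchor a) = 2"

fun action_peak :: "nat \<Rightarrow> 'c action \<Rightarrow> nat" where
  "action_peak n (Regex r) = peak n r"
| "action_peak n a = action_cost n a"

text \<open>While an action is worked off, the actions behind it are untouched and count with their
  cost only; the maximum covers each action becoming the first one. A sum of peaks would not do, as
  an iteration puts the body in front of a quantifier that contains it again.\<close>

primrec list_peak :: "nat \<Rightarrow> 'c action list \<Rightarrow> nat" where
  "list_peak n [] = 0"
| "list_peak n (a # l) = max (action_peak n a + cost n l) (list_peak n l)"

lemma cost_simps [simp]: "cost n [] = 0" "cost n (a # l) = action_cost n a + cost n l"
  by (simp_all add: cost_def)

lemma length_lbits [simp]: "length (lbits g) = length (binary g)"
  by (simp add: lbits_def)

lemma regex_cost_le_peak: "regex_cost r \<le> peak n r"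
  by (induction r) (auto simp: regex_cost_def)

lemma action_cost_le_peak: "action_cost n a \<le> action_peak n a"
  by (cases a) (auto simp: regex_cost_le_peak)

lemma cost_le_list_peak: "cost n l \<le> list_peak n l"
  using action_cost_le_peak[of n] by (cases l) (auto simp: max_def intro: order_trans add_right_mono)

lemma length_binary_mono: "m \<le> n \<Longrightarrow> length (binary m) \<le> length (binary n)"
proof (induction n arbitrary: m rule: less_induct)
  case (less n)
  show ?case
  proof (cases "m = 0")
    case False
    then have "length (binary (m div 2)) \<le> length (binary (n div 2))"
      using less by (intro less.IH div_le_mono) auto
    then show ?thesis
      using False less.prems by (subst (1 2) binary.simps) auto
  qed simp
qed

lemma regex_cost_pred: "regex_cost (Quant r 0 (d - 1) greedy) \<le> regex_cost (Quant r 0 d greedy)"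
  by (cases d) (auto simp: regex_cost_def one_enat_def length_binary_mono)

text \<open>The critical step is an iteration. As long as the body runs, it is followed by a check
  and the quantifier, and these summands are the ones in the definition of \<open>peak\<close>.
  Behind the check the quantifier is first again, with no larger peak than before.\<close>

lemma lstep_peak:
  assumes "lstep W s (l, p, G) b = Some (l', p', G')" "\<forall>a \<in> set l. bound_free a"
  shows "list_peak n l' \<le> list_peak n l"
proof (cases "(W, s, (l, p, G), b)" rule: lstep.cases)
  case (7 W' s' r1 r2 l1 p1 G1 b1)
  then show ?thesis using assms regex_cost_le_peak[of r2 n] by (auto split: if_splits)
next
  case (8 W' s' r m d greedy l1 p1 G1 b1)
  then show ?thesis
    using assms regex_cost_pred[of r d greedy]
    by (auto split: if_splits simp: max_def)
next
  case (11 W' s' g l1 p1 G1 b1)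
  then show ?thesis using assms by (auto simp: Let_def split: if_splits group_state.splits)
qed (use assms in \<open>auto split: if_splits group_state.splits\<close>)

lemma weight_le_cost: "actions_weight p l \<le> cost n l"
  by (induction p l rule: actions_weight.induct) (auto simp: regex_cost_def)

text \<open>\<open>actions_weight\<close> stops counting at a check that fails at the current
  position. Hence the quantifier put back behind \<open>Acheck p\<close> has no weight until input
  is consumed.\<close>

lemma lstep_progress:
  assumes "lstep W s (l, p, G) b = Some (l', p', G')" "\<forall>a \<in> set l. bound_free a"
  shows "p < p' \<or> p' = p \<and> actions_weight p l' < actions_weight p l"
proof (cases "(W, s, (l, p, G), b)" rule: lstep.cases)
  case (11 W' s' g l1 p1 G1 b1)
  then show ?thesis using assms by (auto simp: Let_def split: if_splits group_state.splits)
qed (use assms in \<open>auto split: if_splits group_state.splits\<close>)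

text \<open>The weight decreases between two consumptions of input and is at most \<open>B\<close>
  after each of them.\<close>

lemma lrun_length:
  assumes "lrun W s (l, p, G) bs = Some ([], p', G')" "\<forall>a \<in> set l. bound_free a" "p \<le> length s"
    "groups_ok (length s) G" "list_peak n l \<le> B"
  shows "length bs \<le> actions_weight p l + (length s - p) * (B + 1)"
  using assms
proof (induction bs arbitrary: l p G)
  case (Cons b bs)
  obtain l1 p1 G1 where st: "lstep W s (l, p, G) b = Some (l1, p1, G1)"
    "lrun W s (l1, p1, G1) bs = Some ([], p', G')"
    using Cons.prems(1) by (auto split: option.splits)
  note ok = lstep_ok[OF st(1) Cons.prems(3,4,2)]
  have peak: "list_peak n l1 \<le> B" using lstep_peak[OF st(1) Cons.prems(2)] Cons.prems(5) by (rule order_trans)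
  have IH: "length bs \<le> actions_weight p1 l1 + (length s - p1) * (B + 1)"
    using Cons.IH[OF st(2)] ok peak by simp
  from lstep_progress[OF st(1) Cons.prems(2)] show ?case
  proof
    assume p: "p < p1"
    have "actions_weight p1 l1 \<le> B"
      using weight_le_cost[of p1 l1 n] cost_le_list_peak[of n l1] peak by linarith
    \<comment> \<open>Consuming input releases a budget of \<open>B + 1\<close>: one for the step
      itself and \<open>B\<close> for the weight of the new list.\<close>
    moreover have "(length s - p1) * (B + 1) + (B + 1) \<le> (length s - p) * (B + 1)"
    proof -
      have "Suc (length s - p1) \<le> length s - p" using p ok by linarith
      from mult_le_mono1[OF this, of "B + 1"] show ?thesis by simp
    qed
    ultimately show ?thesis using IH by simp
  qed (use IH in simp)
qed simp


subsection \<open>Accepted words\<close>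

primrec arun :: "'c set \<Rightarrow> 'c list \<Rightarrow> 'c regex \<Rightarrow> 'c phase \<Rightarrow> out list \<Rightarrow> 'c phase option" where
  "arun W s r ph [] = Some ph"
| "arun W s r ph (y # ys) = (case astep W s r ph y of None \<Rightarrow> None | Some ph' \<Rightarrow> arun W s r ph' ys)"

definition branch :: "bool \<Rightarrow> out" where
  "branch b = (if b then Hi else Lo)"

definition accepted :: "'c set \<Rightarrow> 'c list \<Rightarrow> 'c regex \<Rightarrow> 'c phase \<Rightarrow> out list \<Rightarrow> bool" where
  "accepted W s r ph ys \<longleftrightarrow> arun W s r ph ys = Some (Finish [])"

definition out_less :: "out list \<Rightarrow> out list \<Rightarrow> bool" where
  "out_less ys ys' \<longleftrightarrow> (\<exists>u v v'. ys = u @ Lo # v \<and> ys' = u @ Hi # v')"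

lemma out_less_append: "out_less ys ys' \<Longrightarrow> out_less (xs @ ys) (xs @ ys')"
  unfolding out_less_def by (metis append_assoc)

lemma out_less_extend: "out_less ys ys' \<Longrightarrow> out_less (ys @ zs) (ys' @ zs')"
  unfolding out_less_def by (metis append_Cons append_assoc)

lemma accepted_Finish: "accepted W s r (Finish es) ys \<longleftrightarrow> (\<exists>m. ys = es @ replicate m Lo)"
proof (induction ys arbitrary: es)
  case Nil
  then show ?case by (auto simp: accepted_def)
next
  case (Cons y ys)
  show ?case
  proof (cases es)
    case Nil
    have "accepted W s r (Finish []) (y # ys) \<longleftrightarrow> y = Lo \<and> (\<exists>m. ys = replicate m Lo)"
      using Cons[of "[]"] by (auto simp: accepted_def)
    also have "\<dots> \<longleftrightarrow> (\<exists>m. y # ys = replicate m Lo)"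
      by (metis (no_types) Cons_replicate_eq list.inject replicate_Suc)
    finally show ?thesis by (simp add: Nil)
  next
    case (Cons e es')
    then show ?thesis using Cons.IH[of es'] by (auto simp: accepted_def)
  qed
qed

lemma accepted_Matching:
  "accepted W s r (Matching k l p G) ys \<longleftrightarrow>
     (\<exists>bs p' G' m. lrun W s (l, p, G) bs = Some ([], p', G') \<and>
        ys = map branch bs @ Lo # answer_out k p' G' @ replicate m Lo)"
proof (induction ys arbitrary: l p G)
  case Nil
  then show ?case by (auto simp: accepted_def)
next
  case (Cons y ys)
  show ?case
  proof (cases l)
    case Nil
    have "lrun W s ([], p, G) bs = Some ([], p', G') \<longleftrightarrow> bs = [] \<and> p' = p \<and> G' = G" for bs p' G'
      by (cases bs) auto
    moreover have "accepted W s r (Matching k [] p G) (y # ys) \<longleftrightarrow>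
        y = Lo \<and> accepted W s r (Finish (answer_out k p G)) ys"
      by (auto simp: accepted_def)
    ultimately show ?thesis by (auto simp: Nil accepted_Finish)
  next
    case l: (Cons a l')
    have 1: "accepted W s r (Matching k l p G) (y # ys) \<longleftrightarrow>
        (\<exists>b l1 p1 G1. y = branch b \<and> lstep W s (l, p, G) b = Some (l1, p1, G1) \<and>
          accepted W s r (Matching k l1 p1 G1) ys)"
      using l by (auto simp: accepted_def branch_def split: option.splits if_splits)
    have 2: "lrun W s (l, p, G) bs = Some ([], p', G') \<longleftrightarrow>
        (\<exists>b bs' l1 p1 G1. bs = b # bs' \<and> lstep W s (l, p, G) b = Some (l1, p1, G1) \<and>
          lrun W s (l1, p1, G1) bs' = Some ([], p', G'))" for bs p' G'
      using l by (cases bs) (auto split: option.splits)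
    show ?thesis unfolding 1 2 Cons.IH by fastforce
  qed
qed

lemma lrun_ok:
  "lrun W s (l, p, G) bs = Some (l', p', G') \<Longrightarrow> p \<le> length s \<Longrightarrow> groups_ok (length s) G \<Longrightarrow>
   \<forall>a \<in> set l. bound_free a \<Longrightarrow> p' \<le> length s \<and> groups_ok (length s) G'"
proof (induction bs arbitrary: l p G)
  case (Cons b bs)
  obtain l1 p1 G1 where st: "lstep W s (l, p, G) b = Some (l1, p1, G1)"
    "lrun W s (l1, p1, G1) bs = Some (l', p', G')"
    using Cons.prems(1) by (auto split: option.splits)
  then show ?case using Cons.IH[OF st(2)] lstep_ok[OF st(1) Cons.prems(2-4)] by blast
qed simp

section \<open>Size of group maps and answers\<close>

definition small_ids :: "nat \<Rightarrow> groups \<Rightarrow> bool" where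
  "small_ids B G \<longleftrightarrow> (\<forall>e \<in> set G. length (binary (fst e)) \<le> B)"

text \<open>The identifier of a new entry comes from the first action, and its bits are counted in
  the peak of that action.\<close>

lemma lstep_groups:
  assumes "lstep W s (l, p, G) b = Some (l', p', G')" "small_ids B G" "list_peak n l \<le> B"
  shows "length G' \<le> length G + 1 \<and> small_ids B G'"
proof -
  have f: "length (filter P G) \<le> length G" for P by simp
  have w: "length (without g G) \<le> length G" "small_ids B (without g G)" for g
    using assms(2) by (auto simp: without_def small_ids_def)
  show ?thesis
  proof (cases "(W, s, (l, p, G), b)" rule: lstep.cases)
    case (3 W' s' g l1 p1 G1 b1)
    then show ?thesis using assms w[of g]
      by (auto simp: small_ids_def split: if_splits group_state.splits)
  next
    case (8 W' s' r m d greedy l1 p1 G1 b1)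
    then show ?thesis using assms by (auto simp: small_ids_def le_SucI split: if_splits)
  next
    case (9 W' s' g r l1 p1 G1 b1)
    then show ?thesis using assms w[of g] by (auto simp: small_ids_def split: if_splits)
  next
    case (11 W' s' g l1 p1 G1 b1)
    then show ?thesis using assms w[of g]
      by (auto simp: small_ids_def Let_def split: if_splits group_state.splits)
  qed (use assms in \<open>auto split: if_splits\<close>)
qed

lemma lrun_groups:
  "lrun W s (l, p, G) bs = Some (l', p', G') \<Longrightarrow> small_ids B G \<Longrightarrow> list_peak n l \<le> B \<Longrightarrow>
   \<forall>a \<in> set l. bound_free a \<Longrightarrow> p \<le> length s \<Longrightarrow> groups_ok (length s) G \<Longrightarrow>
   length G' \<le> length G + length bs \<and> small_ids B G'"
proof (induction bs arbitrary: l p G)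
  case (Cons b bs)
  obtain l1 p1 G1 where st: "lstep W s (l, p, G) b = Some (l1, p1, G1)"
    "lrun W s (l1, p1, G1) bs = Some (l', p', G')"
    using Cons.prems(1) by (auto split: option.splits)
  note 1 = lstep_groups[OF st(1) Cons.prems(2,3)]
  note 2 = lstep_ok[OF st(1) Cons.prems(5,6,4)]
  have "list_peak n l1 \<le> B" using lstep_peak[OF st(1) Cons.prems(4)] Cons.prems(3) by (rule order_trans)
  then show ?case using Cons.IH[OF st(2)] 1 2 by fastforce
qed simp

lemma length_binary_le: "length (binary n) \<le> n"
proof (induction n rule: less_induct)
  case (less n)
  show ?case
  proof (cases "n = 0")
    case False
    then have "length (binary n) \<le> n div 2 + 1" using less.IH[of "n div 2"] by (subst binary.simps) simp
    then show ?thesis using False by linarith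
  qed simp
qed

lemma length_num_out: "length (num_out n) \<le> 1 + n"
  using length_binary_le[of n] by (simp add: num_out_def)

lemma length_entry_out:
  "length (binary g) \<le> B \<Longrightarrow> positions_le n v \<Longrightarrow> length (entry_out (g, v)) \<le> 4 + 2 * n + B"
proof (cases v)
  case (Opened a)
  assume "length (binary g) \<le> B" "positions_le n v"
  then show ?thesis using length_num_out[of a] Opened by (simp add: num_out_def)
next
  case (Closed a b)
  assume "length (binary g) \<le> B" "positions_le n v"
  then show ?thesis
    using length_num_out[of a] length_num_out[of b] Closed by (simp add: num_out_def)
qed simp

text \<open>One letter for \<open>Match\<close> and at most \<open>n + 1\<close> for each of two
  positions. Each of the \<open>m\<close> entries has one letter for its kind, at most
  \<open>B + 1\<close> for its identifier and at most \<open>n + 1\<close> for each of two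
  positions.\<close>

definition answer_bound :: "nat \<Rightarrow> nat \<Rightarrow> nat \<Rightarrow> nat" where
  "answer_bound n B m = 3 + 2 * n + m * (4 + 2 * n + B)"

lemma length_answer_out:
  assumes "k \<le> n" "p \<le> n" "groups_ok n G" "small_ids B G" "length G \<le> m"
  shows "length (answer_out k p G) \<le> answer_bound n B m"
proof -
  have e: "length (entry_out e) \<le> 4 + 2 * n + B" if "e \<in> set G" for e
    using length_entry_out[of "fst e" B n "snd e"] that assms(3,4)
    by (simp add: groups_ok_def small_ids_def)
  have "length (concat (map entry_out G)) = (\<Sum>e\<leftarrow>G. length (entry_out e))"
    by (simp add: length_concat comp_def)
  also have "\<dots> \<le> (\<Sum>e\<leftarrow>G. 4 + 2 * n + B)" by (rule sum_list_mono) (rule e)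
  also have "\<dots> = length G * (4 + 2 * n + B)" by (simp add: sum_list_triv)
  also have "\<dots> \<le> m * (4 + 2 * n + B)" using assms(5) by (rule mult_le_mono1)
  finally show ?thesis
    using length_num_out[of k] length_num_out[of p] assms(1,2)
    by (simp add: answer_out_def answer_bound_def)
qed

text \<open>The letters of the path are erased, so the decoder does not have to find the place where
  the answer starts.\<close>

fun out_word :: "out \<Rightarrow> answer_token symbol list" where
  "out_word (OTok t) = [Sym t]"
| "out_word (OBit b) = [Bit b]"
| "out_word _ = []"

definition answer_word :: "out list \<Rightarrow> answer_token symbol list" where
  "answer_word ys = concat (map out_word ys)"

lemma answer_word_simps [simp]:
  "answer_word [] = []" "answer_word (y # ys) = out_word y @ answer_word ys"
  "answer_word (xs @ ys) = answer_word xs @ answer_word ys"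
  "answer_word (replicate m Lo) = []" "answer_word (map branch bs) = []"
  by (auto simp: answer_word_def branch_def concat_eq_Nil_conv)

lemma answer_word_num [simp]: "answer_word (num_out n) = encode_num n"
  by (simp add: num_out_def encode_num_def bits_of_def answer_word_def comp_def concat_map_singleton)

lemma answer_word_entries:
  "\<forall>e \<in> set G. snd e \<noteq> Undefined \<Longrightarrow>
   answer_word (concat (map entry_out G)) = concat (map (\<lambda>(g, v). encode_group g v) G)"
proof (induction G)
  case (Cons e G)
  obtain g v where "e = (g, v)" by fastforce
  then show ?case using Cons by (cases v) auto
qed simp

text \<open>The keys of \<open>G\<close> provide the enumeration of the groups. The order that the
  run has left them in is immaterial, since \<open>answer_words\<close> admits every order.\<close>

lemma answer_word_answer:
  assumes "groups_ok n G"
  shows "answer_word (answer_out k p G) \<in> answer_words (Some (k, p, lookup G))"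
proof -
  have d: "distinct (map fst G)" and v: "\<forall>e \<in> set G. snd e \<noteq> Undefined"
    using assms by (auto simp: groups_ok_def)
  have l: "lookup G g = v" if "(g, v) \<in> set G" for g v
    using that d by (simp add: lookup_def)
  have "set (map fst G) = {g. lookup G g \<noteq> Undefined}"
  proof -
    have "g \<in> fst ` set G" if "lookup G g \<noteq> Undefined" for g
      using that by (auto simp: lookup_def split: option.splits dest: map_of_SomeD intro: rev_image_eqI)
    then show ?thesis using l v by force
  qed
  moreover have "map (\<lambda>g. encode_group g (lookup G g)) (map fst G) = map (\<lambda>(g, v). encode_group g v) G"
    using l by auto
  moreover have "answer_word (answer_out k p G) = Sym Match # encode_num k @ encode_num p @
      concat (map (\<lambda>(g, v). encode_group g v) G)"
    by (simp add: answer_out_def answer_word_entries[OF v])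
  ultimately have "answer_word (answer_out k p G) = Sym Match # encode_num k @ encode_num p @
      concat (map (\<lambda>g. encode_group g (lookup G g)) (map fst G)) \<and>
      distinct (map fst G) \<and> set (map fst G) = {g. lookup G g \<noteq> Undefined}"
    using d by (simp only: simp_thms)
  then show ?thesis unfolding answer_words.simps by blast
qed

text \<open>At most \<open>B\<close> steps before the first consumption of input; each of the at
  most \<open>n\<close> consumptions then accounts for itself and for \<open>B\<close> further
  steps.\<close>

definition run_bound :: "nat \<Rightarrow> nat \<Rightarrow> nat" where
  "run_bound n B = B + n * (B + 1)"

text \<open>The best word has one \<open>Hi\<close> for each start without a match and then
  \<open>Lo\<close>, the least complete run, \<open>Lo\<close> and the answer; without any match it
  ends in \<open>NoMatch\<close>. The induction is on the number of starts that remain, under the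
  invariant that the earlier ones have no leaves.\<close>

theorem best_accepted:
  fixes s :: "'c list"
  assumes "no_lower_bounds r" and n: "n = length s" and B: "B = peak n r"
  shows "\<exists>zs. accepted W s r (Start 0) zs \<and> answer_word zs \<in> answer_words (jsregmatch W r s) \<and>
    length zs \<le> n + 2 + run_bound n B + answer_bound n B (run_bound n B) \<and>
    (\<forall>ys. accepted W s r (Start 0) ys \<longrightarrow> (\<exists>m. ys = zs @ replicate m Lo) \<or> out_less zs ys)"
proof -
  let ?L = "\<lambda>k. leaves W s [Regex r] k (\<lambda>_. Undefined)"
  \<comment> \<open>The two letters are the \<open>Lo\<close> before and the \<open>Lo\<close> after
    the run, or \<open>Hi\<close> and \<open>NoMatch\<close> if there is no match.\<close>
  define C where "C = 2 + run_bound n B + answer_bound n B (run_bound n B)"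
  have start: "accepted W s r (Start k) ys \<longleftrightarrow>
      (\<exists>ys'. ys = Lo # ys' \<and> accepted W s r (Matching k [Regex r] k []) ys') \<or>
      (\<exists>ys'. ys = Hi # ys' \<and> accepted W s r (if k < length s then Start (k + 1) else Finish [OTok NoMatch]) ys')"
    for k ys
    by (cases ys) (auto simp: accepted_def)
  have "\<exists>zs. accepted W s r (Start k) zs \<and> answer_word zs \<in> answer_words (jsregmatch W r s) \<and>
    length zs \<le> n - k + C \<and>
    (\<forall>ys. accepted W s r (Start k) ys \<longrightarrow> (\<exists>m. ys = zs @ replicate m Lo) \<or> out_less zs ys)"
    if "k \<le> n" "\<forall>j < k. ?L j = []" for k
    using that
  proof (induction "n - k" arbitrary: k rule: less_induct)
    case less
    have "lookup [] = (\<lambda>_. Undefined)" by (simp add: lookup_def fun_eq_iff)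
    then have best: "best_run W s ([Regex r], k, []) (?L k)"
      using leaves_best_run[of "\<lambda>_. Undefined" "[]" "[Regex r]" W s k] assms(1) by simp
    show ?case
    proof (cases "?L k = []")
      case False
      then obtain bs p G where b: "lrun W s ([Regex r], k, []) bs = Some ([], p, G)" "hd (?L k) = (p, lookup G)"
        "\<And>bs' p' G'. lrun W s ([Regex r], k, []) bs' = Some ([], p', G') \<Longrightarrow> bs' = bs \<or> lex_less bs bs'"
        using best unfolding best_run_def if_not_P[OF False] by blast
      define zs where "zs = Lo # map branch bs @ Lo # answer_out k p G"
      have ok: "p \<le> length s" "groups_ok (length s) G"
        using lrun_ok[OF b(1)] less.prems assms(1) n by (auto simp: groups_ok_def)
      have len: "length bs \<le> run_bound n B"
      proof -
        have "length bs \<le> actions_weight k [Regex r] + (length s - k) * (B + 1)"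
          by (rule lrun_length[OF b(1), of n]) (use less.prems assms in \<open>auto simp: groups_ok_def\<close>)
        moreover have "actions_weight k [Regex r] \<le> B"
          using regex_cost_le_peak[of r n] B by (simp add: regex_cost_def)
        moreover have "(length s - k) * (B + 1) \<le> n * (B + 1)"
          using n by (intro mult_le_mono1) simp
        ultimately show ?thesis unfolding run_bound_def by linarith
      qed
      have "length G \<le> length bs \<and> small_ids B G"
        using lrun_groups[OF b(1), of B n] less.prems assms by (auto simp: groups_ok_def small_ids_def)
      then have "length (answer_out k p G) \<le> answer_bound n B (run_bound n B)"
        using less.prems(1) ok n len by (intro length_answer_out) auto
      then have "length zs \<le> n - k + C" using len by (simp add: zs_def C_def)
      moreover have "accepted W s r (Start k) zs"
        using b(1) unfolding start zs_def accepted_Matching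
        by (intro disjI1 exI conjI refl) (auto intro!: exI[of _ 0])
      moreover have "jsregmatch W r s = Some (k, p, lookup G)"
      proof -
        have "(LEAST j. j \<le> length s \<and> ?L j \<noteq> []) = k"
          by (rule Least_equality) (use less.prems False n in \<open>auto simp: not_less[symmetric]\<close>)
        then show ?thesis using less.prems False n b(2) by (auto simp: jsregmatch_def Let_def)
      qed
      moreover have "answer_word zs = answer_word (answer_out k p G)" by (simp add: zs_def)
      moreover have "(\<exists>m. ys = zs @ replicate m Lo) \<or> out_less zs ys" if "accepted W s r (Start k) ys" for ys
        using that unfolding start
      proof (elim disjE exE conjE)
        fix ys' assume ys: "ys = Hi # ys'"
        then show ?thesis unfolding zs_def out_less_def by (metis append_Nil)
      next
        fix ys' assume ys: "ys = Lo # ys'" and acc: "accepted W s r (Matching k [Regex r] k []) ys'"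
        obtain bs' p' G' m where r: "lrun W s ([Regex r], k, []) bs' = Some ([], p', G')"
          "ys' = map branch bs' @ Lo # answer_out k p' G' @ replicate m Lo"
          using acc unfolding accepted_Matching by blast
        from b(3)[OF r(1)] show ?thesis
        proof
          assume "bs' = bs"
          then show ?thesis using r b(1) ys by (auto simp: zs_def)
        next
          assume "lex_less bs bs'"
          then obtain u v v' where "bs = u @ False # v" "bs' = u @ True # v'"
            by (auto simp: lex_less_def)
          then have "map branch bs = map branch u @ Lo # map branch v"
            "map branch bs' = map branch u @ Hi # map branch v'"
            by (simp_all add: branch_def)
          then have "out_less (map branch bs) (map branch bs')" unfolding out_less_def by blast
          then have "out_less (Lo # map branch bs @ Lo # answer_out k p G)
              (Lo # map branch bs' @ Lo # answer_out k p' G' @ replicate m Lo)"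
            using out_less_append[of _ _ "[Lo]"] out_less_extend by (metis append_Cons append_Nil)
          then show ?thesis by (simp add: zs_def ys r(2))
        qed
      qed
      ultimately show ?thesis using answer_word_answer[OF ok(2)] by (intro exI[of _ zs]) simp
    next
      case True
      have no: "\<not> accepted W s r (Matching k [Regex r] k []) ys'" for ys'
        using best True unfolding accepted_Matching best_run_def by auto
      show ?thesis
      proof (cases "k < n")
        case True
        have k1: "n - (k + 1) < n - k" "k + 1 \<le> n" using True by auto
        have "\<forall>j < k + 1. ?L j = []" using less.prems(2) \<open>?L k = []\<close> by (auto simp: less_Suc_eq)
        from less.hyps[OF k1 this] obtain zs where zs: "accepted W s r (Start (k + 1)) zs"
          "answer_word zs \<in> answer_words (jsregmatch W r s)" "length zs \<le> n - (k + 1) + C"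
          "\<And>ys. accepted W s r (Start (k + 1)) ys \<Longrightarrow> (\<exists>m. ys = zs @ replicate m Lo) \<or> out_less zs ys"
          by blast
        show ?thesis
        proof (intro exI[of _ "Hi # zs"] conjI allI impI)
          show "accepted W s r (Start k) (Hi # zs)" using zs(1) True n by (simp add: start)
          show "answer_word (Hi # zs) \<in> answer_words (jsregmatch W r s)" using zs(2) by simp
          show "length (Hi # zs) \<le> n - k + C" using zs(3) True by simp
          fix ys assume "accepted W s r (Start k) ys"
          then obtain ys' where "ys = Hi # ys'" "accepted W s r (Start (k + 1)) ys'"
            using no True n unfolding start[of k] by auto
          then show "(\<exists>m. ys = (Hi # zs) @ replicate m Lo) \<or> out_less (Hi # zs) ys"
            using zs(4) out_less_append[of zs _ "[Hi]"] by auto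
        qed
      next
        case False
        then have k: "k = n" using less.prems(1) by simp
        have none: "jsregmatch W r s = None"
          using less.prems(2) \<open>?L k = []\<close> k n by (auto simp: jsregmatch_def Let_def le_less)
        have acc: "accepted W s r (Start k) ys \<longleftrightarrow> (\<exists>m. ys = Hi # OTok NoMatch # replicate m Lo)" for ys
          using no k n unfolding start by (auto simp: accepted_Finish)
        show ?thesis
          by (intro exI[of _ "[Hi, OTok NoMatch]"]) (auto simp: acc none C_def intro!: exI[of _ 0])
      qed
    qed
  qed
  from this[of 0] show ?thesis by (simp add: C_def add.assoc)
qed


section \<open>The nondeterministic machine\<close>

subsection \<open>Guessing a word\<close>

text \<open>Nine letters take four bits. \<open>Lo\<close> and \<open>Hi\<close> agree up to the
  last bit, where \<open>Lo\<close> is smaller, and the first bit tells the letters of the answer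
  from those of the path.\<close>

fun code_out :: "out \<Rightarrow> bool list" where
  "code_out Lo = [False, False, False, False]"
| "code_out Hi = [False, False, False, True]"
| "code_out (OTok NoMatch) = [True, False, False, False]"
| "code_out (OTok Match) = [True, False, False, True]"
| "code_out (OTok IsOpened) = [True, False, True, False]"
| "code_out (OTok IsClosed) = [True, False, True, True]"
| "code_out (OTok Num) = [True, True, False, False]"
| "code_out (OBit b) = [True, True, True, b]"

definition code_word :: "out list \<Rightarrow> bool list" where
  "code_word ys = concat (map code_out ys)"

definition out_letters :: "out list" where
  "out_letters = [Lo, Hi, OTok NoMatch, OTok Match, OTok IsOpened, OTok IsClosed, OTok Num,
     OBit False, OBit True]"

lemma set_out_letters: "set out_letters = UNIV"
proof -
  have "y \<in> set out_letters" for y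
  proof (cases y)
    case (OTok t)
    then show ?thesis by (cases t) (auto simp: out_letters_def)
  next
    case (OBit b)
    then show ?thesis by (cases b) (auto simp: out_letters_def)
  qed (auto simp: out_letters_def)
  then show ?thesis by blast
qed

primrec choose_among :: "('r, 'g) cmd list \<Rightarrow> ('r, 'g) cmd" where
  "choose_among [] = Fail"
| "choose_among (c # cs) = Choose c (choose_among cs)"

primrec emit_all :: "'g list \<Rightarrow> ('r, 'g) cmd" where
  "emit_all [] = Skip"
| "emit_all (x # xs) = Emit x ;; emit_all xs"

definition guess_letter :: "out \<Rightarrow> 'c prog" where
  "guess_letter y = emit_all (map LBit (code_out y)) ;; Push rV (LOut y)"

definition guess :: "'c prog" where
  "guess = choose_among (map guess_letter out_letters)"

text \<open>The numbers of rounds of nested loops multiply, which turns five registers of equal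
  length into a fifth power. The letters are moved back after each loop because the loop around it
  starts it again.\<close>

primrec nest :: "('r \<times> 'r) list \<Rightarrow> ('r, 'g) cmd \<Rightarrow> ('r, 'g) cmd" where
  "nest [] c = c"
| "nest (p # ps) c = Drain (fst p) (\<lambda>x. Push (snd p) x ;; nest ps c) ;; move (snd p) (fst p)"

lemma den_emit_all: "den (emit_all xs) (\<sigma>, w) = {(\<sigma>, w @ xs)}"
  by (induction xs arbitrary: w) auto

lemma space_emit_all: "space (emit_all xs) B st"
  by (induction xs arbitrary: st) auto

lemma keeps_emit_all: "keeps r (emit_all xs)" and wf_emit_all: "wf_cmd (emit_all xs)"
  by (induction xs) auto

lemma den_choose_among: "den (choose_among cs) st = (\<Union>c \<in> set cs. den c st)"
  by (induction cs) auto

lemma choose_among_props: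
  "(\<forall>c \<in> set cs. space c B st) \<Longrightarrow> space (choose_among cs) B st"
  "(\<forall>c \<in> set cs. keeps r c) \<Longrightarrow> keeps r (choose_among cs)"
  "(\<forall>c \<in> set cs. wf_cmd c) \<Longrightarrow> wf_cmd (choose_among cs)"
  by (induction cs) auto

lemma guess_props:
  "space guess B st" "r \<noteq> rV \<Longrightarrow> keeps r guess" "wf_cmd guess"
  unfolding guess_def
  by (intro choose_among_props; auto simp: guess_letter_def space_emit_all keeps_emit_all wf_emit_all)+

definition guessed :: "nat \<Rightarrow> (reg, 'c letter) store \<Rightarrow> (reg, 'c letter) store set" where
  "guessed n st = (\<lambda>ys. ((fst st)(rV := rev (map LOut ys) @ fst st rV), snd st @ map LBit (code_word ys)))
     ` {ys. length ys = n}"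

lemma den_guess: "den guess st = guessed 1 st"
proof -
  have "den guess st = (\<Union>y. {((fst st)(rV := LOut y # fst st rV), snd st @ map LBit (code_out y))})"
    by (cases st) (simp add: guess_def den_choose_among set_out_letters guess_letter_def den_emit_all)
  also have "\<dots> = guessed 1 st"
    by (force simp: guessed_def code_word_def length_Suc_conv)
  finally show ?thesis .
qed

lemma guessed_0: "guessed 0 st = {st}"
  by (cases st) (simp add: guessed_def code_word_def)

lemma guessed_add: "(\<Union>st' \<in> guessed m st. guessed n st') = guessed (m + n) st"
proof (rule set_eqI)
  fix st'
  have *: "length zs = m + n \<longleftrightarrow> (\<exists>xs ys. zs = xs @ ys \<and> length xs = m \<and> length ys = n)" for zs :: "out list"
    by (metis append_take_drop_id diff_add_inverse length_append length_drop length_take min_absorb2 le_add1)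
  show "st' \<in> (\<Union>st' \<in> guessed m st. guessed n st') \<longleftrightarrow> st' \<in> guessed (m + n) st"
    unfolding guessed_def using * by (fastforce simp: code_word_def image_iff)
qed

text \<open>Guessing touches only \<open>rV\<close> and the output, so it commutes with updates of
  all other registers.\<close>

lemma guessed_upd: "r \<noteq> rV \<Longrightarrow>
  guessed n (\<sigma>(r := x), w) = (\<lambda>st. ((fst st)(r := x), snd st)) ` guessed n (\<sigma>, w)"
  by (auto simp: guessed_def image_iff fun_upd_twist)

definition nest_ok :: "(reg \<times> reg) list \<Rightarrow> bool" where
  "nest_ok ps \<longleftrightarrow> distinct (map fst ps @ map snd ps @ [rV])"

lemma keeps_nest: "r \<notin> set (map fst ps) \<union> set (map snd ps) \<union> {rV} \<Longrightarrow> keeps r (nest ps guess)"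
  by (induction ps) (auto simp: guess_props)

lemma wf_nest: "nest_ok ps \<Longrightarrow> wf_cmd (nest ps guess)"
proof (induction ps)
  case (Cons p ps)
  have "nest_ok ps" using Cons.prems by (auto simp: nest_ok_def)
  moreover have "keeps (fst p) (nest ps guess)"
    by (rule keeps_nest) (use Cons.prems in \<open>auto simp: nest_ok_def\<close>)
  ultimately show ?case using Cons by (auto simp: nest_ok_def)
qed (simp add: guess_props)

lemma guessed_fst: "st' \<in> guessed n st \<Longrightarrow> r \<noteq> rV \<Longrightarrow> fst st' r = fst st r"
  by (auto simp: guessed_def)

lemma nest_correct:
  assumes "nest_ok ps" "\<forall>p \<in> set ps. \<sigma> (snd p) = []"
  shows "den (nest ps guess) (\<sigma>, w) = guessed (\<Prod>p\<leftarrow>ps. length (\<sigma> (fst p))) (\<sigma>, w) \<and>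
    ((\<forall>p \<in> set ps. length (\<sigma> (fst p)) \<le> B) \<longrightarrow> space (nest ps guess) B (\<sigma>, w))"
  using assms
proof (induction ps arbitrary: \<sigma> w)
  case Nil
  then show ?case by (simp add: den_guess guess_props)
next
  case (Cons p ps)
  obtain x x' where p: "p = (x, x')" by fastforce
  have ok: "nest_ok ps" and ne: "x \<noteq> x'" "x \<noteq> rV" "x' \<noteq> rV"
    "x \<notin> set (map fst ps)" "x' \<notin> set (map fst ps)" "x \<notin> set (map snd ps)" "x' \<notin> set (map snd ps)"
    using Cons.prems p by (auto simp: nest_ok_def)
  define n where "n = (\<Prod>p\<leftarrow>ps. length (\<sigma> (fst p)))"
  define D where "D = (\<lambda>y :: 'a letter. den (Push x' y ;; nest ps guess))"
  define S where "S = (\<lambda>y :: 'a letter. space (Push x' y ;; nest ps guess) B)"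
  have step: "D y (\<tau>, v) = guessed n (\<tau>(x' := y # \<tau> x'), v) \<and>
      ((\<forall>p \<in> set ps. length (\<sigma> (fst p)) \<le> B) \<longrightarrow> S y (\<tau>, v))"
    if "\<forall>p \<in> set ps. \<tau> (fst p) = \<sigma> (fst p) \<and> \<tau> (snd p) = []" for \<tau> v y
  proof -
    let ?\<tau> = "\<tau>(x' := y # \<tau> x')"
    have 1: "\<forall>p \<in> set ps. ?\<tau> (snd p) = []" "\<forall>p \<in> set ps. ?\<tau> (fst p) = \<sigma> (fst p)"
      using that ne by auto
    then have "map (\<lambda>p. length (?\<tau> (fst p))) ps = map (\<lambda>p. length (\<sigma> (fst p))) ps" by simp
    then have n: "(\<Prod>p\<leftarrow>ps. length (?\<tau> (fst p))) = n" by (simp only: n_def)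
    note IH = Cons.IH[OF ok 1(1), of v, unfolded n]
    have "D y (\<tau>, v) = den (nest ps guess) (?\<tau>, v)" "S y (\<tau>, v) = space (nest ps guess) B (?\<tau>, v)"
      by (simp_all add: D_def S_def)
    moreover have "(\<forall>p \<in> set ps. length (\<sigma> (fst p)) \<le> B) = (\<forall>p \<in> set ps. length (?\<tau> (fst p)) \<le> B)"
      using 1(2) by simp
    ultimately show ?thesis using IH by argo
  qed
  \<comment> \<open>The inner loops restore their registers, so every round of the outer loop makes
    the same number \<open>n\<close> of guesses and \<open>guessed_add\<close> sums them up.\<close>
  have loop: "iter D x xs (\<tau>, v) =
      guessed (length xs * n) (\<tau>(x := [], x' := rev xs @ \<tau> x'), v) \<and>
      ((\<forall>p \<in> set ps. length (\<sigma> (fst p)) \<le> B) \<longrightarrow> iter_space S D x xs (\<tau>, v))"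
    if "\<forall>p \<in> set ps. \<tau> (fst p) = \<sigma> (fst p) \<and> \<tau> (snd p) = []" "\<tau> x = xs" for xs \<tau> v
    using that
  proof (induction xs arbitrary: \<tau> v)
    case Nil
    then show ?case by (simp add: guessed_0 fun_upd_idem)
  next
    case (Cons y xs)
    let ?\<tau> = "\<tau>(x := xs, x' := y # \<tau> x')"
    have inv: "\<forall>p \<in> set ps. (\<tau>(x := xs)) (fst p) = \<sigma> (fst p) \<and> (\<tau>(x := xs)) (snd p) = []"
      using Cons.prems ne by auto
    have st: "D y (\<tau>(x := xs), v) = guessed n (?\<tau>, v)"
      "(\<forall>p \<in> set ps. length (\<sigma> (fst p)) \<le> B) \<longrightarrow> S y (\<tau>(x := xs), v)"
    proof -
      have x': "(\<tau>(x := xs)) x' = \<tau> x'" using ne by simp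
      note step[OF inv, of y v, unfolded x']
      then show "D y (\<tau>(x := xs), v) = guessed n (?\<tau>, v)"
        "(\<forall>p \<in> set ps. length (\<sigma> (fst p)) \<le> B) \<longrightarrow> S y (\<tau>(x := xs), v)"
        by blast+
    qed
    have IH: "iter D x xs st' = guessed (length xs * n) ((fst st')(x := [], x' := rev xs @ fst st' x'), snd st') \<and>
        ((\<forall>p \<in> set ps. length (\<sigma> (fst p)) \<le> B) \<longrightarrow> iter_space S D x xs st')"
      if "st' \<in> guessed n (?\<tau>, v)" for st'
    proof -
      have f: "fst st' r = ?\<tau> r" if "r \<noteq> rV" for r
        using guessed_fst[OF \<open>st' \<in> guessed n (?\<tau>, v)\<close> that] by simp
      have "\<forall>p \<in> set ps. fst st' (fst p) = \<sigma> (fst p) \<and> fst st' (snd p) = []"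
      proof
        fix q assume q: "q \<in> set ps"
        then have "fst q \<in> set (map fst ps)" "snd q \<in> set (map snd ps)" by auto
        moreover have "rV \<notin> set (map fst ps)" "rV \<notin> set (map snd ps)" using ok by (auto simp: nest_ok_def)
        ultimately have "fst q \<noteq> rV" "snd q \<noteq> rV" "fst q \<noteq> x" "fst q \<noteq> x'" "snd q \<noteq> x" "snd q \<noteq> x'"
          using ne by metis+
        then show "fst st' (fst q) = \<sigma> (fst q) \<and> fst st' (snd q) = []"
          using f Cons.prems(1) q by simp
      qed
      moreover have "fst st' x = xs" using f ne by simp
      ultimately show ?thesis using Cons.IH[of "fst st'" "snd st'"] unfolding prod.collapse by blast
    qed
    have "iter D x (y # xs) (\<tau>, v) = (\<Union>st' \<in> guessed n (?\<tau>, v). iter D x xs st')"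
      by (simp add: st(1))
    also have "\<dots> = (\<Union>st' \<in> guessed n (?\<tau>, v). guessed (length xs * n)
        ((fst st')(x := [], x' := rev xs @ y # \<tau> x'), snd st'))"
      using IH guessed_fst[of _ n "(?\<tau>, v)" x'] ne by (intro SUP_cong) auto
    also have "\<dots> = (\<Union>st' \<in> (\<lambda>st. ((fst st)(x := [], x' := rev xs @ y # \<tau> x'), snd st)) ` guessed n (?\<tau>, v).
        guessed (length xs * n) st')"
      by simp
    also have "(\<lambda>st. ((fst st)(x := [], x' := rev xs @ y # \<tau> x'), snd st)) ` guessed n (?\<tau>, v) =
        guessed n (?\<tau>(x := [], x' := rev xs @ y # \<tau> x'), v)"
      using guessed_upd[OF ne(3), of n "?\<tau>(x := [])" _ v] guessed_upd[OF ne(2), of n ?\<tau> "[]" v]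
      by (simp add: image_image)
    also have "?\<tau>(x := [], x' := rev xs @ y # \<tau> x') = \<tau>(x := [], x' := rev (y # xs) @ \<tau> x')"
      by (intro ext) simp
    also have "(\<Union>st' \<in> guessed n (\<tau>(x := [], x' := rev (y # xs) @ \<tau> x'), v). guessed (length xs * n) st') =
        guessed (length (y # xs) * n) (\<tau>(x := [], x' := rev (y # xs) @ \<tau> x'), v)"
      by (simp add: guessed_add)
    finally have 1: "iter D x (y # xs) (\<tau>, v) =
        guessed (length (y # xs) * n) (\<tau>(x := [], x' := rev (y # xs) @ \<tau> x'), v)" .
    show ?case
    proof (intro conjI impI)
      show "iter D x (y # xs) (\<tau>, v) =
        guessed (length (y # xs) * n) (\<tau>(x := [], x' := rev (y # xs) @ \<tau> x'), v)" by (rule 1)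
      assume "\<forall>p \<in> set ps. length (\<sigma> (fst p)) \<le> B"
      then show "iter_space S D x (y # xs) (\<tau>, v)" using st IH by simp
    qed
  qed
  have x': "\<sigma> x' = []" using Cons.prems p by simp
  have inv: "\<forall>p \<in> set ps. \<sigma> (fst p) = \<sigma> (fst p) \<and> \<sigma> (snd p) = []" using Cons.prems by simp
  note loop = loop[OF inv refl, of w]
  let ?\<sigma> = "\<sigma>(x := [], x' := rev (\<sigma> x))"
  have d: "den (Drain x (\<lambda>y. Push x' y ;; nest ps guess)) (\<sigma>, w) = guessed (length (\<sigma> x) * n) (?\<sigma>, w)"
    using loop x' by (simp add: D_def)
  have mv: "den (move x' x) st' = {((fst st')(x' := [], x := \<sigma> x), snd st')}"
    if "st' \<in> guessed (length (\<sigma> x) * n) (?\<sigma>, w)" for st'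
    using guessed_fst[OF that] ne by (cases st') simp
  have "den (nest (p # ps) guess) (\<sigma>, w) =
      (\<Union>st' \<in> guessed (length (\<sigma> x) * n) (?\<sigma>, w). den (move x' x) st')"
    using d by (simp add: p)
  also have "\<dots> = (\<lambda>st'. ((fst st')(x' := [], x := \<sigma> x), snd st')) ` guessed (length (\<sigma> x) * n) (?\<sigma>, w)"
    using mv by auto
  also have "\<dots> = guessed (length (\<sigma> x) * n) (?\<sigma>(x' := [], x := \<sigma> x), w)"
    using guessed_upd[OF ne(3), of "length (\<sigma> x) * n" ?\<sigma> "[]" w]
      guessed_upd[OF ne(2), of "length (\<sigma> x) * n" "?\<sigma>(x' := [])" "\<sigma> x" w]
    by (simp add: image_image)
  also have "?\<sigma>(x' := [], x := \<sigma> x) = \<sigma>"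
    using x' by (intro ext) simp
  finally have "den (nest (p # ps) guess) (\<sigma>, w) = guessed (length (\<sigma> x) * n) (\<sigma>, w)" .
  moreover have "space (nest (p # ps) guess) B (\<sigma>, w)" if "\<forall>p \<in> set (p # ps). length (\<sigma> (fst p)) \<le> B"
  proof -
    have "space (move x' x) B st'" if "st' \<in> guessed (length (\<sigma> x) * n) (?\<sigma>, w)" for st'
    proof -
      have "length (fst st' x') \<le> B"
        using guessed_fst[OF that] ne \<open>\<forall>p \<in> set (p # ps). length (\<sigma> (fst p)) \<le> B\<close> p by simp
      moreover have "iter_space (\<lambda>y. space (Push x y) B) (\<lambda>y. den (Push x y)) x' xs st''" for xs st''
        by (induction xs arbitrary: st'') auto
      ultimately show ?thesis by (simp add: move_def)
    qed
    then show ?thesis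
      using that loop d p by (simp add: S_def D_def)
  qed
  ultimately show ?case by (simp add: n_def p)
qed


subsection \<open>Sizes of the phases\<close>

text \<open>The bound has to hold on every branch, also on failing ones. Therefore the number of
  entries is measured by the number \<open>j\<close> of letters read so far, and the answer by the
  length \<open>m\<close> of the whole word.\<close>

definition phase_size :: "nat \<Rightarrow> nat \<Rightarrow> nat \<Rightarrow> nat \<Rightarrow> 'c phase \<Rightarrow> bool" where
  "phase_size n B m j ph = (case ph of
     Start k \<Rightarrow> True
   | Matching k l p G \<Rightarrow> list_peak n l \<le> B \<and> length G \<le> j \<and> small_ids B G
   | Finish es \<Rightarrow> length es \<le> answer_bound n B m)"

lemma astep_size:
  assumes "astep W s r ph y = Some ph'" "phase_ok (length s) ph" "phase_size (length s) B m j ph"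
    "j < m" "peak (length s) r \<le> B"
  shows "phase_size (length s) B m (Suc j) ph'"
proof (cases ph)
  case (Start k)
  then show ?thesis
    using assms by (auto simp: phase_size_def small_ids_def answer_bound_def split: if_splits)
next
  case (Matching k l p G)
  show ?thesis
  proof (cases "l = []")
    case True
    then have "ph' = Finish (answer_out k p G)" using assms(1) Matching by (auto split: if_splits)
    moreover have "length (answer_out k p G) \<le> answer_bound (length s) B m"
      using assms Matching by (intro length_answer_out) (auto simp: phase_size_def)
    ultimately show ?thesis by (simp add: phase_size_def)
  next
    case False
    then obtain l' p' G' where st: "lstep W s (l, p, G) (y = Hi) = Some (l', p', G')"
      "ph' = Matching k l' p' G'"
      using assms(1) Matching by (auto split: if_splits)
    have "list_peak (length s) l' \<le> list_peak (length s) l"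
      using lstep_peak[OF st(1)] assms(2) Matching by simp
    then show ?thesis
      using lstep_groups[OF st(1), of B "length s"] assms(3) Matching st(2) by (auto simp: phase_size_def)
  qed
next
  case (Finish es)
  then show ?thesis using assms(1,3) by (cases es) (auto simp: phase_size_def split: if_splits)
qed

text \<open>Summands in the order of the registers: \<open>B\<close> for the actions,
  \<open>n\<close> for each of the two parts of the input and for the start, then the group map with
  entries of at most \<open>2 + B + 2 * n\<close> letters, the expected answer, the phase, and the
  rest of the guessed word.\<close>

definition state_bound :: "nat \<Rightarrow> nat \<Rightarrow> nat \<Rightarrow> nat" where
  "state_bound n B m = B + 3 * n + m * (2 + B + 2 * n) + answer_bound n B m + 1 + m"

lemma length_actions: "length (concat (map (action_letters s) l)) \<le> cost (length s) l"
proof (induction l)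
  case (Cons a l)
  then show ?case by (cases a) (auto simp: regex_cost_def)
qed simp

lemma length_suffix [simp]: "length (suffix s p) = length s - p"
  by (simp add: suffix_def)

lemma length_group_letters:
  assumes "small_ids B G"
  shows "length (group_letters s G) \<le> length G * (2 + B + 2 * length s)"
proof -
  have "length (entry_letters s e) \<le> 2 + B + 2 * length s" if "e \<in> set G" for e
  proof -
    obtain g v where e: "e = (g, v)" by fastforce
    then have "length (binary g) \<le> B" using that assms by (auto simp: small_ids_def)
    then show ?thesis unfolding e by (cases v) auto
  qed
  then have "(\<Sum>e\<leftarrow>G. length (entry_letters s e)) \<le> (\<Sum>e\<leftarrow>G. 2 + B + 2 * length s)"
    by (rule sum_list_mono)
  then show ?thesis by (simp add: length_concat comp_def sum_list_triv)
qed

lemma tot_regs: "tot (regs a l r k g e ph y, w) =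
  length a + length l + length r + length k + length g + length e + 1 + length y"
  unfolding tot_def by (simp add: UNIV_reg reg_list_def)

lemma tot_phase_regs:
  assumes "phase_size (length s) B m j ph" "phase_ok (length s) ph" "peak (length s) r \<le> B" "j \<le> m" "length ys \<le> m"
  shows "tot (phase_regs s r ph ys, w) \<le> state_bound (length s) B m"
proof (cases ph)
  case (Start k)
  have "length (regex_letters r) \<le> B"
    using regex_cost_le_peak[of r "length s"] assms(3) by (simp add: regex_cost_def)
  then show ?thesis using assms Start by (simp add: tot_regs state_bound_def)
next
  case (Matching k l p G)
  have "length (concat (map (action_letters s) l)) \<le> B"
    using length_actions[of s l] cost_le_list_peak[of "length s" l] assms(1) Matching
    by (simp add: phase_size_def)
  moreover have "length (group_letters s G) \<le> m * (2 + B + 2 * length s)"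
  proof -
    have "small_ids B G" "length G \<le> m" using assms(1,4) Matching by (auto simp: phase_size_def)
    then show ?thesis
      using length_group_letters[of B G s] mult_le_mono1[of "length G" m "2 + B + 2 * length s"] by linarith
  qed
  ultimately show ?thesis using assms(5) Matching by (simp add: tot_regs state_bound_def)
next
  case (Finish es)
  then show ?thesis using assms by (simp add: tot_regs state_bound_def phase_size_def)
qed

lemma phase_regs_upd: "(phase_regs s r ph y)(rY := y') = phase_regs s r ph y'"
  by (cases ph) (simp_all add: regs_upd)

lemma phase_regs_rY: "phase_regs s r ph y rY = y"
  by (cases ph) simp_all

lemma iter_body:
  assumes "no_lower_bounds r"
  shows "phase_ok (length s) ph \<Longrightarrow>
    iter (\<lambda>x. den (body W x)) rY (map LOut ys) (phase_regs s r ph (map LOut ys), w) =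
      (case arun W s r ph ys of None \<Rightarrow> {} | Some ph' \<Rightarrow> {(phase_regs s r ph' [], w)})"
proof (induction ys arbitrary: ph)
  case (Cons y ys)
  have "iter (\<lambda>x. den (body W x)) rY (map LOut (y # ys)) (phase_regs s r ph (map LOut (y # ys)), w) =
      (\<Union>st \<in> den (body W (LOut y)) (phase_regs s r ph (map LOut ys), w).
        iter (\<lambda>x. den (body W x)) rY (map LOut ys) st)"
    by (simp add: phase_regs_upd)
  also have "\<dots> = (case arun W s r ph (y # ys) of None \<Rightarrow> {} | Some ph' \<Rightarrow> {(phase_regs s r ph' [], w)})"
    unfolding den_body[OF Cons.prems]
    by (cases "astep W s r ph y") (auto simp: Cons.IH dest!: astep_ok[OF _ Cons.prems assms])
  finally show ?case .
qed simp

lemma iter_space_body: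
  assumes r: "no_lower_bounds r" and B: "peak (length s) r \<le> B"
    and a: "\<And>x st. space (body W x) (a * (tot st + 1)) st"
    and le: "a * (state_bound (length s) B m + 1) \<le> S"
  shows "phase_ok (length s) ph \<Longrightarrow> phase_size (length s) B m j ph \<Longrightarrow> j + length ys \<le> m \<Longrightarrow>
    iter_space (\<lambda>x. space (body W x) S) (\<lambda>x. den (body W x)) rY (map LOut ys)
      (phase_regs s r ph (map LOut ys), w)"
proof (induction ys arbitrary: ph j)
  case (Cons y ys)
  let ?st = "(phase_regs s r ph (map LOut ys), w)"
  have "tot ?st \<le> state_bound (length s) B m"
    by (rule tot_phase_regs[OF Cons.prems(2,1) B]) (use Cons.prems(3) in auto)
  then have "a * (tot ?st + 1) \<le> S" using le by (meson add_mono_thms_linordered_semiring(3) mult_le_mono2 order_trans)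
  then have "space (body W (LOut y)) S ?st" using a space_mono by blast
  moreover have "iter_space (\<lambda>x. space (body W x) S) (\<lambda>x. den (body W x)) rY (map LOut ys) st'"
    if "st' \<in> den (body W (LOut y)) ?st" for st'
  proof -
    obtain ph' where ph': "astep W s r ph y = Some ph'" "st' = (phase_regs s r ph' (map LOut ys), w)"
    proof (cases "astep W s r ph y")
      case None
      then show thesis
        using \<open>st' \<in> den (body W (LOut y)) ?st\<close> unfolding den_body[OF Cons.prems(1)] by simp
    next
      case (Some ph')
      then have "st' = (phase_regs s r ph' (map LOut ys), w)"
        using \<open>st' \<in> den (body W (LOut y)) ?st\<close> unfolding den_body[OF Cons.prems(1)] by simp
      with Some show thesis by (rule that)
    qed
    show ?thesis
      unfolding ph'(2)
    proof (rule Cons.IH)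
      show "phase_ok (length s) ph'" by (rule astep_ok[OF ph'(1) Cons.prems(1) r])
      show "phase_size (length s) B m (Suc j) ph'"
        by (rule astep_size[OF ph'(1) Cons.prems(1,2) _ B]) (use Cons.prems(3) in simp)
    qed (use Cons.prems(3) in simp)
  qed
  ultimately show ?case by (simp add: phase_regs_upd)
qed simp


subsection \<open>The complete program\<close>

text \<open>Ticks come in fours since the resulting factor \<open>4 ^ 5 = 1024\<close> absorbs the
  constant 101 in the proof of \<open>run_length_le\<close>.\<close>

definition tick4 :: "reg \<Rightarrow> 'c prog" where
  "tick4 r = Push r (LMark Tick) ;; Push r (LMark Tick) ;; Push r (LMark Tick) ;; Push r (LMark Tick)"

definition fill :: "'c prog" where
  "fill = tick4 rA ;; tick4 rL ;; tick4 rR ;; tick4 rK ;; tick4 rG"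

definition read_step :: "'c letter \<Rightarrow> 'c prog" where
  "read_step x = Push rH x ;; fill"

definition split_step :: "'c letter \<Rightarrow> 'c prog" where
  "split_step x = (if is_char x then Push rR x else Push rA x)"

definition loops :: "(reg \<times> reg) list" where
  "loops = [(rA, rT), (rL, rU), (rR, rX), (rK, rN), (rG, rQ)]"

text \<open>The guessed word in \<open>rV\<close> and the input in \<open>rH\<close> are both
  reversed, so emptying these registers restores the reading order. Characters occur only in the
  string, hence \<open>is_char\<close> separates it from the regex.\<close>

definition prepare :: "'c prog" where
  "prepare = clear rA ;; clear rL ;; clear rR ;; clear rK ;; clear rG ;; move rV rY ;;
     Drain rH split_step ;; Push rPh (LMark Starting)"

definition check_end :: "'c prog" where
  "check_end = Peek rPh (\<lambda>x. if x = Some (LMark Finishing)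
     then Peek rE (\<lambda>e. if e = None then Skip else Fail) else Fail)"

text \<open>
  The loops run \<^term>\<open>(4 * (n + 1)) ^ 5\<close> times on inputs of length \<^term>\<open>n\<close>; this is long enough
  for the run that corresponds to the match of highest priority.
\<close>

definition matcher :: "'c set \<Rightarrow> 'c prog" where
  "matcher W = Emit (LBit True) ;; fill ;; Drain rInp read_step ;; nest loops guess ;; prepare ;;
     Drain rY (body W) ;; check_end"

definition filled :: "nat \<Rightarrow> (reg \<Rightarrow> 'c letter list) \<Rightarrow> reg \<Rightarrow> 'c letter list" where
  "filled n \<sigma> = (let t = replicate n (LMark Tick) in
     \<sigma>(rA := t @ \<sigma> rA, rL := t @ \<sigma> rL, rR := t @ \<sigma> rR, rK := t @ \<sigma> rK, rG := t @ \<sigma> rG))"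

lemma den_tick4: "den (tick4 r) (\<sigma>, w) = {(\<sigma>(r := replicate 4 (LMark Tick) @ \<sigma> r), w)}"
  by (simp add: tick4_def eval_nat_numeral)

lemma den_fill: "den fill (\<sigma>, w) = {(filled 4 \<sigma>, w)}"
  by (simp add: fill_def den_tick4 filled_def Let_def)

lemma filled_apply [simp]:
  "filled n \<sigma> rA = replicate n (LMark Tick) @ \<sigma> rA" "filled n \<sigma> rL = replicate n (LMark Tick) @ \<sigma> rL"
  "filled n \<sigma> rR = replicate n (LMark Tick) @ \<sigma> rR" "filled n \<sigma> rK = replicate n (LMark Tick) @ \<sigma> rK"
  "filled n \<sigma> rG = replicate n (LMark Tick) @ \<sigma> rG"
  "r \<notin> {rA, rL, rR, rK, rG} \<Longrightarrow> filled n \<sigma> r = \<sigma> r"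
  by (auto simp: filled_def Let_def)

lemma filled_add: "filled m (filled n \<sigma>) = filled (m + n) \<sigma>"
proof
  fix x show "filled m (filled n \<sigma>) x = filled (m + n) \<sigma> x"
    by (cases x) (simp_all add: replicate_add)
qed

lemma iter_read_step:
  "\<sigma> rInp = xs \<Longrightarrow> iter (\<lambda>x. den (read_step x)) rInp xs (\<sigma>, w) =
    {(filled (4 * length xs) (\<sigma>(rInp := [], rH := rev xs @ \<sigma> rH)), w)}"
proof (induction xs arbitrary: \<sigma>)
  case Nil
  have "filled 0 \<sigma> = \<sigma>"
    by (rule ext, rename_tac x, case_tac x) simp_all
  then show ?case using Nil by (simp add: fun_upd_idem)
next
  case (Cons x xs)
  let ?\<sigma> = "filled 4 (\<sigma>(rInp := xs, rH := x # \<sigma> rH))"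
  have "iter (\<lambda>x. den (read_step x)) rInp (x # xs) (\<sigma>, w) = iter (\<lambda>x. den (read_step x)) rInp xs (?\<sigma>, w)"
    by (intro iter_step) (simp add: read_step_def den_fill)
  also have "\<dots> = {(filled (4 * length xs) (?\<sigma>(rInp := [], rH := rev xs @ ?\<sigma> rH)), w)}"
    by (rule Cons.IH) simp
  also have "filled (4 * length xs) (?\<sigma>(rInp := [], rH := rev xs @ ?\<sigma> rH)) =
      filled (4 * length (x # xs)) (\<sigma>(rInp := [], rH := rev (x # xs) @ \<sigma> rH))"
  proof -
    have "?\<sigma>(rInp := [], rH := rev xs @ ?\<sigma> rH) = filled 4 (\<sigma>(rInp := [], rH := rev (x # xs) @ \<sigma> rH))"
      by (rule ext, rename_tac y, case_tac y) simp_all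
    then show ?thesis by (simp only: filled_add) (simp add: add.commute)
  qed
  finally show ?case .
qed

lemma iter_split_step:
  "\<sigma> rH = xs \<Longrightarrow> iter (\<lambda>x. den (split_step x)) rH xs (\<sigma>, w) =
    {(\<sigma>(rH := [], rR := rev (filter is_char xs) @ \<sigma> rR, rA := rev (filter (\<lambda>x. \<not> is_char x) xs) @ \<sigma> rA), w)}"
proof (induction xs arbitrary: \<sigma>)
  case Nil
  then show ?case by (simp add: fun_upd_idem)
next
  case (Cons x xs)
  let ?\<sigma> = "\<sigma>(rH := xs, rR := (if is_char x then [x] else []) @ \<sigma> rR,
    rA := (if is_char x then [] else [x]) @ \<sigma> rA)"
  have "den (split_step x) (\<sigma>(rH := xs), w) = {(?\<sigma>, w)}"
    by (auto simp: split_step_def intro!: ext)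
  then have "iter (\<lambda>x. den (split_step x)) rH (x # xs) (\<sigma>, w) = iter (\<lambda>x. den (split_step x)) rH xs (?\<sigma>, w)"
    by (rule iter_step)
  also have "\<dots> = {(?\<sigma>(rH := [], rR := rev (filter is_char xs) @ ?\<sigma> rR,
      rA := rev (filter (\<lambda>x. \<not> is_char x) xs) @ ?\<sigma> rA), w)}"
    by (rule Cons.IH) simp
  also have "?\<sigma>(rH := [], rR := rev (filter is_char xs) @ ?\<sigma> rR,
      rA := rev (filter (\<lambda>x. \<not> is_char x) xs) @ ?\<sigma> rA) =
    \<sigma>(rH := [], rR := rev (filter is_char (x # xs)) @ \<sigma> rR,
      rA := rev (filter (\<lambda>x. \<not> is_char x) (x # xs)) @ \<sigma> rA)"
    by (intro ext) simp
  finally show ?case .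
qed

lemma regex_letters_no_char: "x \<in> set (regex_letters r) \<Longrightarrow> \<not> is_char x"
  by (induction r) (auto simp: is_char_def lbits_def split: enat.splits)

definition input_letters :: "'c regex \<Rightarrow> 'c list \<Rightarrow> 'c letter list" where
  "input_letters r s = regex_letters r @ map (\<lambda>c. LTok (TChar c)) s"

lemma filter_input_letters:
  "filter is_char (input_letters r s) = suffix s 0"
  "filter (\<lambda>x. \<not> is_char x) (input_letters r s) = regex_letters r"
proof -
  have "filter is_char (regex_letters r) = []" "filter (\<lambda>x. \<not> is_char x) (regex_letters r) = regex_letters r"
    using regex_letters_no_char by (auto simp: filter_empty_conv filter_id_conv)
  moreover have "filter is_char (map (\<lambda>c. LTok (TChar c)) s) = map (\<lambda>c. LTok (TChar c)) s"
    "filter (\<lambda>x. \<not> is_char x) (map (\<lambda>c. LTok (TChar c)) s) = []"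
    by (auto simp: filter_empty_conv filter_id_conv is_char_def)
  ultimately show "filter is_char (input_letters r s) = suffix s 0"
    "filter (\<lambda>x. \<not> is_char x) (input_letters r s) = regex_letters r"
    by (simp_all add: input_letters_def suffix_def)
qed

definition loaded :: "'c letter list \<Rightarrow> reg \<Rightarrow> 'c letter list" where
  "loaded xs = filled (4 * (length xs + 1)) ((\<lambda>_. [])(rH := rev xs))"

lemma den_load:
  "den (Emit (LBit True) ;; fill ;; Drain rInp read_step) ((\<lambda>_. [])(rInp := xs), []) =
    {(loaded xs, [LBit True])}"
proof -
  let ?\<sigma> = "filled 4 ((\<lambda>_. [])(rInp := xs))"
  have "den (Emit (LBit True) ;; fill ;; Drain rInp read_step) ((\<lambda>_. [])(rInp := xs), []) =
      iter (\<lambda>x. den (read_step x)) rInp xs (?\<sigma>, [LBit True])"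
    by (simp add: den_fill del: iter.simps)
  also have "\<dots> = {(filled (4 * length xs) (?\<sigma>(rInp := [], rH := rev xs @ ?\<sigma> rH)), [LBit True])}"
    by (rule iter_read_step) simp
  also have "filled (4 * length xs) (?\<sigma>(rInp := [], rH := rev xs @ ?\<sigma> rH)) = loaded xs"
  proof -
    have "?\<sigma>(rInp := [], rH := rev xs @ ?\<sigma> rH) = filled 4 ((\<lambda>_. [])(rH := rev xs))"
      by (rule ext, rename_tac y, case_tac y) simp_all
    then show ?thesis by (simp only: filled_add loaded_def) (simp add: add.commute)
  qed
  finally show ?thesis .
qed

lemma den_prepare:
  "den prepare ((loaded (input_letters r s))(rV := rev (map LOut ys)), w) =
    {(phase_regs s r (Start 0) (map LOut ys), w)}"
proof -
  let ?xs = "rev (input_letters r s)"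
  let ?\<sigma> = "(loaded (input_letters r s))(rV := [], rA := [], rL := [], rR := [], rK := [], rG := [],
    rY := map LOut ys)"
  let ?\<sigma>' = "?\<sigma>(rH := [], rR := rev (filter is_char ?xs) @ ?\<sigma> rR,
    rA := rev (filter (\<lambda>x. \<not> is_char x) ?xs) @ ?\<sigma> rA)"
  have "den prepare ((loaded (input_letters r s))(rV := rev (map LOut ys)), w) =
      (\<Union>st \<in> iter (\<lambda>x. den (split_step x)) rH ?xs (?\<sigma>, w). den (Push rPh (LMark Starting)) st)"
  proof -
    have "((loaded (input_letters r s))(rV := rev (map LOut ys), rA := [], rL := [], rR := [],
      rK := [], rG := [], rV := [], rY := map LOut ys)) = ?\<sigma>"
      by (rule ext) simp
    then show ?thesis
      by (simp add: prepare_def loaded_def del: iter.simps fun_upd_apply) (simp add: loaded_def)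
  qed
  also have "iter (\<lambda>x. den (split_step x)) rH ?xs (?\<sigma>, w) = {(?\<sigma>', w)}"
    by (rule iter_split_step) (simp add: loaded_def)
  also have "(\<Union>st \<in> {(?\<sigma>', w)}. den (Push rPh (LMark Starting)) st) =
      {(?\<sigma>'(rPh := [LMark Starting]), w)}"
    by (simp add: loaded_def)
  also have "?\<sigma>'(rPh := [LMark Starting]) = phase_regs s r (Start 0) (map LOut ys)"
    unfolding phase_regs.simps
    by (rule regs_eqI) (simp_all add: loaded_def rev_filter[symmetric] filter_input_letters prefix_def)
  finally show ?thesis .
qed

lemma den_check_end:
  "den check_end (phase_regs s r ph [], w) =
    (if ph = Finish [] then {(phase_regs s r ph [], w)} else {})"
proof (cases ph)
  case (Finish es)
  then show ?thesis by (cases es) (auto simp: check_end_def)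
qed (auto simp: check_end_def)

definition guess_length :: "nat \<Rightarrow> nat" where
  "guess_length n = (4 * (n + 1)) ^ 5"

lemma den_nest_loaded: "den (nest loops guess) (loaded xs, w) = guessed (guess_length (length xs)) (loaded xs, w)"
proof -
  define m where "m = 4 * (length xs + 1)"
  have "length (loaded xs r) = m" if "r \<in> {rA, rL, rR, rK, rG}" for r
    using that by (auto simp: loaded_def m_def)
  then have "(\<Prod>p\<leftarrow>loops. length (loaded xs (fst p))) = m * (m * (m * (m * m)))"
    by (simp add: loops_def)
  also have "\<dots> = m ^ 5" by (simp add: eval_nat_numeral)
  finally have "(\<Prod>p\<leftarrow>loops. length (loaded xs (fst p))) = guess_length (length xs)"
    by (simp only: guess_length_def m_def)
  moreover have "nest_ok loops" by (simp add: nest_ok_def loops_def)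
  moreover have "\<forall>p \<in> set loops. loaded xs (snd p) = []" by (simp add: loops_def loaded_def)
  ultimately show ?thesis using nest_correct[of loops "loaded xs" w] by simp
qed

theorem den_matcher:
  assumes "no_lower_bounds r"
  shows "den (matcher W) ((\<lambda>_. [])(rInp := input_letters r s), []) =
    (\<lambda>ys. (phase_regs s r (Finish []) [], map LBit (True # code_word ys))) `
      {ys. length ys = guess_length (length (input_letters r s)) \<and> accepted W s r (Start 0) ys}"
proof -
  let ?xs = "input_letters r s"
  let ?N = "guess_length (length ?xs)"
  have loop: "den (prepare ;; Drain rY (body W) ;; check_end) ((loaded ?xs)(rV := rev (map LOut ys)), w) =
      (if accepted W s r (Start 0) ys then {(phase_regs s r (Finish []) [], w)} else {})" for ys w
  proof -
    have "den (prepare ;; Drain rY (body W) ;; check_end) ((loaded ?xs)(rV := rev (map LOut ys)), w) =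
        (\<Union>st \<in> iter (\<lambda>x. den (body W x)) rY (map LOut ys) (phase_regs s r (Start 0) (map LOut ys), w).
          den check_end st)"
      by (simp add: den_prepare phase_regs_rY del: phase_regs.simps)
    also have "\<dots> = (if accepted W s r (Start 0) ys then {(phase_regs s r (Finish []) [], w)} else {})"
    proof -
      have "phase_ok (length s) (Start 0)" by simp
      from iter_body[OF assms this] show ?thesis
        by (simp add: accepted_def den_check_end del: phase_regs.simps split: option.split)
    qed
    finally show ?thesis .
  qed
  have "den (matcher W) ((\<lambda>_. [])(rInp := ?xs), []) =
      (\<Union>st \<in> den (Emit (LBit True) ;; fill ;; Drain rInp read_step) ((\<lambda>_. [])(rInp := ?xs), []).
        \<Union>st' \<in> den (nest loops guess) st. den (prepare ;; Drain rY (body W) ;; check_end) st')"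
    unfolding matcher_def den.simps(6) by (simp only: UN_UN_flatten)
  also have "\<dots> = (\<Union>st' \<in> guessed ?N (loaded ?xs, [LBit True]). den (prepare ;; Drain rY (body W) ;; check_end) st')"
    unfolding den_load by (simp add: den_nest_loaded)
  also have "\<dots> = (\<Union>ys \<in> {ys. length ys = ?N}. den (prepare ;; Drain rY (body W) ;; check_end)
      ((loaded ?xs)(rV := rev (map LOut ys)), map LBit (True # code_word ys)))"
    by (simp add: guessed_def loaded_def)
  also have "\<dots> = (\<Union>ys \<in> {ys. length ys = ?N}.
      if accepted W s r (Start 0) ys then {(phase_regs s r (Finish []) [], map LBit (True # code_word ys))} else {})"
    unfolding loop ..
  also have "\<dots> = (\<lambda>ys. (phase_regs s r (Finish []) [], map LBit (True # code_word ys))) `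
      {ys. length ys = ?N \<and> accepted W s r (Start 0) ys}"
    by auto
  finally show ?thesis .
qed


section \<open>Space of the complete program\<close>

lemma space_Drain_loop_free:
  assumes "\<And>x st. space (f x) B st" "length (fst st r) \<le> B"
  shows "space (Drain r f) B st"
proof -
  have "iter_space (\<lambda>x. space (f x) B) (\<lambda>x. den (f x)) r xs st" for xs st
    by (induction xs arbitrary: st) (auto simp: assms(1))
  then show ?thesis using assms(2) by simp
qed

lemma space_clear: "space (clear r) B st \<longleftrightarrow> length (fst st r) \<le> B"
  using space_Drain_loop_free[of "\<lambda>_. Skip" B st r] by (auto simp: clear_def)

lemma space_move: "space (move r r') B st \<longleftrightarrow> length (fst st r) \<le> B"
  using space_Drain_loop_free[of "Push r'" B st r] by (auto simp: move_def)

lemma space_Then_assoc: "space ((c1 ;; c2 ;; c3) ;; c4) B st \<longleftrightarrow> space (c1 ;; c2 ;; c3 ;; c4) B st"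
  by auto

lemma wf_matcher: "wf_cmd (matcher W)"
proof -
  have "nest_ok loops" by (simp add: nest_ok_def loops_def)
  then show ?thesis
    by (simp add: matcher_def fill_def tick4_def read_step_def split_step_def prepare_def check_end_def
        clear_def move_def wf_nest wf_body keeps_body)
qed

lemma body_space:
  fixes W :: "'c :: finite set"
  obtains a where "\<And>x st. space (body W x) (a * (tot st + 1)) st"
proof -
  have "\<forall>x. \<exists>a. \<forall>st. space (body W x) (a * (tot st + 1)) st"
    using linear_body[of W] unfolding grows_linearly_def by blast
  then obtain a where a: "\<And>x st. space (body W x) (a x * (tot st + 1)) st" by metis
  have "a x * n \<le> (\<Sum>x\<in>UNIV. a x) * n" for x n
    by (intro mult_le_mono1 member_le_sum) auto
  then have "space (body W x) ((\<Sum>x\<in>UNIV. a x) * (tot st + 1)) st" for x st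
    using a space_mono by blast
  then show thesis by (rule that)
qed

lemma space_load:
  assumes "length xs \<le> S"
  shows "space (Emit (LBit True) ;; fill ;; Drain rInp read_step) S ((\<lambda>_. [])(rInp := xs), [])"
proof -
  have f: "space fill S st" for st by (simp add: fill_def tick4_def)
  then have "space (Drain rInp read_step) S (filled 4 ((\<lambda>_. [])(rInp := xs)), [LBit True])"
    using assms by (intro space_Drain_loop_free) (auto simp: read_step_def)
  then show ?thesis using f by (simp add: den_fill del: space.simps(9))
qed

lemma space_prepare:
  assumes "4 * (length xs + 1) \<le> S" "length ys \<le> S"
  shows "space prepare S ((loaded xs)(rV := rev (map LOut ys)), w)"
proof -
  have [simp]: "space (Drain rH split_step) S st \<longleftrightarrow> length (fst st rH) \<le> S" for st
    using space_Drain_loop_free[of split_step S st rH] by (auto simp: split_step_def)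
  then show ?thesis
    using assms by (simp add: prepare_def space_clear space_move loaded_def del: space.simps(9))
qed

lemma space_matcher:
  fixes W :: "'c :: finite set" and s :: "'c list"
  assumes r: "no_lower_bounds r" and P: "peak (length s) r \<le> P"
    and a: "\<And>x st. space (body W x) (a * (tot st + 1)) st"
    and m: "m = length (input_letters r s)"
    and S: "4 * (m + 1) \<le> S" "guess_length m \<le> S"
      "a * (state_bound (length s) P (guess_length m) + 1) \<le> S"
  shows "space (matcher W) S ((\<lambda>_. [])(rInp := input_letters r s), [])"
proof -
  let ?xs = "input_letters r s"
  have 1: "space (Emit (LBit True) ;; fill ;; Drain rInp read_step) S ((\<lambda>_. [])(rInp := ?xs), [])"
    by (rule space_load) (use S m in simp)
  have ok: "nest_ok loops" "\<forall>p \<in> set loops. loaded ?xs (snd p) = []"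
    by (simp_all add: nest_ok_def loops_def loaded_def)
  have "\<forall>p \<in> set loops. length (loaded ?xs (fst p)) \<le> S"
    using S(1) m by (simp add: loops_def loaded_def)
  then have 2: "space (nest loops guess) S (loaded ?xs, [LBit True])"
    using nest_correct[of loops "loaded ?xs" "[LBit True]" S] ok by blast
  have 3: "space (prepare ;; Drain rY (body W) ;; check_end) S ((loaded ?xs)(rV := rev (map LOut ys)), w)"
    if ys: "length ys = guess_length m" for ys w
  proof -
    have "space prepare S ((loaded ?xs)(rV := rev (map LOut ys)), w)"
      by (rule space_prepare) (use S m ys in simp_all)
    moreover have "space (Drain rY (body W)) S (phase_regs s r (Start 0) (map LOut ys), w)"
    proof -
      have "iter_space (\<lambda>x. space (body W x) S) (\<lambda>x. den (body W x)) rY (map LOut ys)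
          (phase_regs s r (Start 0) (map LOut ys), w)"
        by (rule iter_space_body[OF r P a S(3), where j = 0]) (simp_all add: phase_size_def ys)
      then show ?thesis using S(2) ys by (simp add: phase_regs_rY del: phase_regs.simps)
    qed
    moreover have "space check_end S st" for st by (simp add: check_end_def)
    ultimately show ?thesis by (simp add: den_prepare del: space.simps(9) den.simps(9) phase_regs.simps) blast
  qed
  have 4: "\<forall>st \<in> den (nest loops guess) (loaded ?xs, [LBit True]).
      space (prepare ;; Drain rY (body W) ;; check_end) S st"
    using 3 unfolding den_nest_loaded by (auto simp: guessed_def m loaded_def)
  have "space ((Emit (LBit True) ;; fill ;; Drain rInp read_step) ;; nest loops guess ;; prepare ;;
      Drain rY (body W) ;; check_end) S ((\<lambda>_. [])(rInp := ?xs), [])"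
    unfolding space.simps(6)[of "Emit (LBit True) ;; fill ;; Drain rInp read_step"] den_load
    using 1 2 4 by (simp del: den.simps space.simps(9) add: space.simps)
  then show ?thesis unfolding matcher_def space_Then_assoc .
qed

section \<open>Polynomial bounds for peaks, runs and space\<close>

lemma regex_weight_le: "no_lower_bounds r \<Longrightarrow> regex_weight r \<le> 6 * length (regex_letters r)"
  by (induction r) (auto split: enat.splits)

text \<open>The peak is a sum of contributions of the nodes of the regex, each charged to the
  letters of that node. The largest contribution is that of a quantifier: the check with
  \<open>n + 2\<close> and the cost of the quantifier itself.\<close>

lemma peak_le:
  assumes "no_lower_bounds r" "length (regex_letters r) \<le> L"
  shows "peak n r \<le> length (regex_letters r) * (7 * L + n + 4)"
  using assms
proof (induction r)
  case (Quant r m d greedy)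
  let ?r = "Quant r m d greedy" and ?t = "7 * L + n + 4"
  \<comment> \<open>Weight at most \<open>6 * L\<close>, since a quantifier with lower bound 0 adds
    only 6 to the weight of its body, and at most \<open>L\<close> letters.\<close>
  have "regex_cost ?r \<le> 7 * L"
    using regex_weight_le[OF Quant.prems(1)] Quant.prems(2) unfolding regex_cost_def by linarith
  then have "2 + n + regex_cost ?r \<le> 1 * ?t" by simp
  moreover have "peak n r \<le> length (regex_letters r) * ?t"
    using Quant by simp
  ultimately have "peak n ?r \<le> (length (regex_letters r) + 1) * ?t" by simp
  also have "\<dots> \<le> length (regex_letters ?r) * ?t" by (rule mult_le_mono1) simp
  finally show ?case .
next
  case (Alt r1 r2)
  then have "peak n r1 \<le> length (regex_letters r1) * (7 * L + n + 4)"
    "peak n r2 \<le> length (regex_letters r2) * (7 * L + n + 4)" by simp_all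
  then show ?case by (simp add: add_mult_distrib)
next
  case (Seq r1 r2)
  then have "peak n r1 \<le> length (regex_letters r1) * (7 * L + n + 4)"
    "peak n r2 \<le> length (regex_letters r2) * (7 * L + n + 4)" by simp_all
  then show ?case by (simp add: add_mult_distrib)
next
  case (Group g r)
  then have "peak n r \<le> length (regex_letters r) * (7 * L + n + 4)" by simp
  moreover have "length (binary g) \<le> length (binary g) * (7 * L + n + 4)" by simp
  moreover have "length (regex_letters (Group g r)) * (7 * L + n + 4) =
      (7 * L + n + 4) + (length (binary g) * (7 * L + n + 4) + length (regex_letters r) * (7 * L + n + 4))"
    by (simp add: add_mult_distrib)
  ultimately show ?case unfolding peak.simps by linarith
next
  case (Backref g)
  have "2 + length (binary g) \<le> (1 + length (binary g)) * 4" by simp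
  also have "\<dots> \<le> length (regex_letters (Backref g)) * (7 * L + n + 4)" by (intro mult_le_mono) simp_all
  finally show ?case by simp
qed simp_all

lemma length_input_letters_le: "length (input_letters r s) \<le> instance_size (r, s)"
proof -
  have "length (regex_letters r) \<le> regex_size r + number_bits r"
    by (induction r) (auto split: enat.splits)
  then show ?thesis by (simp add: input_letters_def)
qed

lemma peak_input_le:
  assumes "no_lower_bounds r" "length (input_letters r s) + 1 \<le> x"
  shows "peak (length s) r \<le> 7 * x ^ 2"
proof -
  let ?L = "length (regex_letters r)"
  have x: "?L + length s + 1 \<le> x" using assms(2) by (simp add: input_letters_def)
  have "peak (length s) r \<le> ?L * (7 * ?L + length s + 4)" by (rule peak_le[OF assms(1)]) simp
  also have "\<dots> \<le> x * (7 * x)" using x by (intro mult_le_mono) simp_all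
  finally show ?thesis by (simp add: power2_eq_square)
qed

text \<open>Runs are bounded by \<open>8 * x ^ 3\<close> and entries by \<open>11 * x ^ 2\<close>,
  which gives \<open>88 * x ^ 5\<close> for the entries of an answer; the remaining summands
  contribute at most \<open>13 * x ^ 5\<close>.\<close>

lemma run_length_le:
  assumes "n + 1 \<le> x" "B \<le> 7 * x ^ 2"
  shows "n + 2 + run_bound n B + answer_bound n B (run_bound n B) \<le> (4 * x) ^ 5"
proof -
  have x: "1 \<le> x" using assms(1) by simp
  have pow: "x ^ i \<le> x ^ 5" if "i \<le> 5" for i using x that by (rule power_increasing[rotated])
  have "run_bound n B = B * (n + 1) + n" by (simp add: run_bound_def algebra_simps)
  also have "\<dots> \<le> 7 * x ^ 2 * x + x ^ 3"
    using assms mult_le_mono[OF assms(2,1)] self_le_power[OF x, of 3] by linarith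
  also have "\<dots> = 8 * x ^ 3" by (simp add: eval_nat_numeral algebra_simps)
  finally have run: "run_bound n B \<le> 8 * x ^ 3" .
  have "4 + 2 * n + B \<le> 11 * x ^ 2"
    using assms self_le_power[OF x, of 2] by linarith
  have "run_bound n B * (4 + 2 * n + B) \<le> 8 * x ^ 3 * (11 * x ^ 2)"
    by (rule mult_le_mono) fact+
  also have "\<dots> = 88 * x ^ 5" by (simp flip: power_add)
  finally have "run_bound n B * (4 + 2 * n + B) \<le> 88 * x ^ 5" .
  then have "n + 2 + run_bound n B + answer_bound n B (run_bound n B) \<le> 101 * x ^ 5"
    using run assms(1) pow[of 3] pow[of 1] unfolding answer_bound_def by simp
  also have "\<dots> \<le> (4 * x) ^ 5" by (simp add: power_mult_distrib)
  finally show ?thesis .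
qed

text \<open>The three summands are the bounds that \<open>space_matcher\<close> asks for: the
  registers with ticks, the guessed word, and one step of the matcher, with
  \<open>7 * (n + 1) ^ 2\<close> as the bound on the peak.\<close>

definition space_bound :: "nat \<Rightarrow> nat \<Rightarrow> nat" where
  "space_bound a n = 4 * (n + 1) + guess_length n +
     a * (state_bound n (7 * (n + 1) ^ 2) (guess_length n) + 1)"

lemma space_bound_poly: "\<exists>p :: nat poly. \<forall>n. space_bound a n = poly p n"
proof -
  define X :: "nat poly" where "X = [:0, 1:]"
  define G where "G = (4 * (X + 1)) ^ 5"
  define P where "P = 7 * (X + 1) ^ 2"
  have [simp]: "poly X n = n" for n by (simp add: X_def)
  have [simp]: "poly G n = guess_length n" "poly P n = 7 * (n + 1) ^ 2" for n
    by (simp_all add: G_def P_def guess_length_def add.commute)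
  have "space_bound a n = poly (4 * (X + 1) + G + of_nat a *
      ((P + 3 * X + G * (2 + P + 2 * X) + (3 + 2 * X + G * (4 + 2 * X + P)) + 1 + G) + 1)) n" for n
    by (simp add: space_bound_def state_bound_def answer_bound_def)
  then show ?thesis by blast
qed

lemma space_matcher_bound:
  fixes W :: "'c :: finite set"
  assumes "no_lower_bounds r" "\<And>x st. space (body W x) (a * (tot st + 1)) st"
  shows "space (matcher W) (space_bound a (instance_size (r, s))) ((\<lambda>_. [])(rInp := input_letters r s), [])"
proof (rule space_matcher[OF assms(1) _ assms(2) refl])
  let ?n = "instance_size (r, s)" and ?m = "length (input_letters r s)"
  have m: "?m \<le> ?n" by (rule length_input_letters_le)
  show "peak (length s) r \<le> 7 * (?n + 1) ^ 2" by (rule peak_input_le[OF assms(1)]) (use m in simp)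
  have G: "guess_length ?m \<le> guess_length ?n"
    unfolding guess_length_def by (intro power_mono) (use m in simp_all)
  have "length s \<le> ?n" by simp
  then have "state_bound (length s) P (guess_length ?m) \<le> state_bound ?n P (guess_length ?n)" for P
    unfolding state_bound_def answer_bound_def using G by (intro add_mono mult_le_mono) simp_all
  then have "a * (state_bound (length s) P (guess_length ?m) + 1) \<le>
      a * (state_bound ?n P (guess_length ?n) + 1)" for P
    by (intro mult_le_mono2 add_right_mono)
  then show "a * (state_bound (length s) (7 * (?n + 1) ^ 2) (guess_length ?m) + 1) \<le> space_bound a ?n"
    unfolding space_bound_def by (rule trans_le_add2)
  show "4 * (?m + 1) \<le> space_bound a ?n"
    unfolding space_bound_def using m by (intro trans_le_add1) simp
  show "guess_length ?m \<le> space_bound a ?n"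
    unfolding space_bound_def by (rule trans_le_add1, rule trans_le_add2, rule G)
qed


section \<open>The decoder\<close>

type_synonym pending = "bool option \<times> bool option \<times> bool option"

text \<open>Total on all blocks, because a decoder has to deliver its value for every number,
  whether or not that number encodes a word.\<close>

fun decode_block :: "bool \<Rightarrow> bool \<Rightarrow> bool \<Rightarrow> bool \<Rightarrow> out list" where
  "decode_block True False False False = [OTok NoMatch]"
| "decode_block True False False True = [OTok Match]"
| "decode_block True False True False = [OTok IsOpened]"
| "decode_block True False True True = [OTok IsClosed]"
| "decode_block True True False b = [OTok Num]"
| "decode_block True True True b = [OBit b]"
| "decode_block False x y b = []"

text \<open>The state \<open>None\<close> is the one before the leading one, which is dropped. Later
  states hold up to three bits of the current block, and the fourth bit completes it.\<close>

fun decode_bit :: "pending option \<Rightarrow> bool \<Rightarrow> pending \<times> out list" where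
  "decode_bit None b = ((None, None, None), [])"
| "decode_bit (Some (Some x, Some y, Some z)) b = ((None, None, None), decode_block x y z b)"
| "decode_bit (Some (Some x, Some y, None)) b = ((Some x, Some y, Some b), [])"
| "decode_bit (Some (Some x, None, z)) b = ((Some x, Some b, None), [])"
| "decode_bit (Some (None, y, z)) b = ((Some b, None, None), [])"

fun decode_bits :: "pending option \<Rightarrow> bool list \<Rightarrow> out list" where
  "decode_bits q [] = []"
| "decode_bits q (b # bs) = snd (decode_bit q b) @ decode_bits (Some (fst (decode_bit q b))) bs"

lemma answer_word_decode: "answer_word (decode_bits None (True # code_word ys)) = answer_word ys"
proof -
  have "answer_word (decode_bits (Some (None, None, None)) (code_word ys)) = answer_word ys"
  proof (induction ys)
    case (Cons y ys)
    have "answer_word (decode_bits (Some (None, None, None)) (code_out y @ zs)) =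
        out_word y @ answer_word (decode_bits (Some (None, None, None)) zs)" for zs
      by (cases y rule: code_out.cases) (simp_all add: eval_nat_numeral)
    then show ?case using Cons by (simp add: code_word_def)
  qed (simp add: code_word_def)
  then show ?thesis by simp
qed

text \<open>The register \<^term>\<open>True\<close> holds the input and \<^term>\<open>False\<close> the pending bits.\<close>

definition decode_step :: "out + pending \<Rightarrow> (bool, out + pending) cmd" where
  "decode_step x = (case x of Inl (OBit b) \<Rightarrow> Peek False (\<lambda>q.
     let (q', ys) = decode_bit (case q of Some (Inr q) \<Rightarrow> Some q | _ \<Rightarrow> None) b
     in Pop False ;; Push False (Inr q') ;; emit_all (map Inl ys)) | _ \<Rightarrow> Skip)"

definition decoder :: "(bool, out + pending) cmd" where
  "decoder = Drain True decode_step"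

text \<open>\<open>OBit\<close> stands both for the bits of the input number and for those of the
  answer, and either way it has to be \<open>Bit\<close> on the tape. Pending bits are shifted by 2
  to stay clear of the symbols for \<open>Lo\<close> and \<open>Hi\<close>.\<close>

fun decoder_symbol :: "out + pending \<Rightarrow> answer_token symbol" where
  "decoder_symbol (Inl (OTok t)) = Sym t"
| "decoder_symbol (Inl (OBit b)) = Bit b"
| "decoder_symbol (Inl Lo) = Aux 0"
| "decoder_symbol (Inl Hi) = Aux 1"
| "decoder_symbol (Inr q) = Aux (2 + to_nat q)"

lemma choice_free_emit_all: "choice_free (emit_all xs)"
  by (induction xs) auto

lemma decode_step_props:
  "wf_cmd (decode_step x)" "keeps True (decode_step x)" "choice_free (decode_step x)"
  "space (decode_step x) B st"
  by (auto simp: decode_step_def wf_emit_all keeps_emit_all choice_free_emit_all space_emit_all Let_def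
      split: sum.split out.split prod.split option.split)

lemma den_decoder: "\<exists>\<sigma>'. den decoder ((\<lambda>_. [])(True := map (\<lambda>b. Inl (OBit b)) bs), []) =
  {(\<sigma>', map Inl (decode_bits None bs))}"
proof -
  have "\<exists>\<sigma>'. iter (\<lambda>x. den (decode_step x)) True (map (\<lambda>b. Inl (OBit b)) bs) (\<sigma>, w) =
      {(\<sigma>', w @ map Inl (decode_bits q bs))}"
    if "\<sigma> False = (case q of None \<Rightarrow> [] | Some q \<Rightarrow> [Inr q])" for q \<sigma> w
    using that
  proof (induction bs arbitrary: q \<sigma> w)
    case (Cons b bs)
    let ?d = "decode_bit q b"
    let ?\<sigma> = "\<sigma>(True := map (\<lambda>b. Inl (OBit b)) bs, False := [Inr (fst ?d)])"
    have "den (decode_step (Inl (OBit b))) (\<sigma>(True := map (\<lambda>b. Inl (OBit b)) bs), w) =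
        {(?\<sigma>, w @ map Inl (snd ?d))}"
      using Cons.prems by (cases q) (simp_all add: decode_step_def Let_def den_emit_all split: prod.split)
    then have "iter (\<lambda>x. den (decode_step x)) True (map (\<lambda>b. Inl (OBit b)) (b # bs)) (\<sigma>, w) =
        iter (\<lambda>x. den (decode_step x)) True (map (\<lambda>b. Inl (OBit b)) bs) (?\<sigma>, w @ map Inl (snd ?d))"
      unfolding list.map by (rule iter_step)
    moreover have "\<exists>\<sigma>'. iter (\<lambda>x. den (decode_step x)) True (map (\<lambda>b. Inl (OBit b)) bs)
        (?\<sigma>, w @ map Inl (snd ?d)) = {(\<sigma>', (w @ map Inl (snd ?d)) @ map Inl (decode_bits (Some (fst ?d)) bs))}"
      by (rule Cons.IH) simp
    ultimately show ?case by simp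
  qed auto
  from this[of "(\<lambda>_. [])(True := map (\<lambda>b. Inl (OBit b)) bs)" None "[]"] show ?thesis
    by (simp add: decoder_def del: iter.simps)
qed

interpretation decoder: compilation_io decoder_symbol "[Some True, None, Some False]" decoder True "[Some False]"
proof
  show "inj decoder_symbol"
  proof (rule injI)
    fix x y assume "decoder_symbol x = decoder_symbol y"
    then show "x = y"
      by (cases x rule: decoder_symbol.cases; cases y rule: decoder_symbol.cases) auto
  qed
  show "decoder_symbol x \<noteq> Blank" for x by (cases x rule: decoder_symbol.cases) auto
  have "x = None \<or> x = Some True \<or> x = Some False" for x by (cases x) auto
  then show "set [Some True, None, Some False] = UNIV" by auto
  show "wf_cmd decoder" by (simp add: decoder_def decode_step_props)
qed auto

text \<open>The two translations differ only on \<open>Lo\<close> and \<open>Hi\<close>, and these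
  are never emitted by the decoder.\<close>

lemma answer_word_eq: "map decoder_symbol (map Inl (decode_bits q bs)) = answer_word (decode_bits q bs)"
proof -
  have "map decoder_symbol (map Inl zs) = answer_word zs" if "\<forall>z \<in> set zs. z \<noteq> Lo \<and> z \<noteq> Hi" for zs
    using that
  proof (induction zs)
    case (Cons z zs)
    then show ?case by (cases z) auto
  qed simp
  moreover have "\<forall>z \<in> set (decode_bits q bs). z \<noteq> Lo \<and> z \<noteq> Hi"
  proof (induction bs arbitrary: q)
    case (Cons b bs)
    have "\<forall>z \<in> set (snd (decode_bit q b)). z \<noteq> Lo \<and> z \<noteq> Hi"
    proof -
      have "\<forall>z \<in> set (decode_block w x y v). z \<noteq> Lo \<and> z \<noteq> Hi" for w x y v
        by (cases "(w, x, y, v)" rule: decode_block.cases) auto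
      then show ?thesis by (cases "(q, b)" rule: decode_bit.cases) auto
    qed
    then show ?case using Cons by auto
  qed simp
  ultimately show ?thesis by blast
qed

lemma polytime_decoder_answer: "polytime_decoder (\<lambda>n. answer_word (decode_bits None (binary n)))"
proof -
  obtain p :: "nat poly" where p: "\<And>B. time decoder B = poly p B" using time_poly[of decoder] by blast
  have "halts_within decoder.machine (bits_of n) (poly p (length (binary n))) \<and>
      (\<exists>c \<in> accepting_configs decoder.machine (bits_of n).
        has_output c (answer_word (decode_bits None (binary n))))" for n
  proof -
    let ?xs = "map (\<lambda>b. Inl (OBit b)) (binary n) :: (out + pending) list"
    have xs: "map decoder_symbol ?xs = bits_of n" by (simp add: bits_of_def)
    have "space decoder (length (binary n)) (decoder.input_store ?xs)"
      unfolding decoder_def decoder.input_store_def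
      by (rule space_Drain_loop_free) (simp_all add: decode_step_props)
    note c = decoder.machine_correct[OF this, unfolded xs p]
    obtain \<sigma>' where "den decoder (decoder.input_store ?xs) = {(\<sigma>', map Inl (decode_bits None (binary n)))}"
      unfolding decoder.input_store_def using den_decoder by blast
    then show ?thesis using c(1) c(3)[of "(\<sigma>', map Inl (decode_bits None (binary n)))"]
      by (simp add: answer_word_eq del: map_map)
  qed
  moreover have "deterministic decoder.machine"
    by (rule decoder.deterministic_machine) (simp add: decoder_def decode_step_props)
  ultimately show ?thesis unfolding polytime_decoder_def using decoder.ntm_machine by blast
qed


section \<open>The optimum\<close>

lemma bits_value_foldl: "foldl (\<lambda>n b. 2 * n + of_bool b) a bs = a * 2 ^ length bs + bits_value bs"
  for a :: nat
proof (induction bs rule: rev_induct)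
  case (snoc b bs)
  then show ?case by (simp add: bits_value_append)
qed (simp add: bits_value_def)

lemma bits_value_app: "bits_value (xs @ ys) = bits_value xs * 2 ^ length ys + bits_value ys"
  using bits_value_foldl[of "bits_value xs" ys] by (simp add: bits_value_def)

lemma bits_value_less: "bits_value bs < 2 ^ length bs"
  by (induction bs rule: rev_induct) (auto simp: bits_value_append bits_value_def)

lemma bits_value_lex:
  assumes "length v = length v'"
  shows "bits_value (u @ False # v) < bits_value (u @ True # v')"
proof -
  have "bits_value (u @ b # v) = bits_value u * 2 ^ Suc (length v) + (of_bool b * 2 ^ length v + bits_value v)" for b v
    using bits_value_app[of u "b # v"] bits_value_app[of "[b]" v] by (simp add: bits_value_def)
  then show ?thesis using bits_value_less[of v] assms by simp
qed

lemma binary_double: "n > 0 \<Longrightarrow> binary (2 * n + of_bool b) = binary n @ [b]"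
  by (subst binary.simps) auto

text \<open>The purpose of the leading one: it makes the printed word recoverable from its
  value.\<close>

lemma binary_bits_value: "binary (bits_value (True # bs)) = True # bs"
proof (induction bs rule: rev_induct)
  case Nil
  show ?case by (simp add: bits_value_def binary.simps)
next
  case (snoc b bs)
  have "bits_value (True # bs) > 0"
    using bits_value_app[of "[True]" bs] by (simp add: bits_value_def)
  then have "binary (bits_value ((True # bs) @ [b])) = (True # bs) @ [b]"
    using snoc by (simp only: bits_value_append binary_double)
  then show ?case by simp
qed

lemma length_code_word: "length (code_word ys) = 4 * length ys"
proof -
  have "length (code_out y) = 4" for y by (cases y rule: code_out.cases) simp_all
  then show ?thesis by (induction ys) (simp_all add: code_word_def)
qed

lemma out_less_code_word:
  assumes "out_less ys ys'" "length ys = length ys'"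
  shows "bits_value (True # code_word ys) < bits_value (True # code_word ys')"
proof -
  obtain u v v' where u: "ys = u @ Lo # v" "ys' = u @ Hi # v'"
    using assms(1) unfolding out_less_def by blast
  have "True # code_word ys = (True # code_word u @ [False, False, False]) @ False # code_word v"
    "True # code_word ys' = (True # code_word u @ [False, False, False]) @ True # code_word v'"
    unfolding u by (simp_all add: code_word_def)
  moreover have "length (code_word v) = length (code_word v')"
    using assms(2) u by (simp add: length_code_word)
  ultimately show ?thesis by (simp only: bits_value_lex)
qed

section \<open>Outputs of the compiled matcher\<close>

fun matcher_symbol :: "'c :: finite letter \<Rightarrow> 'c token symbol" where
  "matcher_symbol (LTok t) = Sym t"
| "matcher_symbol (LBit b) = Bit b"
| "matcher_symbol (LOut y) = Aux (to_nat (Inl y :: out + mark))"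
| "matcher_symbol (LMark m) = Aux (to_nat (Inr m :: out + mark))"

interpretation matcher: compilation_io matcher_symbol "Some rInp # None # map Some reg_list" "matcher W"
  rInp "map Some reg_list" for W :: "'c :: finite set"
proof
  show "inj (matcher_symbol :: 'c letter \<Rightarrow> _)"
  proof (rule injI)
    fix x y :: "'c letter" assume "matcher_symbol x = matcher_symbol y"
    then show "x = y" by (cases x; cases y) auto
  qed
  show "matcher_symbol x \<noteq> Blank" for x :: "'c letter" by (cases x) auto
  show "set (Some rInp # None # map Some reg_list) = (UNIV :: reg option set)"
    using UNIV_reg by (auto simp: UNIV_option_conv)
  show "distinct (Some rInp # None # map Some reg_list)"
    by (simp add: distinct_map reg_list_def)
  show "wf_cmd (matcher W)" by (rule wf_matcher)
qed auto

lemma matcher_symbol_input: "map matcher_symbol (input_letters r s) = encode_instance (r, s)"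
proof -
  have [simp]: "map matcher_symbol (lbits n) = bits_of n" for n by (simp add: lbits_def bits_of_def)
  have "map matcher_symbol (regex_letters r) = encode_regex r"
    by (induction r) (auto split: enat.splits)
  then show ?thesis by (simp add: input_letters_def)
qed

lemma matcher_correct:
  fixes W :: "'c :: finite set"
  assumes r: "no_lower_bounds r"
    and a: "\<And>x st. space (body W x) (a * (tot st + 1)) st"
    and t: "t = time (matcher W) (space_bound a (instance_size (r, s)))"
    and M: "M = matcher.machine W"
  shows "halts_within M (encode_instance (r, s)) t"
    and "c \<in> accepting_configs M (encode_instance (r, s)) \<Longrightarrow> \<exists>bs. has_output c (map Bit bs)"
    and "outputs M (encode_instance (r, s)) = (\<lambda>ys. bits_value (True # code_word ys)) `
      {ys. length ys = guess_length (length (input_letters r s)) \<and> accepted W s r (Start 0) ys}"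
proof -
  let ?w = "encode_instance (r, s)"
  let ?Y = "{ys. length ys = guess_length (length (input_letters r s)) \<and> accepted W s r (Start 0) ys}"
  have "space (matcher W) (space_bound a (instance_size (r, s))) (matcher.input_store (input_letters r s))"
    unfolding matcher.input_store_def by (rule space_matcher_bound[OF r a])
  note c = matcher.machine_correct[OF this, unfolded matcher_symbol_input, folded M t]
  have den: "den (matcher W) (matcher.input_store (input_letters r s)) =
      (\<lambda>ys. (phase_regs s r (Finish []) [], map LBit (True # code_word ys))) ` ?Y"
    unfolding matcher.input_store_def by (rule den_matcher[OF r])
  have out: "\<exists>ys \<in> ?Y. has_output c (map Bit (True # code_word ys))" if "c \<in> accepting_configs M ?w" for c
    using c(2)[OF that] unfolding den by (auto simp: comp_def)
  show "halts_within M ?w t" by (rule c(1))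
  show "\<exists>bs. has_output c (map Bit bs)" if "c \<in> accepting_configs M ?w" using out[OF that] by blast
  show "outputs M ?w = (\<lambda>ys. bits_value (True # code_word ys)) ` ?Y"
  proof (intro equalityI subsetI)
    fix v assume "v \<in> outputs M ?w"
    then obtain bs c where bs: "v = bits_value bs" "c \<in> accepting_configs M ?w" "has_output c (map Bit bs)"
      unfolding outputs_def by blast
    obtain ys where ys: "ys \<in> ?Y" "has_output c (map Bit (True # code_word ys))" using out[OF bs(2)] by blast
    have "map Bit bs = (map Bit (True # code_word ys) :: 'c token symbol list)"
      by (rule has_output_unique[OF bs(3) ys(2)])
    moreover have "inj (Bit :: bool \<Rightarrow> 'c token symbol)" by (auto intro: injI)
    ultimately have "bs = True # code_word ys" using inj_map_eq_map by blast
    then show "v \<in> (\<lambda>ys. bits_value (True # code_word ys)) ` ?Y" using bs(1) ys(1) by blast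
  next
    fix v assume "v \<in> (\<lambda>ys. bits_value (True # code_word ys)) ` ?Y"
    then obtain ys where ys: "ys \<in> ?Y" "v = bits_value (True # code_word ys)" by blast
    then have "(phase_regs s r (Finish []) [], map LBit (True # code_word ys)) \<in>
        den (matcher W) (matcher.input_store (input_letters r s))" unfolding den by blast
    from c(3)[OF this] have "\<exists>c \<in> accepting_configs M ?w. has_output c (map Bit (True # code_word ys))"
      by (simp add: comp_def)
    then show "v \<in> outputs M ?w" unfolding outputs_def using ys(2) by blast
  qed
qed

lemma accepted_pad: "accepted W s r ph ys \<Longrightarrow> accepted W s r ph (ys @ replicate m Lo)"
proof (induction ys arbitrary: ph)
  case Nil
  then have "ph = Finish []" by (simp add: accepted_def)
  then show ?case by (simp add: accepted_Finish)
next
  case (Cons y ys)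
  then show ?case by (auto simp: accepted_def split: option.splits)
qed

text \<open>The best word is padded with \<open>Lo\<close> to the guessed length. Among accepted
  words of this length only the padded word itself extends the best word, and all others are
  larger.\<close>

lemma best_guess:
  assumes "no_lower_bounds r"
  obtains ys where "length ys = guess_length (length (input_letters r s))" "accepted W s r (Start 0) ys"
    "answer_word ys \<in> answer_words (jsregmatch W r s)"
    "\<And>ys'. length ys' = length ys \<Longrightarrow> accepted W s r (Start 0) ys' \<Longrightarrow> ys' = ys \<or> out_less ys ys'"
proof -
  let ?N = "guess_length (length (input_letters r s))" and ?B = "peak (length s) r"
  obtain zs where zs: "accepted W s r (Start 0) zs" "answer_word zs \<in> answer_words (jsregmatch W r s)"
    "length zs \<le> length s + 2 + run_bound (length s) ?B + answer_bound (length s) ?B (run_bound (length s) ?B)"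
    "\<And>ys. accepted W s r (Start 0) ys \<Longrightarrow> (\<exists>m. ys = zs @ replicate m Lo) \<or> out_less zs ys"
    using best_accepted[OF assms refl refl, where W = W] by blast
  have "length s + 2 + run_bound (length s) ?B + answer_bound (length s) ?B (run_bound (length s) ?B) \<le> ?N"
    unfolding guess_length_def
    by (rule run_length_le[OF _ peak_input_le[OF assms]]) (simp_all add: input_letters_def)
  with zs(3) have len: "length zs \<le> ?N" by (rule order_trans)
  define ys where "ys = zs @ replicate (?N - length zs) Lo"
  show thesis
  proof (rule that)
    show "length ys = ?N" using len by (simp add: ys_def)
    show "accepted W s r (Start 0) ys"
      unfolding ys_def by (rule accepted_pad[OF zs(1)])
    show "answer_word ys \<in> answer_words (jsregmatch W r s)" using zs(2) by (simp add: ys_def)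
    show "ys' = ys \<or> out_less ys ys'" if ys': "length ys' = length ys" "accepted W s r (Start 0) ys'" for ys'
    proof -
      consider m where "ys' = zs @ replicate m Lo" | "out_less zs ys'" using zs(4)[OF ys'(2)] by blast
      then show ?thesis
      proof cases
        case 1
        then show ?thesis using ys'(1) by (auto simp: ys_def)
      next
        case 2
        then show ?thesis using out_less_extend[of zs ys' "replicate (?N - length zs) Lo" "[]"] by (simp add: ys_def)
      qed
    qed
  qed
qed

theorem theorem17:
  fixes W :: "'c::finite set"
  shows "in_OptP matching_instances instance_size encode_instance
           (\<lambda>(r, s). jsregmatch W r s) answer_words"
proof -
  obtain a where a: "\<And>x st. space (body W x) (a * (tot st + 1)) st" by (rule body_space[of W]) blast
  define M where "M = matcher.machine W"
  \<comment> \<open>As \<open>Lo\<close> has the smaller code, the optimum is a minimum.\<close>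
  define F where "F = (\<lambda>x. LEAST v. v \<in> outputs M (encode_instance x))"
  obtain q where q: "\<And>n. space_bound a n = poly q n" using space_bound_poly[of a] by blast
  obtain p where p: "\<And>B. time (matcher W) B = poly p B" using time_poly[of "matcher W"] by blast
  \<comment> \<open>The program takes polynomial time in its space bound, which is polynomial in the
    instance size, hence the composition of \<open>p\<close> and \<open>q\<close>.\<close>
  have opt: "halts_within M (encode_instance x) (poly (pcompose p q) (instance_size x)) \<and>
      (\<forall>c \<in> accepting_configs M (encode_instance x). \<exists>bs. has_output c (map Bit bs)) \<and>
      F x \<in> outputs M (encode_instance x) \<and> (\<forall>v \<in> outputs M (encode_instance x). F x \<le> v) \<and>
      answer_word (decode_bits None (binary (F x))) \<in> answer_words (case x of (r, s) \<Rightarrow> jsregmatch W r s)"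
    if "x \<in> matching_instances" for x
  proof -
    obtain r s where x: "x = (r, s)" by fastforce
    have r: "no_lower_bounds r" using that x by (simp add: matching_instances_def)
    note c = matcher_correct[OF r a refl M_def, where s = s, unfolded p q, folded poly_pcompose x]
    obtain ys where ys: "length ys = guess_length (length (input_letters r s))" "accepted W s r (Start 0) ys"
      "answer_word ys \<in> answer_words (jsregmatch W r s)"
      "\<And>ys'. length ys' = length ys \<Longrightarrow> accepted W s r (Start 0) ys' \<Longrightarrow> ys' = ys \<or> out_less ys ys'"
      by (rule best_guess[OF r, where W = W and s = s]) blast
    let ?v = "bits_value (True # code_word ys)"
    have v: "?v \<in> outputs M (encode_instance x)" unfolding c(3) using ys(1,2) by blast
    have le: "?v \<le> v" if "v \<in> outputs M (encode_instance x)" for v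
      using that ys(1,4) out_less_code_word[of ys] unfolding c(3) by (force simp: less_imp_le)
    have F: "F x = ?v" unfolding F_def using v le by (rule Least_equality)
    have "answer_word (decode_bits None (binary (F x))) = answer_word ys"
      unfolding F binary_bits_value by (rule answer_word_decode)
    then show ?thesis using c(1,2) v le ys(3) unfolding F by (simp add: x)
  qed
  have "OptP_value matching_instances instance_size encode_instance F"
    unfolding OptP_value_def using opt matcher.ntm_machine[of W] unfolding M_def by blast
  then show ?thesis
    unfolding in_OptP_def using polytime_decoder_answer opt by (intro exI conjI) (assumption | blast)+
qed

end
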